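(* Let $p\ge1$, $\theta\in\mathbb{R}^p$, $|\rho|<1$, and consider the adaptively controlled ARX$(p,0)$ process with first-order autoregressive noise described in the context, with least squares estimator $\widehat\vartheta_n$ of $\vartheta$. Assume that $\rho\ne0$ and that $(V_n)$ has a finite conditional moment of order $>2$. In addition, suppose that $(x_n)$ has the same almost sure regularity as $(V_n)$. Then, as $n\to\infty$, $$\sqrt n\,(\widehat\vartheta_n-\vartheta)\ \xrightarrow{\ \mathcal L\ }\ \mathcal N(0,\Lambda^{-1}),$$ where $$\Lambda=\begin{pmatrix} I_{p+1} & K^t\\ K & H\end{pmatrix},\qquad \Lambda^{-1}=\frac{1-\rho^2}{\rho^{2(p+1)}}\begin{pmatrix} S I_{p+1}+K^tK & -K^t\\ -K & 1\end{pmatrix},$$ with $K=(0,-(\theta_1+\rho),-(\theta_2+\rho^2),\dots,-(\theta_p+\rho^p))$, $H=\sum_{k=1}^p(\theta_k+\rho^k)^2+\frac{\rho^{2(p+1)}}{1-\rho^2}$ and $S=\frac{\rho^{2(p+1)}}{1-\rho^2}$.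
   Context: Model. For all $n\ge 0$, $$X_{n+1}=\sum_{k=1}^p\theta_kX_{n-k+1}+U_n+\varepsilon_{n+1},\qquad \varepsilon_{n+1}=\rho\varepsilon_n+V_{n+1},$$ with $\theta=(\theta_1,\dots,\theta_p)^t\in\mathbb{R}^p$, $|\rho|<1$. Initial values ($X_k$ for $k\le 0$, $\varepsilon_0$, $U_0$, $U_{-1}$) are arbitrary ($\mathcal F_0$-measurable). $(V_n)$ is a martingale difference sequence adapted to a filtration $(\mathcal F_n)$ with $\mathbb{E}[V_{n+1}^2\mid\mathcal F_n]=\sigma^2$ a.s. for all $n\ge0$, where $\sigma^2>0$ is a constant. "Finite conditional moment of order $>2$" means: there is $a>2$ with $\sup_{n\ge0}\mathbb{E}[|V_{n+1}|^a\mid\mathcal F_n]<\infty$ a.s. "$(x_n)$ has the same almost sure regularity as $(V_n)$" means: for this $a$ and all $2\le b<a$, $\sum_{k=1}^n|x_k|^b=\mathcal O(n)$ a.s. (a property that $(V_n)$ itself has). Regression vector and parameter. $\Phi_n=(X_n,X_{n-1},\dots,X_{n-p+1},X_{n-p},U_{n-1})^t\in\mathbb{R}^{p+2}$, and $\vartheta\in\mathbb{R}^{p+2}$ is $$\vartheta=\begin{pmatrix}\theta\\0\\0\end{pmatrix}-\rho\begin{pmatrix}-1\\ \theta\\ 1\end{pmatrix},$$ so that for $n\ge 1$, $X_{n+1}=\vartheta^t\Phi_n+U_n+V_{n+1}$. Estimator and control. $S_n=\sum_{k=0}^n\Phi_k\Phi_k^t+I_{p+2}$; the least squares estimator satisfies,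 for $n\ge0$, $$\widehat\vartheta_{n+1}=\widehat\vartheta_n+S_n^{-1}\Phi_n\bigl(X_{n+1}-U_n-\widehat\vartheta_n^{\,t}\Phi_n\bigr),$$ with $\widehat\vartheta_0$ arbitrary. The adaptive tracking control is $U_n=x_{n+1}-\widehat\vartheta_n^{\,t}\Phi_n$ (for $n\ge 1$; $U_0$ may be arbitrary), where $(x_n)$ is a predictable real reference trajectory ($x_{n+1}$ is $\mathcal F_n$-measurable) satisfying $\sum_{k=1}^n x_k^2=o(n)$ a.s. $\xrightarrow{\mathcal L}$ denotes convergence in distribution. *)

theory Defs
  imports "HOL-Probability.Probability" "HOL-Library.Landau_Symbols"
begin

text \<open>
  The library has weak convergence only for measures on the real line (via distribution
  functions), so it is defined here by bounded continuous test functions.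
\<close>

definition converges_in_law ::
  "'a measure \<Rightarrow> (nat \<Rightarrow> 'a \<Rightarrow> 'b::euclidean_space) \<Rightarrow> 'b measure \<Rightarrow> bool" where
  "converges_in_law M Y \<mu> \<longleftrightarrow>
     (\<forall>n. Y n \<in> borel_measurable M) \<and>
     (\<forall>f :: 'b \<Rightarrow> real. continuous_on UNIV f \<and> bounded (range f) \<longrightarrow>
        (\<lambda>n. \<integral>\<omega>. f (Y n \<omega>) \<partial>M) \<longlonglongrightarrow> (\<integral>y. f y \<partial>\<mu>))"

text \<open>
  The law \<open>N(m, \<Sigma>)\<close>, defined by its Lebesgue density; only meaningful for a symmetric
  positive definite covariance matrix \<open>\<Sigma>\<close>.
\<close>

definition gaussian_measure :: "real ^ 'd \<Rightarrow> real ^ 'd ^ 'd \<Rightarrow> (real ^ 'd) measure" where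
  "gaussian_measure m \<Sigma> = density lborel (\<lambda>x. ennreal
     (exp (- ((x - m) \<bullet> (matrix_inv \<Sigma> *v (x - m))) / 2) / sqrt ((2 * pi) ^ CARD('d) * det \<Sigma>)))"

definition filtered_space :: "'a measure \<Rightarrow> (nat \<Rightarrow> 'a measure) \<Rightarrow> bool" where
  "filtered_space M F \<longleftrightarrow> filtration (space M) F \<and> (\<forall>n. subalgebra M (F n))"

definition martingale_difference ::
  "'a measure \<Rightarrow> (nat \<Rightarrow> 'a measure) \<Rightarrow> (nat \<Rightarrow> 'a \<Rightarrow> real) \<Rightarrow> bool" where
  "martingale_difference M F V \<longleftrightarrow>
     (\<forall>n. V (n + 1) \<in> borel_measurable (F (n + 1)) \<and> integrable M (V (n + 1)) \<and>
        (AE \<omega> in M. real_cond_exp M (F n) (V (n + 1)) \<omega> = 0))"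

text \<open>
  The conditional moment is the \<open>[0, \<infinity>]\<close>-valued conditional expectation, because
  \<open>\<bar>V (n + 1)\<bar> powr a\<close> need not be integrable.
\<close>

definition finite_conditional_moment ::
  "real \<Rightarrow> 'a measure \<Rightarrow> (nat \<Rightarrow> 'a measure) \<Rightarrow> (nat \<Rightarrow> 'a \<Rightarrow> real) \<Rightarrow> bool" where
  "finite_conditional_moment a M F V \<longleftrightarrow>
     (AE \<omega> in M. (SUP n. nn_cond_exp M (F n) (\<lambda>\<omega>'. ennreal (\<bar>V (n + 1) \<omega>'\<bar> powr a)) \<omega>) < \<infinity>)"

definition as_regular :: "real \<Rightarrow> 'a measure \<Rightarrow> (nat \<Rightarrow> 'a \<Rightarrow> real) \<Rightarrow> bool" where
  "as_regular a M x \<longleftrightarrow>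
     (\<forall>b. 2 \<le> b \<and> b < a \<longrightarrow>
        (AE \<omega> in M. (\<lambda>n. \<Sum>k=1..n. \<bar>x k \<omega>\<bar> powr b) \<in> O(\<lambda>n. real n)))"

text \<open>
  Vectors of length \<open>p + 2\<close> live in \<open>real ^ 'd\<close>; the coordinates are numbered \<open>1, \<dots>, p + 2\<close>
  by a bijection \<open>ix :: 'd \<Rightarrow> nat\<close> onto \<open>{1..p + 2}\<close>. The vector \<open>\<theta>\<close> is given by its
  components \<open>\<theta> 1, \<dots>, \<theta> p\<close>; other values of \<open>\<theta>\<close> are never used.
  Output and input are indexed by \<open>int\<close> because of the initial values at times \<open>k \<le> 0\<close>.
\<close>

definition regressor ::
  "nat \<Rightarrow> ('d \<Rightarrow> nat) \<Rightarrow> (int \<Rightarrow> 'a \<Rightarrow> real) \<Rightarrow> (int \<Rightarrow> 'a \<Rightarrow> real) \<Rightarrow> nat \<Rightarrow> 'a \<Rightarrow> real ^ 'd" where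
  "regressor p ix X U n \<omega> =
     (\<chi> i. if ix i \<le> p + 1 then X (int n - int (ix i) + 1) \<omega> else U (int n - 1) \<omega>)"

definition true_parameter ::
  "nat \<Rightarrow> ('d \<Rightarrow> nat) \<Rightarrow> (nat \<Rightarrow> real) \<Rightarrow> real \<Rightarrow> real ^ 'd" where
  "true_parameter p ix \<theta> \<rho> =
     (\<chi> i. if ix i \<le> p then \<theta> (ix i) else 0) -
     \<rho> *\<^sub>R (\<chi> i. if ix i = 1 then - 1 else if ix i \<le> p + 1 then \<theta> (ix i - 1) else 1)"

definition gram ::
  "nat \<Rightarrow> ('d \<Rightarrow> nat) \<Rightarrow> (int \<Rightarrow> 'a \<Rightarrow> real) \<Rightarrow> (int \<Rightarrow> 'a \<Rightarrow> real) \<Rightarrow> nat \<Rightarrow> 'a \<Rightarrow> real ^ 'd ^ 'd" where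
  "gram p ix X U n \<omega> =
     (\<Sum>k\<le>n. (columnvector (regressor p ix X U k \<omega>) :: real ^ 1 ^ 'd)
            ** rowvector (regressor p ix X U k \<omega>)) + mat 1"

definition arx_model ::
  "'a measure \<Rightarrow> nat \<Rightarrow> (nat \<Rightarrow> real) \<Rightarrow> real \<Rightarrow> (int \<Rightarrow> 'a \<Rightarrow> real) \<Rightarrow> (int \<Rightarrow> 'a \<Rightarrow> real) \<Rightarrow>
    (nat \<Rightarrow> 'a \<Rightarrow> real) \<Rightarrow> (nat \<Rightarrow> 'a \<Rightarrow> real) \<Rightarrow> bool" where
  "arx_model M p \<theta> \<rho> X U \<epsilon> V \<longleftrightarrow>
     (\<forall>n. \<forall>\<omega>\<in>space M.
        X (int n + 1) \<omega> = (\<Sum>k=1..p. \<theta> k * X (int n - int k + 1) \<omega>) + U (int n) \<omega> + \<epsilon> (n + 1) \<omega> \<and>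
        \<epsilon> (n + 1) \<omega> = \<rho> * \<epsilon> n \<omega> + V (n + 1) \<omega>)"

definition least_squares ::
  "'a measure \<Rightarrow> nat \<Rightarrow> ('d \<Rightarrow> nat) \<Rightarrow> (int \<Rightarrow> 'a \<Rightarrow> real) \<Rightarrow> (int \<Rightarrow> 'a \<Rightarrow> real) \<Rightarrow>
    (nat \<Rightarrow> 'a \<Rightarrow> real ^ 'd) \<Rightarrow> bool" where
  "least_squares M p ix X U est \<longleftrightarrow>
     (\<forall>n. \<forall>\<omega>\<in>space M.
        est (n + 1) \<omega> = est n \<omega> +
          (X (int n + 1) \<omega> - U (int n) \<omega> - est n \<omega> \<bullet> regressor p ix X U n \<omega>) *\<^sub>R
          (matrix_inv (gram p ix X U n \<omega>) *v regressor p ix X U n \<omega>))"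

definition tracking_control ::
  "'a measure \<Rightarrow> nat \<Rightarrow> ('d \<Rightarrow> nat) \<Rightarrow> (int \<Rightarrow> 'a \<Rightarrow> real) \<Rightarrow> (int \<Rightarrow> 'a \<Rightarrow> real) \<Rightarrow>
    (nat \<Rightarrow> 'a \<Rightarrow> real ^ 'd) \<Rightarrow> (nat \<Rightarrow> 'a \<Rightarrow> real) \<Rightarrow> bool" where
  "tracking_control M p ix X U est x \<longleftrightarrow>
     (\<forall>n\<ge>1. \<forall>\<omega>\<in>space M. U (int n) \<omega> = x (n + 1) \<omega> - est n \<omega> \<bullet> regressor p ix X U n \<omega>)"

text \<open>The entries of \<open>K\<close> are numbered from 1, so the leading 0 is entry 1.\<close>

definition K_row :: "(nat \<Rightarrow> real) \<Rightarrow> real \<Rightarrow> nat \<Rightarrow> real" where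
  "K_row \<theta> \<rho> j = (if j = 1 then 0 else - (\<theta> (j - 1) + \<rho> ^ (j - 1)))"

definition S_const :: "nat \<Rightarrow> real \<Rightarrow> real" where
  "S_const p \<rho> = \<rho> ^ (2 * (p + 1)) / (1 - \<rho>\<^sup>2)"

definition H_const :: "nat \<Rightarrow> (nat \<Rightarrow> real) \<Rightarrow> real \<Rightarrow> real" where
  "H_const p \<theta> \<rho> = (\<Sum>k=1..p. (\<theta> k + \<rho> ^ k)\<^sup>2) + \<rho> ^ (2 * (p + 1)) / (1 - \<rho>\<^sup>2)"

text \<open>Symmetric: leading block \<open>A\<close> of size \<open>p + 1\<close>, last row and last column both \<open>(r, h)\<close>.\<close>

definition bordered_matrix ::
  "nat \<Rightarrow> ('d \<Rightarrow> nat) \<Rightarrow> (nat \<Rightarrow> nat \<Rightarrow> real) \<Rightarrow> (nat \<Rightarrow> real) \<Rightarrow> real \<Rightarrow> real ^ 'd ^ 'd" where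
  "bordered_matrix p ix A r h =
     (\<chi> i j. if ix i \<le> p + 1 \<and> ix j \<le> p + 1 then A (ix i) (ix j)
            else if ix i \<le> p + 1 then r (ix i)
            else if ix j \<le> p + 1 then r (ix j)
            else h)"

definition Lambda :: "nat \<Rightarrow> ('d \<Rightarrow> nat) \<Rightarrow> (nat \<Rightarrow> real) \<Rightarrow> real \<Rightarrow> real ^ 'd ^ 'd" where
  "Lambda p ix \<theta> \<rho> =
     bordered_matrix p ix (\<lambda>a b. if a = b then 1 else 0) (K_row \<theta> \<rho>) (H_const p \<theta> \<rho>)"

definition Lambda_inverse :: "nat \<Rightarrow> ('d \<Rightarrow> nat) \<Rightarrow> (nat \<Rightarrow> real) \<Rightarrow> real \<Rightarrow> real ^ 'd ^ 'd" where
  "Lambda_inverse p ix \<theta> \<rho> =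
     ((1 - \<rho>\<^sup>2) / \<rho> ^ (2 * (p + 1))) *\<^sub>R
     bordered_matrix p ix
       (\<lambda>a b. S_const p \<rho> * (if a = b then 1 else 0) + K_row \<theta> \<rho> a * K_row \<theta> \<rho> b)
       (\<lambda>a. - K_row \<theta> \<rho> a) 1"

end

theory Submission
  imports Defs
begin

text \<open>
  Write \<open>A\<^sub>n = I + \<Sum>\<^bsub>k<n\<^esub> \<Phi>\<^sub>k \<Phi>\<^sub>k\<^sup>t\<close> and let \<open>e\<^sub>n\<close> be the estimation error. The least squares recursion
  says that \<open>A\<^sub>n e\<^sub>n\<close> is, up to a term that does not depend on \<open>n\<close>, the martingale
  \<open>\<Sum>\<^bsub>k<n\<^esub> V\<^bsub>k+1\<^esub> \<Phi>\<^sub>k\<close>. So it is enough to prove \<open>A\<^sub>n / n \<rightarrow> \<sigma>\<^sup>2 \<Lambda>\<close> in probability: the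
  martingale central limit theorem, Slutsky's argument and Levy's theorem then give the limit law.

  The closed loop is stabilised by the control. The quadratic form \<open>e\<^sub>n\<^sup>t A\<^sub>n e\<^sub>n\<close> is a Lyapunov
  function, which bounds the sum of the normalised squared excitation errors
  \<open>\<alpha>\<^sub>k = \<pi>\<^sub>k\<^sup>2 / (1 + \<Phi>\<^sub>k\<^sup>t A\<^sub>k\<^sup>-\<^sup>1 \<Phi>\<^sub>k)\<close> by a power of \<open>log det A\<^sub>n\<close>. Because the decrements of
  \<open>tr A\<^sub>k\<^sup>-\<^sup>1\<close> are summable, \<open>\<bar>\<Phi>\<^sub>k\<bar>\<^sup>2\<close> then grows with a power of \<open>k\<close> less than 1, and
  \<open>\<Sum>\<^bsub>k\<le>n\<^esub> \<pi>\<^sub>k\<^sup>2 = o(n)\<close>. Hence \<open>X\<^sub>k\<close> equals \<open>V\<^sub>k\<close> up to an error that is negligible in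
  quadratic mean, so that \<open>\<Phi>\<^sub>k\<close> is asymptotically a linear function of \<open>V\<^sub>k, \<dots>, V\<^bsub>k-p\<^esub>\<close> and
  \<open>\<epsilon>\<^bsub>k-p-1\<^esub>\<close>, whose covariance is \<open>\<sigma>\<^sup>2 \<Lambda>\<close>.
\<close>

section \<open>Rank-one updates of the information matrix\<close>

text \<open>The stability estimate is circular: the bound on the sum of the \<alpha>_k contains log
  det A_n, which is a logarithm of the regressors, and the regressors contain the excitation errors.
  The circle is broken through exponents. An arbitrarily small multiple of the logarithm
  exponentiates to an arbitrarily small power of the running maximum, and such a power can be
  absorbed on the left.

  The conditional moments of order a are bounded only by an almost surely finite random variable, so
  moments of |V| of order a may be infinite. Moment estimates are therefore made on events where the
  bound is a constant, and the laws of large numbers hold in probability.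

  The random matrix A_n is not inverted in the limit argument. A direction u is written as
  \<sigma>^2 \<Lambda> w, the martingale is tested against w, and A_n / n - \<sigma>^2 \<Lambda>
  enters as a small factor in front of the scaled error, which first proves tightness and then
  disappears.

  The number S is the Schur complement and the determinant of \<Lambda>. It is positive because
  \<rho> \<noteq> 0; for \<rho> = 0 the matrix would be singular.\<close>

definition outer :: "real ^ 'd \<Rightarrow> real ^ 'd \<Rightarrow> real ^ 'd ^ 'd" where
  "outer u v = (\<chi> i j. u $ i * v $ j)"

lemma outer_nth [simp]: "outer u v $ i $ j = u $ i * v $ j"
  by (simp add: outer_def)

lemma columnvector_rowvector: "(columnvector u :: real ^ 1 ^ 'd) ** rowvector v = outer u (v :: real ^ 'd)"
  by (simp add: matrix_matrix_mult_def columnvector_def rowvector_def vec_eq_iff)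

lemma outer_mult_vec: "outer u v *v w = (v \<bullet> w) *\<^sub>R (u :: real ^ 'd)"
  by (simp add: matrix_vector_mult_def vec_eq_iff inner_vec_def sum_distrib_left mult_ac)

lemma matrix_mult_outer: "(A :: real ^ 'd ^ 'd) ** outer u v = outer (A *v u) v"
  by (simp add: matrix_matrix_mult_def matrix_vector_mult_def vec_eq_iff sum_distrib_right mult.assoc)

lemma outer_mult_matrix: "outer u v ** (A :: real ^ 'd ^ 'd) = outer u (transpose A *v v)"
  by (simp add: matrix_matrix_mult_def matrix_vector_mult_def vec_eq_iff sum_distrib_left mult_ac transpose_def)

lemma matrix_add_mult: "(A + B) ** C = A ** C + B ** (C :: real ^ 'd ^ 'd)"
  by (simp add: matrix_matrix_mult_def vec_eq_iff distrib_right sum.distrib)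

text \<open>An orthogonal change of basis turns \<open>v\<close> into a multiple of a basis vector.
  The conjugated matrix differs from the identity only in column \<open>k\<close>, and Cramer's
  lemma reads off its determinant.\<close>

lemma det_identity_plus_outer: "det (mat 1 + outer u v) = 1 + u \<bullet> (v :: real ^ 'd)"
proof -
  fix k :: 'd
  have "norm v = norm (norm v *\<^sub>R axis k 1 :: real ^ 'd)"
    by (simp add: norm_axis_1)
  then obtain f :: "real ^ 'd \<Rightarrow> real ^ 'd" where f: "orthogonal_transformation f" "f v = norm v *\<^sub>R axis k 1"
    by (rule orthogonal_transformation_exists)
  define Q where "Q = matrix f"
  have lf: "linear f" and oQ: "orthogonal_matrix Q"
    using f(1) orthogonal_transformation_matrix[of f] by (auto simp: Q_def)
  have Qv: "Q *v w = f w" for w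
    unfolding Q_def using fun_cong[OF matrix_vector_mul(2)[OF lf]] by simp
  have QQ: "Q ** transpose Q = mat 1"
    using oQ by (simp add: orthogonal_matrix_def)
  have dQ: "det Q * det (transpose Q) = 1"
    using QQ by (metis det_I det_mul)
  define w where "w = norm v *\<^sub>R f u"
  have "Q ** (mat 1 + outer u v) ** transpose Q = mat 1 + outer (f u) (f v)"
    by (simp add: matrix_add_ldistrib matrix_add_mult QQ matrix_mult_outer outer_mult_matrix Qv)
  also have "\<dots> = (\<chi> i j. if j = k then (mat 1 *v (axis k 1 + w)) $ i else (mat 1 :: real ^ 'd ^ 'd) $ i $ j)"
    unfolding matrix_vector_mul_lid by (auto simp: vec_eq_iff f(2) w_def mat_def axis_def)
  finally have "det (Q ** (mat 1 + outer u v) ** transpose Q) = (axis k 1 + w) $ k * 1"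
    using cramer_lemma[of k "mat 1" "axis k 1 + w"] by (simp only: det_I)
  moreover have "det (Q ** (mat 1 + outer u v) ** transpose Q) = det (mat 1 + outer u v)"
    using dQ by (simp add: det_mul mult.commute mult.left_commute)
  moreover have "u \<bullet> v = f u \<bullet> f v"
    using f(1) by (simp add: orthogonal_transformation_def)
  moreover have "f u \<bullet> f v = w $ k"
    by (simp add: f(2) w_def inner_axis)
  ultimately show ?thesis
    by (simp add: axis_def)
qed

lemma det_plus_outer:
  fixes A P :: "real ^ 'd ^ 'd"
  assumes "A ** P = mat 1"
  shows "det (A + outer u v) = det A * (1 + (P *v u) \<bullet> v)"
proof -
  have "A + outer u v = A ** (mat 1 + outer (P *v u) v)"
    by (simp add: matrix_add_ldistrib matrix_mult_outer matrix_vector_mul_assoc assms)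
  then show ?thesis
    by (simp add: det_mul det_identity_plus_outer)
qed

lemma matrix_inv_eqI:
  fixes A P :: "real ^ 'd ^ 'd"
  assumes "A ** P = mat 1"
  shows "matrix_inv A = P"
proof -
  have "P ** A = mat 1" using assms matrix_left_right_inverse by blast
  with assms have "A ** matrix_inv A = mat 1"
    unfolding matrix_inv_def by (rule_tac someI2[of _ P]) auto
  then have "P ** A ** matrix_inv A = P"
    by (simp add: matrix_mul_assoc[symmetric])
  then show ?thesis by (simp add: \<open>P ** A = mat 1\<close>)
qed

text \<open>Checked on vectors: both the update of \<open>A\<close> and the correction of
  \<open>P\<close> produce multiples of \<open>u\<close>. With \<open>s = w \<bullet> x\<close>
  their total coefficient is s - (s / c) (1 + u . w), which vanishes because c = 1 + u . w.\<close>

lemma sherman_morrison: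
  fixes A P :: "real ^ 'd ^ 'd"
  assumes "A ** P = mat 1" "transpose P = P" "1 + u \<bullet> (P *v u) \<noteq> 0"
  shows "(A + outer u u) ** (P - outer (P *v u) (P *v u) /\<^sub>R (1 + u \<bullet> (P *v u))) = mat 1"
proof -
  define w c where "w = P *v u" and "c = 1 + u \<bullet> w"
  have AP: "A *v (P *v x) = x" for x
    by (simp add: matrix_vector_mul_assoc assms)
  have uP: "u \<bullet> (P *v x) = w \<bullet> x" for x
    unfolding w_def by (metis assms(2) dot_lmul_matrix transpose_matrix_vector)
  have c: "c \<noteq> 0" using assms(3) by (simp add: c_def w_def)
  have "((A + outer u u) ** (P - outer w w /\<^sub>R c)) *v x = x" for x
  proof -
    define s where "s = w \<bullet> x"
    have 1: "(outer w w /\<^sub>R c) *v x = (s / c) *\<^sub>R w"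
      by (simp add: scaleR_matrix_vector_assoc[symmetric] outer_mult_vec s_def divide_inverse mult.commute)
    have "((A + outer u u) ** (P - outer w w /\<^sub>R c)) *v x = (A + outer u u) *v (P *v x - (s / c) *\<^sub>R w)"
      by (simp add: matrix_vector_mul_assoc[symmetric] matrix_vector_mult_diff_rdistrib 1)
    also have "\<dots> = x - (s / c) *\<^sub>R u + (s - s / c * (u \<bullet> w)) *\<^sub>R u"
      by (simp add: matrix_vector_mult_add_rdistrib matrix_vector_mult_diff_distrib AP
          matrix_vector_mult_scaleR outer_mult_vec inner_diff_right uP s_def[symmetric])
         (simp add: w_def AP algebra_simps)
    also have "\<dots> = x + (s - s / c * (1 + u \<bullet> w)) *\<^sub>R u"
      by (simp add: algebra_simps)
    also have "s - s / c * (1 + u \<bullet> w) = 0"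
      using c by (simp add: c_def)
    finally show ?thesis by simp
  qed
  then have "(A + outer u u) ** (P - outer w w /\<^sub>R c) = mat 1"
    by (subst matrix_eq) simp
  then show ?thesis by (simp add: w_def c_def)
qed

text \<open>The Leibniz formula, estimated term by term. The bound is crude, but only its logarithm
  matters for the volume.\<close>

lemma abs_det_le:
  fixes A :: "real ^ 'd ^ 'd"
  assumes "\<And>i j. \<bar>A $ i $ j\<bar> \<le> B"
  shows "\<bar>det A\<bar> \<le> fact CARD('d) * B ^ CARD('d)"
proof -
  have "\<bar>det A\<bar> \<le> (\<Sum>p | p permutes (UNIV :: 'd set). \<bar>of_int (sign p) * (\<Prod>i\<in>UNIV. A $ i $ p i)\<bar>)"
    unfolding det_def by (rule sum_abs)
  also have "\<dots> \<le> (\<Sum>p | p permutes (UNIV :: 'd set). B ^ CARD('d))"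
  proof (rule sum_mono)
    fix p :: "'d \<Rightarrow> 'd"
    have "\<bar>\<Prod>i\<in>UNIV. A $ i $ p i\<bar> \<le> (\<Prod>i\<in>(UNIV :: 'd set). B)"
      unfolding abs_prod by (rule prod_mono) (use assms in auto)
    then show "\<bar>of_int (sign p) * (\<Prod>i\<in>UNIV. A $ i $ p i)\<bar> \<le> B ^ CARD('d)"
      by (simp add: abs_mult sign_def)
  qed
  also have "\<dots> = fact CARD('d) * B ^ CARD('d)"
    by (simp add: card_permutations)
  finally show ?thesis .
qed

section \<open>The information matrix, its inverse and the leverage\<close>

definition information :: "(nat \<Rightarrow> real ^ 'd) \<Rightarrow> nat \<Rightarrow> real ^ 'd ^ 'd" where
  "information \<Phi> n = (\<Sum>k<n. outer (\<Phi> k) (\<Phi> k)) + mat 1"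

text \<open>The recursion is the rank-one update of the inverse, started at the identity. In this
  form symmetry and measurability follow by induction.\<close>

primrec inv_information :: "(nat \<Rightarrow> real ^ 'd) \<Rightarrow> nat \<Rightarrow> real ^ 'd ^ 'd" where
  "inv_information \<Phi> 0 = mat 1"
| "inv_information \<Phi> (Suc n) = inv_information \<Phi> n
     - outer (inv_information \<Phi> n *v \<Phi> n) (inv_information \<Phi> n *v \<Phi> n)
       /\<^sub>R (1 + \<Phi> n \<bullet> (inv_information \<Phi> n *v \<Phi> n))"

text \<open>The weight is the inverse before the update with \<open>\<Phi> n\<close>, so the value g
  may exceed 1. With the updated inverse the same form equals g / (1 + g).\<close>

definition leverage :: "(nat \<Rightarrow> real ^ 'd) \<Rightarrow> nat \<Rightarrow> real" where
  "leverage \<Phi> n = \<Phi> n \<bullet> (inv_information \<Phi> n *v \<Phi> n)"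

definition log_volume :: "(nat \<Rightarrow> real ^ 'd) \<Rightarrow> nat \<Rightarrow> real" where
  "log_volume \<Phi> n = ln (det (information \<Phi> n))"

lemma information_Suc: "information \<Phi> (Suc n) = information \<Phi> n + outer (\<Phi> n) (\<Phi> n)"
  by (simp add: information_def)

lemma inner_information:
  "u \<bullet> (information \<Phi> n *v v) = u \<bullet> v + (\<Sum>k<n. (\<Phi> k \<bullet> u) * (\<Phi> k \<bullet> v))"
proof (induction n)
  case (Suc n)
  have "u \<bullet> (information \<Phi> (Suc n) *v v) = u \<bullet> (information \<Phi> n *v v) + (\<Phi> n \<bullet> v) * (u \<bullet> \<Phi> n)"
    by (simp only: information_Suc matrix_vector_mult_add_rdistrib outer_mult_vec inner_add_right inner_scaleR_right)
  then show ?case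
    using Suc by (simp add: inner_commute[of u "\<Phi> n"] mult.commute)
qed (simp add: information_def)

lemma transpose_inv_information: "transpose (inv_information \<Phi> n) = inv_information \<Phi> n"
proof (induction n)
  case (Suc n)
  have "inv_information \<Phi> n $ j $ i = inv_information \<Phi> n $ i $ j" for i j
    using arg_cong[OF Suc, of "\<lambda>A. A $ i $ j"] by (simp add: transpose_def)
  then show ?case
    by (simp add: transpose_def vec_eq_iff mult.commute)
qed (simp add: transpose_mat)

text \<open>The two claims depend on each other: the rank-one update needs a nonzero denominator,
  hence nonnegativity, and nonnegativity holds for every right inverse P of A, because u . P u is
  the quadratic form of A at P u.\<close>

lemma inv_information_props:
  shows information_mult_inv: "information \<Phi> n ** inv_information \<Phi> n = mat 1"
    and inv_information_psd: "\<And>u. 0 \<le> u \<bullet> (inv_information \<Phi> n *v u)"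
proof -
  have *: "0 \<le> u \<bullet> (P *v u)" if "information \<Phi> n ** P = mat 1" for n u P
  proof -
    have "u = information \<Phi> n *v (P *v u)"
      by (simp add: matrix_vector_mul_assoc that)
    then have "u \<bullet> (P *v u) = (P *v u) \<bullet> (information \<Phi> n *v (P *v u))"
      by (metis inner_commute)
    also have "\<dots> \<ge> 0"
      unfolding inner_information by (intro add_nonneg_nonneg sum_nonneg) auto
    finally show ?thesis .
  qed
  show 1: "information \<Phi> n ** inv_information \<Phi> n = mat 1"
  proof (induction n)
    case (Suc n)
    show ?case
      unfolding information_Suc inv_information.simps
      by (rule sherman_morrison[OF Suc transpose_inv_information])
         (use *[OF Suc, of "\<Phi> n"] in auto)
  qed (simp add: information_def)
  show "0 \<le> u \<bullet> (inv_information \<Phi> n *v u)" for u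
    by (rule *[OF 1])
qed

lemma leverage_nonneg: "0 \<le> leverage \<Phi> n"
  by (simp add: leverage_def inv_information_psd)

lemma matrix_inv_information: "matrix_inv (information \<Phi> n) = inv_information \<Phi> n"
  by (rule matrix_inv_eqI) (rule information_mult_inv)

text \<open>The estimator moves along the updated inverse. Expressing this direction by the old
  inverse separates what is known before the step and produces the factor 1 / (1 + g).\<close>

lemma inv_information_Suc_mult:
  "inv_information \<Phi> (Suc n) *v \<Phi> n = (inv_information \<Phi> n *v \<Phi> n) /\<^sub>R (1 + leverage \<Phi> n)"
proof -
  let ?w = "inv_information \<Phi> n *v \<Phi> n"
  have "inv_information \<Phi> (Suc n) *v \<Phi> n = ?w - ((?w \<bullet> \<Phi> n) / (1 + leverage \<Phi> n)) *\<^sub>R ?w"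
    by (simp add: leverage_def matrix_vector_mult_diff_rdistrib outer_mult_vec scaleR_matrix_vector_assoc[symmetric] divide_inverse mult.commute)
  also have "\<dots> = (1 - (?w \<bullet> \<Phi> n) / (1 + leverage \<Phi> n)) *\<^sub>R ?w"
    by (simp add: scaleR_left_diff_distrib)
  also have "1 - (?w \<bullet> \<Phi> n) / (1 + leverage \<Phi> n) = inverse (1 + leverage \<Phi> n)"
    using leverage_nonneg[of \<Phi> n] by (simp add: leverage_def inner_commute field_simps)
  finally show ?thesis .
qed

lemma det_information_Suc: "det (information \<Phi> (Suc n)) = det (information \<Phi> n) * (1 + leverage \<Phi> n)"
  unfolding information_Suc det_plus_outer[OF information_mult_inv] by (simp add: leverage_def inner_commute)

lemma det_information_ge_1: "1 \<le> det (information \<Phi> n)"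
proof (induction n)
  case (Suc n)
  then have "1 * 1 \<le> det (information \<Phi> n) * (1 + leverage \<Phi> n)"
    by (intro mult_mono) (use leverage_nonneg[of \<Phi> n] in auto)
  then show ?case by (simp add: det_information_Suc)
qed (simp add: information_def)

lemma log_volume_nonneg: "0 \<le> log_volume \<Phi> n"
  by (simp add: log_volume_def det_information_ge_1)

lemma log_volume_Suc: "log_volume \<Phi> (Suc n) = log_volume \<Phi> n + ln (1 + leverage \<Phi> n)"
  using det_information_ge_1[of \<Phi> n] leverage_nonneg[of \<Phi> n]
  by (simp add: log_volume_def det_information_Suc ln_mult)

text \<open>This is ln y \<le> y - 1 at y = 1 / (1 + g). Summed, it bounds the coefficients of the
  squared noise in the Lyapunov recursion by log det A_n.\<close>

lemma leverage_ratio_le: "leverage \<Phi> n / (1 + leverage \<Phi> n) \<le> log_volume \<Phi> (Suc n) - log_volume \<Phi> n"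
proof -
  let ?g = "leverage \<Phi> n"
  have "ln (inverse (1 + ?g)) \<le> inverse (1 + ?g) - 1"
    using leverage_nonneg[of \<Phi> n] by (intro ln_le_minus_one) auto
  moreover have "ln (inverse (1 + ?g)) = - ln (1 + ?g)"
    using leverage_nonneg[of \<Phi> n] by (intro ln_inverse)
  moreover have "inverse (1 + ?g) - 1 = - (?g / (1 + ?g))"
    using leverage_nonneg[of \<Phi> n] by (simp add: field_simps)
  ultimately show ?thesis
    by (simp add: log_volume_Suc)
qed

text \<open>Every entry of the matrix is at most 1 plus the sum of the squared norms, so the Leibniz
  bound is a polynomial in that sum.\<close>

lemma log_volume_le:
  fixes \<Phi> :: "nat \<Rightarrow> real ^ 'd"
  shows "log_volume \<Phi> n \<le> ln (fact CARD('d)) + CARD('d) * ln (1 + (\<Sum>k<n. (norm (\<Phi> k))\<^sup>2))"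
proof -
  let ?B = "1 + (\<Sum>k<n. (norm (\<Phi> k))\<^sup>2)"
  have B: "1 \<le> ?B" by (simp add: sum_nonneg)
  have "\<bar>information \<Phi> n $ i $ j\<bar> \<le> ?B" for i j
  proof -
    have "\<bar>\<Sum>k<n. \<Phi> k $ i * \<Phi> k $ j\<bar> \<le> (\<Sum>k<n. \<bar>\<Phi> k $ i\<bar> * \<bar>\<Phi> k $ j\<bar>)"
      by (rule order_trans[OF sum_abs]) (simp add: abs_mult)
    also have "\<dots> \<le> (\<Sum>k<n. (norm (\<Phi> k))\<^sup>2)"
      unfolding power2_eq_square by (intro sum_mono mult_mono component_le_norm_cart) auto
    finally show ?thesis
      by (auto simp: information_def mat_def)
  qed
  from abs_det_le[OF this] have "det (information \<Phi> n) \<le> fact CARD('d) * ?B ^ CARD('d)" by simp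
  then have "log_volume \<Phi> n \<le> ln (fact CARD('d) * ?B ^ CARD('d))"
    unfolding log_volume_def using det_information_ge_1[of \<Phi> n] by (intro ln_mono) auto
  also have "\<dots> = ln (fact CARD('d)) + CARD('d) * ln ?B"
    using B by (subst ln_mult) (auto simp: ln_realpow)
  finally show ?thesis .
qed

definition trace_drop :: "(nat \<Rightarrow> real ^ 'd) \<Rightarrow> nat \<Rightarrow> real" where
  "trace_drop \<Phi> n = trace (inv_information \<Phi> n) - trace (inv_information \<Phi> (Suc n))"

lemma trace_drop_eq:
  "trace_drop \<Phi> n = (norm (inv_information \<Phi> n *v \<Phi> n))\<^sup>2 / (1 + leverage \<Phi> n)"
  by (simp add: trace_drop_def trace_def leverage_def sum_subtractf[symmetric] power2_norm_eq_inner
      inner_vec_def divide_inverse sum_distrib_left mult.commute)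

lemma trace_drop_nonneg: "0 \<le> trace_drop \<Phi> n"
  unfolding trace_drop_eq using leverage_nonneg[of \<Phi> n] by simp

text \<open>The sum telescopes. The trace starts at the dimension and cannot become negative, the
  inverse being positive semidefinite.\<close>

lemma sum_trace_drop_le:
  fixes \<Phi> :: "nat \<Rightarrow> real ^ 'd"
  shows "(\<Sum>k<n. trace_drop \<Phi> k) \<le> CARD('d)"
proof -
  have "(\<Sum>k<n. trace_drop \<Phi> k) = trace (inv_information \<Phi> 0) - trace (inv_information \<Phi> n)"
    unfolding trace_drop_def by (rule sum_lessThan_telescope')
  moreover have "0 \<le> inv_information \<Phi> n $ i $ i" for i
    using inv_information_psd[of "axis i 1" \<Phi> n] by (simp add: matrix_vector_mul_component inner_axis' inner_axis row_def column_def matrix_vector_mult_basis)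
  then have "0 \<le> trace (inv_information \<Phi> n)"
    by (simp add: trace_def sum_nonneg)
  ultimately show ?thesis by (simp add: trace_I)
qed

text \<open>Guo's device: the part of the leverage exceeding 1 is paid for by the summable trace drops.\<close>

lemma leverage_le: "leverage \<Phi> n \<le> 1 + trace_drop \<Phi> n * (norm (\<Phi> n))\<^sup>2"
proof -
  let ?g = "leverage \<Phi> n" and ?w = "inv_information \<Phi> n *v \<Phi> n"
  have g: "0 \<le> ?g" by (rule leverage_nonneg)
  have "\<bar>\<Phi> n \<bullet> ?w\<bar>\<^sup>2 \<le> (norm (\<Phi> n) * norm ?w)\<^sup>2"
    by (intro power_mono Cauchy_Schwarz_ineq2) auto
  then have "?g\<^sup>2 \<le> (norm (\<Phi> n))\<^sup>2 * (norm ?w)\<^sup>2"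
    by (simp add: leverage_def power_mult_distrib)
  then have "?g\<^sup>2 / (1 + ?g) \<le> trace_drop \<Phi> n * (norm (\<Phi> n))\<^sup>2"
    using g by (simp add: trace_drop_eq divide_right_mono mult.commute)
  \<comment> \<open>The first summand is at most 1; the second is the one just bounded by
    Cauchy-Schwarz.\<close>
  moreover have "?g = ?g / (1 + ?g) + ?g\<^sup>2 / (1 + ?g)"
  proof -
    have "?g / (1 + ?g) + ?g\<^sup>2 / (1 + ?g) = ?g * (1 + ?g) / (1 + ?g)"
      by (simp add: add_divide_distrib[symmetric] power2_eq_square distrib_left)
    then show ?thesis using g by simp
  qed
  moreover have "?g / (1 + ?g) \<le> 1" using g by simp
  ultimately show ?thesis by linarith
qed

section \<open>Stability of the closed loop along a path\<close>

text \<open>The square root prepares for Cauchy-Schwarz: a product of factors max 1 (\<alpha>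
  \<delta>) becomes the exponential of a sum of square roots of \<alpha> \<delta>, which is at most
  the geometric mean of the two separate sums.\<close>

lemma max_one_le_exp_sqrt:
  fixes y :: real
  assumes "0 \<le> y"
  shows "max 1 y \<le> exp (2 * sqrt y)"
proof -
  have "sqrt y \<le> exp (sqrt y)"
    using exp_ge_add_one_self[of "sqrt y"] by linarith
  then have "sqrt y * sqrt y \<le> exp (sqrt y) * exp (sqrt y)"
    by (intro mult_mono) (use assms in auto)
  then show ?thesis
    using assms by (simp add: mult_exp_exp)
qed

lemma sum_sqrt_mult_le:
  fixes u v :: "'i \<Rightarrow> real"
  assumes "\<And>i. i \<in> I \<Longrightarrow> 0 \<le> u i" "\<And>i. i \<in> I \<Longrightarrow> 0 \<le> v i"
  shows "(\<Sum>i\<in>I. sqrt (u i * v i)) \<le> sqrt ((\<Sum>i\<in>I. u i) * (\<Sum>i\<in>I. v i))"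
proof -
  have "(\<Sum>i\<in>I. \<bar>sqrt (u i)\<bar> * \<bar>sqrt (v i)\<bar>) \<le> L2_set (\<lambda>i. sqrt (u i)) I * L2_set (\<lambda>i. sqrt (v i)) I"
    by (rule L2_set_mult_ineq)
  also have "\<dots> = sqrt ((\<Sum>i\<in>I. u i) * (\<Sum>i\<in>I. v i))"
    using assms by (simp add: L2_set_def real_sqrt_mult)
  also have "(\<Sum>i\<in>I. \<bar>sqrt (u i)\<bar> * \<bar>sqrt (v i)\<bar>) = (\<Sum>i\<in>I. sqrt (u i * v i))"
    using assms by (intro sum.cong) (auto simp: real_sqrt_mult)
  finally show ?thesis .
qed

text \<open>A discrete Gronwall inequality. Since all factors are at least 1, each additive term may
  be multiplied by the full product.\<close>

lemma product_recursion_le: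
  fixes m \<gamma> b :: "nat \<Rightarrow> real"
  assumes "\<And>n. n0 < n \<Longrightarrow> n \<le> N \<Longrightarrow> m n \<le> max 1 (\<gamma> n) * m (n - 1) + b n"
    and "\<And>n. n0 < n \<Longrightarrow> n \<le> N \<Longrightarrow> 0 \<le> b n" "n0 \<le> N"
  shows "m N \<le> (\<Prod>n\<in>{n0<..N}. max 1 (\<gamma> n)) * (m n0 + (\<Sum>n\<in>{n0<..N}. b n))"
  using assms
proof (induction N)
  case (Suc N)
  show ?case
  proof (cases "n0 = Suc N")
    case False
    then have n0: "n0 \<le> N" using Suc.prems by simp
    have ins: "{n0<..Suc N} = insert (Suc N) {n0<..N}" using n0 by auto
    let ?p = "\<Prod>n\<in>{n0<..N}. max 1 (\<gamma> n)" and ?s = "\<Sum>n\<in>{n0<..N}. b n"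
    have p: "1 \<le> ?p" by (intro prod_ge_1) auto
    have b: "0 \<le> b (Suc N)" using Suc.prems(2)[of "Suc N"] n0 by simp
    have "1 * b (Suc N) \<le> max 1 (\<gamma> (Suc N)) * ?p * b (Suc N)"
      by (intro mult_right_mono b) (use mult_mono[of 1 "max 1 (\<gamma> (Suc N))" 1 ?p] p in auto)
    moreover have "m (Suc N) \<le> max 1 (\<gamma> (Suc N)) * m N + b (Suc N)"
      using Suc.prems(1)[of "Suc N"] n0 by simp
    moreover have "max 1 (\<gamma> (Suc N)) * m N \<le> max 1 (\<gamma> (Suc N)) * (?p * (m n0 + ?s))"
      by (intro mult_left_mono Suc.IH) (use Suc.prems n0 in auto)
    ultimately show ?thesis
      by (simp add: ins algebra_simps)
  qed simp
qed simp

lemma exp_ln_powr: "0 < x \<Longrightarrow> exp (c * ln x) = (x::real) powr c"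
  by (simp add: powr_def)

text \<open>
  The closed loop along one path: \<open>w k = \<pi>\<^sub>k\<^sup>2\<close> is the squared excitation error, \<open>r k = \<bar>\<Phi>\<^sub>k\<bar>\<^sup>2\<close>,
  and \<open>m\<close> is the running maximum of \<open>w\<close>. Since the trace drops \<open>\<delta>\<close> are summable, the product
  of the growth factors \<open>C \<alpha>\<^sub>k \<delta>\<^sub>k\<close> is at most an arbitrarily small power of the determinant.
\<close>

locale closed_loop_path =
  fixes w \<alpha> \<delta> D r m :: "nat \<Rightarrow> real" and A \<Delta> c d C \<kappa> :: real
  assumes w: "\<And>k. 1 \<le> k \<Longrightarrow> 0 \<le> w k" "\<And>k. 1 \<le> k \<Longrightarrow> w k \<le> \<alpha> k * (2 + \<delta> k * r k)"
    and \<alpha>: "\<And>k. 0 \<le> \<alpha> k" "\<And>n. 1 \<le> n \<Longrightarrow> (\<Sum>k=1..n. \<alpha> k) \<le> A * (1 + D n)\<^sup>2"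
    and \<delta>: "\<And>k. 0 \<le> \<delta> k" "\<And>n. (\<Sum>k<n. \<delta> k) \<le> \<Delta>"
    and D: "\<And>n. 0 \<le> D n" "\<And>n. D n \<le> c + d * ln (1 + (\<Sum>k\<le>n. r k))"
    and r: "\<And>k. 0 \<le> r k" "\<And>k. 1 \<le> k \<Longrightarrow> r k \<le> C * (m (k - 1) + real k powr \<kappa>)"
    and m: "m 0 = 0" "\<And>k. m (Suc k) = max (m k) (w (Suc k))"
    and ranges: "0 < \<kappa>" "\<kappa> < 1" "1 \<le> C" "1 \<le> A" "1 \<le> d" "0 \<le> c" "0 \<le> \<Delta>"
begin

lemma m_mono: "i \<le> j \<Longrightarrow> m i \<le> m j"
  by (rule lift_Suc_mono_le[of m]) (simp_all add: m)

lemma m_nonneg: "0 \<le> m k"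
  using m_mono[of 0 k] m by simp

lemma \<delta>_le: "\<delta> k \<le> \<Delta>"
proof -
  have "\<delta> k \<le> (\<Sum>i<Suc k. \<delta> i)" using \<delta>(1) by (simp add: sum_nonneg)
  also have "\<dots> \<le> \<Delta>" by (rule \<delta>)
  finally show ?thesis .
qed

text \<open>A polynomial in \<open>N\<close> times the running maximum is precise enough, because
  this sum enters only through the logarithm that bounds \<open>D\<close>.\<close>

lemma sum_r_le: "\<exists>B\<ge>1. \<forall>N\<ge>1. 1 + (\<Sum>k\<le>N. r k) \<le> B * real N ^ 2 * (1 + m N)"
proof (intro exI conjI allI impI)
  show "1 \<le> 1 + r 0 + C" using r ranges by (simp add: add_nonneg_nonneg)
  fix N :: nat assume N: "1 \<le> N"
  have rk: "r k \<le> C * real N * (1 + m N)" if "k \<in> {1..N}" for k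
  proof -
    have "real k powr \<kappa> \<le> real N powr 1"
      using that ranges by (intro order_trans[OF powr_mono2[of \<kappa> "real k" "real N"] powr_mono]) auto
    moreover have "m (k - 1) \<le> real N * m N"
    proof -
      have "m (k - 1) \<le> m N" by (rule m_mono) (use that in auto)
      also have "\<dots> \<le> real N * m N"
        using mult_right_mono[of 1 "real N" "m N"] N m_nonneg[of N] by simp
      finally show ?thesis .
    qed
    ultimately have "m (k - 1) + real k powr \<kappa> \<le> real N * (1 + m N)"
      using N by (simp add: algebra_simps)
    then have "C * (m (k - 1) + real k powr \<kappa>) \<le> C * (real N * (1 + m N))"
      using ranges by (intro mult_left_mono) auto
    with r(2)[of k] that show ?thesis by (simp add: mult.assoc)
  qed
  \<comment> \<open>The bound on \<open>r\<close> in terms of \<open>m\<close> starts at 1, so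
    \<open>r 0\<close> goes into the constant.\<close>
  have "{..N} = insert 0 {1..N}" by auto
  then have "1 + (\<Sum>k\<le>N. r k) = 1 + r 0 + (\<Sum>k=1..N. r k)" by simp
  also have "\<dots> \<le> 1 + r 0 + N * (C * real N * (1 + m N))"
    using sum_bounded_above[of "{1..N}" r, OF rk] by simp
  also have "\<dots> \<le> (1 + r 0) * (real N ^ 2 * (1 + m N)) + C * (real N ^ 2 * (1 + m N))"
  proof -
    have "1 * 1 \<le> real N ^ 2 * (1 + m N)"
      using N m_nonneg[of N] by (intro mult_mono) auto
    then have "(1 + r 0) * 1 \<le> (1 + r 0) * (real N ^ 2 * (1 + m N))"
      using r(1)[of 0] by (intro mult_left_mono) auto
    then show ?thesis by (simp add: power2_eq_square mult_ac)
  qed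
  also have "\<dots> = (1 + r 0 + C) * real N ^ 2 * (1 + m N)"
    by (simp add: algebra_simps)
  finally show "1 + (\<Sum>k\<le>N. r k) \<le> (1 + r 0 + C) * real N ^ 2 * (1 + m N)" .
qed

text \<open>\<open>D\<close> is at most a multiple of a logarithm, so exponentiating s (1 + D) costs
  powers whose exponents are proportional to s. A small s makes both of them small.\<close>

lemma exp_D_le:
  assumes "0 \<le> s"
  shows "\<exists>B\<ge>1. \<forall>N\<ge>1. exp (s * (1 + D N)) \<le> B * real N powr (2 * s * d) * (1 + m N) powr (s * d)"
proof -
  obtain B where B: "1 \<le> B" "\<And>N. 1 \<le> N \<Longrightarrow> 1 + (\<Sum>k\<le>N. r k) \<le> B * real N ^ 2 * (1 + m N)"
    using sum_r_le by blast
  show ?thesis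
  proof (intro exI conjI allI impI)
    show "1 \<le> exp (s * (1 + c)) * B powr (s * d)"
    proof -
      have "1 \<le> B powr (s * d)"
        using assms ranges B by (intro ge_one_powr_ge_zero) auto
      moreover have "1 \<le> exp (s * (1 + c))" using assms ranges by simp
      ultimately show ?thesis using mult_mono[of 1 "exp (s * (1 + c))" 1 "B powr (s * d)"] by simp
    qed
    fix N :: nat assume N: "1 \<le> N"
    let ?x = "1 + (\<Sum>k\<le>N. r k)"
    have x: "1 \<le> ?x" using r by (simp add: sum_nonneg)
    have "exp (s * (1 + D N)) \<le> exp (s * (1 + c) + (s * d) * ln ?x)"
      using mult_left_mono[OF D(2)[of N] assms] by (simp add: algebra_simps)
    also have "\<dots> = exp (s * (1 + c)) * ?x powr (s * d)"
      using x by (simp add: exp_add exp_ln_powr)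
    also have "\<dots> \<le> exp (s * (1 + c)) * (B * real N ^ 2 * (1 + m N)) powr (s * d)"
      using x B(2)[OF N] assms ranges by (intro mult_left_mono powr_mono2) auto
    also have "\<dots> = exp (s * (1 + c)) * B powr (s * d) * real N powr (2 * s * d) * (1 + m N) powr (s * d)"
    proof -
      have "(B * real N ^ 2 * (1 + m N)) powr (s * d) = B powr (s * d) * (real N ^ 2) powr (s * d) * (1 + m N) powr (s * d)"
        using B m_nonneg[of N] by (simp add: powr_mult)
      also have "real N ^ 2 = real N powr 2"
        using N by simp
      also have "(real N powr 2) powr (s * d) = real N powr (2 * s * d)"
        by (simp only: powr_powr mult.assoc)
      finally show ?thesis by simp
    qed
    finally show "exp (s * (1 + D N)) \<le> exp (s * (1 + c)) * B powr (s * d) * real N powr (2 * s * d) * (1 + m N) powr (s * d)" .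
  qed
qed

text \<open>An exponential of any positive rate dominates a square. The constant comes from squaring
  y \<le> exp y at y = (s / 2) (1 + D N).\<close>

lemma square_le_exp:
  assumes "0 < s"
  shows "(1 + D N)\<^sup>2 \<le> (2 / s)\<^sup>2 * exp (s * (1 + D N))"
proof -
  have "s / 2 * (1 + D N) \<le> exp (s / 2 * (1 + D N))"
    using exp_ge_add_one_self[of "s / 2 * (1 + D N)"] by linarith
  then have "(s / 2 * (1 + D N))\<^sup>2 \<le> (exp (s / 2 * (1 + D N)))\<^sup>2"
    using assms D(1)[of N] by (intro power_mono) auto
  also have "\<dots> = exp (s * (1 + D N))"
    by (simp add: exp_double[symmetric])
  finally have "(2 / s)\<^sup>2 * (s / 2 * (1 + D N))\<^sup>2 \<le> (2 / s)\<^sup>2 * exp (s * (1 + D N))"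
    by (intro mult_left_mono) auto
  moreover have "(2 / s)\<^sup>2 * (s / 2 * (1 + D N))\<^sup>2 = (1 + D N)\<^sup>2"
  proof -
    have "2 / s * (s / 2 * (1 + D N)) = 1 + D N" using assms by simp
    then show ?thesis by (simp only: power_mult_distrib[symmetric])
  qed
  ultimately show ?thesis by simp
qed

text \<open>This is the source of smallness in the growth estimate: the \<delta>_k are summable, so
  discarding finitely many indices makes their sum as small as desired.\<close>

lemma tail_\<delta>:
  assumes "0 < \<eta>"
  shows "\<exists>n0\<ge>1. \<forall>N. (\<Sum>k\<in>{n0<..N}. \<delta> k) \<le> \<eta>"
proof -
  have s: "summable \<delta>"
    by (rule summableI_nonneg_bounded[of \<delta> \<Delta>]) (use \<delta> in auto)
  then obtain n0 where n0: "\<And>n. n \<ge> n0 \<Longrightarrow> \<bar>\<Sum>i. \<delta> (i + n)\<bar> < \<eta>"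
    using suminf_exist_split[OF assms s] by (auto simp: real_norm_def)
  show ?thesis
  proof (intro exI conjI allI)
    show "1 \<le> Suc n0" by simp
    fix N
    have "(\<Sum>k\<in>{Suc n0<..N}. \<delta> k) \<le> (\<Sum>k\<in>{n0..<n0 + Suc N}. \<delta> k)"
      by (intro sum_mono2) (use \<delta> in auto)
    also have "\<dots> = (\<Sum>i<Suc N. \<delta> (i + n0))"
      using sum.shift_bounds_nat_ivl[of \<delta> 0 n0 "Suc N"] by (simp add: add.commute lessThan_atLeast0)
    also have "\<dots> \<le> (\<Sum>i. \<delta> (i + n0))"
      using s \<delta> by (intro sum_le_suminf) (auto simp: summable_iff_shift)
    also have "\<dots> \<le> \<eta>" using n0[of n0] by simp
    finally show "(\<Sum>k\<in>{Suc n0<..N}. \<delta> k) \<le> \<eta>" .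
  qed
qed

lemma sum_\<alpha>_le: "1 \<le> N \<Longrightarrow> (\<Sum>n\<in>{n0<..N}. \<alpha> n) \<le> A * (1 + D N)\<^sup>2"
  using \<alpha> by (intro order_trans[OF sum_mono2[of "{1..N}" "{n0<..N}" \<alpha>] \<alpha>(2)]) auto

text \<open>Inserting the bound on \<open>r\<close> lets C \<alpha> \<delta> multiply the previous
  maximum, while the rest is additive with a factor \<alpha>, whose sum is controlled. The
  \<open>max 1\<close> covers the steps at which the maximum does not change.\<close>

lemma m_step:
  assumes "1 \<le> n"
  shows "m n \<le> max 1 (C * (\<alpha> n * \<delta> n)) * m (n - 1) + (2 + C * \<Delta>) * real n powr \<kappa> * \<alpha> n"
proof -
  obtain k where k: "n = Suc k" using assms by (cases n) auto
  have 1: "1 \<le> real n powr \<kappa>"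
    using assms ranges by (intro ge_one_powr_ge_zero) auto
  have "w n \<le> \<alpha> n * (2 + \<delta> n * (C * (m k + real n powr \<kappa>)))"
    using w(2)[of n] mult_left_mono[OF mult_left_mono[OF r(2)[of n] \<delta>(1)[of n]] \<alpha>(1)[of n]] assms k
    by (simp add: algebra_simps)
  also have "\<dots> = C * (\<alpha> n * \<delta> n) * m k + (2 * 1 + C * \<delta> n * real n powr \<kappa>) * \<alpha> n"
    by (simp add: algebra_simps)
  also have "\<dots> \<le> max 1 (C * (\<alpha> n * \<delta> n)) * m k + (2 * real n powr \<kappa> + C * \<Delta> * real n powr \<kappa>) * \<alpha> n"
    using 1 \<delta>_le[of n] ranges \<alpha>(1)[of n] m_nonneg[of k]
    by (intro add_mono mult_right_mono mult_left_mono) auto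
  finally have "w n \<le> max 1 (C * (\<alpha> n * \<delta> n)) * m k + (2 + C * \<Delta>) * real n powr \<kappa> * \<alpha> n"
    by (simp add: algebra_simps)
  moreover have "1 * m k \<le> max 1 (C * (\<alpha> n * \<delta> n)) * m k"
    by (intro mult_right_mono m_nonneg) auto
  moreover have "0 \<le> (2 + C * \<Delta>) * real n powr \<kappa> * \<alpha> n"
    using ranges \<alpha>(1)[of n] by (intro mult_nonneg_nonneg) auto
  ultimately show ?thesis using k m(2)[of k] by simp
qed

text \<open>The Gronwall bound consists of an exponential of D, a factor (1 + D)^2 and a power of N.
  By \<open>exp_D_le\<close> it is at most a constant times N^(\<kappa> + 2 \<tau>) (1 + m
  N)^\<tau>. As \<tau> < 1, the power of the maximum can be moved to the left.\<close>

lemma m_polynomial: "\<exists>\<kappa>' B. 0 < \<kappa>' \<and> \<kappa>' < 1 \<and> 1 \<le> B \<and> (\<forall>N\<ge>1. 1 + m N \<le> B * real N powr \<kappa>')"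
proof -
  \<comment> \<open>The absorption leads to the exponent (\<kappa> + 2 \<tau>) / (1 - \<tau>), which
    is below 1 exactly when 3 \<tau> < 1 - \<kappa>. The value taken is half of the critical
    one.\<close>
  define \<tau> where "\<tau> = (1 - \<kappa>) / 6"
  have \<tau>: "0 < \<tau>" "\<tau> < 1" "\<kappa> + 2 * \<tau> < 1 - \<tau>" using ranges by (auto simp: \<tau>_def field_simps)
  define s where "s = \<tau> / d"
  have s: "0 < s" "s * d = \<tau>" using \<tau> ranges by (auto simp: s_def)
  \<comment> \<open>With this tail sum, the square root of C A (1 + D)^2 \<eta> is exactly (s / 4)
    (1 + D).\<close>
  define \<eta> where "\<eta> = (s / 4)\<^sup>2 / (C * A)"
  have \<eta>: "0 < \<eta>" using s ranges by (auto simp: \<eta>_def)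
  obtain n0 where n0: "1 \<le> n0" "\<And>N. (\<Sum>k\<in>{n0<..N}. \<delta> k) \<le> \<eta>"
    using tail_\<delta>[OF \<eta>] by blast
  obtain B where B: "1 \<le> B" "\<And>N. 1 \<le> N \<Longrightarrow> exp (s * (1 + D N)) \<le> B * real N powr (2 * s * d) * (1 + m N) powr (s * d)"
    using exp_D_le[of s] s by auto
  have P: "(\<Prod>n\<in>{n0<..N}. max 1 (C * (\<alpha> n * \<delta> n))) \<le> exp (s / 2 * (1 + D N))" if N: "1 \<le> N" for N
  proof -
    have "(\<Prod>n\<in>{n0<..N}. max 1 (C * (\<alpha> n * \<delta> n))) \<le> (\<Prod>n\<in>{n0<..N}. exp (2 * sqrt ((C * \<alpha> n) * \<delta> n)))"
      using ranges \<alpha>(1) \<delta>(1) max_one_le_exp_sqrt[of "C * (\<alpha> n * \<delta> n)" for n]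
      by (intro prod_mono) (auto simp: mult.assoc)
    also have "\<dots> = exp (2 * (\<Sum>n\<in>{n0<..N}. sqrt ((C * \<alpha> n) * \<delta> n)))"
      by (simp add: exp_sum sum_distrib_left)
    also have "\<dots> \<le> exp (2 * (s / 4 * (1 + D N)))"
    proof -
      have "(\<Sum>n\<in>{n0<..N}. sqrt ((C * \<alpha> n) * \<delta> n)) \<le> sqrt ((\<Sum>n\<in>{n0<..N}. C * \<alpha> n) * (\<Sum>n\<in>{n0<..N}. \<delta> n))"
        using ranges \<alpha>(1) \<delta>(1) by (intro sum_sqrt_mult_le) auto
      also have "\<dots> \<le> sqrt ((C * (A * (1 + D N)\<^sup>2)) * \<eta>)"
        unfolding sum_distrib_left[symmetric]
        using ranges \<alpha>(1) \<delta>(1) \<eta> by (intro real_sqrt_le_mono mult_mono n0 mult_left_mono sum_\<alpha>_le N sum_nonneg) auto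
      also have "\<dots> = sqrt ((s / 4 * (1 + D N))\<^sup>2)"
        using ranges by (simp add: \<eta>_def power_mult_distrib power2_eq_square)
      also have "\<dots> = s / 4 * (1 + D N)"
        using s D(1)[of N] by (subst real_sqrt_abs) auto
      finally show ?thesis by simp
    qed
    finally show ?thesis by (simp add: mult.assoc)
  qed
  \<comment> \<open>The exponential at rate s is shared: one half pays for the product, the other
    half for (1 + D)^2. The factor (4 / s)^2 is that of \<open>square_le_exp\<close> at rate s /
    2.\<close>
  define G where "G = m n0 + (2 + C * \<Delta>) * A * (4 / s)\<^sup>2"
  have G: "0 \<le> G" using m_nonneg[of n0] ranges by (auto simp: G_def)
  have main: "m N \<le> G * B * real N powr (\<kappa> + 2 * \<tau>) * (1 + m N) powr \<tau>" if N: "n0 \<le> N" for N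
  proof -
    have N1: "1 \<le> N" using N n0 by simp
    have one: "1 \<le> real N powr \<kappa>" using N1 ranges by (intro ge_one_powr_ge_zero) auto
    have e1: "1 \<le> exp (s / 2 * (1 + D N))" using s D(1)[of N] by simp
    have "m N \<le> (\<Prod>n\<in>{n0<..N}. max 1 (C * (\<alpha> n * \<delta> n)))
        * (m n0 + (\<Sum>n\<in>{n0<..N}. (2 + C * \<Delta>) * real N powr \<kappa> * \<alpha> n))"
    proof (rule product_recursion_le[OF _ _ N])
      fix n assume n: "n0 < n" "n \<le> N"
      have "(2 + C * \<Delta>) * real n powr \<kappa> * \<alpha> n \<le> (2 + C * \<Delta>) * real N powr \<kappa> * \<alpha> n"
        using n ranges \<alpha>(1)[of n] by (intro mult_right_mono mult_left_mono powr_mono2) auto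
      then show "m n \<le> max 1 (C * (\<alpha> n * \<delta> n)) * m (n - 1) + (2 + C * \<Delta>) * real N powr \<kappa> * \<alpha> n"
        using m_step[of n] n by simp
      show "0 \<le> (2 + C * \<Delta>) * real N powr \<kappa> * \<alpha> n"
        using ranges \<alpha>(1)[of n] by simp
    qed
    also have "\<dots> \<le> exp (s / 2 * (1 + D N)) * (m n0 + (2 + C * \<Delta>) * real N powr \<kappa> * (A * (1 + D N)\<^sup>2))"
      unfolding sum_distrib_left[symmetric]
      using ranges m_nonneg[of n0] \<alpha>(1)
      by (intro mult_mono P N1 add_mono mult_left_mono sum_\<alpha>_le add_nonneg_nonneg mult_nonneg_nonneg sum_nonneg) auto
    also have "\<dots> \<le> exp (s / 2 * (1 + D N)) * (m n0 * (real N powr \<kappa> * exp (s / 2 * (1 + D N)))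
          + (2 + C * \<Delta>) * real N powr \<kappa> * (A * ((4 / s)\<^sup>2 * exp (s / 2 * (1 + D N)))))"
    proof (intro mult_left_mono add_mono)
      show "m n0 \<le> m n0 * (real N powr \<kappa> * exp (s / 2 * (1 + D N)))"
        using mult_left_mono[OF mult_mono[OF one e1] m_nonneg[of n0]] by simp
      show "(1 + D N)\<^sup>2 \<le> (4 / s)\<^sup>2 * exp (s / 2 * (1 + D N))"
        using square_le_exp[of "s / 2" N] s by simp
    qed (use ranges in auto)
    also have "\<dots> = G * real N powr \<kappa> * (exp (s / 2 * (1 + D N)) * exp (s / 2 * (1 + D N)))"
      by (simp add: G_def algebra_simps)
    also have "\<dots> = G * real N powr \<kappa> * exp (s * (1 + D N))"
      by (simp add: exp_add[symmetric])
    also have "\<dots> \<le> G * real N powr \<kappa> * (B * real N powr (2 * s * d) * (1 + m N) powr (s * d))"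
      by (intro mult_left_mono B N1) (use G in auto)
    also have "\<dots> = G * B * real N powr (\<kappa> + 2 * \<tau>) * (1 + m N) powr \<tau>"
    proof -
      have e: "2 * s * d = 2 * \<tau>" using s by simp
      show ?thesis by (simp only: s(2) e powr_add) (simp add: mult_ac)
    qed
    finally show ?thesis .
  qed
  define \<kappa>' where "\<kappa>' = (\<kappa> + 2 * \<tau>) / (1 - \<tau>)"
  have \<kappa>': "0 < \<kappa>'" "\<kappa>' < 1" using \<tau> ranges by (auto simp: \<kappa>'_def)
  define E where "E = (1 + G * B) powr (1 / (1 - \<tau>))"
  have GB: "0 \<le> G * B" using G B by simp
  have large: "1 + m N \<le> E * real N powr \<kappa>'" if N: "n0 \<le> N" for N
  proof -
    have N1: "1 \<le> N" using N n0 by simp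
    let ?y = "1 + m N"
    have y: "1 \<le> ?y" using m_nonneg[of N] by simp
    have "1 * 1 \<le> real N powr (\<kappa> + 2 * \<tau>) * ?y powr \<tau>"
      using N1 y \<tau> ranges by (intro mult_mono ge_one_powr_ge_zero) auto
    with main[OF N] have "?y \<le> (1 + G * B) * real N powr (\<kappa> + 2 * \<tau>) * ?y powr \<tau>"
      by (simp add: algebra_simps)
    then have "?y powr (1 - \<tau>) \<le> (1 + G * B) * real N powr (\<kappa> + 2 * \<tau>)"
      using y by (simp add: powr_diff divide_le_eq)
    then have "(?y powr (1 - \<tau>)) powr (1 / (1 - \<tau>)) \<le> ((1 + G * B) * real N powr (\<kappa> + 2 * \<tau>)) powr (1 / (1 - \<tau>))"
      using \<tau> by (intro powr_mono2) auto
    also have "\<dots> = E * real N powr \<kappa>'"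
      using GB by (simp add: powr_mult powr_powr E_def \<kappa>'_def)
    finally show ?thesis using y \<tau> by (simp add: powr_powr)
  qed
  show ?thesis
  proof (intro exI conjI allI impI)
    show "1 \<le> max E (1 + m n0)" using m_nonneg[of n0] by simp
    fix N :: nat assume N: "1 \<le> N"
    show "1 + m N \<le> max E (1 + m n0) * real N powr \<kappa>'"
    proof (cases "n0 \<le> N")
      case True
      then show ?thesis
        by (intro order_trans[OF large[OF True] mult_right_mono]) auto
    next
      case False
      \<comment> \<open>The finitely many N below \<open>n0\<close> are covered by the constant,
        because \<open>m\<close> is monotone.\<close>
      have "1 \<le> real N powr \<kappa>'" using N \<kappa>' by (intro ge_one_powr_ge_zero) auto
      then have "(1 + m n0) * 1 \<le> max E (1 + m n0) * real N powr \<kappa>'"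
        using m_nonneg[of n0] by (intro mult_mono) auto
      then show ?thesis using m_mono[of N n0] False by simp
    qed
  qed (use \<kappa>' in auto)
qed

theorem stability:
  "\<exists>\<mu> B. 0 < \<mu> \<and> \<mu> < 1 \<and> (\<forall>k\<ge>1. r k \<le> B * real k powr \<mu>) \<and> (\<lambda>n. (\<Sum>k=1..n. w k) / real n) \<longlonglongrightarrow> 0"
proof -
  obtain \<kappa>' B where B: "0 < \<kappa>'" "\<kappa>' < 1" "1 \<le> B" "\<And>N. N \<ge> 1 \<Longrightarrow> 1 + m N \<le> B * real N powr \<kappa>'"
    using m_polynomial by blast
  define \<mu> where "\<mu> = max \<kappa> \<kappa>'"
  have \<mu>: "0 < \<mu>" "\<mu> < 1" using B ranges by (auto simp: \<mu>_def)
  have rk: "r k \<le> C * (B + 1) * real k powr \<mu>" if k: "1 \<le> k" for k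
  proof -
    have "m (k - 1) \<le> B * real k powr \<kappa>'"
      using m_mono[of "k - 1" k] B(4)[OF k] by simp
    also have "\<dots> \<le> B * real k powr \<mu>"
      using k B by (intro mult_left_mono powr_mono) (auto simp: \<mu>_def)
    finally have "m (k - 1) + real k powr \<kappa> \<le> B * real k powr \<mu> + real k powr \<mu>"
      using k by (intro add_mono powr_mono) (auto simp: \<mu>_def)
    then have "C * (m (k - 1) + real k powr \<kappa>) \<le> C * (B * real k powr \<mu> + real k powr \<mu>)"
      using ranges by (intro mult_left_mono) auto
    with r(2)[OF k] show ?thesis by (simp add: algebra_simps)
  qed
  \<comment> \<open>The total exponent below is \<mu> + 3 s d: the parts 2 s d and s d come from the
    two powers in \<open>exp_D_le\<close>, with \<kappa>' replaced by 1. This s makes it (1 + \<mu>)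
    / 2, which is below 1.\<close>
  define s where "s = (1 - \<mu>) / (6 * d)"
  have s: "0 < s" "3 * (s * d) = (1 - \<mu>) / 2" using \<mu> ranges by (auto simp: s_def)
  obtain B' where B': "1 \<le> B'" "\<And>N. 1 \<le> N \<Longrightarrow> exp (s * (1 + D N)) \<le> B' * real N powr (2 * s * d) * (1 + m N) powr (s * d)"
    using exp_D_le[of s] s by auto
  define E where "E = A * ((2 / s)\<^sup>2 * (B' * B powr (s * d))) * (2 + \<Delta> * (C * (B + 1)))"
  have bound: "(\<Sum>k=1..n. w k) \<le> E * real n powr (\<mu> + 3 * (s * d))" if n: "1 \<le> n" for n
  proof -
    have one: "1 \<le> real n powr \<mu>" using n \<mu> by (intro ge_one_powr_ge_zero) auto
    have e: "exp (s * (1 + D n)) \<le> B' * B powr (s * d) * real n powr (3 * (s * d))"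
    proof -
      have "(1 + m n) powr (s * d) \<le> (B * real n powr \<kappa>') powr (s * d)"
        using B(4)[OF n] m_nonneg[of n] s(1) ranges by (intro powr_mono2) auto
      also have "\<dots> = B powr (s * d) * real n powr (\<kappa>' * (s * d))"
        using B by (simp add: powr_mult powr_powr)
      also have "\<dots> \<le> B powr (s * d) * real n powr (1 * (s * d))"
        using n B s(1) ranges by (intro mult_left_mono powr_mono mult_right_mono) auto
      finally have "B' * real n powr (2 * s * d) * (1 + m n) powr (s * d)
          \<le> B' * real n powr (2 * s * d) * (B powr (s * d) * real n powr (s * d))"
        using B' by (intro mult_left_mono) auto
      also have "\<dots> = B' * B powr (s * d) * (real n powr (2 * s * d) * real n powr (s * d))"
        by simp
      also have "real n powr (2 * s * d) * real n powr (s * d) = real n powr (3 * (s * d))"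
        by (simp add: powr_add[symmetric] algebra_simps)
      finally show ?thesis using B'(2)[OF n] by linarith
    qed
    have "(\<Sum>k=1..n. w k) \<le> (\<Sum>k=1..n. \<alpha> k * (2 * real n powr \<mu> + \<Delta> * (C * (B + 1) * real n powr \<mu>)))"
    proof (rule sum_mono)
      fix k assume k: "k \<in> {1..n}"
      have "r k \<le> C * (B + 1) * real n powr \<mu>"
        using rk[of k] k ranges B \<mu>
        by (intro order_trans[OF rk[of k] mult_left_mono[OF powr_mono2]]) auto
      then have "\<delta> k * r k \<le> \<Delta> * (C * (B + 1) * real n powr \<mu>)"
        using \<delta>_le[of k] \<delta>(1)[of k] r(1)[of k] ranges by (intro mult_mono) auto
      then have "\<alpha> k * (2 + \<delta> k * r k) \<le> \<alpha> k * (2 * real n powr \<mu> + \<Delta> * (C * (B + 1) * real n powr \<mu>))"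
        using one \<alpha>(1)[of k] by (intro mult_left_mono add_mono) auto
      then show "w k \<le> \<alpha> k * (2 * real n powr \<mu> + \<Delta> * (C * (B + 1) * real n powr \<mu>))"
        using w(2)[of k] k by simp
    qed
    also have "\<dots> = (\<Sum>k=1..n. \<alpha> k) * ((2 + \<Delta> * (C * (B + 1))) * real n powr \<mu>)"
      by (simp only: sum_distrib_right[symmetric]) (simp add: algebra_simps)
    also have "\<dots> \<le> (A * ((2 / s)\<^sup>2 * (B' * B powr (s * d) * real n powr (3 * (s * d))))) * ((2 + \<Delta> * (C * (B + 1))) * real n powr \<mu>)"
    proof (intro mult_right_mono)
      have "(1 + D n)\<^sup>2 \<le> (2 / s)\<^sup>2 * (B' * B powr (s * d) * real n powr (3 * (s * d)))"
        by (rule order_trans[OF square_le_exp[OF s(1)] mult_left_mono[OF e]]) simp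
      then show "(\<Sum>k=1..n. \<alpha> k) \<le> A * ((2 / s)\<^sup>2 * (B' * B powr (s * d) * real n powr (3 * (s * d))))"
        using \<alpha>(2)[OF n] ranges by (intro order_trans[OF \<alpha>(2)[OF n] mult_left_mono]) auto
    qed (use ranges B in auto)
    also have "\<dots> = E * real n powr (\<mu> + 3 * (s * d))"
      by (simp add: E_def powr_add mult_ac)
    finally show ?thesis .
  qed
  have "(\<lambda>n. (\<Sum>k=1..n. w k) / real n) \<longlonglongrightarrow> 0"
  proof (rule tendsto_sandwich[OF _ _ tendsto_const])
    show "\<forall>\<^sub>F n in sequentially. 0 \<le> (\<Sum>k=1..n. w k) / real n"
      using w(1) by (intro always_eventually allI divide_nonneg_nonneg sum_nonneg) auto
    show "\<forall>\<^sub>F n in sequentially. (\<Sum>k=1..n. w k) / real n \<le> E * real n powr (- ((1 - \<mu>) / 2))"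
      using eventually_ge_at_top[of 1]
    proof eventually_elim
      case (elim n)
      have "\<mu> + 3 * (s * d) = 1 + - ((1 - \<mu>) / 2)" unfolding s(2) by (simp add: field_simps)
      then have "real n powr (\<mu> + 3 * (s * d)) = real n * real n powr (- ((1 - \<mu>) / 2))"
        using elim by (simp only: powr_add) simp
      with bound[OF elim] elim show ?case by (simp add: divide_le_eq mult_ac)
    qed
    show "(\<lambda>n. E * real n powr (- ((1 - \<mu>) / 2))) \<longlonglongrightarrow> 0"
      using \<mu> by (intro tendsto_mult_right_zero tendsto_neg_powr filterlim_real_sequentially) auto
  qed
  then show ?thesis using \<mu> rk by blast
qed

end

section \<open>Convergence in probability\<close>

text \<open>Phrased with exceptional events, so that no measurability of the sequence is needed.\<close>

definition tends_in_prob :: "'a measure \<Rightarrow> (nat \<Rightarrow> 'a \<Rightarrow> 'b::metric_space) \<Rightarrow> 'b \<Rightarrow> bool" where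
  "tends_in_prob M Z c \<longleftrightarrow> (\<forall>e>0. \<forall>\<^sub>F n in sequentially.
     \<exists>A\<in>sets M. measure M A < e \<and> (\<forall>\<omega>\<in>space M - A. dist (Z n \<omega>) c < e))"

context prob_space
begin

lemma tends_in_probI:
  assumes "\<And>e. 0 < e \<Longrightarrow> \<forall>\<^sub>F n in sequentially.
     \<exists>A\<in>sets M. measure M A \<le> e \<and> (\<forall>\<omega>\<in>space M - A. dist (Z n \<omega>) c \<le> e)"
  shows "tends_in_prob M Z c"
  unfolding tends_in_prob_def
proof (intro allI impI)
  fix e :: real assume e: "0 < e"
  then have "\<forall>\<^sub>F n in sequentially.
     \<exists>A\<in>sets M. measure M A \<le> e / 2 \<and> (\<forall>\<omega>\<in>space M - A. dist (Z n \<omega>) c \<le> e / 2)"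
    using assms[of "e / 2"] by simp
  then show "\<forall>\<^sub>F n in sequentially.
     \<exists>A\<in>sets M. measure M A < e \<and> (\<forall>\<omega>\<in>space M - A. dist (Z n \<omega>) c < e)"
  proof eventually_elim
    case (elim n)
    then obtain A where "A \<in> sets M" "measure M A \<le> e / 2" "\<forall>\<omega>\<in>space M - A. dist (Z n \<omega>) c \<le> e / 2"
      by blast
    then show ?case
      using e by (intro bexI[of _ A]) (auto intro: le_less_trans[of _ "e / 2"])
  qed
qed

lemma tends_in_probD:
  assumes "tends_in_prob M Z c" "0 < p" "0 < e"
  shows "\<forall>\<^sub>F n in sequentially. \<exists>A\<in>sets M. measure M A < p \<and> (\<forall>\<omega>\<in>space M - A. dist (Z n \<omega>) c < e)"
proof -
  have "\<forall>\<^sub>F n in sequentially. \<exists>A\<in>sets M. measure M A < min p e \<and> (\<forall>\<omega>\<in>space M - A. dist (Z n \<omega>) c < min p e)"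
    using assms(1) unfolding tends_in_prob_def by (rule allE[of _ "min p e"]) (use assms in simp)
  then show ?thesis
    by eventually_elim (meson min_less_iff_conj)
qed

lemma tends_in_prob_Pair:
  assumes "tends_in_prob M X a" "tends_in_prob M Y b"
  shows "tends_in_prob M (\<lambda>n \<omega>. (X n \<omega>, Y n \<omega>)) (a, b)"
proof (rule tends_in_probI)
  fix e :: real assume e: "0 < e"
  then have "0 < e / 2" by simp
  from tends_in_probD[OF assms(1) this this] tends_in_probD[OF assms(2) this this]
  show "\<forall>\<^sub>F n in sequentially. \<exists>A\<in>sets M. measure M A \<le> e \<and>
      (\<forall>\<omega>\<in>space M - A. dist (X n \<omega>, Y n \<omega>) (a, b) \<le> e)"
  proof eventually_elim
    case (elim n)
    then obtain A B where A: "A \<in> sets M" "measure M A < e / 2" "\<forall>\<omega>\<in>space M - A. dist (X n \<omega>) a < e / 2"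
      and B: "B \<in> sets M" "measure M B < e / 2" "\<forall>\<omega>\<in>space M - B. dist (Y n \<omega>) b < e / 2"
      by blast
    have "dist (X n \<omega>, Y n \<omega>) (a, b) \<le> e" if "\<omega> \<in> space M - (A \<union> B)" for \<omega>
    proof -
      have "dist (X n \<omega>, Y n \<omega>) (a, b) \<le> dist (X n \<omega>) a + dist (Y n \<omega>) b"
        unfolding dist_Pair_Pair by (rule sqrt_sum_squares_le_sum) auto
      then show ?thesis using that A(3) B(3) by force
    qed
    then show ?case
      using A B measure_Un_le[of A M B] by (intro bexI[of _ "A \<union> B"]) auto
  qed
qed

lemma tends_in_prob_isCont:
  assumes "tends_in_prob M Z c" "isCont g c"
  shows "tends_in_prob M (\<lambda>n \<omega>. g (Z n \<omega>)) (g c)"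
proof (rule tends_in_probI)
  fix e :: real assume e: "0 < e"
  with assms(2) obtain d where d: "0 < d" "\<And>x. dist x c < d \<Longrightarrow> dist (g x) (g c) < e"
    unfolding continuous_at_eps_delta by blast
  from tends_in_probD[OF assms(1) e d(1)]
  show "\<forall>\<^sub>F n in sequentially. \<exists>A\<in>sets M. measure M A \<le> e \<and> (\<forall>\<omega>\<in>space M - A. dist (g (Z n \<omega>)) (g c) \<le> e)"
    by eventually_elim (meson d(2) less_imp_le)
qed

lemma tends_in_prob_isCont2:
  assumes "tends_in_prob M X a" "tends_in_prob M Y b" "isCont (\<lambda>z. g (fst z) (snd z)) (a, b)"
  shows "tends_in_prob M (\<lambda>n \<omega>. g (X n \<omega>) (Y n \<omega>)) (g a b)"
  using tends_in_prob_isCont[OF tends_in_prob_Pair[OF assms(1,2)] assms(3)] by simp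

lemma tends_in_prob_add:
  fixes a b :: "'b::real_normed_vector"
  assumes "tends_in_prob M X a" "tends_in_prob M Y b"
  shows "tends_in_prob M (\<lambda>n \<omega>. X n \<omega> + Y n \<omega>) (a + b)"
  by (rule tends_in_prob_isCont2[OF assms]) (intro continuous_intros)

lemma tends_in_prob_mult:
  fixes a b :: real
  assumes "tends_in_prob M X a" "tends_in_prob M Y b"
  shows "tends_in_prob M (\<lambda>n \<omega>. X n \<omega> * Y n \<omega>) (a * b)"
  by (rule tends_in_prob_isCont2[OF assms]) (intro continuous_intros)

lemma tends_in_prob_const: "tends_in_prob M (\<lambda>n \<omega>. c) c"
  by (rule tends_in_probI) (intro always_eventually allI bexI[of _ "{}"], auto)

lemma tends_in_prob_cmult:
  fixes a c :: real
  shows "tends_in_prob M X a \<Longrightarrow> tends_in_prob M (\<lambda>n \<omega>. c * X n \<omega>) (c * a)"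
  by (rule tends_in_prob_mult[OF tends_in_prob_const])

lemma tends_in_prob_sum:
  fixes a :: "'i \<Rightarrow> 'b::real_normed_vector"
  assumes "\<And>i. i \<in> I \<Longrightarrow> tends_in_prob M (X i) (a i)"
  shows "tends_in_prob M (\<lambda>n \<omega>. \<Sum>i\<in>I. X i n \<omega>) (\<Sum>i\<in>I. a i)"
  using assms
proof (induction I rule: infinite_finite_induct)
  case (insert i I)
  then show ?case
    using tends_in_prob_add[OF insert.prems[of i] insert.IH] by simp
qed (simp_all add: tends_in_prob_const)

lemma tends_in_prob_bound:
  assumes "tends_in_prob M Z 0" "\<And>n \<omega>. \<omega> \<in> space M \<Longrightarrow> norm (Y n \<omega>) \<le> norm (Z n \<omega>)"
  shows "tends_in_prob M Y 0"
  unfolding tends_in_prob_def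
proof (intro allI impI)
  fix e :: real assume "0 < e"
  then have "\<forall>\<^sub>F n in sequentially. \<exists>A\<in>sets M. measure M A < e \<and> (\<forall>\<omega>\<in>space M - A. dist (Z n \<omega>) 0 < e)"
    using assms(1) unfolding tends_in_prob_def by blast
  then show "\<forall>\<^sub>F n in sequentially. \<exists>A\<in>sets M. measure M A < e \<and> (\<forall>\<omega>\<in>space M - A. dist (Y n \<omega>) 0 < e)"
  proof eventually_elim
    case (elim n)
    then obtain A where A: "A \<in> sets M" "measure M A < e" "\<And>\<omega>. \<omega> \<in> space M - A \<Longrightarrow> dist (Z n \<omega>) 0 < e"
      by blast
    have "dist (Y n \<omega>) 0 < e" if "\<omega> \<in> space M - A" for \<omega>
      using assms(2)[of \<omega> n] A(3)[OF that] that by (simp add: dist_norm)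
    with A show ?case by blast
  qed
qed

lemma tends_in_prob_cong:
  assumes "\<And>n \<omega>. \<omega> \<in> space M \<Longrightarrow> X n \<omega> = Y n \<omega>"
  shows "tends_in_prob M X c \<longleftrightarrow> tends_in_prob M Y c"
  unfolding tends_in_prob_def using assms by auto

lemma tends_in_prob_subseq:
  assumes "tends_in_prob M Z c" "filterlim s at_top sequentially"
  shows "tends_in_prob M (\<lambda>n. Z (s n)) c"
  unfolding tends_in_prob_def
proof (intro allI impI)
  fix e :: real assume "0 < e"
  with assms(1) have "\<forall>\<^sub>F n in sequentially. \<exists>A\<in>sets M. measure M A < e \<and> (\<forall>\<omega>\<in>space M - A. dist (Z n \<omega>) c < e)"
    unfolding tends_in_prob_def by blast
  from eventually_compose_filterlim[OF this assms(2)]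
  show "\<forall>\<^sub>F n in sequentially. \<exists>A\<in>sets M. measure M A < e \<and> (\<forall>\<omega>\<in>space M - A. dist (Z (s n) \<omega>) c < e)" .
qed

text \<open>The events that \<open>P\<close> fails at some time after N decrease to a null set, so
  continuity from above makes one of them small. As in Egorov's theorem, an almost sure eventual
  property becomes uniform off a small event.\<close>

lemma eventually_measure_tail_less:
  assumes P: "\<And>n. Measurable.pred M (P n)" and ev: "AE \<omega> in M. \<forall>\<^sub>F n in sequentially. P n \<omega>"
    and e: "0 < (e::real)"
  shows "\<exists>N. \<exists>A\<in>sets M. measure M A < e \<and> (\<forall>\<omega>\<in>space M - A. \<forall>n\<ge>N. P n \<omega>)"
proof -
  define A where "A N = {\<omega>\<in>space M. \<exists>n\<ge>N. \<not> P n \<omega>}" for N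
  have A_eq: "A N = (\<Union>n\<in>{N..}. {\<omega>\<in>space M. \<not> P n \<omega>})" for N
    by (auto simp: A_def)
  have A_sets: "A N \<in> sets M" for N
    unfolding A_eq using P by (intro sets.countable_UN'' predE pred_intros_logic) auto
  have "(\<lambda>N. measure M (A N)) \<longlonglongrightarrow> measure M (\<Inter>N. A N)"
  proof (rule finite_Lim_measure_decseq)
    show "decseq A"
      unfolding decseq_def A_eq by (intro allI impI UN_mono) auto
  qed (use A_sets in auto)
  moreover have "measure M (\<Inter>N. A N) = 0"
  proof -
    have "AE \<omega> in M. \<omega> \<notin> (\<Inter>N. A N)"
      using ev by eventually_elim (auto simp: A_def eventually_sequentially)
    then show ?thesis using A_sets by (subst prob_eq_0) auto
  qed
  ultimately have "\<forall>\<^sub>F N in sequentially. measure M (A N) < e"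
    using e by (simp add: order_tendstoD)
  then obtain N where "measure M (A N) < e"
    by (auto simp: eventually_sequentially)
  then show ?thesis
    using A_sets by (intro exI[of _ N] bexI[of _ "A N"] conjI ballI) (auto simp: A_eq)
qed

lemma tends_in_prob_AE:
  fixes Z :: "nat \<Rightarrow> 'a \<Rightarrow> 'b::{metric_space, second_countable_topology}"
  assumes [measurable]: "\<And>n. Z n \<in> borel_measurable M" and "AE \<omega> in M. (\<lambda>n. Z n \<omega>) \<longlonglongrightarrow> c"
  shows "tends_in_prob M Z c"
proof (rule tends_in_probI)
  fix e :: real assume e: "0 < e"
  have "AE \<omega> in M. \<forall>\<^sub>F n in sequentially. dist (Z n \<omega>) c < e"
    using assms(2) by eventually_elim (use e in \<open>auto simp: tendsto_iff\<close>)
  from eventually_measure_tail_less[OF _ this e]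
  obtain N A where "A \<in> sets M" "measure M A < e" "\<forall>\<omega>\<in>space M - A. \<forall>n\<ge>N. dist (Z n \<omega>) c < e"
    by auto
  then show "\<forall>\<^sub>F n in sequentially. \<exists>A\<in>sets M. measure M A \<le> e \<and> (\<forall>\<omega>\<in>space M - A. dist (Z n \<omega>) c \<le> e)"
    unfolding eventually_sequentially by (intro exI[of _ N] allI impI bexI[of _ A]) (auto intro: less_imp_le)
qed

text \<open>By Cauchy-Schwarz the average of the cross products is at most the geometric mean of the
  two averages, which tends to the square root of q times 0.\<close>

lemma tends_in_prob_quadratic_perturbation:
  fixes x y :: "nat \<Rightarrow> 'a \<Rightarrow> real"
  assumes "tends_in_prob M (\<lambda>n \<omega>. (\<Sum>k<n. (x k \<omega>)\<^sup>2) / real n) q"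
    and "tends_in_prob M (\<lambda>n \<omega>. (\<Sum>k<n. (y k \<omega>)\<^sup>2) / real n) 0"
  shows "tends_in_prob M (\<lambda>n \<omega>. (\<Sum>k<n. (x k \<omega> + y k \<omega>)\<^sup>2) / real n) q"
proof -
  let ?X = "\<lambda>n \<omega>. (\<Sum>k<n. (x k \<omega>)\<^sup>2) / real n" and ?Y = "\<lambda>n \<omega>. (\<Sum>k<n. (y k \<omega>)\<^sup>2) / real n"
  let ?XY = "\<lambda>n \<omega>. (\<Sum>k<n. x k \<omega> * y k \<omega>) / real n"
  have "tends_in_prob M (\<lambda>n \<omega>. sqrt (?X n \<omega> * ?Y n \<omega>)) (sqrt (q * 0))"
    by (rule tends_in_prob_isCont[OF tends_in_prob_mult[OF assms]]) (intro isCont_real_sqrt)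
  then have "tends_in_prob M (\<lambda>n \<omega>. sqrt (?X n \<omega> * ?Y n \<omega>)) 0"
    by simp
  then have XY: "tends_in_prob M ?XY 0"
  proof (rule tends_in_prob_bound)
    fix n \<omega>
    have "\<bar>\<Sum>k<n. x k \<omega> * y k \<omega>\<bar> \<le> (\<Sum>k<n. \<bar>x k \<omega>\<bar> * \<bar>y k \<omega>\<bar>)"
      by (rule order_trans[OF sum_abs]) (simp add: abs_mult)
    also have "\<dots> \<le> L2_set (\<lambda>k. x k \<omega>) {..<n} * L2_set (\<lambda>k. y k \<omega>) {..<n}"
      by (rule L2_set_mult_ineq)
    finally have "\<bar>?XY n \<omega>\<bar> \<le> (L2_set (\<lambda>k. x k \<omega>) {..<n} * L2_set (\<lambda>k. y k \<omega>) {..<n}) / real n"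
      by (simp add: divide_right_mono)
    also have "\<dots> = sqrt (?X n \<omega> * ?Y n \<omega>)"
      by (simp add: L2_set_def real_sqrt_mult real_sqrt_divide)
    finally show "norm (?XY n \<omega>) \<le> norm (sqrt (?X n \<omega> * ?Y n \<omega>))"
      by simp
  qed
  have "(\<Sum>k<n. (x k \<omega> + y k \<omega>)\<^sup>2) / real n = ?X n \<omega> + 2 * ?XY n \<omega> + ?Y n \<omega>" for n \<omega>
    by (simp add: power2_sum sum.distrib add_divide_distrib mult.assoc flip: sum_distrib_left)
  then show ?thesis
    using tends_in_prob_add[OF tends_in_prob_add[OF assms(1) tends_in_prob_cmult[OF XY, of 2]] assms(2)] by simp
qed

end

section \<open>Martingale noise\<close>

locale martingale_noise = prob_space M for M :: "'a measure" +
  fixes F :: "nat \<Rightarrow> 'a measure" and V :: "nat \<Rightarrow> 'a \<Rightarrow> real" and \<sigma> a :: real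
  assumes filtered: "filtered_space M F" and mart_diff: "martingale_difference M F V"
    and \<sigma>_pos: "0 < \<sigma>"
    and cond_var: "\<And>n. AE \<omega> in M. real_cond_exp M (F n) (\<lambda>\<omega>'. (V (n + 1) \<omega>')\<^sup>2) \<omega> = \<sigma>\<^sup>2"
    and a_gt_2: "2 < a" and cond_moment: "finite_conditional_moment a M F V"
begin

lemma subalg: "subalgebra M (F n)"
  using filtered by (simp add: filtered_space_def)

lemma space_F: "space (F n) = space M"
  using subalg[of n] by (simp add: subalgebra_def)

lemma sigma_finite_F: "sigma_finite_subalgebra M (F n)"
  by (rule finite_measure_subalgebra_is_sigma_finite) (unfold_locales, rule subalg)

lemma measurable_F_M: "f \<in> measurable (F n) N \<Longrightarrow> f \<in> measurable M N"
  by (rule measurable_from_subalg[OF subalg])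

lemma measurable_F_mono: "f \<in> measurable (F m) N \<Longrightarrow> m \<le> n \<Longrightarrow> f \<in> measurable (F n) N"
  using filtered filtration.sets_F_mono[of "space M" F m n]
  by (intro measurable_from_subalg[of "F n" "F m"]) (auto simp: subalgebra_def space_F filtered_space_def)

lemma V_F: "V (Suc n) \<in> borel_measurable (F (Suc n))"
  using mart_diff by (simp add: martingale_difference_def)

lemma V_M [measurable]: "V (Suc n) \<in> borel_measurable M"
  by (rule measurable_F_M[OF V_F])

lemma V_integrable: "integrable M (V (Suc n))"
  using mart_diff by (simp add: martingale_difference_def)

text \<open>\<open>real_cond_exp\<close> would turn an infinite conditional variance into 0. The
  value \<sigma>^2 > 0 excludes this, so the identity already holds among extended nonnegative
  values and can be used before integrability is known.\<close>

lemma AE_nn_cond_var: "AE \<omega> in M. nn_cond_exp M (F n) (\<lambda>\<omega>'. ennreal ((V (Suc n) \<omega>')\<^sup>2)) \<omega> = ennreal (\<sigma>\<^sup>2)"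
proof -
  have "AE \<omega> in M. (0::ennreal) = nn_cond_exp M (F n) (\<lambda>_. 0) \<omega>"
    by (rule sigma_finite_subalgebra.nn_cond_exp_F_meas[OF sigma_finite_F]) simp
  with cond_var[of n] show ?thesis
  proof eventually_elim
    case (elim \<omega>)
    let ?v = "nn_cond_exp M (F n) (\<lambda>\<omega>'. ennreal ((V (Suc n) \<omega>')\<^sup>2)) \<omega>"
    have "(\<lambda>\<omega>'. ennreal (- (V (Suc n) \<omega>')\<^sup>2)) = (\<lambda>_. 0)"
      by (intro ext ennreal_neg) simp
    then have v: "enn2real ?v = \<sigma>\<^sup>2"
      using elim by (simp add: real_cond_exp_def)
    then have "?v \<noteq> \<top>"
      using \<sigma>_pos by (auto simp: enn2real_top)
    then show ?case
      using v by (metis ennreal_enn2real_if)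
  qed
qed

lemma nn_integral_mult_V2:
  assumes [measurable]: "Y \<in> borel_measurable (F n)"
  shows "(\<integral>\<^sup>+\<omega>. Y \<omega> * ennreal ((V (Suc n) \<omega>)\<^sup>2) \<partial>M) = ennreal (\<sigma>\<^sup>2) * (\<integral>\<^sup>+\<omega>. Y \<omega> \<partial>M)"
proof -
  have [measurable]: "Y \<in> borel_measurable M" by (rule measurable_F_M[OF assms])
  have "(\<integral>\<^sup>+\<omega>. Y \<omega> * ennreal ((V (Suc n) \<omega>)\<^sup>2) \<partial>M)
      = (\<integral>\<^sup>+\<omega>. Y \<omega> * nn_cond_exp M (F n) (\<lambda>\<omega>'. ennreal ((V (Suc n) \<omega>')\<^sup>2)) \<omega> \<partial>M)"
    by (rule sigma_finite_subalgebra.nn_cond_exp_intg[OF sigma_finite_F, symmetric]) auto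
  also have "\<dots> = (\<integral>\<^sup>+\<omega>. ennreal (\<sigma>\<^sup>2) * Y \<omega> \<partial>M)"
    by (rule nn_integral_cong_AE) (use AE_nn_cond_var[of n] in \<open>auto simp: mult.commute\<close>)
  also have "\<dots> = ennreal (\<sigma>\<^sup>2) * (\<integral>\<^sup>+\<omega>. Y \<omega> \<partial>M)"
    by (rule nn_integral_cmult) simp
  finally show ?thesis .
qed

text \<open>Square integrability is a consequence: integrating the conditional variance against the
  weight 1 gives \<sigma>^2.\<close>

lemma V2_integrable: "integrable M (\<lambda>\<omega>. (V (Suc n) \<omega>)\<^sup>2)"
  using nn_integral_mult_V2[of "\<lambda>_. 1" n]
  by (intro integrableI_nonneg) (auto simp: emeasure_space_1)

lemma mult_V2_integrable:
  assumes "integrable M Y" "Y \<in> borel_measurable (F n)"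
  shows "integrable M (\<lambda>\<omega>. Y \<omega> * (V (Suc n) \<omega>)\<^sup>2)"
proof (rule integrableI_bounded)
  have [measurable]: "Y \<in> borel_measurable M" by (rule measurable_F_M[OF assms(2)])
  show "(\<lambda>\<omega>. Y \<omega> * (V (Suc n) \<omega>)\<^sup>2) \<in> borel_measurable M" by measurable
  have "(\<integral>\<^sup>+\<omega>. ennreal (norm (Y \<omega> * (V (Suc n) \<omega>)\<^sup>2)) \<partial>M) = (\<integral>\<^sup>+\<omega>. ennreal (norm (Y \<omega>)) * ennreal ((V (Suc n) \<omega>)\<^sup>2) \<partial>M)"
    by (simp add: abs_mult ennreal_mult)
  also have "\<dots> = ennreal (\<sigma>\<^sup>2) * (\<integral>\<^sup>+\<omega>. ennreal (norm (Y \<omega>)) \<partial>M)"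
    by (rule nn_integral_mult_V2) (use assms in measurable)
  also have "\<dots> < \<infinity>"
    using assms(1) by (auto simp: integrable_iff_bounded ennreal_mult_less_top)
  finally show "(\<integral>\<^sup>+\<omega>. ennreal (norm (Y \<omega> * (V (Suc n) \<omega>)\<^sup>2)) \<partial>M) < \<infinity>" .
qed

lemma integral_mult_V2:
  assumes "integrable M Y" "Y \<in> borel_measurable (F n)"
  shows "(\<integral>\<omega>. Y \<omega> * (V (Suc n) \<omega>)\<^sup>2 \<partial>M) = \<sigma>\<^sup>2 * (\<integral>\<omega>. Y \<omega> \<partial>M)"
proof -
  have [measurable]: "Y \<in> borel_measurable M" by (rule measurable_F_M[OF assms(2)])
  have "(\<integral>\<omega>. Y \<omega> * (V (Suc n) \<omega>)\<^sup>2 \<partial>M)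
      = (\<integral>\<omega>. Y \<omega> * real_cond_exp M (F n) (\<lambda>\<omega>'. (V (Suc n) \<omega>')\<^sup>2) \<omega> \<partial>M)"
    by (rule sigma_finite_subalgebra.real_cond_exp_intg(2)[OF sigma_finite_F, symmetric])
       (use mult_V2_integrable[OF assms] assms(2) in auto)
  also have "\<dots> = (\<integral>\<omega>. \<sigma>\<^sup>2 * Y \<omega> \<partial>M)"
    by (rule integral_cong_AE) (use cond_var[of n] in \<open>auto simp: mult.commute\<close>)
  finally show ?thesis by simp
qed

lemma integral_mult_V:
  assumes "integrable M (\<lambda>\<omega>. Y \<omega> * V (Suc n) \<omega>)" "Y \<in> borel_measurable (F n)"
  shows "(\<integral>\<omega>. Y \<omega> * V (Suc n) \<omega> \<partial>M) = 0"
proof -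
  have [measurable]: "Y \<in> borel_measurable M" by (rule measurable_F_M[OF assms(2)])
  have "(\<integral>\<omega>. Y \<omega> * V (Suc n) \<omega> \<partial>M) = (\<integral>\<omega>. Y \<omega> * real_cond_exp M (F n) (V (Suc n)) \<omega> \<partial>M)"
    by (rule sigma_finite_subalgebra.real_cond_exp_intg(2)[OF sigma_finite_F, symmetric]) (use assms in auto)
  also have "\<dots> = (\<integral>\<omega>. 0 \<partial>M)"
    by (rule integral_cong_AE) (use mart_diff in \<open>auto simp: martingale_difference_def\<close>)
  finally show ?thesis by simp
qed

lemma bounded_mult_integrable:
  fixes Y :: "'a \<Rightarrow> 'c::{second_countable_topology, real_normed_algebra, banach}"
  assumes [measurable]: "Y \<in> borel_measurable M" and "\<And>\<omega>. \<omega> \<in> space M \<Longrightarrow> norm (Y \<omega>) \<le> b" "integrable M g"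
  shows "integrable M (\<lambda>\<omega>. Y \<omega> * g \<omega>)"
proof (rule Bochner_Integration.integrable_bound)
  show "integrable M (\<lambda>\<omega>. b * norm (g \<omega>))" using assms(3) by simp
  show "(\<lambda>\<omega>. Y \<omega> * g \<omega>) \<in> borel_measurable M" using assms(3) by measurable
  show "AE \<omega> in M. norm (Y \<omega> * g \<omega>) \<le> norm (b * norm (g \<omega>))"
  proof (rule AE_I2)
    fix \<omega> assume "\<omega> \<in> space M"
    then have b: "norm (Y \<omega>) \<le> b" using assms(2) by blast
    have "norm (Y \<omega> * g \<omega>) \<le> norm (Y \<omega>) * norm (g \<omega>)" by (rule norm_mult_ineq)
    also have "\<dots> \<le> b * norm (g \<omega>)" using b by (rule mult_right_mono) simp
    finally show "norm (Y \<omega> * g \<omega>) \<le> norm (b * norm (g \<omega>))" by simp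
  qed
qed

lemma bounded_integrable:
  fixes Y :: "'a \<Rightarrow> 'c::{second_countable_topology, banach}"
  assumes "Y \<in> borel_measurable M" "\<And>\<omega>. \<omega> \<in> space M \<Longrightarrow> norm (Y \<omega>) \<le> b"
  shows "integrable M Y"
  using assms by (intro integrable_const_bound[of _ b]) auto

lemma complex_integral_mult_V:
  fixes Y :: "'a \<Rightarrow> complex"
  assumes Y: "Y \<in> borel_measurable (F n)" and b: "\<And>\<omega>. \<omega> \<in> space M \<Longrightarrow> norm (Y \<omega>) \<le> b"
  shows "(\<integral>\<omega>. Y \<omega> * of_real (V (Suc n) \<omega>) \<partial>M) = 0"
proof -
  have [measurable]: "Y \<in> borel_measurable M" by (rule measurable_F_M[OF Y])
  have i: "integrable M (\<lambda>\<omega>. Y \<omega> * of_real (V (Suc n) \<omega>))"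
    by (rule bounded_mult_integrable[OF _ b]) (auto intro: V_integrable)
  have "integrable M (\<lambda>\<omega>. Re (Y \<omega>) * V (Suc n) \<omega>)" "integrable M (\<lambda>\<omega>. Im (Y \<omega>) * V (Suc n) \<omega>)"
    using integrable_Re[OF i] integrable_Im[OF i] by simp_all
  then have "(\<integral>\<omega>. Re (Y \<omega>) * V (Suc n) \<omega> \<partial>M) = 0" "(\<integral>\<omega>. Im (Y \<omega>) * V (Suc n) \<omega> \<partial>M) = 0"
    using Y by (auto intro!: integral_mult_V)
  then show ?thesis
    using i by (intro complex_eqI) (simp_all flip: integral_Re integral_Im)
qed

lemma complex_integral_mult_V2:
  fixes Y :: "'a \<Rightarrow> complex"
  assumes Y: "Y \<in> borel_measurable (F n)" and b: "\<And>\<omega>. \<omega> \<in> space M \<Longrightarrow> norm (Y \<omega>) \<le> b"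
  shows "(\<integral>\<omega>. Y \<omega> * of_real ((V (Suc n) \<omega>)\<^sup>2) \<partial>M) = of_real (\<sigma>\<^sup>2) * (\<integral>\<omega>. Y \<omega> \<partial>M)"
proof -
  have [measurable]: "Y \<in> borel_measurable M" by (rule measurable_F_M[OF Y])
  have i: "integrable M (\<lambda>\<omega>. Y \<omega> * of_real ((V (Suc n) \<omega>)\<^sup>2))"
    using V2_integrable[of n] by (intro bounded_mult_integrable[OF _ b]) (auto simp del: of_real_power)
  have iY: "integrable M Y" by (rule bounded_integrable[OF _ b]) auto
  have r: "(\<integral>\<omega>. Re (Y \<omega>) * (V (Suc n) \<omega>)\<^sup>2 \<partial>M) = \<sigma>\<^sup>2 * (\<integral>\<omega>. Re (Y \<omega>) \<partial>M)"
      "(\<integral>\<omega>. Im (Y \<omega>) * (V (Suc n) \<omega>)\<^sup>2 \<partial>M) = \<sigma>\<^sup>2 * (\<integral>\<omega>. Im (Y \<omega>) \<partial>M)"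
    using integral_mult_V2[of "\<lambda>\<omega>. Re (Y \<omega>)" n] integral_mult_V2[of "\<lambda>\<omega>. Im (Y \<omega>)" n] iY Y by simp_all
  have "Re (\<integral>\<omega>. Y \<omega> * of_real ((V (Suc n) \<omega>)\<^sup>2) \<partial>M) = (\<integral>\<omega>. Re (Y \<omega>) * (V (Suc n) \<omega>)\<^sup>2 \<partial>M)"
    by (subst integral_Re[OF i, symmetric]) (simp del: of_real_power)
  moreover have "Im (\<integral>\<omega>. Y \<omega> * of_real ((V (Suc n) \<omega>)\<^sup>2) \<partial>M) = (\<integral>\<omega>. Im (Y \<omega>) * (V (Suc n) \<omega>)\<^sup>2 \<partial>M)"
    by (subst integral_Im[OF i, symmetric]) (simp del: of_real_power)
  ultimately show ?thesis
    using iY by (intro complex_eqI) (simp_all add: r del: of_real_power)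
qed

section \<open>Localised conditional moments\<close>

definition cond_abs_moment :: "nat \<Rightarrow> 'a \<Rightarrow> ennreal" where
  "cond_abs_moment n = nn_cond_exp M (F n) (\<lambda>\<omega>. ennreal (\<bar>V (Suc n) \<omega>\<bar> powr a))"

text \<open>
  The conditional moments are bounded only by an almost surely finite random constant, so the
  moment estimates are localised to the tame events, which exhaust the space as \<open>B\<close> grows.
\<close>

definition tame :: "real \<Rightarrow> nat \<Rightarrow> 'a set" where
  "tame B n = {\<omega>\<in>space M. cond_abs_moment n \<omega> \<le> ennreal B}"

lemma tame_F [measurable]: "tame B n \<in> sets (F n)"
proof -
  have "{\<omega>\<in>space (F n). cond_abs_moment n \<omega> \<le> ennreal B} \<in> sets (F n)"
    unfolding cond_abs_moment_def by measurable
  then show ?thesis by (simp add: tame_def space_F)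
qed

lemma tame_M [measurable]: "tame B n \<in> sets M"
  using tame_F[of B n] subalg[of n] by (auto simp: subalgebra_def)

text \<open>The indicator is known at time n, so it passes into the conditional expectation together
  with \<open>Y\<close>; there it caps the conditional moment at \<open>B\<close>.\<close>

lemma nn_integral_tame_moment:
  assumes [measurable]: "Y \<in> borel_measurable (F n)"
  shows "(\<integral>\<^sup>+\<omega>. Y \<omega> * indicator (tame B n) \<omega> * ennreal (\<bar>V (Suc n) \<omega>\<bar> powr a) \<partial>M) \<le> ennreal B * (\<integral>\<^sup>+\<omega>. Y \<omega> \<partial>M)"
proof -
  have [measurable]: "Y \<in> borel_measurable M" by (rule measurable_F_M[OF assms])
  have "(\<integral>\<^sup>+\<omega>. Y \<omega> * indicator (tame B n) \<omega> * ennreal (\<bar>V (Suc n) \<omega>\<bar> powr a) \<partial>M)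
      = (\<integral>\<^sup>+\<omega>. Y \<omega> * indicator (tame B n) \<omega> * cond_abs_moment n \<omega> \<partial>M)"
    unfolding cond_abs_moment_def
    by (rule sigma_finite_subalgebra.nn_cond_exp_intg[OF sigma_finite_F, symmetric]) auto
  also have "\<dots> \<le> (\<integral>\<^sup>+\<omega>. ennreal B * Y \<omega> \<partial>M)"
    by (rule nn_integral_mono) (auto simp: tame_def indicator_def mult.commute[of "ennreal B"] intro: mult_left_mono)
  also have "\<dots> = ennreal B * (\<integral>\<^sup>+\<omega>. Y \<omega> \<partial>M)"
    by (rule nn_integral_cmult) simp
  finally show ?thesis .
qed

lemma tame_mono: "B \<le> B' \<Longrightarrow> tame B n \<subseteq> tame B' n"
  by (auto simp: tame_def intro: order_trans ennreal_leI)

lemma AE_tame: "AE \<omega> in M. \<exists>K::nat. \<forall>n. \<omega> \<in> tame (real K) n"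
proof -
  have "AE \<omega> in M. (SUP n. cond_abs_moment n \<omega>) < \<infinity>"
    using cond_moment by (simp add: finite_conditional_moment_def cond_abs_moment_def)
  then show ?thesis
  proof (rule AE_mp, intro AE_I2 impI)
    fix \<omega> assume \<omega>: "\<omega> \<in> space M" and fin: "(SUP n. cond_abs_moment n \<omega>) < \<infinity>"
    then obtain r where r: "(SUP n. cond_abs_moment n \<omega>) = ennreal r" "0 \<le> r"
      by (cases "SUP n. cond_abs_moment n \<omega>") auto
    have "\<omega> \<in> tame (real (nat \<lceil>r\<rceil>)) n" for n
    proof -
      have "cond_abs_moment n \<omega> \<le> (SUP n. cond_abs_moment n \<omega>)"
        by (rule SUP_upper) simp
      also have "\<dots> \<le> ennreal (real (nat \<lceil>r\<rceil>))"
        unfolding r(1) using r(2) by (intro ennreal_leI) linarith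
      finally show ?thesis using \<omega> by (simp add: tame_def)
    qed
    then show "\<exists>K::nat. \<forall>n. \<omega> \<in> tame (real K) n" by blast
  qed
qed

text \<open>The tame events increase with \<open>B\<close> and exhaust the space up to a null set,
  so the random bound on the conditional moments is at most a constant off an event of small
  probability.\<close>

lemma mostly_tame:
  assumes "0 < (e::real)"
  shows "\<exists>B\<ge>1. \<exists>A\<in>sets M. measure M A < e \<and> (\<forall>\<omega>\<in>space M - A. \<forall>n. \<omega> \<in> tame B n)"
proof -
  have "AE \<omega> in M. \<forall>\<^sub>F K in sequentially. \<forall>n. \<omega> \<in> tame (real K) n"
    using AE_tame
  proof eventually_elim
    case (elim \<omega>)
    then obtain K where "\<forall>n. \<omega> \<in> tame (real K) n" by blast
    then show ?case
      unfolding eventually_sequentially using tame_mono by (intro exI[of _ K]) (meson of_nat_le_iff subsetD)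
  qed
  from eventually_measure_tail_less[OF _ this assms]
  obtain N A where *: "A \<in> sets M" "measure M A < e" "\<forall>\<omega>\<in>space M - A. \<forall>K\<ge>N. \<forall>n. \<omega> \<in> tame (real K) n"
    by auto
  show ?thesis
    by (rule exI[of _ "real (Suc N)"]) (use * in \<open>auto intro!: bexI[of _ A] simp del: of_nat_Suc\<close>)
qed

text \<open>The truncated series \<open>\<Sum> \<bar>V\<^sub>k\<bar> powr a / k powr r\<close> has finite expectation for \<open>r > 1\<close>.\<close>

lemma AE_V_growth: "AE \<omega> in M. \<exists>K\<ge>0. \<forall>n. (V (Suc n) \<omega>)\<^sup>2 \<le> K * real (Suc n) powr ((2 + a) / (2 * a))"
proof -
  \<comment> \<open>The midpoint of 1 and a / 2. The series needs r > 1, and r < a / 2 makes the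
    resulting exponent 2 r / a = (2 + a) / (2 a) of the squared noise less than 1.\<close>
  define r where "r = (2 + a) / 4"
  have r: "1 < r" using a_gt_2 by (simp add: r_def)
  have sm: "summable (\<lambda>n. real (Suc n) powr - r)"
    using r summable_Suc_iff[of "\<lambda>n. real n powr - r"] by (simp add: summable_real_powr_iff)
  have fin: "AE \<omega> in M. (\<Sum>n. ennreal (real (Suc n) powr - r) * indicator (tame (real B) n) \<omega> * ennreal (\<bar>V (Suc n) \<omega>\<bar> powr a)) \<noteq> \<infinity>" for B :: nat
  proof (rule nn_integral_PInf_AE)
    have "(\<integral>\<^sup>+\<omega>. (\<Sum>n. ennreal (real (Suc n) powr - r) * indicator (tame (real B) n) \<omega> * ennreal (\<bar>V (Suc n) \<omega>\<bar> powr a)) \<partial>M)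
      = (\<Sum>n. \<integral>\<^sup>+\<omega>. ennreal (real (Suc n) powr - r) * indicator (tame (real B) n) \<omega> * ennreal (\<bar>V (Suc n) \<omega>\<bar> powr a) \<partial>M)"
      by (rule nn_integral_suminf) measurable
    also have "\<dots> \<le> (\<Sum>n. ennreal (real B) * (\<integral>\<^sup>+\<omega>. ennreal (real (Suc n) powr - r) \<partial>M))"
      by (intro suminf_le nn_integral_tame_moment) auto
    also have "\<dots> = (\<Sum>n. ennreal (real B * real (Suc n) powr - r))"
      by (simp add: emeasure_space_1 ennreal_mult)
    also have "\<dots> = ennreal (\<Sum>n. real B * real (Suc n) powr - r)"
      by (rule suminf_ennreal2) (use sm in \<open>auto intro: summable_mult\<close>)
    finally show "(\<integral>\<^sup>+\<omega>. (\<Sum>n. ennreal (real (Suc n) powr - r) * indicator (tame (real B) n) \<omega> * ennreal (\<bar>V (Suc n) \<omega>\<bar> powr a)) \<partial>M) \<noteq> \<infinity>"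
      by (auto simp: top_unique)
  qed measurable
  then have "AE \<omega> in M. \<forall>B::nat. (\<Sum>n. ennreal (real (Suc n) powr - r) * indicator (tame (real B) n) \<omega> * ennreal (\<bar>V (Suc n) \<omega>\<bar> powr a)) \<noteq> \<infinity>"
    by (simp only: AE_all_countable) simp
  with AE_tame show ?thesis
  proof eventually_elim
    case (elim \<omega>)
    then obtain B :: nat where B: "\<And>n. \<omega> \<in> tame (real B) n" by blast
    \<comment> \<open>On a path that is tame for \<open>B\<close> at all times the indicators equal
      1, so the full series is finite and dominates each of its terms.\<close>
    define L where "L = (\<Sum>n. ennreal (real (Suc n) powr - r) * ennreal (\<bar>V (Suc n) \<omega>\<bar> powr a))"
    have "L \<noteq> \<infinity>" using elim(2)[rule_format, of B] B by (simp add: L_def)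
    then obtain K where K: "L = ennreal K" "0 \<le> K" by (cases L) auto
    have "(V (Suc n) \<omega>)\<^sup>2 \<le> K powr (2 / a) * real (Suc n) powr ((2 + a) / (2 * a))" for n
    proof -
      have "ennreal (real (Suc n) powr - r * \<bar>V (Suc n) \<omega>\<bar> powr a) \<le> L"
        unfolding L_def using sum_le_suminf[of "\<lambda>n. ennreal (real (Suc n) powr - r) * ennreal (\<bar>V (Suc n) \<omega>\<bar> powr a)" "{n}"]
        by (simp add: ennreal_mult)
      then have "real (Suc n) powr - r * \<bar>V (Suc n) \<omega>\<bar> powr a \<le> K"
        using K by (simp add: ennreal_le_iff)
      then have "\<bar>V (Suc n) \<omega>\<bar> powr a \<le> K * real (Suc n) powr r"
        by (simp add: powr_minus field_simps)
      then have "(\<bar>V (Suc n) \<omega>\<bar> powr a) powr (2 / a) \<le> (K * real (Suc n) powr r) powr (2 / a)"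
        using a_gt_2 by (intro powr_mono2) auto
      moreover have "(\<bar>V (Suc n) \<omega>\<bar> powr a) powr (2 / a) = (V (Suc n) \<omega>)\<^sup>2"
        using a_gt_2 by (simp add: powr_powr)
      moreover have "(K * real (Suc n) powr r) powr (2 / a) = K powr (2 / a) * real (Suc n) powr ((2 + a) / (2 * a))"
      proof -
        have "r * (2 / a) = (2 + a) / (2 * a)" using a_gt_2 by (simp add: r_def field_simps)
        then show ?thesis using K by (simp only: powr_mult powr_powr powr_ge_zero)
      qed
      ultimately show ?thesis by simp
    qed
    then show ?case by (intro exI[of _ "K powr (2 / a)"]) auto
  qed
qed

end

context prob_space
begin

lemma markov_ineq:
  fixes u :: "'a \<Rightarrow> real"
  assumes "integrable M u" "\<And>\<omega>. \<omega> \<in> space M \<Longrightarrow> 0 \<le> u \<omega>" "0 < c"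
  shows "measure M {\<omega>\<in>space M. c \<le> u \<omega>} \<le> (\<integral>\<omega>. u \<omega> \<partial>M) / c"
proof -
  let ?A = "{\<omega>\<in>space M. c \<le> u \<omega>}"
  have [measurable]: "?A \<in> sets M" using assms(1) by measurable
  have "c * measure M ?A = (\<integral>\<omega>. c * indicator ?A \<omega> \<partial>M)" by simp
  also have "\<dots> \<le> (\<integral>\<omega>. u \<omega> \<partial>M)"
  proof (rule integral_mono)
    show "c * indicator ?A \<omega> \<le> u \<omega>" if "\<omega> \<in> space M" for \<omega>
      using assms that by (auto simp: indicator_def)
  qed (use assms in \<open>simp_all add: emeasure_eq_measure\<close>)
  finally show ?thesis using assms(3) by (simp add: field_simps)
qed

end

context martingale_noise
begin

section \<open>Square-integrable martingales\<close>

lemma integrable_mult_of_squares: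
  fixes f g :: "'a \<Rightarrow> real"
  assumes [measurable]: "f \<in> borel_measurable M" "g \<in> borel_measurable M"
    and "integrable M (\<lambda>\<omega>. (f \<omega>)\<^sup>2)" "integrable M (\<lambda>\<omega>. (g \<omega>)\<^sup>2)"
  shows "integrable M (\<lambda>\<omega>. f \<omega> * g \<omega>)"
proof (rule Bochner_Integration.integrable_bound)
  show "integrable M (\<lambda>\<omega>. (f \<omega>)\<^sup>2 + (g \<omega>)\<^sup>2)" using assms by simp
  have "\<bar>x * y\<bar> \<le> x\<^sup>2 + y\<^sup>2" for x y :: real
  proof -
    have "2 * (\<bar>x\<bar> * \<bar>y\<bar>) \<le> x\<^sup>2 + y\<^sup>2"
      using sum_squares_bound[of "\<bar>x\<bar>" "\<bar>y\<bar>"] by simp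
    moreover have "0 \<le> \<bar>x\<bar> * \<bar>y\<bar>" by simp
    ultimately show ?thesis unfolding abs_mult by linarith
  qed
  then show "AE \<omega> in M. norm (f \<omega> * g \<omega>) \<le> norm ((f \<omega>)\<^sup>2 + (g \<omega>)\<^sup>2)" by simp
qed measurable

text \<open>Orthogonality of the increments. It is assumed against arbitrary square-integrable
  functions of the past, so that the statement serves predictable transforms as well as the
  truncated squares of the noise.\<close>

lemma sum_mart_diff_L2:
  fixes D :: "nat \<Rightarrow> 'a \<Rightarrow> real"
  assumes D_F: "\<And>k. D k \<in> borel_measurable (F (Suc k))" and sq: "\<And>k. integrable M (\<lambda>\<omega>. (D k \<omega>)\<^sup>2)"
    and orth: "\<And>k (Y :: 'a \<Rightarrow> real). Y \<in> borel_measurable (F k) \<Longrightarrow> integrable M (\<lambda>\<omega>. (Y \<omega>)\<^sup>2) \<Longrightarrow> (\<integral>\<omega>. Y \<omega> * D k \<omega> \<partial>M) = 0"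
  shows "integrable M (\<lambda>\<omega>. (\<Sum>k<n. D k \<omega>)\<^sup>2) \<and> (\<integral>\<omega>. (\<Sum>k<n. D k \<omega>)\<^sup>2 \<partial>M) = (\<Sum>k<n. \<integral>\<omega>. (D k \<omega>)\<^sup>2 \<partial>M)"
proof (induction n)
  case (Suc n)
  define S where "S \<omega> = (\<Sum>k<n. D k \<omega>)" for \<omega>
  have S_F: "S \<in> borel_measurable (F n)"
    unfolding S_def by (intro borel_measurable_sum measurable_F_mono[OF D_F]) auto
  have [measurable]: "S \<in> borel_measurable M" "D n \<in> borel_measurable M"
    using measurable_F_M[OF S_F] measurable_F_M[OF D_F] by auto
  have IH: "integrable M (\<lambda>\<omega>. (S \<omega>)\<^sup>2)" "(\<integral>\<omega>. (S \<omega>)\<^sup>2 \<partial>M) = (\<Sum>k<n. \<integral>\<omega>. (D k \<omega>)\<^sup>2 \<partial>M)"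
    using Suc by (auto simp: S_def)
  have i: "integrable M (\<lambda>\<omega>. S \<omega> * D n \<omega>)"
    by (rule integrable_mult_of_squares) (use IH sq in auto)
  have o: "(\<integral>\<omega>. S \<omega> * D n \<omega> \<partial>M) = 0" by (rule orth[OF S_F IH(1)])
  have eq: "(\<Sum>k<Suc n. D k \<omega>)\<^sup>2 = (S \<omega>)\<^sup>2 + (D n \<omega>)\<^sup>2 + 2 * (S \<omega> * D n \<omega>)" for \<omega>
    by (simp add: S_def power2_sum)
  show ?case unfolding eq using IH i o sq[of n] by simp
qed simp

text \<open>The test at \<open>k\<close> already includes \<open>c k\<close>, so the retained sum
  cannot overshoot \<open>B\<close>. As \<open>c k\<close> will be the square of a weight known at
  time k, the test remains predictable.\<close>

lemma stopped_sum_le: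
  fixes c :: "nat \<Rightarrow> real"
  assumes "\<And>k. 0 \<le> c k" "0 \<le> B"
  shows "(\<Sum>k<n. if (\<Sum>j\<le>k. c j) \<le> B then c k else 0) \<le> B"
proof (induction n)
  case (Suc n)
  show ?case
  proof (cases "(\<Sum>j\<le>n. c j) \<le> B")
    case True
    have "(\<Sum>k<n. if (\<Sum>j\<le>k. c j) \<le> B then c k else 0) \<le> (\<Sum>k<n. c k)"
      by (intro sum_mono) (use assms in auto)
    with True show ?thesis by (simp add: lessThan_Suc_atMost[symmetric])
  qed (use Suc in simp)
qed (use assms in simp)

lemma stopped_measurable:
  fixes W :: "nat \<Rightarrow> 'a \<Rightarrow> real"
  assumes W: "\<And>k. W k \<in> borel_measurable (F k)"
  shows "(\<lambda>\<omega>. if (\<Sum>j\<le>k. (W j \<omega>)\<^sup>2) \<le> (B::real) then W k \<omega> else 0) \<in> borel_measurable (F k)"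
proof -
  have [measurable]: "j \<le> k \<Longrightarrow> W j \<in> borel_measurable (F k)" for j
    by (rule measurable_F_mono[OF W])
  have [measurable]: "(\<lambda>\<omega>. \<Sum>j\<le>k. (W j \<omega>)\<^sup>2) \<in> borel_measurable (F k)"
    by (intro borel_measurable_sum) auto
  have [measurable]: "W k \<in> borel_measurable (F k)" by (rule W)
  show ?thesis by measurable
qed

lemma transform_mart_diff:
  fixes W :: "nat \<Rightarrow> 'a \<Rightarrow> real"
  assumes W: "\<And>k. W k \<in> borel_measurable (F k)" and b: "\<And>k \<omega>. \<bar>W k \<omega>\<bar> \<le> (b::real)"
  shows "integrable M (\<lambda>\<omega>. (\<Sum>k<n. W k \<omega> * V (Suc k) \<omega>)\<^sup>2)"
    and "(\<integral>\<omega>. (\<Sum>k<n. W k \<omega> * V (Suc k) \<omega>)\<^sup>2 \<partial>M) = \<sigma>\<^sup>2 * (\<integral>\<omega>. (\<Sum>k<n. (W k \<omega>)\<^sup>2) \<partial>M)"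
proof -
  have [measurable]: "W k \<in> borel_measurable M" for k by (rule measurable_F_M[OF W])
  have W2: "integrable M (\<lambda>\<omega>. (W k \<omega>)\<^sup>2)" for k
  proof (rule integrable_const_bound[of _ "b\<^sup>2"])
    have "(W k \<omega>)\<^sup>2 \<le> b\<^sup>2" for \<omega>
      using power_mono[OF b[of k \<omega>] abs_ge_zero, where n = 2] by simp
    then show "AE \<omega> in M. norm ((W k \<omega>)\<^sup>2) \<le> b\<^sup>2" by simp
  qed measurable
  have i: "integrable M (\<lambda>\<omega>. (W k \<omega>)\<^sup>2 * (V (Suc k) \<omega>)\<^sup>2)" for k
    by (rule mult_V2_integrable[OF W2]) (use W in measurable)
  have *: "integrable M (\<lambda>\<omega>. (\<Sum>k<n. W k \<omega> * V (Suc k) \<omega>)\<^sup>2)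
    \<and> (\<integral>\<omega>. (\<Sum>k<n. W k \<omega> * V (Suc k) \<omega>)\<^sup>2 \<partial>M) = (\<Sum>k<n. \<integral>\<omega>. (W k \<omega> * V (Suc k) \<omega>)\<^sup>2 \<partial>M)"
  proof (rule sum_mart_diff_L2)
    fix k
    show "(\<lambda>\<omega>. W k \<omega> * V (Suc k) \<omega>) \<in> borel_measurable (F (Suc k))"
      using measurable_F_mono[OF W, where m = k and n = "Suc k"] V_F[of k] by simp
    show "integrable M (\<lambda>\<omega>. (W k \<omega> * V (Suc k) \<omega>)\<^sup>2)" using i by (simp add: power_mult_distrib)
    fix Y :: "'a \<Rightarrow> real" assume Y: "Y \<in> borel_measurable (F k)" "integrable M (\<lambda>\<omega>. (Y \<omega>)\<^sup>2)"
    have [measurable]: "Y \<in> borel_measurable M" by (rule measurable_F_M[OF Y(1)])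
    have "integrable M (\<lambda>\<omega>. Y \<omega> * (W k \<omega> * V (Suc k) \<omega>))"
      by (rule integrable_mult_of_squares) (use Y i in \<open>auto simp: power_mult_distrib\<close>)
    then have "(\<integral>\<omega>. (Y \<omega> * W k \<omega>) * V (Suc k) \<omega> \<partial>M) = 0"
      using Y W[of k] by (intro integral_mult_V) (auto simp: mult.assoc)
    then show "(\<integral>\<omega>. Y \<omega> * (W k \<omega> * V (Suc k) \<omega>) \<partial>M) = 0" by (simp add: mult.assoc)
  qed
  then show "integrable M (\<lambda>\<omega>. (\<Sum>k<n. W k \<omega> * V (Suc k) \<omega>)\<^sup>2)" by blast
  have "(\<integral>\<omega>. (W k \<omega> * V (Suc k) \<omega>)\<^sup>2 \<partial>M) = \<sigma>\<^sup>2 * (\<integral>\<omega>. (W k \<omega>)\<^sup>2 \<partial>M)" for k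
    unfolding power_mult_distrib by (rule integral_mult_V2[OF W2]) (use W in measurable)
  with * show "(\<integral>\<omega>. (\<Sum>k<n. W k \<omega> * V (Suc k) \<omega>)\<^sup>2 \<partial>M) = \<sigma>\<^sup>2 * (\<integral>\<omega>. (\<Sum>k<n. (W k \<omega>)\<^sup>2) \<partial>M)"
    by (simp add: W2 sum_distrib_left)
qed

text \<open>An inequality of Lenglart type, with no moments required of the weights. A weight is
  replaced by 0 once the squares up to it exceed \<open>B\<close>. The stopped transform has second
  moment at most \<sigma>^2 B, Chebyshev's inequality gives the exceptional event, and where the
  squares up to n sum to at most \<open>B\<close> nothing has been stopped.\<close>

lemma lenglart:
  fixes W :: "nat \<Rightarrow> 'a \<Rightarrow> real"
  assumes W: "\<And>k. W k \<in> borel_measurable (F k)" and B: "0 \<le> B" and K: "0 < K"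
  shows "\<exists>A\<in>sets M. measure M A \<le> \<sigma>\<^sup>2 * B / K\<^sup>2 \<and>
     (\<forall>\<omega>\<in>space M - A. (\<Sum>k<n. (W k \<omega>)\<^sup>2) \<le> B \<longrightarrow> \<bar>\<Sum>k<n. W k \<omega> * V (Suc k) \<omega>\<bar> < K)"
proof -
  define W' where "W' k \<omega> = (if (\<Sum>j\<le>k. (W j \<omega>)\<^sup>2) \<le> B then W k \<omega> else 0)" for k \<omega>
  have W'_F: "W' k \<in> borel_measurable (F k)" for k
    unfolding W'_def by (rule stopped_measurable[OF W])
  have [measurable]: "W' k \<in> borel_measurable M" for k by (rule measurable_F_M[OF W'_F])
  have W'_sum: "(\<Sum>k<n. (W' k \<omega>)\<^sup>2) \<le> B" for n \<omega>
  proof -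
    have "(\<Sum>k<n. (W' k \<omega>)\<^sup>2) = (\<Sum>k<n. if (\<Sum>j\<le>k. (W j \<omega>)\<^sup>2) \<le> B then (W k \<omega>)\<^sup>2 else 0)"
      by (intro sum.cong) (auto simp: W'_def)
    then show ?thesis using stopped_sum_le[of "\<lambda>k. (W k \<omega>)\<^sup>2" B n] B by simp
  qed
  have W'_b: "\<bar>W' k \<omega>\<bar> \<le> sqrt B" for k \<omega>
  proof -
    have "(W' k \<omega>)\<^sup>2 \<le> (\<Sum>k<Suc k. (W' k \<omega>)\<^sup>2)" by (simp add: sum_nonneg)
    then have "(W' k \<omega>)\<^sup>2 \<le> B" using W'_sum[of \<omega> "Suc k"] by linarith
    then show ?thesis using real_le_rsqrt[of "\<bar>W' k \<omega>\<bar>" B] by simp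
  qed
  let ?S = "\<lambda>\<omega>. \<Sum>k<n. W' k \<omega> * V (Suc k) \<omega>"
  let ?A = "{\<omega>\<in>space M. K\<^sup>2 \<le> (?S \<omega>)\<^sup>2}"
  have i: "integrable M (\<lambda>\<omega>. (\<Sum>k<n. (W' k \<omega>)\<^sup>2))"
    using W'_sum by (intro integrable_const_bound[of _ B]) (auto simp: sum_nonneg)
  have "measure M ?A \<le> (\<integral>\<omega>. (?S \<omega>)\<^sup>2 \<partial>M) / K\<^sup>2"
    by (rule markov_ineq) (use transform_mart_diff(1)[OF W'_F W'_b] K in auto)
  also have "(\<integral>\<omega>. (?S \<omega>)\<^sup>2 \<partial>M) = \<sigma>\<^sup>2 * (\<integral>\<omega>. (\<Sum>k<n. (W' k \<omega>)\<^sup>2) \<partial>M)"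
    by (rule transform_mart_diff(2)[OF W'_F W'_b])
  also have "\<dots> \<le> \<sigma>\<^sup>2 * B"
  proof -
    have "(\<integral>\<omega>. (\<Sum>k<n. (W' k \<omega>)\<^sup>2) \<partial>M) \<le> (\<integral>\<omega>. B \<partial>M)"
      by (rule integral_mono[OF i]) (use W'_sum in auto)
    then show ?thesis by (intro mult_left_mono) (auto simp: prob_space)
  qed
  finally have 1: "measure M ?A \<le> \<sigma>\<^sup>2 * B / K\<^sup>2" by (simp add: divide_right_mono)
  have 2: "\<bar>\<Sum>k<n. W k \<omega> * V (Suc k) \<omega>\<bar> < K" if "\<omega> \<in> space M - ?A" "(\<Sum>k<n. (W k \<omega>)\<^sup>2) \<le> B" for \<omega>
  proof -
    have "W' k \<omega> = W k \<omega>" if "k < n" for k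
    proof -
      have "(\<Sum>j\<le>k. (W j \<omega>)\<^sup>2) \<le> (\<Sum>j<n. (W j \<omega>)\<^sup>2)"
        using that by (intro sum_mono2) auto
      then show ?thesis using \<open>(\<Sum>k<n. (W k \<omega>)\<^sup>2) \<le> B\<close> by (simp add: W'_def)
    qed
    then have "?S \<omega> = (\<Sum>k<n. W k \<omega> * V (Suc k) \<omega>)" by simp
    moreover have "\<bar>?S \<omega>\<bar>\<^sup>2 < K\<^sup>2" using that(1) by auto
    then have "\<bar>?S \<omega>\<bar> < K" using K by (rule_tac power2_less_imp_less) auto
    ultimately show ?thesis by simp
  qed
  show ?thesis
    by (rule bexI[of _ ?A]) (use 1 2 in \<open>auto simp: not_le\<close>)
qed

lemma transform_tends_in_prob_0:
  fixes W :: "nat \<Rightarrow> nat \<Rightarrow> 'a \<Rightarrow> real"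
  assumes W: "\<And>n k. W n k \<in> borel_measurable (F k)"
    and "tends_in_prob M (\<lambda>n \<omega>. \<Sum>k<n. (W n k \<omega>)\<^sup>2) 0"
  shows "tends_in_prob M (\<lambda>n \<omega>. \<Sum>k<n. W n k \<omega> * V (Suc k) \<omega>) 0"
proof (rule tends_in_probI)
  fix e :: real assume e: "0 < e"
  \<comment> \<open>Chosen so that the Lenglart bound \<sigma>^2 B / e^2 equals e / 2.\<close>
  define B where "B = e ^ 3 / (2 * \<sigma>\<^sup>2)"
  have B: "0 < B" "\<sigma>\<^sup>2 * B / e\<^sup>2 = e / 2"
    using e \<sigma>_pos by (auto simp: B_def power2_eq_square power3_eq_cube)
  have "0 < e / 2" using e by simp
  from tends_in_probD[OF assms(2) this B(1)]
  show "\<forall>\<^sub>F n in sequentially. \<exists>A\<in>sets M. measure M A \<le> e \<and>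
      (\<forall>\<omega>\<in>space M - A. dist (\<Sum>k<n. W n k \<omega> * V (Suc k) \<omega>) 0 \<le> e)"
  proof eventually_elim
    case (elim n)
    then obtain A1 where A1: "A1 \<in> sets M" "measure M A1 < e / 2"
        "\<And>\<omega>. \<omega> \<in> space M - A1 \<Longrightarrow> (\<Sum>k<n. (W n k \<omega>)\<^sup>2) < B"
      by (force simp: sum_nonneg)
    obtain A2 where A2: "A2 \<in> sets M" "measure M A2 \<le> e / 2"
        "\<And>\<omega>. \<omega> \<in> space M - A2 \<Longrightarrow> (\<Sum>k<n. (W n k \<omega>)\<^sup>2) \<le> B \<Longrightarrow> \<bar>\<Sum>k<n. W n k \<omega> * V (Suc k) \<omega>\<bar> < e"
      using lenglart[of "W n" B e n, OF W] B e by auto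
    show ?case
    proof (intro bexI[of _ "A1 \<union> A2"] conjI ballI)
      show "measure M (A1 \<union> A2) \<le> e"
        using measure_Un_le[OF A1(1) A2(1)] A1(2) A2(2) by simp
      fix \<omega> assume "\<omega> \<in> space M - (A1 \<union> A2)"
      then show "dist (\<Sum>k<n. W n k \<omega> * V (Suc k) \<omega>) 0 \<le> e"
        using A1(3)[of \<omega>] A2(3)[of \<omega>] by auto
    qed (use A1 A2 in auto)
  qed
qed

lemma transform_bounded_in_prob:
  fixes W :: "nat \<Rightarrow> nat \<Rightarrow> 'a \<Rightarrow> real"
  assumes W: "\<And>n k. W n k \<in> borel_measurable (F k)"
    and "tends_in_prob M (\<lambda>n \<omega>. \<Sum>k<n. (W n k \<omega>)\<^sup>2) q" and e: "0 < e"
  shows "\<exists>K>0. \<forall>\<^sub>F n in sequentially. \<exists>A\<in>sets M. measure M A < e \<and>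
      (\<forall>\<omega>\<in>space M - A. \<bar>\<Sum>k<n. W n k \<omega> * V (Suc k) \<omega>\<bar> < K)"
proof -
  define B where "B = \<bar>q\<bar> + 1"
  \<comment> \<open>Chosen so that the Lenglart bound \<sigma>^2 B / K^2 equals e / 4.\<close>
  define K where "K = sqrt (4 * \<sigma>\<^sup>2 * B / e)"
  have B: "0 < B" by (simp add: B_def)
  have K: "0 < K" "\<sigma>\<^sup>2 * B / K\<^sup>2 = e / 4"
    using e B \<sigma>_pos by (auto simp: K_def)
  have "0 < e / 2" using e by simp
  from tends_in_probD[OF assms(2) this zero_less_one]
  have "\<forall>\<^sub>F n in sequentially. \<exists>A\<in>sets M. measure M A < e \<and>
      (\<forall>\<omega>\<in>space M - A. \<bar>\<Sum>k<n. W n k \<omega> * V (Suc k) \<omega>\<bar> < K)"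
  proof eventually_elim
    case (elim n)
    then obtain A1 where A1: "A1 \<in> sets M" "measure M A1 < e / 2"
        "\<And>\<omega>. \<omega> \<in> space M - A1 \<Longrightarrow> \<bar>(\<Sum>k<n. (W n k \<omega>)\<^sup>2) - q\<bar> < 1"
      by (auto simp: dist_real_def)
    obtain A2 where A2: "A2 \<in> sets M" "measure M A2 \<le> e / 4"
        "\<And>\<omega>. \<omega> \<in> space M - A2 \<Longrightarrow> (\<Sum>k<n. (W n k \<omega>)\<^sup>2) \<le> B \<Longrightarrow> \<bar>\<Sum>k<n. W n k \<omega> * V (Suc k) \<omega>\<bar> < K"
      using lenglart[of "W n" B K n, OF W] B K by auto
    show ?case
    proof (intro bexI[of _ "A1 \<union> A2"] conjI ballI)
      show "measure M (A1 \<union> A2) < e"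
        using measure_Un_le[OF A1(1) A2(1)] A1(2) A2(2) e by simp
      fix \<omega> assume \<omega>: "\<omega> \<in> space M - (A1 \<union> A2)"
      then have "(\<Sum>k<n. (W n k \<omega>)\<^sup>2) \<le> B"
        using A1(3)[of \<omega>] unfolding B_def by auto
      then show "\<bar>\<Sum>k<n. W n k \<omega> * V (Suc k) \<omega>\<bar> < K"
        using A2(3)[of \<omega>] \<omega> by auto
    qed (use A1 A2 in auto)
  qed
  then show ?thesis using K by blast
qed

text \<open>
  \<open>V\<^sup>2 - \<sigma>\<^sup>2\<close> is split at the level \<open>b\<close>: the truncated part is a bounded martingale difference,
  the rest is small in \<open>L\<^sup>1\<close> on the tame event, uniformly in \<open>k\<close>.
\<close>

lemma tame_square_LLN_L1:
  assumes b: "1 \<le> b" and B: "1 \<le> B" and n: "1 \<le> n" and \<eta>: "0 < \<eta>"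
  defines "Z \<equiv> \<lambda>\<omega>. (\<Sum>k<n. indicator (tame B k) \<omega> * ((V (Suc k) \<omega>)\<^sup>2 - \<sigma>\<^sup>2)) / real n"
  shows "integrable M Z" "(\<integral>\<omega>. \<bar>Z \<omega>\<bar> \<partial>M) \<le> b\<^sup>2 / (real n * \<eta>) + \<eta> + 2 * B * b powr (1 - a / 2)"
proof -
  define I where "I k \<omega> = (indicator (tame B k) \<omega> :: real)" for k \<omega>
  define T where "T k \<omega> = min ((V (Suc k) \<omega>)\<^sup>2) b" for k \<omega>
  \<comment> \<open>\<open>T'\<close> compensates the truncated square. On the tame event, V^2 -
    \<sigma>^2 splits as D + R - Q: a bounded martingale difference, the truncation error, and the
    conditional mean of that error.\<close>
  define T' where "T' k = real_cond_exp M (F k) (T k)" for k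
  define D where "D k \<omega> = I k \<omega> * (T k \<omega> - T' k \<omega>)" for k \<omega>
  define R where "R k \<omega> = I k \<omega> * ((V (Suc k) \<omega>)\<^sup>2 - T k \<omega>)" for k \<omega>
  define Q where "Q k \<omega> = I k \<omega> * (\<sigma>\<^sup>2 - T' k \<omega>)" for k \<omega>
  have [measurable]: "I k \<in> borel_measurable (F k)" "I k \<in> borel_measurable M" for k
    unfolding I_def by measurable
  have I01: "I k \<omega> \<in> {0, 1}" for k \<omega> by (simp add: I_def indicator_def)
  have [measurable]: "T k \<in> borel_measurable M" for k unfolding T_def by measurable
  have T_F: "T k \<in> borel_measurable (F (Suc k))" for k
    unfolding T_def using V_F[of k] by measurable
  have [measurable]: "T' k \<in> borel_measurable (F k)" "T' k \<in> borel_measurable M" for k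
    by (auto simp: T'_def)
  have Tb: "0 \<le> T k \<omega>" "T k \<omega> \<le> b" "T k \<omega> \<le> (V (Suc k) \<omega>)\<^sup>2" for k \<omega>
    using b by (auto simp: T_def)
  have T_int: "integrable M (T k)" for k
    using Tb by (intro integrable_const_bound[of _ b]) auto
  have T'b: "AE \<omega> in M. 0 \<le> T' k \<omega>" "AE \<omega> in M. T' k \<omega> \<le> b" for k
    unfolding T'_def using Tb T_int
    by (auto intro!: sigma_finite_subalgebra.real_cond_exp_ge_c[OF sigma_finite_F]
        sigma_finite_subalgebra.real_cond_exp_le_c[OF sigma_finite_F])
  \<comment> \<open>Truncation only lowers the conditional mean. Hence \<open>Q\<close> is
    nonnegative and has the same expectation, and so the same L1 norm, as \<open>R\<close>.\<close>
  have T'\<sigma>: "AE \<omega> in M. T' k \<omega> \<le> \<sigma>\<^sup>2" for k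
    using sigma_finite_subalgebra.real_cond_exp_mono[OF sigma_finite_F, of "T k" "\<lambda>\<omega>. (V (Suc k) \<omega>)\<^sup>2" k]
      T_int V2_integrable Tb cond_var[of k] by (auto simp: T'_def)
  have T'_int: "integrable M (T' k)" for k
    using T'b[of k] by (intro integrable_const_bound[of _ b]) auto
  have Db: "AE \<omega> in M. \<bar>D k \<omega>\<bar> \<le> b" for k
    using T'b[of k]
  proof eventually_elim
    case (elim \<omega>)
    then show ?case using I01[of k \<omega>] Tb[of k \<omega>] b by (auto simp: D_def)
  qed
  have D2b: "AE \<omega> in M. (D k \<omega>)\<^sup>2 \<le> b\<^sup>2" for k
    using Db[of k] by eventually_elim (metis abs_ge_zero power2_abs power_mono)
  have [measurable]: "D k \<in> borel_measurable M" "R k \<in> borel_measurable M" "Q k \<in> borel_measurable M" for k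
    unfolding D_def R_def Q_def by measurable
  have D2: "integrable M (\<lambda>\<omega>. (D k \<omega>)\<^sup>2)" for k
    using D2b[of k] by (intro integrable_const_bound[of _ "b\<^sup>2"]) auto
  have D_int: "integrable M (D k)" for k
    using Db[of k] by (intro integrable_const_bound[of _ b]) auto
  have D_L2: "integrable M (\<lambda>\<omega>. (\<Sum>k<n. D k \<omega>)\<^sup>2) \<and> (\<integral>\<omega>. (\<Sum>k<n. D k \<omega>)\<^sup>2 \<partial>M) = (\<Sum>k<n. \<integral>\<omega>. (D k \<omega>)\<^sup>2 \<partial>M)"
  proof (rule sum_mart_diff_L2[OF _ D2])
    fix k
    show "D k \<in> borel_measurable (F (Suc k))"
      unfolding D_def
      by (intro borel_measurable_times borel_measurable_diff T_F; rule measurable_F_mono[of _ k]) auto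
    fix Y :: "'a \<Rightarrow> real" assume Y: "Y \<in> borel_measurable (F k)" "integrable M (\<lambda>\<omega>. (Y \<omega>)\<^sup>2)"
    have [measurable]: "Y \<in> borel_measurable M" by (rule measurable_F_M[OF Y(1)])
    have 1: "integrable M (\<lambda>\<omega>. (Y \<omega> * I k \<omega>) * T k \<omega>)"
    proof -
      have "integrable M (\<lambda>\<omega>. Y \<omega> * (I k \<omega> * T k \<omega>))"
      proof (rule integrable_mult_of_squares)
        show "integrable M (\<lambda>\<omega>. (I k \<omega> * T k \<omega>)\<^sup>2)"
        proof (rule integrable_const_bound[of _ "b\<^sup>2"])
          have "(I k \<omega> * T k \<omega>)\<^sup>2 \<le> b\<^sup>2" for \<omega>
            using I01[of k \<omega>] Tb[of k \<omega>] by (auto intro: power_mono)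
          then show "AE \<omega> in M. norm ((I k \<omega> * T k \<omega>)\<^sup>2) \<le> b\<^sup>2" by simp
        qed measurable
      qed (use Y in auto)
      then show ?thesis by (simp add: mult.assoc)
    qed
    have "integrable M (\<lambda>\<omega>. (Y \<omega> * I k \<omega>) * T' k \<omega>)"
         "(\<integral>\<omega>. (Y \<omega> * I k \<omega>) * T' k \<omega> \<partial>M) = (\<integral>\<omega>. (Y \<omega> * I k \<omega>) * T k \<omega> \<partial>M)"
      unfolding T'_def
      by (rule sigma_finite_subalgebra.real_cond_exp_intg[OF sigma_finite_F 1]; use Y(1) in measurable)+
    then have "(\<integral>\<omega>. (Y \<omega> * I k \<omega>) * T k \<omega> - (Y \<omega> * I k \<omega>) * T' k \<omega> \<partial>M) = 0"
      using 1 by simp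
    then show "(\<integral>\<omega>. Y \<omega> * D k \<omega> \<partial>M) = 0"
      by (simp add: D_def algebra_simps)
  qed
  have R_nonneg: "0 \<le> R k \<omega>" for k \<omega>
    using I01[of k \<omega>] Tb[of k \<omega>] by (auto simp: R_def)
  have R_int: "integrable M (R k)" for k
    unfolding R_def using V2_integrable[of k] T_int[of k] I01[of k]
    by (intro bounded_mult_integrable[where b = 1]) (auto simp: I_def indicator_def)
  have Q_int: "integrable M (Q k)" for k
    unfolding Q_def using T'_int[of k]
    by (intro bounded_mult_integrable[where b = 1]) (auto simp: I_def indicator_def)
  have Q_abs: "(\<integral>\<omega>. \<bar>Q k \<omega>\<bar> \<partial>M) = (\<integral>\<omega>. R k \<omega> \<partial>M)" for k
  proof -
    have I_int: "integrable M (I k)"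
      using I01[of k] by (intro integrable_const_bound[of _ 1]) (auto simp: I_def indicator_def)
    have 1: "integrable M (\<lambda>\<omega>. I k \<omega> * T k \<omega>)"
      using T_int[of k] by (intro bounded_mult_integrable[where b = 1]) (auto simp: I_def indicator_def)
    have 2: "integrable M (\<lambda>\<omega>. I k \<omega> * T' k \<omega>)" "(\<integral>\<omega>. I k \<omega> * T' k \<omega> \<partial>M) = (\<integral>\<omega>. I k \<omega> * T k \<omega> \<partial>M)"
      unfolding T'_def
      by (rule sigma_finite_subalgebra.real_cond_exp_intg[OF sigma_finite_F 1]; measurable)+
    have "(\<integral>\<omega>. \<bar>Q k \<omega>\<bar> \<partial>M) = (\<integral>\<omega>. Q k \<omega> \<partial>M)"
    proof (rule integral_cong_AE)
      show "AE \<omega> in M. \<bar>Q k \<omega>\<bar> = Q k \<omega>"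
        using T'\<sigma>[of k]
      proof eventually_elim
        case (elim \<omega>)
        then show ?case using I01[of k \<omega>] by (auto simp: Q_def)
      qed
    qed measurable
    also have "\<dots> = \<sigma>\<^sup>2 * (\<integral>\<omega>. I k \<omega> \<partial>M) - (\<integral>\<omega>. I k \<omega> * T k \<omega> \<partial>M)"
      unfolding Q_def using I_int 2 by (simp add: right_diff_distrib mult.commute)
    also have "\<sigma>\<^sup>2 * (\<integral>\<omega>. I k \<omega> \<partial>M) = (\<integral>\<omega>. I k \<omega> * (V (Suc k) \<omega>)\<^sup>2 \<partial>M)"
      by (rule integral_mult_V2[OF I_int, symmetric]) measurable
    also have "\<dots> - (\<integral>\<omega>. I k \<omega> * T k \<omega> \<partial>M) = (\<integral>\<omega>. R k \<omega> \<partial>M)"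
      unfolding R_def using mult_V2_integrable[OF I_int, of k] 1 by (simp add: right_diff_distrib)
    finally show ?thesis .
  qed
  have R_small: "(\<integral>\<omega>. R k \<omega> \<partial>M) \<le> B * b powr (1 - a / 2)" for k
  proof -
    \<comment> \<open>Above the level b the square is |v|^(2 - a) times |v|^a, and since 2 - a is
      negative the first factor is at most b^(1 - a / 2).\<close>
    have pw: "v\<^sup>2 - min (v\<^sup>2) b \<le> b powr (1 - a / 2) * \<bar>v\<bar> powr a" for v :: real
    proof (cases "v\<^sup>2 \<le> b")
      case False
      then have v: "0 < \<bar>v\<bar>" "b \<le> v\<^sup>2" using b by auto
      have "v\<^sup>2 = \<bar>v\<bar> powr 2" using v by simp
      also have "\<dots> = \<bar>v\<bar> powr (2 * (1 - a / 2)) * \<bar>v\<bar> powr a"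
        by (simp add: powr_add[symmetric] right_diff_distrib)
      also have "\<bar>v\<bar> powr (2 * (1 - a / 2)) = (v\<^sup>2) powr (1 - a / 2)"
      proof -
        have "v\<^sup>2 = \<bar>v\<bar> powr 2" using v by simp
        then show ?thesis by (simp only: powr_powr)
      qed
      also have "\<dots> \<le> b powr (1 - a / 2)"
        using b v a_gt_2 by (intro powr_mono2') auto
      finally have "v\<^sup>2 \<le> b powr (1 - a / 2) * \<bar>v\<bar> powr a"
        by (simp add: mult_right_mono)
      then show ?thesis using False b by simp
    qed simp
    have "ennreal (\<integral>\<omega>. R k \<omega> \<partial>M) = (\<integral>\<^sup>+\<omega>. ennreal (R k \<omega>) \<partial>M)"
      using R_int R_nonneg by (simp add: nn_integral_eq_integral)
    also have "\<dots> \<le> (\<integral>\<^sup>+\<omega>. ennreal (b powr (1 - a / 2)) * indicator (tame B k) \<omega> * ennreal (\<bar>V (Suc k) \<omega>\<bar> powr a) \<partial>M)"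
      using pw by (intro nn_integral_mono) (auto simp: R_def I_def T_def indicator_def ennreal_mult[symmetric] intro!: ennreal_leI)
    also have "\<dots> \<le> ennreal B * (\<integral>\<^sup>+\<omega>. ennreal (b powr (1 - a / 2)) \<partial>M)"
      by (rule nn_integral_tame_moment) simp
    also have "\<dots> = ennreal (B * b powr (1 - a / 2))"
      using B by (simp add: emeasure_space_1 ennreal_mult)
    finally show ?thesis using B by (simp add: ennreal_le_iff)
  qed
  have Z_eq: "Z \<omega> = (\<Sum>k<n. D k \<omega>) / n + (\<Sum>k<n. R k \<omega> - Q k \<omega>) / n" for \<omega>
    unfolding Z_def add_divide_distrib[symmetric] sum.distrib[symmetric]
    by (simp add: D_def R_def Q_def I_def algebra_simps)
  show "integrable M Z"
    unfolding Z_eq using D_int R_int Q_int by (intro Bochner_Integration.integrable_add integrable_divide Bochner_Integration.integrable_sum Bochner_Integration.integrable_diff)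
  have "(\<integral>\<omega>. \<bar>Z \<omega>\<bar> \<partial>M) \<le> (\<integral>\<omega>. ((\<Sum>k<n. D k \<omega>)\<^sup>2 / (n\<^sup>2 * \<eta>) + \<eta>) + (\<Sum>k<n. R k \<omega> + \<bar>Q k \<omega>\<bar>) / n \<partial>M)"
  proof (rule integral_mono)
    show "integrable M (\<lambda>\<omega>. \<bar>Z \<omega>\<bar>)" using \<open>integrable M Z\<close> by simp
    show "integrable M (\<lambda>\<omega>. ((\<Sum>k<n. D k \<omega>)\<^sup>2 / (n\<^sup>2 * \<eta>) + \<eta>) + (\<Sum>k<n. R k \<omega> + \<bar>Q k \<omega>\<bar>) / n)"
      using D_L2 R_int Q_int by simp
    fix \<omega>
    let ?x = "(\<Sum>k<n. D k \<omega>) / n"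
    \<comment> \<open>The arithmetic-geometric mean inequality takes the place of Cauchy-Schwarz for
      integrals: the second moment of the average of \<open>D\<close> is small for large n, even
      after division by \<eta>.\<close>
    have "\<bar>x\<bar> \<le> x\<^sup>2 / \<eta> + \<eta>" for x :: real
    proof -
      have "2 * (\<bar>x\<bar> * \<eta>) \<le> x\<^sup>2 + \<eta>\<^sup>2"
        using sum_squares_bound[of "\<bar>x\<bar>" \<eta>] by (simp add: mult.assoc)
      moreover have "0 \<le> \<bar>x\<bar> * \<eta>" using \<eta> by simp
      ultimately have "\<bar>x\<bar> * \<eta> \<le> x\<^sup>2 + \<eta>\<^sup>2" by linarith
      then have "\<bar>x\<bar> \<le> (x\<^sup>2 + \<eta>\<^sup>2) / \<eta>" using \<eta> by (simp only: pos_le_divide_eq)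
      then show ?thesis using \<eta> by (simp add: add_divide_distrib power2_eq_square)
    qed
    from this[of ?x] have "\<bar>?x\<bar> \<le> ?x\<^sup>2 / \<eta> + \<eta>" .
    also have "?x\<^sup>2 / \<eta> = (\<Sum>k<n. D k \<omega>)\<^sup>2 / (n\<^sup>2 * \<eta>)" by (simp add: power_divide)
    finally have "\<bar>?x\<bar> \<le> (\<Sum>k<n. D k \<omega>)\<^sup>2 / (n\<^sup>2 * \<eta>) + \<eta>" .
    moreover have "\<bar>(\<Sum>k<n. R k \<omega> - Q k \<omega>) / n\<bar> \<le> (\<Sum>k<n. R k \<omega> + \<bar>Q k \<omega>\<bar>) / n"
    proof -
      have "\<bar>\<Sum>k<n. R k \<omega> - Q k \<omega>\<bar> \<le> (\<Sum>k<n. \<bar>R k \<omega> - Q k \<omega>\<bar>)" by (rule sum_abs)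
      also have "\<dots> \<le> (\<Sum>k<n. R k \<omega> + \<bar>Q k \<omega>\<bar>)"
        using R_nonneg by (intro sum_mono) (metis abs_of_nonneg abs_triangle_ineq4)
      finally show ?thesis by (simp add: divide_right_mono)
    qed
    ultimately show "\<bar>Z \<omega>\<bar> \<le> ((\<Sum>k<n. D k \<omega>)\<^sup>2 / (n\<^sup>2 * \<eta>) + \<eta>) + (\<Sum>k<n. R k \<omega> + \<bar>Q k \<omega>\<bar>) / n"
      unfolding Z_eq by (intro order_trans[OF abs_triangle_ineq] add_mono)
  qed
  also have "\<dots> = (\<Sum>k<n. \<integral>\<omega>. (D k \<omega>)\<^sup>2 \<partial>M) / (n\<^sup>2 * \<eta>) + \<eta> + (\<Sum>k<n. 2 * (\<integral>\<omega>. R k \<omega> \<partial>M)) / n"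
  proof -
    have 1: "integrable M (\<lambda>\<omega>. (\<Sum>k<n. D k \<omega>)\<^sup>2 / (n\<^sup>2 * \<eta>) + \<eta>)"
      using D_L2 by (intro Bochner_Integration.integrable_add integrable_divide) auto
    have 2: "integrable M (\<lambda>\<omega>. (\<Sum>k<n. R k \<omega> + \<bar>Q k \<omega>\<bar>) / n)"
      using R_int Q_int by (intro integrable_divide Bochner_Integration.integrable_sum Bochner_Integration.integrable_add integrable_abs) auto
    have 3: "(\<integral>\<omega>. (\<Sum>k<n. D k \<omega>)\<^sup>2 / (n\<^sup>2 * \<eta>) + \<eta> \<partial>M) = (\<Sum>k<n. \<integral>\<omega>. (D k \<omega>)\<^sup>2 \<partial>M) / (n\<^sup>2 * \<eta>) + \<eta>"
      using D_L2 by (subst Bochner_Integration.integral_add) (auto simp: prob_space)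
    have 4: "(\<integral>\<omega>. R k \<omega> + \<bar>Q k \<omega>\<bar> \<partial>M) = 2 * (\<integral>\<omega>. R k \<omega> \<partial>M)" for k
      using R_int[of k] Q_int[of k] Q_abs[of k] by (subst Bochner_Integration.integral_add) auto
    have 5: "(\<integral>\<omega>. (\<Sum>k<n. R k \<omega> + \<bar>Q k \<omega>\<bar>) / n \<partial>M) = (\<Sum>k<n. \<integral>\<omega>. R k \<omega> + \<bar>Q k \<omega>\<bar> \<partial>M) / n"
      using R_int Q_int by (subst integral_divide_zero, subst Bochner_Integration.integral_sum) auto
    show ?thesis
      unfolding Bochner_Integration.integral_add[OF 1 2] 3 5 4 ..
  qed
  also have "\<dots> \<le> (n * b\<^sup>2) / (n\<^sup>2 * \<eta>) + \<eta> + (n * (2 * (B * b powr (1 - a / 2)))) / n"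
  proof (intro add_mono divide_right_mono order_refl)
    have "(\<integral>\<omega>. (D k \<omega>)\<^sup>2 \<partial>M) \<le> b\<^sup>2" for k
    proof -
      have "(\<integral>\<omega>. (D k \<omega>)\<^sup>2 \<partial>M) \<le> (\<integral>\<omega>. b\<^sup>2 \<partial>M)"
        by (rule integral_mono_AE[OF D2]) (use D2b in auto)
      then show ?thesis by (simp add: prob_space)
    qed
    then show "(\<Sum>k<n. \<integral>\<omega>. (D k \<omega>)\<^sup>2 \<partial>M) \<le> n * b\<^sup>2"
      using sum_bounded_above[of "{..<n}" "\<lambda>k. \<integral>\<omega>. (D k \<omega>)\<^sup>2 \<partial>M" "b\<^sup>2"] by simp
    show "(\<Sum>k<n. 2 * (\<integral>\<omega>. R k \<omega> \<partial>M)) \<le> n * (2 * (B * b powr (1 - a / 2)))"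
      using sum_bounded_above[of "{..<n}" "\<lambda>k. 2 * (\<integral>\<omega>. R k \<omega> \<partial>M)" "2 * (B * b powr (1 - a / 2))"] R_small by simp
  qed (use \<eta> in auto)
  also have "\<dots> = b\<^sup>2 / (real n * \<eta>) + \<eta> + 2 * B * b powr (1 - a / 2)"
    using n by (simp add: power2_eq_square)
  finally show "(\<integral>\<omega>. \<bar>Z \<omega>\<bar> \<partial>M) \<le> b\<^sup>2 / (real n * \<eta>) + \<eta> + 2 * B * b powr (1 - a / 2)" .
qed

text \<open>The parameters are chosen in this order: \<open>B\<close> for tameness off a small
  event, then the truncation level \<open>b\<close> for a small truncation error, and finally n for
  a small martingale part.\<close>

lemma noise_square_LLN:
  "tends_in_prob M (\<lambda>n \<omega>. (\<Sum>k<n. (V (Suc k) \<omega>)\<^sup>2) / real n) (\<sigma>\<^sup>2)"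
proof (rule tends_in_probI)
  fix e :: real assume e: "0 < e"
  then have "0 < e / 2" by simp
  from mostly_tame[OF this] obtain B A0 where B: "1 \<le> B" and A0: "A0 \<in> sets M" "measure M A0 < e / 2"
      "\<And>\<omega> n. \<omega> \<in> space M - A0 \<Longrightarrow> \<omega> \<in> tame B n"
    by blast
  \<comment> \<open>Each of the three terms of the L1 bound is to be at most \<eta>. Markov's
    inequality at level e then costs 3 \<eta> / e = e / 2.\<close>
  define \<eta> where "\<eta> = e\<^sup>2 / 6"
  have \<eta>: "0 < \<eta>" using e by (simp add: \<eta>_def)
  have "((\<lambda>b. b powr (1 - a / 2)) \<longlongrightarrow> 0) at_top"
    using a_gt_2 by (intro tendsto_neg_powr filterlim_ident) auto
  then have "((\<lambda>b. 2 * B * b powr (1 - a / 2)) \<longlongrightarrow> 0) at_top"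
    by (rule tendsto_mult_right_zero)
  then have "\<forall>\<^sub>F b in at_top. 2 * B * b powr (1 - a / 2) < \<eta> \<and> 1 \<le> b"
    using \<eta> by (intro eventually_conj order_tendstoD eventually_ge_at_top) auto
  then obtain b where b: "2 * B * b powr (1 - a / 2) < \<eta>" "1 \<le> b"
    by (metis (no_types, lifting) eventually_at_top_linorder order_refl)
  have "(\<lambda>n. b\<^sup>2 / \<eta> / real n) \<longlonglongrightarrow> 0" by (rule lim_const_over_n)
  then have "\<forall>\<^sub>F n in sequentially. b\<^sup>2 / \<eta> / real n < \<eta> \<and> 1 \<le> n"
    using \<eta> by (intro eventually_conj order_tendstoD eventually_ge_at_top) auto
  then show "\<forall>\<^sub>F n in sequentially. \<exists>A\<in>sets M. measure M A \<le> e \<and>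
      (\<forall>\<omega>\<in>space M - A. dist ((\<Sum>k<n. (V (Suc k) \<omega>)\<^sup>2) / real n) (\<sigma>\<^sup>2) \<le> e)"
  proof eventually_elim
    case (elim n)
    define Z where "Z \<omega> = (\<Sum>k<n. indicator (tame B k) \<omega> * ((V (Suc k) \<omega>)\<^sup>2 - \<sigma>\<^sup>2)) / real n" for \<omega>
    note L1 = tame_square_LLN_L1[OF b(2) B _ \<eta>, of n, folded Z_def]
    have Z_int: "integrable M Z" using L1(1) elim by simp
    have "(\<integral>\<omega>. \<bar>Z \<omega>\<bar> \<partial>M) \<le> \<eta> + \<eta> + \<eta>"
      using L1(2) elim b by (simp add: mult.commute)
    then have E: "(\<integral>\<omega>. \<bar>Z \<omega>\<bar> \<partial>M) \<le> e\<^sup>2 / 2" by (simp add: \<eta>_def)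
    let ?A = "{\<omega>\<in>space M. e \<le> \<bar>Z \<omega>\<bar>}"
    have "measure M ?A \<le> (\<integral>\<omega>. \<bar>Z \<omega>\<bar> \<partial>M) / e"
      by (rule markov_ineq) (use Z_int e in auto)
    also have "\<dots> \<le> (e\<^sup>2 / 2) / e" using E e by (intro divide_right_mono) auto
    also have "\<dots> = e / 2" by (simp add: power2_eq_square)
    finally have m: "measure M ?A \<le> e / 2" .
    have A: "?A \<in> sets M" using Z_int by measurable
    show ?case
    proof (intro bexI[of _ "A0 \<union> ?A"] conjI ballI)
      show "measure M (A0 \<union> ?A) \<le> e"
        using measure_Un_le[OF A0(1) A] A0(2) m by simp
      fix \<omega> assume \<omega>: "\<omega> \<in> space M - (A0 \<union> ?A)"
      then have "Z \<omega> = (\<Sum>k<n. (V (Suc k) \<omega>)\<^sup>2 - \<sigma>\<^sup>2) / real n"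
        using A0(3)[of \<omega>] by (simp add: Z_def indicator_def)
      also have "\<dots> = (\<Sum>k<n. (V (Suc k) \<omega>)\<^sup>2) / real n - \<sigma>\<^sup>2"
        using elim by (simp add: sum_subtractf diff_divide_distrib)
      finally show "dist ((\<Sum>k<n. (V (Suc k) \<omega>)\<^sup>2) / real n) (\<sigma>\<^sup>2) \<le> e"
        using \<omega> by (auto simp: dist_real_def)
    qed (use A0 A in auto)
  qed
qed

end

section \<open>The martingale central limit theorem\<close>

text \<open>Interpolation between the two standard remainder estimates: the cubic one is better for
  |x| \<le> 1, the quadratic one beyond, so every power between 2 and 3 is admissible.\<close>

lemma iexp_approx_powr:
  assumes "2 \<le> b" "b \<le> 3"
  shows "cmod (iexp x - (1 + \<i> * x - complex_of_real (x\<^sup>2 / 2))) \<le> \<bar>x\<bar> powr b"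
proof -
  have *: "(\<Sum>k\<le>2. (\<i> * complex_of_real x) ^ k / fact k) = 1 + \<i> * x - complex_of_real (x\<^sup>2 / 2)"
    by (simp add: numeral_2_eq_2 power_mult_distrib)
  show ?thesis
  proof (cases "\<bar>x\<bar> \<le> 1")
    case True
    have "cmod (iexp x - (\<Sum>k\<le>2. (\<i> * x) ^ k / fact k)) \<le> \<bar>x\<bar> ^ Suc 2 / fact (Suc 2)"
      by (rule iexp_approx1)
    also have "\<dots> \<le> \<bar>x\<bar> ^ 3 / 1"
      by (intro frac_le) (auto simp: numeral_3_eq_3)
    also have "\<dots> \<le> \<bar>x\<bar> powr b"
    proof (cases "x = 0")
      case False
      then have "\<bar>x\<bar> ^ 3 = \<bar>x\<bar> powr 3" by simp
      also have "\<dots> \<le> \<bar>x\<bar> powr b" using True assms False by (intro powr_mono') auto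
      finally show ?thesis by simp
    qed simp
    finally show ?thesis unfolding * .
  next
    case False
    have "cmod (iexp x - (\<Sum>k\<le>2. (\<i> * x) ^ k / fact k)) \<le> 2 * \<bar>x\<bar> ^ 2 / fact 2"
      by (rule iexp_approx2)
    also have "\<dots> = \<bar>x\<bar> powr 2" using False by simp
    also have "\<dots> \<le> \<bar>x\<bar> powr b" using False assms by (intro powr_mono) auto
    finally show ?thesis unfolding * .
  qed
qed

lemma abs_exp_minus_approx:
  fixes x :: real
  assumes "0 \<le> x"
  shows "\<bar>1 - x - exp (- x)\<bar> \<le> x\<^sup>2"
proof -
  \<comment> \<open>The product is 1 + x^3.\<close>
  have "1 \<le> (1 - x + x\<^sup>2) * (1 + x)"
    using assms by (simp add: algebra_simps power2_eq_square)
  also have "\<dots> \<le> (1 - x + x\<^sup>2) * exp x"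
  proof (rule mult_left_mono)
    have "0 \<le> (1 - x / 2)\<^sup>2 + 3 / 4 * x\<^sup>2" by simp
    then show "0 \<le> 1 - x + x\<^sup>2" by (simp add: power2_eq_square algebra_simps)
  qed (rule exp_ge_add_one_self)
  finally have "exp (- x) \<le> 1 - x + x\<^sup>2"
    by (simp add: exp_minus field_simps)
  moreover have "1 - x \<le> exp (- x)" using exp_ge_add_one_self[of "- x"] by simp
  ultimately show ?thesis by simp
qed

context martingale_noise
begin

text \<open>The Taylor remainder admits powers up to 3, and the conditional moments are controlled
  up to a. A value strictly above 2 is what makes the remainder negligible against the
  variance.\<close>

definition exponent :: real where "exponent = min a 3"

lemma exponent: "2 < exponent" "exponent \<le> 3" "exponent \<le> a"
  using a_gt_2 by (auto simp: exponent_def)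

text \<open>Both factors are expanded to second order in w. The linear term vanishes because V is a
  martingale difference, the quadratic terms cancel by the conditional variance, and the remainders
  \<open>R1\<close> and \<open>R2\<close> are left. Each is w^2 times a quantity that is small with
  \<eta>, so that the errors of all steps add up to a small multiple of the sum of the w^2.\<close>

lemma clt_step:
  fixes Y :: "'a \<Rightarrow> complex" and w :: "'a \<Rightarrow> real"
  assumes Y: "Y \<in> borel_measurable (F n)" and w: "w \<in> borel_measurable (F n)"
    and YL: "\<And>\<omega>. cmod (Y \<omega>) \<le> L" and w\<eta>: "\<And>\<omega>. \<bar>w \<omega>\<bar> \<le> \<eta>" and \<eta>: "0 < \<eta>" "\<eta> \<le> 1"
    and w0: "\<And>\<omega>. \<omega> \<notin> tame B n \<Longrightarrow> w \<omega> = 0" and B: "1 \<le> B"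
  shows "cmod (\<integral>\<omega>. Y \<omega> * (iexp (w \<omega> * V (Suc n) \<omega>) - of_real (exp (- (\<sigma>\<^sup>2 * (w \<omega>)\<^sup>2 / 2)))) \<partial>M)
      \<le> L * ((1 + B) * \<eta> powr (exponent - 2) + \<sigma> ^ 4 * \<eta>\<^sup>2) * (\<integral>\<omega>. (w \<omega>)\<^sup>2 \<partial>M)"
proof -
  let ?v = "V (Suc n)"
  have [measurable]: "Y \<in> borel_measurable M" "w \<in> borel_measurable M"
    using Y w by (auto intro: measurable_F_M)
  have L: "0 \<le> L" using YL[of undefined] norm_ge_zero order_trans by blast
  have w1: "\<bar>w \<omega>\<bar> \<le> 1" for \<omega> using w\<eta>[of \<omega>] \<eta> by linarith
  have w2\<eta>: "(w \<omega>)\<^sup>2 \<le> \<eta>\<^sup>2" for \<omega> using power_mono[OF w\<eta>[of \<omega>] abs_ge_zero, where n = 2] by simp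
  have w21: "(w \<omega>)\<^sup>2 \<le> 1" for \<omega> using power_mono[OF w1[of \<omega>] abs_ge_zero, where n = 2] by simp
  have w2_int: "integrable M (\<lambda>\<omega>. (w \<omega>)\<^sup>2)"
    using w21 by (intro integrable_const_bound[of _ 1]) auto
  define R1 where "R1 \<omega> = iexp (w \<omega> * ?v \<omega>) - (1 + \<i> * of_real (w \<omega> * ?v \<omega>) - complex_of_real ((w \<omega> * ?v \<omega>)\<^sup>2 / 2))" for \<omega>
  define R2 where "R2 \<omega> = 1 - \<sigma>\<^sup>2 * (w \<omega>)\<^sup>2 / 2 - exp (- (\<sigma>\<^sup>2 * (w \<omega>)\<^sup>2 / 2))" for \<omega>
  have [measurable]: "R1 \<in> borel_measurable M" "R2 \<in> borel_measurable M"
    unfolding R1_def R2_def by measurable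
  have R1_le: "2 \<le> b \<Longrightarrow> b \<le> 3 \<Longrightarrow> cmod (R1 \<omega>) \<le> \<bar>w \<omega> * ?v \<omega>\<bar> powr b" for b \<omega>
    unfolding R1_def by (rule iexp_approx_powr)
  have R2_le: "\<bar>R2 \<omega>\<bar> \<le> \<sigma> ^ 4 * \<eta>\<^sup>2 * (w \<omega>)\<^sup>2" for \<omega>
  proof -
    have "\<bar>R2 \<omega>\<bar> \<le> (\<sigma>\<^sup>2 * (w \<omega>)\<^sup>2 / 2)\<^sup>2"
      unfolding R2_def by (rule abs_exp_minus_approx) simp
    also have "\<dots> = \<sigma> ^ 4 * ((w \<omega>)\<^sup>2 * (w \<omega>)\<^sup>2) / 4"
      by (simp add: power2_eq_square power4_eq_xxxx)
    also have "\<dots> \<le> \<sigma> ^ 4 * (\<eta>\<^sup>2 * (w \<omega>)\<^sup>2) / 1"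
      by (intro frac_le mult_left_mono mult_right_mono w2\<eta>) auto
    finally show ?thesis by (simp add: mult.assoc)
  qed
  have R1_int: "integrable M (\<lambda>\<omega>. Y \<omega> * R1 \<omega>)"
  proof (rule Bochner_Integration.integrable_bound)
    show "integrable M (\<lambda>\<omega>. L * (?v \<omega>)\<^sup>2)" using V2_integrable[of n] by simp
    have "cmod (Y \<omega> * R1 \<omega>) \<le> L * (?v \<omega>)\<^sup>2" for \<omega>
    proof -
      have "cmod (R1 \<omega>) \<le> \<bar>w \<omega> * ?v \<omega>\<bar> powr 2" by (rule R1_le) auto
      also have "\<dots> = (w \<omega>)\<^sup>2 * (?v \<omega>)\<^sup>2" by (simp add: power_mult_distrib)
      also have "\<dots> \<le> 1 * (?v \<omega>)\<^sup>2" by (intro mult_right_mono w21) auto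
      finally show ?thesis unfolding norm_mult using YL[of \<omega>] L by (intro mult_mono) auto
    qed
    then show "AE \<omega> in M. norm (Y \<omega> * R1 \<omega>) \<le> norm (L * (?v \<omega>)\<^sup>2)"
      using L by simp
  qed measurable
  have R2_int: "integrable M (\<lambda>\<omega>. Y \<omega> * of_real (R2 \<omega>))"
  proof (rule Bochner_Integration.integrable_bound)
    show "integrable M (\<lambda>\<omega>. L * (\<sigma> ^ 4 * \<eta>\<^sup>2 * (w \<omega>)\<^sup>2))" using w2_int by simp
    have "cmod (Y \<omega> * of_real (R2 \<omega>)) \<le> L * (\<sigma> ^ 4 * \<eta>\<^sup>2 * (w \<omega>)\<^sup>2)" for \<omega>
      unfolding norm_mult norm_of_real using YL[of \<omega>] L R2_le[of \<omega>] by (intro mult_mono) auto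
    then show "AE \<omega> in M. norm (Y \<omega> * of_real (R2 \<omega>)) \<le> norm (L * (\<sigma> ^ 4 * \<eta>\<^sup>2 * (w \<omega>)\<^sup>2))"
      using L by simp
  qed measurable
  have Yw: "(\<lambda>\<omega>. Y \<omega> * of_real (w \<omega>)) \<in> borel_measurable (F n)" "\<And>\<omega>. cmod (Y \<omega> * of_real (w \<omega>)) \<le> L * 1"
    using Y w by (simp, unfold norm_mult, intro mult_mono) (use YL w1 L in auto)
  have Yw2: "(\<lambda>\<omega>. Y \<omega> * of_real ((w \<omega>)\<^sup>2)) \<in> borel_measurable (F n)" "\<And>\<omega>. cmod (Y \<omega> * of_real ((w \<omega>)\<^sup>2)) \<le> L * 1"
    using Y w by (simp, unfold norm_mult, intro mult_mono) (use YL w21 L in \<open>auto simp: norm_power abs_square_le_1 intro: power_le_one\<close>)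
  have i1: "integrable M (\<lambda>\<omega>. \<i> * (Y \<omega> * of_real (w \<omega>) * of_real (?v \<omega>)))"
    using Yw(2) by (intro integrable_mult_right bounded_mult_integrable[where b = "L * 1"]) (auto intro: V_integrable)
  have i2: "integrable M (\<lambda>\<omega>. Y \<omega> * of_real ((w \<omega>)\<^sup>2) * of_real ((?v \<omega>)\<^sup>2))"
    using Yw2(2) V2_integrable[of n] by (intro bounded_mult_integrable[where b = "L * 1"]) (auto simp del: of_real_power)
  have i3: "integrable M (\<lambda>\<omega>. Y \<omega> * of_real ((w \<omega>)\<^sup>2))"
    using Yw2(2) by (intro bounded_integrable[where b = "L * 1"]) auto
  have e1: "(\<integral>\<omega>. \<i> * (Y \<omega> * of_real (w \<omega>) * of_real (?v \<omega>)) \<partial>M) = 0"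
    using complex_integral_mult_V[OF Yw(1), of "L * 1"] Yw(2) by simp
  have e2: "(\<integral>\<omega>. Y \<omega> * of_real ((w \<omega>)\<^sup>2) * of_real ((?v \<omega>)\<^sup>2) \<partial>M) = of_real (\<sigma>\<^sup>2) * (\<integral>\<omega>. Y \<omega> * of_real ((w \<omega>)\<^sup>2) \<partial>M)"
    by (rule complex_integral_mult_V2[OF Yw2(1), of "L * 1"]) (use Yw2(2) in blast)
  \<comment> \<open>\<open>U\<close> collects the quadratic terms; its integral is zero by the
    conditional variance.\<close>
  define U where "U \<omega> = (Y \<omega> * of_real ((w \<omega>)\<^sup>2) * of_real ((?v \<omega>)\<^sup>2) - of_real (\<sigma>\<^sup>2) * (Y \<omega> * of_real ((w \<omega>)\<^sup>2))) / 2" for \<omega>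
  have U: "integrable M U" "(\<integral>\<omega>. U \<omega> \<partial>M) = 0"
    unfolding U_def using i2 i3 e2 by (auto simp del: of_real_power)
  have eq: "Y \<omega> * (iexp (w \<omega> * ?v \<omega>) - of_real (exp (- (\<sigma>\<^sup>2 * (w \<omega>)\<^sup>2 / 2))))
     = Y \<omega> * R1 \<omega> + Y \<omega> * of_real (R2 \<omega>) + \<i> * (Y \<omega> * of_real (w \<omega>) * of_real (?v \<omega>)) - U \<omega>" for \<omega>
    unfolding R1_def R2_def U_def by (simp add: field_simps power_mult_distrib)
  have "(\<integral>\<omega>. Y \<omega> * (iexp (w \<omega> * ?v \<omega>) - of_real (exp (- (\<sigma>\<^sup>2 * (w \<omega>)\<^sup>2 / 2)))) \<partial>M)
      = (\<integral>\<omega>. Y \<omega> * R1 \<omega> \<partial>M) + (\<integral>\<omega>. Y \<omega> * of_real (R2 \<omega>) \<partial>M)"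
    unfolding eq using R1_int R2_int i1 U e1 by simp
  also have "cmod \<dots> \<le> (\<integral>\<omega>. cmod (Y \<omega> * R1 \<omega>) \<partial>M) + (\<integral>\<omega>. cmod (Y \<omega> * of_real (R2 \<omega>)) \<partial>M)"
    by (intro order_trans[OF norm_triangle_ineq] add_mono integral_norm_bound)
  also have "\<dots> \<le> (1 + B) * (L * \<eta> powr (exponent - 2) * (\<integral>\<omega>. (w \<omega>)\<^sup>2 \<partial>M)) + L * (\<sigma> ^ 4 * \<eta>\<^sup>2) * (\<integral>\<omega>. (w \<omega>)\<^sup>2 \<partial>M)"
  proof (rule add_mono)
    have "(\<integral>\<omega>. cmod (Y \<omega> * of_real (R2 \<omega>)) \<partial>M) \<le> (\<integral>\<omega>. L * (\<sigma> ^ 4 * \<eta>\<^sup>2) * (w \<omega>)\<^sup>2 \<partial>M)"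
    proof (rule integral_mono)
      show "cmod (Y \<omega> * of_real (R2 \<omega>)) \<le> L * (\<sigma> ^ 4 * \<eta>\<^sup>2) * (w \<omega>)\<^sup>2" for \<omega>
        unfolding norm_mult norm_of_real mult.assoc[of L] using YL[of \<omega>] L R2_le[of \<omega>] by (intro mult_mono) auto
    qed (use R2_int w2_int in auto)
    then show "(\<integral>\<omega>. cmod (Y \<omega> * of_real (R2 \<omega>)) \<partial>M) \<le> L * (\<sigma> ^ 4 * \<eta>\<^sup>2) * (\<integral>\<omega>. (w \<omega>)\<^sup>2 \<partial>M)" by simp
    define G where "G \<omega> = L * \<eta> powr (exponent - 2) * (w \<omega>)\<^sup>2" for \<omega>
    have G0: "0 \<le> G \<omega>" for \<omega> using L by (simp add: G_def)
    have G_F: "(\<lambda>\<omega>. ennreal (G \<omega>)) \<in> borel_measurable (F n)" unfolding G_def using w by measurable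
    then have [measurable]: "(\<lambda>\<omega>. ennreal (G \<omega>)) \<in> borel_measurable M" by (rule measurable_F_M)
    have G_int: "integrable M G" unfolding G_def using w2_int by simp
    \<comment> \<open>The power of |w| is split into w^2 and a remaining power of order
      \<open>exponent - 2\<close>, which supplies the small factor. The corresponding power of |V|
      is at most 1 + |V|^a, and this is what the tame event controls.\<close>
    have pw: "cmod (Y \<omega> * R1 \<omega>) \<le> G \<omega> + G \<omega> * (indicator (tame B n) \<omega> * \<bar>?v \<omega>\<bar> powr a)" for \<omega>
    proof (cases "w \<omega> = 0")
      case True
      then show ?thesis by (simp add: R1_def G_def)
    next
      case False
      then have t: "\<omega> \<in> tame B n" using w0 by blast
      have "cmod (R1 \<omega>) \<le> \<bar>w \<omega> * ?v \<omega>\<bar> powr exponent"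
        using exponent by (intro R1_le) auto
      also have "\<dots> = \<bar>w \<omega>\<bar> powr exponent * \<bar>?v \<omega>\<bar> powr exponent"
        by (simp add: abs_mult powr_mult)
      also have "\<dots> \<le> (\<eta> powr (exponent - 2) * (w \<omega>)\<^sup>2) * (1 + \<bar>?v \<omega>\<bar> powr a)"
      proof (rule mult_mono)
        have "\<bar>w \<omega>\<bar> powr exponent = \<bar>w \<omega>\<bar> powr (exponent - 2) * \<bar>w \<omega>\<bar> powr 2"
          by (simp only: powr_add[symmetric]) simp
        also have "\<dots> = \<bar>w \<omega>\<bar> powr (exponent - 2) * (w \<omega>)\<^sup>2" using False by simp
        also have "\<dots> \<le> \<eta> powr (exponent - 2) * (w \<omega>)\<^sup>2"
          using exponent w\<eta>[of \<omega>] by (intro mult_right_mono powr_mono2) auto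
        finally show "\<bar>w \<omega>\<bar> powr exponent \<le> \<eta> powr (exponent - 2) * (w \<omega>)\<^sup>2" .
        show "\<bar>?v \<omega>\<bar> powr exponent \<le> 1 + \<bar>?v \<omega>\<bar> powr a"
        proof (cases "\<bar>?v \<omega>\<bar> \<le> 1")
          case True
          then have "\<bar>?v \<omega>\<bar> powr exponent \<le> 1 powr exponent" using exponent by (intro powr_mono2) auto
          then show ?thesis by (simp add: add_increasing2)
        next
          case False
          then have "\<bar>?v \<omega>\<bar> powr exponent \<le> \<bar>?v \<omega>\<bar> powr a" using exponent by (intro powr_mono) auto
          then show ?thesis by simp
        qed
      qed auto
      finally have "cmod (R1 \<omega>) \<le> (\<eta> powr (exponent - 2) * (w \<omega>)\<^sup>2) * (1 + \<bar>?v \<omega>\<bar> powr a)" .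
      then have "cmod (Y \<omega> * R1 \<omega>) \<le> L * ((\<eta> powr (exponent - 2) * (w \<omega>)\<^sup>2) * (1 + \<bar>?v \<omega>\<bar> powr a))"
        unfolding norm_mult using YL[of \<omega>] L by (intro mult_mono) auto
      also have "\<dots> = G \<omega> + G \<omega> * (indicator (tame B n) \<omega> * \<bar>?v \<omega>\<bar> powr a)"
        using t by (simp add: G_def algebra_simps)
      finally show ?thesis .
    qed
    have "ennreal (\<integral>\<omega>. cmod (Y \<omega> * R1 \<omega>) \<partial>M) = (\<integral>\<^sup>+\<omega>. ennreal (cmod (Y \<omega> * R1 \<omega>)) \<partial>M)"
      using R1_int by (intro nn_integral_eq_integral[symmetric]) auto
    also have "\<dots> \<le> (\<integral>\<^sup>+\<omega>. ennreal (G \<omega>) + ennreal (G \<omega>) * indicator (tame B n) \<omega> * ennreal (\<bar>?v \<omega>\<bar> powr a) \<partial>M)"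
    proof (rule nn_integral_mono)
      fix \<omega>
      have "ennreal (cmod (Y \<omega> * R1 \<omega>)) \<le> ennreal (G \<omega> + G \<omega> * (indicator (tame B n) \<omega> * \<bar>?v \<omega>\<bar> powr a))"
        by (rule ennreal_leI[OF pw])
      also have "\<dots> = ennreal (G \<omega>) + ennreal (G \<omega>) * indicator (tame B n) \<omega> * ennreal (\<bar>?v \<omega>\<bar> powr a)"
        using G0[of \<omega>] by (auto simp: indicator_def ennreal_mult)
      finally show "ennreal (cmod (Y \<omega> * R1 \<omega>)) \<le> ennreal (G \<omega>) + ennreal (G \<omega>) * indicator (tame B n) \<omega> * ennreal (\<bar>?v \<omega>\<bar> powr a)" .
    qed
    also have "\<dots> = (\<integral>\<^sup>+\<omega>. ennreal (G \<omega>) \<partial>M) + (\<integral>\<^sup>+\<omega>. ennreal (G \<omega>) * indicator (tame B n) \<omega> * ennreal (\<bar>?v \<omega>\<bar> powr a) \<partial>M)"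
      by (rule nn_integral_add) measurable
    also have "\<dots> \<le> (\<integral>\<^sup>+\<omega>. ennreal (G \<omega>) \<partial>M) + ennreal B * (\<integral>\<^sup>+\<omega>. ennreal (G \<omega>) \<partial>M)"
      by (intro add_left_mono nn_integral_tame_moment G_F)
    also have "(\<integral>\<^sup>+\<omega>. ennreal (G \<omega>) \<partial>M) = ennreal (\<integral>\<omega>. G \<omega> \<partial>M)"
      using G_int G0 by (intro nn_integral_eq_integral) auto
    also have "ennreal (\<integral>\<omega>. G \<omega> \<partial>M) + ennreal B * ennreal (\<integral>\<omega>. G \<omega> \<partial>M) = ennreal ((1 + B) * (\<integral>\<omega>. G \<omega> \<partial>M))"
      using B G0 by (simp add: ennreal_mult[symmetric] ennreal_plus[symmetric] distrib_right del: ennreal_plus)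
    finally have "(\<integral>\<omega>. cmod (Y \<omega> * R1 \<omega>) \<partial>M) \<le> (1 + B) * (\<integral>\<omega>. G \<omega> \<partial>M)"
      using B G0 by (subst (asm) ennreal_le_iff) auto
    then show "(\<integral>\<omega>. cmod (Y \<omega> * R1 \<omega>) \<partial>M) \<le> (1 + B) * (L * \<eta> powr (exponent - 2) * (\<integral>\<omega>. (w \<omega>)\<^sup>2 \<partial>M))"
      by (simp add: G_def)
  qed
  also have "\<dots> = L * ((1 + B) * \<eta> powr (exponent - 2) + \<sigma> ^ 4 * \<eta>\<^sup>2) * (\<integral>\<omega>. (w \<omega>)\<^sup>2 \<partial>M)"
    by (simp add: algebra_simps)
  finally show ?thesis .
qed

text \<open>\<open>Z m\<close> divides iexp of the partial sum by the characteristic function that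
  conditionally Gaussian increments would have. Its expectation starts at 1, and a step changes it
  by at most a small multiple of the expected squared weight. Summing these changes uses the uniform
  bound \<open>Q\<close>.\<close>

lemma clt_truncated:
  fixes W :: "nat \<Rightarrow> 'a \<Rightarrow> real"
  assumes W: "\<And>k. W k \<in> borel_measurable (F k)" and W\<eta>: "\<And>k \<omega>. \<bar>W k \<omega>\<bar> \<le> \<eta>" and \<eta>: "0 < \<eta>" "\<eta> \<le> 1"
    and W0: "\<And>k \<omega>. \<omega> \<notin> tame B k \<Longrightarrow> W k \<omega> = 0" and B: "1 \<le> B"
    and WQ: "\<And>n \<omega>. (\<Sum>k<n. (W k \<omega>)\<^sup>2) \<le> Q"
  shows "cmod ((\<integral>\<omega>. iexp (\<Sum>k<n. W k \<omega> * V (Suc k) \<omega>) * of_real (exp (\<sigma>\<^sup>2 * (\<Sum>k<n. (W k \<omega>)\<^sup>2) / 2)) \<partial>M) - 1)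
    \<le> exp (\<sigma>\<^sup>2 * Q / 2) * ((1 + B) * \<eta> powr (exponent - 2) + \<sigma> ^ 4 * \<eta>\<^sup>2) * Q"
proof -
  have [measurable]: "W k \<in> borel_measurable M" for k by (rule measurable_F_M[OF W])
  define c where "c = exp (\<sigma>\<^sup>2 * Q / 2) * ((1 + B) * \<eta> powr (exponent - 2) + \<sigma> ^ 4 * \<eta>\<^sup>2)"
  have c: "0 \<le> c" using B by (simp add: c_def)
  define S where "S m \<omega> = (\<Sum>k<m. W k \<omega> * V (Suc k) \<omega>)" for m \<omega>
  define q where "q m \<omega> = (\<Sum>k<m. (W k \<omega>)\<^sup>2)" for m \<omega>
  define Z where "Z m \<omega> = iexp (S m \<omega>) * of_real (exp (\<sigma>\<^sup>2 * q m \<omega> / 2))" for m \<omega>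
  have [measurable]: "S m \<in> borel_measurable M" "q m \<in> borel_measurable M" for m
    unfolding S_def q_def by measurable
  have [measurable]: "Z m \<in> borel_measurable M" for m unfolding Z_def by measurable
  have qL: "exp (\<sigma>\<^sup>2 * q m \<omega> / 2) \<le> exp (\<sigma>\<^sup>2 * Q / 2)" for m \<omega>
    using WQ by (auto simp: q_def intro: mult_left_mono)
  have Z_int: "integrable M (Z m)" for m
    by (rule bounded_integrable[where b = "exp (\<sigma>\<^sup>2 * Q / 2)"]) (use qL in \<open>auto simp: Z_def norm_mult\<close>)
  have w2_int: "integrable M (\<lambda>\<omega>. (W k \<omega>)\<^sup>2)" for k
  proof (rule bounded_integrable)
    show "norm ((W k \<omega>)\<^sup>2) \<le> \<eta>\<^sup>2" for \<omega>
      using power_mono[OF W\<eta>[of k \<omega>] abs_ge_zero, where n = 2] by simp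
  qed measurable
  have step: "cmod ((\<integral>\<omega>. Z (Suc m) \<omega> \<partial>M) - (\<integral>\<omega>. Z m \<omega> \<partial>M)) \<le> c * (\<integral>\<omega>. (W m \<omega>)\<^sup>2 \<partial>M)" for m
  proof -
    \<comment> \<open>The compensator is taken up to \<open>Suc m\<close>: it involves the weights
      up to m only, so it is known at time m and the whole factor \<open>Y\<close> can be
      conditioned out.\<close>
    define Y where "Y \<omega> = iexp (S m \<omega>) * of_real (exp (\<sigma>\<^sup>2 * q (Suc m) \<omega> / 2))" for \<omega>
    have S_F: "S m \<in> borel_measurable (F m)"
      unfolding S_def
      by (intro borel_measurable_sum borel_measurable_times measurable_F_mono[OF W] measurable_F_mono[OF V_F]) auto
    have q_F: "q (Suc m) \<in> borel_measurable (F m)"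
      unfolding q_def
      by (intro borel_measurable_sum borel_measurable_power measurable_F_mono[OF W]) auto
    have Y_F: "Y \<in> borel_measurable (F m)"
      unfolding Y_def using S_F q_F by measurable
    have "Z (Suc m) \<omega> - Z m \<omega> = Y \<omega> * (iexp (W m \<omega> * V (Suc m) \<omega>) - of_real (exp (- (\<sigma>\<^sup>2 * (W m \<omega>)\<^sup>2 / 2))))" for \<omega>
    proof -
      have "Z m \<omega> = iexp (S m \<omega>) * of_real (exp (\<sigma>\<^sup>2 * q (Suc m) \<omega> / 2) * exp (- (\<sigma>\<^sup>2 * (W m \<omega>)\<^sup>2 / 2)))"
        by (simp add: Z_def q_def exp_add[symmetric] field_simps)
      moreover have "Z (Suc m) \<omega> = iexp (S m \<omega>) * iexp (W m \<omega> * V (Suc m) \<omega>) * of_real (exp (\<sigma>\<^sup>2 * q (Suc m) \<omega> / 2))"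
        by (simp add: Z_def S_def exp_add distrib_left)
      ultimately show ?thesis by (simp add: Y_def algebra_simps)
    qed
    then have "(\<integral>\<omega>. Z (Suc m) \<omega> \<partial>M) - (\<integral>\<omega>. Z m \<omega> \<partial>M)
        = (\<integral>\<omega>. Y \<omega> * (iexp (W m \<omega> * V (Suc m) \<omega>) - of_real (exp (- (\<sigma>\<^sup>2 * (W m \<omega>)\<^sup>2 / 2)))) \<partial>M)"
      by (subst Bochner_Integration.integral_diff[symmetric, OF Z_int Z_int]) simp
    also have "cmod \<dots> \<le> c * (\<integral>\<omega>. (W m \<omega>)\<^sup>2 \<partial>M)"
      unfolding c_def
      by (rule clt_step[OF Y_F W _ W\<eta> \<eta> W0 B]) (use qL[of "Suc m"] in \<open>auto simp: Y_def norm_mult\<close>)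
    finally show ?thesis .
  qed
  have "cmod ((\<integral>\<omega>. Z n \<omega> \<partial>M) - 1) \<le> c * (\<Sum>m<n. \<integral>\<omega>. (W m \<omega>)\<^sup>2 \<partial>M)"
  proof (induction n)
    case 0
    then show ?case by (simp add: Z_def S_def q_def prob_space)
  next
    case (Suc m)
    have "cmod ((\<integral>\<omega>. Z (Suc m) \<omega> \<partial>M) - 1) \<le> cmod ((\<integral>\<omega>. Z (Suc m) \<omega> \<partial>M) - (\<integral>\<omega>. Z m \<omega> \<partial>M)) + cmod ((\<integral>\<omega>. Z m \<omega> \<partial>M) - 1)"
      using norm_triangle_ineq[of "(\<integral>\<omega>. Z (Suc m) \<omega> \<partial>M) - (\<integral>\<omega>. Z m \<omega> \<partial>M)" "(\<integral>\<omega>. Z m \<omega> \<partial>M) - 1"] by simp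
    with step[of m] Suc show ?case by (simp add: distrib_left)
  qed
  also have "(\<Sum>m<n. \<integral>\<omega>. (W m \<omega>)\<^sup>2 \<partial>M) = (\<integral>\<omega>. (\<Sum>m<n. (W m \<omega>)\<^sup>2) \<partial>M)"
    using w2_int by simp
  also have "c * \<dots> \<le> c * Q"
  proof (rule mult_left_mono[OF _ c])
    have "(\<integral>\<omega>. (\<Sum>m<n. (W m \<omega>)\<^sup>2) \<partial>M) \<le> (\<integral>\<omega>. Q \<partial>M)"
      by (rule integral_mono) (use w2_int WQ in auto)
    then show "(\<integral>\<omega>. (\<Sum>m<n. (W m \<omega>)\<^sup>2) \<partial>M) \<le> Q" by (simp add: prob_space)
  qed
  finally show ?thesis by (simp add: Z_def S_def q_def c_def)
qed

text \<open>Truncated weights satisfy the boundedness assumptions of \<open>clt_truncated\<close>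
  and differ from the given ones only on a small event. Off that event the compensator is close to
  the constant \<open>T\<close>, which can be divided out.\<close>

theorem martingale_CLT:
  fixes W :: "nat \<Rightarrow> nat \<Rightarrow> 'a \<Rightarrow> real"
  assumes W: "\<And>n k. W n k \<in> borel_measurable (F k)"
    and sq: "tends_in_prob M (\<lambda>n \<omega>. \<Sum>k<n. (W n k \<omega>)\<^sup>2) q" and q: "0 \<le> q"
    and negl: "\<And>e. 0 < e \<Longrightarrow> \<forall>\<^sub>F n in sequentially. \<exists>A\<in>sets M. measure M A < e \<and> (\<forall>\<omega>\<in>space M - A. \<forall>k<n. \<bar>W n k \<omega>\<bar> \<le> e)"
  shows "(\<lambda>n. \<integral>\<omega>. iexp (\<Sum>k<n. W n k \<omega> * V (Suc k) \<omega>) \<partial>M) \<longlonglongrightarrow> of_real (exp (- (\<sigma>\<^sup>2 * q / 2)))"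
proof (rule tendstoI)
  fix e :: real assume e: "0 < e"
  define L where "L = exp (\<sigma>\<^sup>2 * (q + 1) / 2)"
  define T where "T = exp (\<sigma>\<^sup>2 * q / 2)"
  have T: "1 \<le> T" "T \<le> L" using q by (auto simp: T_def L_def intro: mult_left_mono)
  \<comment> \<open>Three exceptional events of measure at most \<open>e1\<close> will arise, and on
    them the compared quantities differ by at most 2 L. This value keeps their contribution below e
    / 2.\<close>
  define e1 where "e1 = e / (16 * L)"
  have e1: "0 < e1" "2 * L * (3 * e1) < e / 2" using e T by (auto simp: e1_def)
  from mostly_tame[OF e1(1)] obtain B A0 where B: "1 \<le> B" and A0: "A0 \<in> sets M" "measure M A0 < e1"
      "\<And>\<omega> n. \<omega> \<in> space M - A0 \<Longrightarrow> \<omega> \<in> tame B n"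
    by blast
  have "((\<lambda>\<eta>. L * ((1 + B) * \<eta> powr (exponent - 2) + \<sigma> ^ 4 * \<eta>\<^sup>2) * (q + 1)) \<longlongrightarrow> L * ((1 + B) * 0 + \<sigma> ^ 4 * 0\<^sup>2) * (q + 1)) (at_right 0)"
  proof (intro tendsto_intros)
    have "((\<lambda>\<eta>. \<eta> powr (exponent - 2)) \<longlongrightarrow> 0 powr (exponent - 2)) (at_right 0)"
      using exponent by (intro tendsto_powr2) (auto simp: eventually_at_filter intro!: tendsto_intros always_eventually)
    then show "((\<lambda>\<eta>. \<eta> powr (exponent - 2)) \<longlongrightarrow> 0) (at_right 0)" by simp
  qed
  then have "\<forall>\<^sub>F \<eta> in at_right 0. L * ((1 + B) * \<eta> powr (exponent - 2) + \<sigma> ^ 4 * \<eta>\<^sup>2) * (q + 1) < e / 4"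
    using e by (intro order_tendstoD(2)) auto
  moreover have "\<forall>\<^sub>F \<eta> in at_right 0. (0::real) < \<eta> \<and> \<eta> < min 1 e1"
    using e1 by (auto simp: eventually_at_right_field intro!: exI[of _ "min 1 e1"])
  ultimately have "\<forall>\<^sub>F \<eta> in at_right 0. L * ((1 + B) * \<eta> powr (exponent - 2) + \<sigma> ^ 4 * \<eta>\<^sup>2) * (q + 1) < e / 4 \<and> (0::real) < \<eta> \<and> \<eta> < min 1 e1"
    by (rule eventually_conj)
  then obtain \<eta> where \<eta>: "L * ((1 + B) * \<eta> powr (exponent - 2) + \<sigma> ^ 4 * \<eta>\<^sup>2) * (q + 1) < e / 4" "0 < \<eta>" "\<eta> < min 1 e1"
    using eventually_happens[of _ "at_right (0::real)"] by auto
  have cont: "isCont (\<lambda>z. exp (\<sigma>\<^sup>2 * z / 2)) q" by (intro continuous_intros) auto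
  obtain d where d: "0 < d" "\<And>z. \<bar>z - q\<bar> < d \<Longrightarrow> \<bar>exp (\<sigma>\<^sup>2 * z / 2) - T\<bar> < e / 8"
    using cont[unfolded continuous_at_eps_delta, rule_format, of "e / 8"] e by (auto simp: dist_real_def T_def)
  have d': "0 < min d 1" using d by simp
  from tends_in_probD[OF sq e1(1) d'] negl[OF \<eta>(2)]
  show "\<forall>\<^sub>F n in sequentially. dist (\<integral>\<omega>. iexp (\<Sum>k<n. W n k \<omega> * V (Suc k) \<omega>) \<partial>M) (of_real (exp (- (\<sigma>\<^sup>2 * q / 2)))) < e"
  proof eventually_elim
    case (elim n)
    then obtain A1 A2 where A1: "A1 \<in> sets M" "measure M A1 < e1"
        "\<And>\<omega>. \<omega> \<in> space M - A1 \<Longrightarrow> \<bar>(\<Sum>k<n. (W n k \<omega>)\<^sup>2) - q\<bar> < min d 1"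
      and A2: "A2 \<in> sets M" "measure M A2 < \<eta>" "\<And>\<omega> k. \<omega> \<in> space M - A2 \<Longrightarrow> k < n \<Longrightarrow> \<bar>W n k \<omega>\<bar> \<le> \<eta>"
      by (auto simp: dist_real_def)
    define A where "A = A0 \<union> A1 \<union> A2"
    have [measurable]: "A \<in> sets M" using A0 A1 A2 by (auto simp: A_def)
    have mA: "measure M A \<le> 3 * e1"
      using measure_Un_le[of "A0 \<union> A1" M A2] measure_Un_le[of A0 M A1] A0 A1 A2 \<eta> by (auto simp: A_def)
    \<comment> \<open>Three cuts: to the tame event, to weights of size at most \<eta>, and to the
      times at which the squares still sum to at most q + 1. Each of them is decided at time k, so
      predictability is kept.\<close>
    define W' where "W' k \<omega> = (if \<omega> \<in> tame B k \<and> \<bar>W n k \<omega>\<bar> \<le> \<eta> then (if (\<Sum>j\<le>k. (W n j \<omega>)\<^sup>2) \<le> q + 1 then W n k \<omega> else 0) else 0)" for k \<omega>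
    have W'_F: "W' k \<in> borel_measurable (F k)" for k
    proof -
      have [measurable]: "(\<lambda>\<omega>. if (\<Sum>j\<le>k. (W n j \<omega>)\<^sup>2) \<le> q + 1 then W n k \<omega> else 0) \<in> borel_measurable (F k)"
        by (rule stopped_measurable[OF W])
      have [measurable]: "W n k \<in> borel_measurable (F k)" by (rule W)
      show ?thesis unfolding W'_def by measurable
    qed
    have [measurable]: "W' k \<in> borel_measurable M" "W n k \<in> borel_measurable M" for k
      by (auto intro: measurable_F_M[OF W'_F] measurable_F_M[OF W])
    have W'_\<eta>: "\<bar>W' k \<omega>\<bar> \<le> \<eta>" for k \<omega> using \<eta> by (simp add: W'_def)
    have W'_0: "\<omega> \<notin> tame B k \<Longrightarrow> W' k \<omega> = 0" for k \<omega> by (simp add: W'_def)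
    have W'_Q: "(\<Sum>k<m. (W' k \<omega>)\<^sup>2) \<le> q + 1" for m \<omega>
    proof -
      have "(\<Sum>k<m. (W' k \<omega>)\<^sup>2) \<le> (\<Sum>k<m. if (\<Sum>j\<le>k. (W n j \<omega>)\<^sup>2) \<le> q + 1 then (W n k \<omega>)\<^sup>2 else 0)"
        by (intro sum_mono) (auto simp: W'_def)
      also have "\<dots> \<le> q + 1" using q by (intro stopped_sum_le) auto
      finally show ?thesis .
    qed
    have same: "W' k \<omega> = W n k \<omega>" if "\<omega> \<in> space M - A" "k < n" for k \<omega>
    proof -
      have "(\<Sum>j\<le>k. (W n j \<omega>)\<^sup>2) \<le> (\<Sum>j<n. (W n j \<omega>)\<^sup>2)"
        using that by (intro sum_mono2) auto
      also have "\<dots> \<le> q + 1" using A1(3)[of \<omega>] that by (auto simp: A_def)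
      finally show ?thesis using A0(3)[of \<omega> k] A2(3)[of \<omega> k] that by (auto simp: W'_def A_def)
    qed
    define S where "S \<omega> = iexp (\<Sum>k<n. W n k \<omega> * V (Suc k) \<omega>)" for \<omega>
    define S' where "S' \<omega> = iexp (\<Sum>k<n. W' k \<omega> * V (Suc k) \<omega>) * of_real (exp (\<sigma>\<^sup>2 * (\<Sum>k<n. (W' k \<omega>)\<^sup>2) / 2))" for \<omega>
    have [measurable]: "S \<in> borel_measurable M" "S' \<in> borel_measurable M"
      unfolding S_def S'_def by measurable
    have S'L: "cmod (S' \<omega>) \<le> L" for \<omega>
      using W'_Q[of \<omega> n] by (auto simp: S'_def L_def norm_mult intro: mult_left_mono)
    have S_int: "integrable M S" by (rule bounded_integrable[where b = 1]) (auto simp: S_def)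
    have S'_int: "integrable M S'" by (rule bounded_integrable[OF _ S'L]) measurable
    have 1: "cmod ((\<integral>\<omega>. S' \<omega> \<partial>M) - 1) < e / 4"
      using clt_truncated[OF W'_F W'_\<eta> \<eta>(2) _ W'_0 B W'_Q, where n = n] \<eta> unfolding S'_def L_def by auto
    have "cmod (of_real T * (\<integral>\<omega>. S \<omega> \<partial>M) - (\<integral>\<omega>. S' \<omega> \<partial>M)) = cmod (\<integral>\<omega>. of_real T * S \<omega> - S' \<omega> \<partial>M)"
      using S_int S'_int by simp
    also have "\<dots> \<le> (\<integral>\<omega>. cmod (of_real T * S \<omega> - S' \<omega>) \<partial>M)" by (rule integral_norm_bound)
    also have "\<dots> \<le> (\<integral>\<omega>. e / 8 + 2 * L * indicator A \<omega> \<partial>M)"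
    proof (rule integral_mono)
      show "integrable M (\<lambda>\<omega>. cmod (of_real T * S \<omega> - S' \<omega>))" using S_int S'_int by simp
      show "integrable M (\<lambda>\<omega>. e / 8 + 2 * L * indicator A \<omega> :: real)"
        by (auto simp: emeasure_eq_measure)
      fix \<omega> assume \<omega>: "\<omega> \<in> space M"
      show "cmod (of_real T * S \<omega> - S' \<omega>) \<le> e / 8 + 2 * L * indicator A \<omega>"
      proof (cases "\<omega> \<in> A")
        case True
        have "cmod (of_real T * S \<omega> - S' \<omega>) \<le> cmod (of_real T * S \<omega>) + cmod (S' \<omega>)" by (rule norm_triangle_ineq4)
        also have "\<dots> \<le> L + L" using S'L[of \<omega>] T by (intro add_mono) (auto simp: S_def norm_mult)
        finally show ?thesis using True e by simp
      next
        case False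
        then have \<omega>A: "\<omega> \<in> space M - A" using \<omega> by blast
        let ?q = "\<Sum>k<n. (W n k \<omega>)\<^sup>2"
        have "S' \<omega> = S \<omega> * of_real (exp (\<sigma>\<^sup>2 * ?q / 2))"
          using same[OF \<omega>A] by (simp add: S'_def S_def)
        then have "of_real T * S \<omega> - S' \<omega> = S \<omega> * of_real (T - exp (\<sigma>\<^sup>2 * ?q / 2))"
          by (simp add: algebra_simps)
        then have "cmod (of_real T * S \<omega> - S' \<omega>) = \<bar>T - exp (\<sigma>\<^sup>2 * ?q / 2)\<bar>"
          by (simp add: norm_mult S_def del: of_real_diff)
        also have "\<dots> < e / 8" using d(2)[of ?q] A1(3)[of \<omega>] \<omega>A by (auto simp: A_def abs_minus_commute)
        finally show ?thesis using False by simp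
      qed
    qed
    also have "\<dots> = e / 8 + 2 * L * measure M A"
      by (subst Bochner_Integration.integral_add) (auto simp: prob_space emeasure_eq_measure)
    also have "\<dots> \<le> e / 8 + 2 * L * (3 * e1)" using mA T by (intro add_left_mono mult_left_mono) auto
    finally have 2: "cmod (of_real T * (\<integral>\<omega>. S \<omega> \<partial>M) - (\<integral>\<omega>. S' \<omega> \<partial>M)) < e * 5 / 8" using e1 by simp
    have "cmod (of_real T * (\<integral>\<omega>. S \<omega> \<partial>M) - 1) < e"
      using norm_triangle_ineq[of "of_real T * (\<integral>\<omega>. S \<omega> \<partial>M) - (\<integral>\<omega>. S' \<omega> \<partial>M)" "(\<integral>\<omega>. S' \<omega> \<partial>M) - 1"] 1 2 e by simp
    \<comment> \<open>\<open>T\<close> is at least 1, so dividing by it does not enlarge the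
      error.\<close>
    moreover have "(\<integral>\<omega>. S \<omega> \<partial>M) - of_real (exp (- (\<sigma>\<^sup>2 * q / 2))) = of_real (1 / T) * (of_real T * (\<integral>\<omega>. S \<omega> \<partial>M) - 1)"
      using T by (simp add: T_def exp_minus field_simps)
    then have "cmod ((\<integral>\<omega>. S \<omega> \<partial>M) - of_real (exp (- (\<sigma>\<^sup>2 * q / 2)))) = 1 / T * cmod (of_real T * (\<integral>\<omega>. S \<omega> \<partial>M) - 1)"
      using T by (simp only: norm_mult norm_of_real) simp
    moreover have "1 / T * cmod (of_real T * (\<integral>\<omega>. S \<omega> \<partial>M) - 1) \<le> 1 * cmod (of_real T * (\<integral>\<omega>. S \<omega> \<partial>M) - 1)"
      using T by (intro mult_right_mono) auto
    ultimately have "cmod ((\<integral>\<omega>. S \<omega> \<partial>M) - of_real (exp (- (\<sigma>\<^sup>2 * q / 2)))) < e"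
      by linarith
    then show ?case unfolding dist_norm S_def .
  qed
qed

text \<open>
  A Robbins--Siegmund argument: the Lyapunov function \<open>v\<close>, divided by \<open>(1 + D)\<^sup>2\<close>, is a
  supermartingale up to a perturbation whose total mass telescopes. Dividing by \<open>1 + v 1\<close> makes
  it integrable whatever the initial values are.
\<close>

lemma lyapunov_sum_bound:
  fixes v \<pi> f D :: "nat \<Rightarrow> 'a \<Rightarrow> real"
  assumes meas: "\<And>n. v (Suc n) \<in> borel_measurable (F (Suc n))" "\<And>n. \<pi> n \<in> borel_measurable (F n)"
      "\<And>n. f n \<in> borel_measurable (F n)" "\<And>n. D n \<in> borel_measurable (F n)"
    and v0: "\<And>n \<omega>. \<omega> \<in> space M \<Longrightarrow> 0 \<le> v (Suc n) \<omega>"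
    and f01: "\<And>n \<omega>. \<omega> \<in> space M \<Longrightarrow> 0 \<le> f n \<omega>" "\<And>n \<omega>. \<omega> \<in> space M \<Longrightarrow> f n \<omega> \<le> 1"
    and D: "\<And>n \<omega>. \<omega> \<in> space M \<Longrightarrow> 0 \<le> D n \<omega>" "\<And>n \<omega>. \<omega> \<in> space M \<Longrightarrow> f (Suc n) \<omega> \<le> D (Suc n) \<omega> - D n \<omega>"
    and rec: "\<And>n \<omega>. \<omega> \<in> space M \<Longrightarrow> v (Suc (Suc n)) \<omega> = v (Suc n) \<omega> - (1 - f (Suc n) \<omega>) * (\<pi> (Suc n) \<omega>)\<^sup>2
        - 2 * (1 - f (Suc n) \<omega>) * \<pi> (Suc n) \<omega> * V (Suc (Suc n)) \<omega> + f (Suc n) \<omega> * (V (Suc (Suc n)) \<omega>)\<^sup>2"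
    and dom: "\<And>n \<omega>. \<omega> \<in> space M \<Longrightarrow> (1 - f (Suc n) \<omega>) * (\<pi> (Suc n) \<omega>)\<^sup>2 \<le> v (Suc n) \<omega>"
  shows "AE \<omega> in M. \<exists>A\<ge>1. \<forall>n\<ge>1. (\<Sum>k=1..n. (1 - f k \<omega>) * (\<pi> k \<omega>)\<^sup>2) \<le> A * (1 + D n \<omega>)\<^sup>2"
proof -
  note [measurable] = measurable_F_M[OF meas(1)] measurable_F_M[OF meas(2)] measurable_F_M[OF meas(3)] measurable_F_M[OF meas(4)]
  have D_mono: "D m \<omega> \<le> D n \<omega>" if "m \<le> n" "\<omega> \<in> space M" for m n \<omega>
  proof (rule lift_Suc_mono_le[OF _ that(1)])
    show "D k \<omega> \<le> D (Suc k) \<omega>" for k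
      using D(2)[OF that(2), of k] f01(1)[OF that(2), of "Suc k"] by simp
  qed
  define h where "h \<omega> = 1 / (1 + v 1 \<omega>)" for \<omega>
  define y where "y n \<omega> = h \<omega> / (1 + D n \<omega>)\<^sup>2" for n \<omega>
  define \<alpha> where "\<alpha> n \<omega> = (1 - f n \<omega>) * (\<pi> n \<omega>)\<^sup>2" for n \<omega>
  \<comment> \<open>\<open>u n\<close> pairs \<open>v (Suc n)\<close> with \<open>D n\<close>. The
    weight \<open>y (Suc n)\<close> that goes with the next value of \<open>v\<close> is therefore
    known at time \<open>Suc n\<close> and can be taken out of the conditional expectation.\<close>
  define u where "u n \<omega> = y n \<omega> * v (Suc n) \<omega>" for n \<omega>
  have h: "0 < h \<omega>" "h \<omega> \<le> 1" if "\<omega> \<in> space M" for \<omega>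
    using v0[OF that, of 0] by (auto simp: h_def)
  have y: "0 \<le> y n \<omega>" "y n \<omega> \<le> 1" if "\<omega> \<in> space M" for n \<omega>
  proof -
    have "1 \<le> (1 + D n \<omega>)\<^sup>2" using D(1)[OF that, of n] by simp
    then show "0 \<le> y n \<omega>" "y n \<omega> \<le> 1" using h[OF that] by (auto simp: y_def divide_le_eq)
  qed
  have y_Suc: "y (Suc n) \<omega> \<le> y n \<omega>" if "\<omega> \<in> space M" for n \<omega>
    unfolding y_def using h[OF that] D(1)[OF that, of n] D_mono[OF _ that, of n "Suc n"]
    by (intro divide_left_mono power_mono mult_pos_pos) auto
  have h_F: "h \<in> borel_measurable (F (Suc n))" for n
    unfolding h_def using measurable_F_mono[OF meas(1)[of 0], of "Suc n"] by simp
  have y_F: "y (Suc n) \<in> borel_measurable (F (Suc n))" for n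
    unfolding y_def using h_F[of n] meas(4)[of "Suc n"] by measurable
  have y_M [measurable]: "y n \<in> borel_measurable M" for n
    unfolding y_def using measurable_F_M[OF h_F[of 0]] by measurable
  have \<alpha>0: "0 \<le> \<alpha> n \<omega>" if "\<omega> \<in> space M" for n \<omega>
    using f01(2)[OF that, of n] by (simp add: \<alpha>_def)
  have [measurable]: "\<alpha> n \<in> borel_measurable M" "u n \<in> borel_measurable M" for n
    unfolding \<alpha>_def u_def by measurable
  have step: "integrable M (u (Suc n)) \<and> integrable M (\<lambda>\<omega>. y (Suc n) \<omega> * \<alpha> (Suc n) \<omega>) \<and>
      (\<integral>\<omega>. u (Suc n) \<omega> \<partial>M) + (\<integral>\<omega>. y (Suc n) \<omega> * \<alpha> (Suc n) \<omega> \<partial>M)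
        \<le> (\<integral>\<omega>. u n \<omega> \<partial>M) + \<sigma>\<^sup>2 * (\<integral>\<omega>. y (Suc n) \<omega> * f (Suc n) \<omega> \<partial>M)"
    if u_int: "integrable M (u n)" for n
  proof -
    let ?y = "y (Suc n)" and ?f = "f (Suc n)" and ?\<pi> = "\<pi> (Suc n)" and ?V = "V (Suc (Suc n))"
    have yv_le: "?y \<omega> * v (Suc n) \<omega> \<le> u n \<omega>" "0 \<le> ?y \<omega> * v (Suc n) \<omega>" if "\<omega> \<in> space M" for \<omega>
      unfolding u_def using y_Suc[OF that, of n] v0[OF that, of n] y[OF that] by (auto intro: mult_right_mono)
    have yv: "integrable M (\<lambda>\<omega>. ?y \<omega> * v (Suc n) \<omega>)"
      by (rule Bochner_Integration.integrable_bound[OF u_int])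
         (use yv_le in \<open>auto intro!: AE_I2 order_trans[OF yv_le(1)]\<close>)
    have y\<alpha>_le: "?y \<omega> * \<alpha> (Suc n) \<omega> \<le> ?y \<omega> * v (Suc n) \<omega>" "0 \<le> ?y \<omega> * \<alpha> (Suc n) \<omega>" if "\<omega> \<in> space M" for \<omega>
      using dom[OF that, of n] y[OF that, of "Suc n"] \<alpha>0[OF that, of "Suc n"] by (auto simp: \<alpha>_def intro: mult_left_mono)
    have y\<alpha>: "integrable M (\<lambda>\<omega>. ?y \<omega> * \<alpha> (Suc n) \<omega>)"
      by (rule Bochner_Integration.integrable_bound[OF yv])
         (use y\<alpha>_le in \<open>auto intro!: AE_I2 order_trans[OF y\<alpha>_le(1)]\<close>)
    have yf: "integrable M (\<lambda>\<omega>. ?y \<omega> * ?f \<omega>)"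
      using y f01 by (intro bounded_integrable[where b = 1]) (auto simp: abs_mult intro!: mult_le_one)
    have yf_F: "(\<lambda>\<omega>. ?y \<omega> * ?f \<omega>) \<in> borel_measurable (F (Suc n))"
      using y_F[of n] meas(3)[of "Suc n"] by measurable
    \<comment> \<open>The cross term is dominated by y \<alpha> + V^2, because the factor y (1 - f)
      lies between 0 and 1.\<close>
    have y\<pi>V: "integrable M (\<lambda>\<omega>. (?y \<omega> * (1 - ?f \<omega>) * ?\<pi> \<omega>) * ?V \<omega>)"
    proof (rule Bochner_Integration.integrable_bound)
      show "integrable M (\<lambda>\<omega>. ?y \<omega> * \<alpha> (Suc n) \<omega> + (?V \<omega>)\<^sup>2)"
        using y\<alpha> V2_integrable by simp
      show "AE \<omega> in M. norm ((?y \<omega> * (1 - ?f \<omega>) * ?\<pi> \<omega>) * ?V \<omega>) \<le> norm (?y \<omega> * \<alpha> (Suc n) \<omega> + (?V \<omega>)\<^sup>2)"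
      proof (rule AE_I2)
        fix \<omega> assume \<omega>: "\<omega> \<in> space M"
        let ?c = "?y \<omega> * (1 - ?f \<omega>)"
        have c: "0 \<le> ?c" "?c \<le> 1"
          using y[OF \<omega>, of "Suc n"] f01[OF \<omega>, of "Suc n"] mult_mono[of "?y \<omega>" 1 "1 - ?f \<omega>" 1] by auto
        have "2 * (\<bar>?\<pi> \<omega>\<bar> * \<bar>?V \<omega>\<bar>) \<le> (?\<pi> \<omega>)\<^sup>2 + (?V \<omega>)\<^sup>2"
          using sum_squares_bound[of "\<bar>?\<pi> \<omega>\<bar>" "\<bar>?V \<omega>\<bar>"] by simp
        moreover have "0 \<le> \<bar>?\<pi> \<omega>\<bar> * \<bar>?V \<omega>\<bar>" by simp
        ultimately have "\<bar>?\<pi> \<omega>\<bar> * \<bar>?V \<omega>\<bar> \<le> (?\<pi> \<omega>)\<^sup>2 + (?V \<omega>)\<^sup>2" by linarith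
        then have "?c * (\<bar>?\<pi> \<omega>\<bar> * \<bar>?V \<omega>\<bar>) \<le> ?c * ((?\<pi> \<omega>)\<^sup>2 + (?V \<omega>)\<^sup>2)"
          by (rule mult_left_mono) (rule c)
        also have "\<dots> \<le> ?y \<omega> * \<alpha> (Suc n) \<omega> + (?V \<omega>)\<^sup>2"
          using mult_right_mono[OF c(2), of "(?V \<omega>)\<^sup>2"] by (simp add: \<alpha>_def algebra_simps)
        finally have "\<bar>(?c * ?\<pi> \<omega>) * ?V \<omega>\<bar> \<le> ?y \<omega> * \<alpha> (Suc n) \<omega> + (?V \<omega>)\<^sup>2"
          using y[OF \<omega>, of "Suc n"] f01[OF \<omega>, of "Suc n"] by (simp add: abs_mult mult.assoc)
        then show "norm ((?c * ?\<pi> \<omega>) * ?V \<omega>) \<le> norm (?y \<omega> * \<alpha> (Suc n) \<omega> + (?V \<omega>)\<^sup>2)" by simp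
      qed
    qed measurable
    have y\<pi>V0: "(\<integral>\<omega>. (?y \<omega> * (1 - ?f \<omega>) * ?\<pi> \<omega>) * ?V \<omega> \<partial>M) = 0"
      by (rule integral_mult_V[OF y\<pi>V]) (use y_F[of n] meas(2)[of "Suc n"] meas(3)[of "Suc n"] in measurable)
    have yfV: "integrable M (\<lambda>\<omega>. (?y \<omega> * ?f \<omega>) * (?V \<omega>)\<^sup>2)"
        "(\<integral>\<omega>. (?y \<omega> * ?f \<omega>) * (?V \<omega>)\<^sup>2 \<partial>M) = \<sigma>\<^sup>2 * (\<integral>\<omega>. ?y \<omega> * ?f \<omega> \<partial>M)"
      by (rule mult_V2_integrable[OF yf yf_F], rule integral_mult_V2[OF yf yf_F])
    define E where "E \<omega> = ?y \<omega> * v (Suc n) \<omega> - ?y \<omega> * \<alpha> (Suc n) \<omega> - 2 * ((?y \<omega> * (1 - ?f \<omega>) * ?\<pi> \<omega>) * ?V \<omega>)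
        + (?y \<omega> * ?f \<omega>) * (?V \<omega>)\<^sup>2" for \<omega>
    have eq: "u (Suc n) \<omega> = E \<omega>" if "\<omega> \<in> space M" for \<omega>
      unfolding u_def E_def rec[OF that, of n] \<alpha>_def by (simp add: algebra_simps)
    have E: "integrable M E" "(\<integral>\<omega>. E \<omega> \<partial>M) = (\<integral>\<omega>. ?y \<omega> * v (Suc n) \<omega> \<partial>M) - (\<integral>\<omega>. ?y \<omega> * \<alpha> (Suc n) \<omega> \<partial>M)
        + \<sigma>\<^sup>2 * (\<integral>\<omega>. ?y \<omega> * ?f \<omega> \<partial>M)"
      unfolding E_def using yv y\<alpha> y\<pi>V y\<pi>V0 yfV by simp_all
    have u_Suc: "integrable M (u (Suc n))" "(\<integral>\<omega>. u (Suc n) \<omega> \<partial>M) = (\<integral>\<omega>. E \<omega> \<partial>M)"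
      using E(1) eq by (auto cong: Bochner_Integration.integrable_cong Bochner_Integration.integral_cong)
    have "(\<integral>\<omega>. ?y \<omega> * v (Suc n) \<omega> \<partial>M) \<le> (\<integral>\<omega>. u n \<omega> \<partial>M)"
      by (rule integral_mono[OF yv u_int]) (rule yv_le)
    then show ?thesis using u_Suc E(2) y\<alpha> by simp
  qed
  have u0: "integrable M (u 0)" "(\<integral>\<omega>. u 0 \<omega> \<partial>M) \<le> 1"
  proof -
    have b: "0 \<le> u 0 \<omega>" "u 0 \<omega> \<le> 1" if "\<omega> \<in> space M" for \<omega>
    proof -
      have "h \<omega> * v 1 \<omega> \<le> 1" "0 \<le> h \<omega> * v 1 \<omega>"
        using v0[OF that, of 0] by (auto simp: h_def)
      moreover have "1 \<le> (1 + D 0 \<omega>)\<^sup>2" using D(1)[OF that, of 0] by simp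
      ultimately show "0 \<le> u 0 \<omega>" "u 0 \<omega> \<le> 1" by (auto simp: u_def y_def divide_le_eq)
    qed
    show i: "integrable M (u 0)" using b by (intro bounded_integrable[where b = 1]) auto
    have "(\<integral>\<omega>. u 0 \<omega> \<partial>M) \<le> (\<integral>\<omega>. 1 \<partial>M)" by (rule integral_mono[OF i]) (use b in auto)
    then show "(\<integral>\<omega>. u 0 \<omega> \<partial>M) \<le> 1" by (simp add: prob_space)
  qed
  have u_int: "integrable M (u n)" for n
    by (induction n) (use u0 step in auto)
  have yf_int: "integrable M (\<lambda>\<omega>. y (Suc n) \<omega> * f (Suc n) \<omega>)" for n
    using y f01 by (intro bounded_integrable[where b = 1]) (auto simp: abs_mult intro!: mult_le_one)
  have total: "(\<integral>\<omega>. u n \<omega> \<partial>M) + (\<Sum>k<n. \<integral>\<omega>. y (Suc k) \<omega> * \<alpha> (Suc k) \<omega> \<partial>M)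
      \<le> (\<integral>\<omega>. u 0 \<omega> \<partial>M) + \<sigma>\<^sup>2 * (\<Sum>k<n. \<integral>\<omega>. y (Suc k) \<omega> * f (Suc k) \<omega> \<partial>M)" for n
  proof (induction n)
    case (Suc n)
    then show ?case using step[OF u_int[of n]] by (simp add: distrib_left)
  qed simp
  have yf_sum: "(\<Sum>k<n. \<integral>\<omega>. y (Suc k) \<omega> * f (Suc k) \<omega> \<partial>M) \<le> 1" for n
  proof -
    have pw: "(\<Sum>k<n. y (Suc k) \<omega> * f (Suc k) \<omega>) \<le> 1" if \<omega>: "\<omega> \<in> space M" for \<omega>
    proof -
      \<comment> \<open>Since y is at most 1 / (1 + D)^2 and f is at most the increment of D, each
        term is dominated by an increment of -1 / (1 + D), and these telescope.\<close>
      have "(\<Sum>k<n. y (Suc k) \<omega> * f (Suc k) \<omega>) \<le> (\<Sum>k<n. 1 / (1 + D k \<omega>) - 1 / (1 + D (Suc k) \<omega>))"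
      proof (rule sum_mono)
        fix k
        let ?a = "1 + D k \<omega>" and ?b = "1 + D (Suc k) \<omega>"
        have ab: "0 < ?a" "?a \<le> ?b" using D(1)[OF \<omega>, of k] D_mono[OF _ \<omega>, of k "Suc k"] by auto
        have "y (Suc k) \<omega> * f (Suc k) \<omega> \<le> (1 / ?b\<^sup>2) * (?b - ?a)"
          using h[OF \<omega>] D(2)[OF \<omega>, of k] f01(1)[OF \<omega>, of "Suc k"]
          by (intro mult_mono) (auto simp: y_def divide_right_mono)
        also have "\<dots> \<le> (1 / (?a * ?b)) * (?b - ?a)"
          using ab by (intro mult_right_mono frac_le) (auto simp: power2_eq_square intro: mult_right_mono)
        also have "\<dots> = 1 / ?a - 1 / ?b" using ab by (simp add: field_simps)
        finally show "y (Suc k) \<omega> * f (Suc k) \<omega> \<le> 1 / ?a - 1 / ?b" .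
      qed
      also have "\<dots> = 1 / (1 + D 0 \<omega>) - 1 / (1 + D n \<omega>)" by (rule sum_lessThan_telescope')
      also have "\<dots> \<le> 1 / (1 + D 0 \<omega>)" using D(1)[OF \<omega>, of n] by simp
      also have "\<dots> \<le> 1" using D(1)[OF \<omega>, of 0] by simp
      finally show ?thesis .
    qed
    have "(\<Sum>k<n. \<integral>\<omega>. y (Suc k) \<omega> * f (Suc k) \<omega> \<partial>M) = (\<integral>\<omega>. (\<Sum>k<n. y (Suc k) \<omega> * f (Suc k) \<omega>) \<partial>M)"
      using yf_int by simp
    also have "\<dots> \<le> (\<integral>\<omega>. 1 \<partial>M)" by (rule integral_mono) (use yf_int pw in auto)
    finally show ?thesis by (simp add: prob_space)
  qed
  have y\<alpha>_int: "integrable M (\<lambda>\<omega>. y (Suc k) \<omega> * \<alpha> (Suc k) \<omega>)" for k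
    using step[OF u_int[of k]] by blast
  have y\<alpha>_sum: "(\<Sum>k<n. \<integral>\<omega>. y (Suc k) \<omega> * \<alpha> (Suc k) \<omega> \<partial>M) \<le> 1 + \<sigma>\<^sup>2" for n
  proof -
    have "0 \<le> (\<integral>\<omega>. u n \<omega> \<partial>M)"
      by (rule integral_nonneg_AE, rule AE_I2) (use y v0 in \<open>auto simp: u_def\<close>)
    moreover have "\<sigma>\<^sup>2 * (\<Sum>k<n. \<integral>\<omega>. y (Suc k) \<omega> * f (Suc k) \<omega> \<partial>M) \<le> \<sigma>\<^sup>2 * 1"
      by (rule mult_left_mono[OF yf_sum]) simp
    ultimately show ?thesis using total[of n] u0 by linarith
  qed
  have "AE \<omega> in M. (\<Sum>k. ennreal (y (Suc k) \<omega> * \<alpha> (Suc k) \<omega>)) \<noteq> \<infinity>"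
  proof (rule nn_integral_PInf_AE)
    have "(\<integral>\<^sup>+\<omega>. (\<Sum>k. ennreal (y (Suc k) \<omega> * \<alpha> (Suc k) \<omega>)) \<partial>M) = (\<Sum>k. \<integral>\<^sup>+\<omega>. ennreal (y (Suc k) \<omega> * \<alpha> (Suc k) \<omega>) \<partial>M)"
      by (rule nn_integral_suminf) measurable
    also have "\<dots> = (\<Sum>k. ennreal (\<integral>\<omega>. y (Suc k) \<omega> * \<alpha> (Suc k) \<omega> \<partial>M))"
      using y\<alpha>_int y \<alpha>0 by (intro suminf_cong nn_integral_eq_integral) auto
    also have "\<dots> \<le> ennreal (1 + \<sigma>\<^sup>2)"
    proof (rule suminf_le_const)
      fix n
      have "(\<Sum>k<n. ennreal (\<integral>\<omega>. y (Suc k) \<omega> * \<alpha> (Suc k) \<omega> \<partial>M)) = ennreal (\<Sum>k<n. \<integral>\<omega>. y (Suc k) \<omega> * \<alpha> (Suc k) \<omega> \<partial>M)"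
        using y \<alpha>0 by (intro sum_ennreal integral_nonneg_AE AE_I2) auto
      also have "\<dots> \<le> ennreal (1 + \<sigma>\<^sup>2)" by (rule ennreal_leI[OF y\<alpha>_sum])
      finally show "(\<Sum>k<n. ennreal (\<integral>\<omega>. y (Suc k) \<omega> * \<alpha> (Suc k) \<omega> \<partial>M)) \<le> ennreal (1 + \<sigma>\<^sup>2)" .
    qed simp
    finally show "(\<integral>\<^sup>+\<omega>. (\<Sum>k. ennreal (y (Suc k) \<omega> * \<alpha> (Suc k) \<omega>)) \<partial>M) \<noteq> \<infinity>"
      by (auto simp: top_unique)
  qed measurable
  then show ?thesis
  proof (rule AE_mp, intro AE_I2 impI)
    fix \<omega> assume \<omega>: "\<omega> \<in> space M" and fin: "(\<Sum>k. ennreal (y (Suc k) \<omega> * \<alpha> (Suc k) \<omega>)) \<noteq> \<infinity>"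
    then obtain K where K: "(\<Sum>k. ennreal (y (Suc k) \<omega> * \<alpha> (Suc k) \<omega>)) = ennreal K" "0 \<le> K"
      by (cases "\<Sum>k. ennreal (y (Suc k) \<omega> * \<alpha> (Suc k) \<omega>)") auto
    have part: "(\<Sum>k=1..n. y k \<omega> * \<alpha> k \<omega>) \<le> K" for n
    proof -
      have "ennreal (\<Sum>k<n. y (Suc k) \<omega> * \<alpha> (Suc k) \<omega>) = (\<Sum>k<n. ennreal (y (Suc k) \<omega> * \<alpha> (Suc k) \<omega>))"
        using y[OF \<omega>] \<alpha>0[OF \<omega>] by (intro sum_ennreal[symmetric]) auto
      also have "\<dots> \<le> ennreal K" unfolding K(1)[symmetric] by (intro sum_le_suminf) auto
      finally have "(\<Sum>k<n. y (Suc k) \<omega> * \<alpha> (Suc k) \<omega>) \<le> K" using K by (simp add: ennreal_le_iff)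
      moreover have "(\<Sum>k=1..n. y k \<omega> * \<alpha> k \<omega>) = (\<Sum>k<n. y (Suc k) \<omega> * \<alpha> (Suc k) \<omega>)"
        by (simp add: sum.atLeast1_atMost_eq)
      ultimately show ?thesis by simp
    qed
    have "(\<Sum>k=1..n. \<alpha> k \<omega>) \<le> (1 + K) * (1 + v 1 \<omega>) * (1 + D n \<omega>)\<^sup>2" for n
    proof -
      let ?G = "(1 + v 1 \<omega>) * (1 + D n \<omega>)\<^sup>2"
      have v1: "0 < 1 + v 1 \<omega>" using v0[OF \<omega>, of 0] by simp
      \<comment> \<open>The normalisation is undone: as D is monotone, \<open>y k\<close> is at
        least 1 / ?G for all k \<le> n.\<close>
      have "(\<Sum>k=1..n. \<alpha> k \<omega>) \<le> (\<Sum>k=1..n. ?G * (y k \<omega> * \<alpha> k \<omega>))"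
      proof (rule sum_mono)
        fix k assume k: "k \<in> {1..n}"
        have d: "0 < 1 + D k \<omega>" using D(1)[OF \<omega>, of k] by simp
        have "(1 + D k \<omega>)\<^sup>2 \<le> (1 + D n \<omega>)\<^sup>2"
          using D(1)[OF \<omega>, of k] D_mono[OF _ \<omega>, of k n] k by (intro power_mono) auto
        then have "1 \<le> (1 + D n \<omega>)\<^sup>2 / (1 + D k \<omega>)\<^sup>2" using d by (simp add: le_divide_eq)
        then have "1 \<le> ?G * y k \<omega>" using v1 by (simp add: y_def h_def)
        then have "1 * \<alpha> k \<omega> \<le> (?G * y k \<omega>) * \<alpha> k \<omega>" by (rule mult_right_mono) (rule \<alpha>0[OF \<omega>])
        then show "\<alpha> k \<omega> \<le> ?G * (y k \<omega> * \<alpha> k \<omega>)" by (simp add: mult.assoc)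
      qed
      also have "\<dots> = ?G * (\<Sum>k=1..n. y k \<omega> * \<alpha> k \<omega>)" by (simp add: sum_distrib_left)
      also have "\<dots> \<le> ?G * (1 + K)" using part[of n] v1 by (intro mult_left_mono) auto
      finally show ?thesis by (simp add: mult_ac)
    qed
    moreover have "1 \<le> (1 + K) * (1 + v 1 \<omega>)"
      using mult_mono[of 1 "1 + K" 1 "1 + v 1 \<omega>"] K v0[OF \<omega>, of 0] by simp
    ultimately show "\<exists>A\<ge>1. \<forall>n\<ge>1. (\<Sum>k=1..n. (1 - f k \<omega>) * (\<pi> k \<omega>)\<^sup>2) \<le> A * (1 + D n \<omega>)\<^sup>2"
      unfolding \<alpha>_def by blast
  qed
qed

end

section \<open>Gaussian vectors and Levy's continuity theorem\<close>

abbreviation gauss :: "real \<Rightarrow> real" where "gauss \<equiv> std_normal_density"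

lemma gauss_char:
  "integrable lborel (\<lambda>x. iexp (u * x) * of_real (gauss x))"
  "(\<integral>x. iexp (u * x) * of_real (gauss x) \<partial>lborel) = of_real (exp (- (u\<^sup>2 / 2)))"
proof -
  have "integrable lborel (\<lambda>x. complex_of_real (gauss x))" by simp
  then show "integrable lborel (\<lambda>x. iexp (u * x) * of_real (gauss x))"
    by (rule Bochner_Integration.integrable_bound) (auto simp: norm_mult)
  have "char std_normal_distribution u = (\<integral>x. gauss x *\<^sub>R iexp (u * x) \<partial>lborel)"
    unfolding char_def by (subst integral_density) auto
  then show "(\<integral>x. iexp (u * x) * of_real (gauss x) \<partial>lborel) = of_real (exp (- (u\<^sup>2 / 2)))"
    by (simp add: char_std_normal_distribution scaleR_conv_of_real mult.commute)
qed

lemma gauss_char_shift: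
  "integrable lborel (\<lambda>x. iexp (u * x) * of_real (gauss (x + c)))"
  "(\<integral>x. iexp (u * x) * of_real (gauss (x + c)) \<partial>lborel) = iexp (- (u * c)) * of_real (exp (- (u\<^sup>2 / 2)))"
proof -
  let ?f = "\<lambda>x. iexp (- (u * c)) * (iexp (u * x) * of_real (gauss x))"
  have f: "integrable lborel ?f" using gauss_char(1)[of u] by (rule integrable_mult_right)
  have eq: "?f (c + 1 * x) = iexp (u * x) * of_real (gauss (x + c))" for x
  proof -
    have "iexp (- (u * c)) * iexp (u * (c + 1 * x)) = iexp (u * x)"
      by (simp add: exp_add[symmetric] algebra_simps)
    then show ?thesis by (simp only: mult.assoc[symmetric]) (simp add: add.commute)
  qed
  show "integrable lborel (\<lambda>x. iexp (u * x) * of_real (gauss (x + c)))"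
    using lborel_integrable_real_affine[OF f, of 1 c] by (simp only: eq)
  show "(\<integral>x. iexp (u * x) * of_real (gauss (x + c)) \<partial>lborel) = iexp (- (u * c)) * of_real (exp (- (u\<^sup>2 / 2)))"
    using lborel_integral_real_affine[of 1 ?f c] gauss_char[of u] by (simp only: eq) simp
qed

lemma gauss_char_scale:
  assumes "0 < r"
  shows "integrable lborel (\<lambda>x. iexp (u * x) * of_real (r * gauss (r * x)))"
    "(\<integral>x. iexp (u * x) * of_real (r * gauss (r * x)) \<partial>lborel) = of_real (exp (- ((u / r)\<^sup>2 / 2)))"
proof -
  let ?f = "\<lambda>x. iexp (u / r * x) * of_real (gauss x)"
  have eq: "r *\<^sub>R ?f (0 + r * x) = iexp (u * x) * of_real (r * gauss (r * x))" for x
    using assms by (simp add: scaleR_conv_of_real)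
  show "integrable lborel (\<lambda>x. iexp (u * x) * of_real (r * gauss (r * x)))"
    unfolding eq[symmetric] using lborel_integrable_real_affine[OF gauss_char(1)[of "u / r"], of r 0] assms
    by (intro integrable_scaleR_right) simp
  show "(\<integral>x. iexp (u * x) * of_real (r * gauss (r * x)) \<partial>lborel) = of_real (exp (- ((u / r)\<^sup>2 / 2)))"
    unfolding eq[symmetric] using lborel_integral_real_affine[of r ?f 0] gauss_char(2)[of "u / r"] assms
    by simp
qed

lemma gauss_nn:
  "(\<integral>\<^sup>+x. ennreal (gauss (x + c)) \<partial>lborel) = 1"
  "0 < r \<Longrightarrow> (\<integral>\<^sup>+x. ennreal (r * gauss (r * x)) \<partial>lborel) = 1"
proof -
  have 1: "(\<integral>\<^sup>+x. ennreal (gauss x) \<partial>lborel) = 1"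
    by (subst nn_integral_eq_integral) auto
  show "(\<integral>\<^sup>+x. ennreal (gauss (x + c)) \<partial>lborel) = 1"
    using nn_integral_real_affine[of "\<lambda>x. ennreal (gauss x)" 1 c] 1 by (simp add: add.commute)
  assume r: "0 < r"
  show "(\<integral>\<^sup>+x. ennreal (r * gauss (r * x)) \<partial>lborel) = 1"
    using nn_integral_real_affine[of "\<lambda>x. ennreal (gauss x)" r 0] 1 r
    by (simp add: ennreal_mult nn_integral_cmult)
qed

text \<open>
  The density of a Gaussian vector whose coordinates other than \<open>e\<close> are conditionally independent
  given the coordinate \<open>e\<close>.
\<close>

definition bordered_density :: "'b::euclidean_space \<Rightarrow> real \<Rightarrow> 'b \<Rightarrow> 'b \<Rightarrow> real" where
  "bordered_density e r k x = r * gauss (r * (x \<bullet> e)) * (\<Prod>b\<in>Basis - {e}. gauss (x \<bullet> b + (k \<bullet> b) * (x \<bullet> e)))"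

definition bordered_gaussian :: "'b::euclidean_space \<Rightarrow> real \<Rightarrow> 'b \<Rightarrow> 'b measure" where
  "bordered_gaussian e r k = density lborel (\<lambda>x. ennreal (bordered_density e r k x))"

lemma bordered_density_nonneg: "0 < r \<Longrightarrow> 0 \<le> bordered_density e r k x"
  unfolding bordered_density_def by (intro mult_nonneg_nonneg prod_nonneg) auto

lemma bordered_density_measurable [measurable]: "bordered_density e r k \<in> borel_measurable borel"
  unfolding bordered_density_def by measurable

text \<open>Fubini over the coordinates, with the one along \<open>e\<close> integrated last. For a
  fixed value t of it, the others are independent unit Gaussians with means -(k . b) t. Their
  characteristic functions contribute a phase that shifts the frequency in t from u . e to u . e
  minus the sum of the (u . b) (k . b), and t itself has standard deviation 1 / r.\<close>

lemma bordered_gaussian_props: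
  fixes e :: "'b::euclidean_space"
  assumes e: "e \<in> Basis" and r: "0 < r"
  shows prob_space_bordered_gaussian: "prob_space (bordered_gaussian e r k)"
    and char_bordered_gaussian: "(\<integral>x. iexp (u \<bullet> x) \<partial>bordered_gaussian e r k)
      = of_real (exp (- (((u \<bullet> e - (\<Sum>b\<in>Basis - {e}. (u \<bullet> b) * (k \<bullet> b))) / r)\<^sup>2 / 2)) * (\<Prod>b\<in>Basis - {e}. exp (- ((u \<bullet> b)\<^sup>2 / 2))))"
proof -
  define J where "J = (Basis :: 'b set) - {e}"
  have J: "finite J" "e \<notin> J" "Basis = insert e J" using e by (auto simp: J_def)
  define L :: "'b \<Rightarrow> real measure" where "L = (\<lambda>_. lborel)"
  interpret product_sigma_finite L unfolding L_def by standard
  define g where "g f = (\<Sum>b\<in>Basis. f b *\<^sub>R b)" for f :: "'b \<Rightarrow> real"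
  have g_M: "g \<in> borel_measurable (Pi\<^sub>M Basis L)"
    unfolding g_def L_def by measurable
  have lb: "lborel = distr (Pi\<^sub>M Basis L) borel g"
    unfolding L_def g_def by (rule lborel_eq)
  have g_b: "g f \<bullet> b = f b" if "b \<in> Basis" for f b
    using that by (simp add: g_def inner_sum_left_Basis)
  define \<rho> where "\<rho> f = r * gauss (r * f e) * (\<Prod>b\<in>J. gauss (f b + (k \<bullet> b) * f e))" for f :: "'b \<Rightarrow> real"
  have \<rho>: "bordered_density e r k (g f) = \<rho> f" for f
    unfolding bordered_density_def \<rho>_def J_def[symmetric] using e by (auto simp: g_b J intro!: prod.cong)
  have \<rho>0: "0 \<le> \<rho> f" for f unfolding \<rho>[symmetric] by (rule bordered_density_nonneg[OF r])
  have [measurable]: "\<rho> \<in> borel_measurable (Pi\<^sub>M Basis L)"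
    unfolding \<rho>[symmetric] using g_M by measurable
  have nn: "(\<integral>\<^sup>+f. ennreal (\<rho> f) \<partial>Pi\<^sub>M Basis L) = 1"
  proof -
    have "(\<integral>\<^sup>+f. ennreal (\<rho> f) \<partial>Pi\<^sub>M Basis L) = (\<integral>\<^sup>+t. (\<integral>\<^sup>+f. ennreal (\<rho> (f(e := t))) \<partial>Pi\<^sub>M J L) \<partial>L e)"
      unfolding J(3) by (rule product_nn_integral_insert_rev) (use J in \<open>auto simp flip: J(3)\<close>)
    also have "\<dots> = (\<integral>\<^sup>+t. ennreal (r * gauss (r * t)) \<partial>L e)"
    proof (rule nn_integral_cong)
      fix t
      have "ennreal (\<rho> (f(e := t))) = ennreal (r * gauss (r * t)) * (\<Prod>b\<in>J. ennreal (gauss (f b + (k \<bullet> b) * t)))" for f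
      proof -
        have "\<rho> (f(e := t)) = r * gauss (r * t) * (\<Prod>b\<in>J. gauss (f b + (k \<bullet> b) * t))"
          unfolding \<rho>_def using J(2) by (auto intro!: prod.cong)
        then show ?thesis using r by (simp add: ennreal_mult prod_ennreal prod_nonneg)
      qed
      then have "(\<integral>\<^sup>+f. ennreal (\<rho> (f(e := t))) \<partial>Pi\<^sub>M J L)
          = ennreal (r * gauss (r * t)) * (\<integral>\<^sup>+f. (\<Prod>b\<in>J. ennreal (gauss (f b + (k \<bullet> b) * t))) \<partial>Pi\<^sub>M J L)"
        by (simp only:) (rule nn_integral_cmult, simp add: L_def)
      also have "(\<integral>\<^sup>+f. (\<Prod>b\<in>J. ennreal (gauss (f b + (k \<bullet> b) * t))) \<partial>Pi\<^sub>M J L) = (\<Prod>b\<in>J. \<integral>\<^sup>+x. ennreal (gauss (x + (k \<bullet> b) * t)) \<partial>L b)"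
        by (rule product_nn_integral_prod) (use J in \<open>auto simp: L_def\<close>)
      also have "\<dots> = 1" by (simp add: L_def gauss_nn)
      finally show "(\<integral>\<^sup>+f. ennreal (\<rho> (f(e := t))) \<partial>Pi\<^sub>M J L) = ennreal (r * gauss (r * t))" by (simp only: mult_1_right)
    qed
    also have "\<dots> = 1" unfolding L_def by (rule gauss_nn(2)[OF r])
    finally show ?thesis .
  qed
  show "prob_space (bordered_gaussian e r k)"
  proof
    have "emeasure (bordered_gaussian e r k) (space (bordered_gaussian e r k)) = (\<integral>\<^sup>+x. ennreal (bordered_density e r k x) \<partial>lborel)"
      unfolding bordered_gaussian_def by (simp add: emeasure_density)
    also have "\<dots> = (\<integral>\<^sup>+f. ennreal (\<rho> f) \<partial>Pi\<^sub>M Basis L)"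
      unfolding lb by (subst nn_integral_distr[OF g_M]) (auto simp: \<rho>)
    finally show "emeasure (bordered_gaussian e r k) (space (bordered_gaussian e r k)) = 1" using nn by simp
  qed
  define G where "G f = iexp (\<Sum>b\<in>Basis. (u \<bullet> b) * f b) * of_real (\<rho> f)" for f :: "'b \<Rightarrow> real"
  have G_g: "G f = iexp (u \<bullet> g f) * of_real (bordered_density e r k (g f))" for f
    unfolding G_def \<rho> by (simp add: g_def inner_sum_right mult.commute)
  have G_int: "integrable (Pi\<^sub>M Basis L) G"
  proof (rule integrableI_bounded)
    show "G \<in> borel_measurable (Pi\<^sub>M Basis L)" unfolding G_g using g_M by measurable
    show "(\<integral>\<^sup>+f. ennreal (norm (G f)) \<partial>Pi\<^sub>M Basis L) < \<infinity>"
      using nn \<rho>0 by (simp add: G_def norm_mult)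
  qed
  define w where "w = u \<bullet> e - (\<Sum>b\<in>J. (u \<bullet> b) * (k \<bullet> b))"
  define p where "p = (\<Prod>b\<in>J. exp (- ((u \<bullet> b)\<^sup>2 / 2)))"
  have "(\<integral>x. iexp (u \<bullet> x) \<partial>bordered_gaussian e r k) = (\<integral>x. bordered_density e r k x *\<^sub>R iexp (u \<bullet> x) \<partial>lborel)"
    unfolding bordered_gaussian_def by (subst integral_density) (auto simp: bordered_density_nonneg[OF r])
  also have "\<dots> = (\<integral>f. bordered_density e r k (g f) *\<^sub>R iexp (u \<bullet> g f) \<partial>Pi\<^sub>M Basis L)"
    unfolding lb by (rule integral_distr[OF g_M]) measurable
  also have "\<dots> = (\<integral>f. G f \<partial>Pi\<^sub>M Basis L)"
    by (intro Bochner_Integration.integral_cong refl) (simp add: G_g scaleR_conv_of_real mult.commute)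
  also have "\<dots> = (\<integral>f. (\<integral>h. G (merge {e} J (f, h)) \<partial>Pi\<^sub>M J L) \<partial>Pi\<^sub>M {e} L)"
    using product_integral_fold[of "{e}" J G] G_int J by auto
  also have "\<dots> = (\<integral>f. iexp (w * f e) * of_real (r * gauss (r * f e)) * of_real p \<partial>Pi\<^sub>M {e} L)"
  proof (rule Bochner_Integration.integral_cong[OF refl])
    fix f :: "'b \<Rightarrow> real"
    let ?t = "f e"
    have "G (merge {e} J (f, h)) = iexp ((u \<bullet> e) * ?t) * of_real (r * gauss (r * ?t)) *
        (\<Prod>b\<in>J. iexp ((u \<bullet> b) * h b) * of_real (gauss (h b + (k \<bullet> b) * ?t)))" for h
    proof -
      have m: "merge {e} J (f, h) e = ?t" "\<And>b. b \<in> J \<Longrightarrow> merge {e} J (f, h) b = h b"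
        using J by (auto simp: merge_def)
      have "(\<Sum>b\<in>Basis. (u \<bullet> b) * merge {e} J (f, h) b) = (u \<bullet> e) * ?t + (\<Sum>b\<in>J. (u \<bullet> b) * h b)"
        unfolding J(3) using J(1,2) m by simp
      moreover have "\<rho> (merge {e} J (f, h)) = r * gauss (r * ?t) * (\<Prod>b\<in>J. gauss (h b + (k \<bullet> b) * ?t))"
        unfolding \<rho>_def m(1) using m(2) by (auto intro!: prod.cong)
      ultimately show ?thesis
        unfolding G_def using J(1) by (simp add: distrib_left exp_add exp_sum sum_distrib_left prod.distrib of_real_prod)
    qed
    then have "(\<integral>h. G (merge {e} J (f, h)) \<partial>Pi\<^sub>M J L) = iexp ((u \<bullet> e) * ?t) * of_real (r * gauss (r * ?t)) *
       (\<integral>h. (\<Prod>b\<in>J. iexp ((u \<bullet> b) * h b) * of_real (gauss (h b + (k \<bullet> b) * ?t))) \<partial>Pi\<^sub>M J L)"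
      by simp
    also have "(\<integral>h. (\<Prod>b\<in>J. iexp ((u \<bullet> b) * h b) * of_real (gauss (h b + (k \<bullet> b) * ?t))) \<partial>Pi\<^sub>M J L)
        = (\<Prod>b\<in>J. \<integral>x. iexp ((u \<bullet> b) * x) * of_real (gauss (x + (k \<bullet> b) * ?t)) \<partial>L b)"
      by (rule product_integral_prod[OF J(1)]) (simp only: L_def gauss_char_shift)
    also have "\<dots> = (\<Prod>b\<in>J. iexp (- ((u \<bullet> b) * ((k \<bullet> b) * ?t))) * of_real (exp (- ((u \<bullet> b)\<^sup>2 / 2))))"
      by (simp only: L_def gauss_char_shift)
    also have "\<dots> = iexp (- (\<Sum>b\<in>J. (u \<bullet> b) * (k \<bullet> b)) * ?t) * of_real p"
    proof -
      have "(\<Prod>b\<in>J. iexp (- ((u \<bullet> b) * ((k \<bullet> b) * ?t)))) = iexp (- (\<Sum>b\<in>J. (u \<bullet> b) * (k \<bullet> b)) * ?t)"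
        by (simp add: exp_sum[OF J(1), symmetric] sum_negf sum_distrib_left sum_distrib_right mult.assoc)
      moreover have "(\<Prod>b\<in>J. complex_of_real (exp (- ((u \<bullet> b)\<^sup>2 / 2)))) = of_real p"
        by (simp add: p_def of_real_prod)
      ultimately show ?thesis by (simp only: prod.distrib)
    qed
    finally show "(\<integral>h. G (merge {e} J (f, h)) \<partial>Pi\<^sub>M J L) = iexp (w * ?t) * of_real (r * gauss (r * ?t)) * of_real p"
      by (simp add: w_def exp_add[symmetric] algebra_simps)
  qed
  also have "\<dots> = (\<integral>t. iexp (w * t) * of_real (r * gauss (r * t)) * of_real p \<partial>L e)"
    by (rule product_integral_singleton[of "\<lambda>t. iexp (w * t) * of_real (r * gauss (r * t)) * of_real p" e]) (simp add: L_def)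
  also have "\<dots> = of_real (exp (- ((w / r)\<^sup>2 / 2))) * of_real p"
    using gauss_char_scale[OF r, of w] by (simp only: L_def integral_mult_left_zero)
  finally show "(\<integral>x. iexp (u \<bullet> x) \<partial>bordered_gaussian e r k)
      = of_real (exp (- (((u \<bullet> e - (\<Sum>b\<in>Basis - {e}. (u \<bullet> b) * (k \<bullet> b))) / r)\<^sup>2 / 2)) * (\<Prod>b\<in>Basis - {e}. exp (- ((u \<bullet> b)\<^sup>2 / 2))))"
    by (simp add: w_def p_def J_def)
qed

text \<open>For r = 1 and k = 0 the bordered density is a product of identical one-dimensional
  factors, whichever basis vector is distinguished.\<close>

definition std_gaussian :: "'b::euclidean_space measure" where
  "std_gaussian = bordered_gaussian (SOME b. b \<in> Basis) 1 0"

lemma std_gaussian_density: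
  "std_gaussian = density lborel (\<lambda>x :: 'b::euclidean_space. ennreal (exp (- ((norm x)\<^sup>2 / 2)) / sqrt (2 * pi) ^ DIM('b)))"
proof -
  define e where "e = (SOME b :: 'b. b \<in> Basis)"
  have e: "e \<in> Basis" unfolding e_def using nonempty_Basis by (simp add: some_in_eq)
  have "bordered_density e 1 0 x = exp (- ((norm x)\<^sup>2 / 2)) / sqrt (2 * pi) ^ DIM('b)" for x :: 'b
  proof -
    have "bordered_density e 1 0 x = (\<Prod>b\<in>Basis. gauss (x \<bullet> b))"
      using e by (simp add: bordered_density_def prod.remove[of Basis e])
    also have "\<dots> = (\<Prod>b\<in>Basis. 1 / sqrt (2 * pi) * exp (- ((x \<bullet> b)\<^sup>2 / 2)))"
      by (simp add: std_normal_density_def)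
    also have "\<dots> = (1 / sqrt (2 * pi)) ^ DIM('b) * exp (- ((norm x)\<^sup>2 / 2))"
      by (simp only: prod.distrib prod_constant exp_sum[OF finite_Basis, symmetric])
         (simp add: norm_eq_sqrt_inner euclidean_inner[of x x] power2_eq_square sum_negf sum_divide_distrib sum_nonneg)
    finally show ?thesis by (simp add: power_one_over)
  qed
  then show ?thesis by (simp add: std_gaussian_def e_def[symmetric] bordered_gaussian_def)
qed

lemma prob_space_std_gaussian: "prob_space (std_gaussian :: 'b::euclidean_space measure)"
  unfolding std_gaussian_def using nonempty_Basis
  by (intro prob_space_bordered_gaussian) (auto simp: some_in_eq)

lemma sets_std_gaussian [measurable_cong, simp]: "sets (std_gaussian :: 'b::euclidean_space measure) = sets borel"
  by (simp add: std_gaussian_density)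

lemma space_std_gaussian [simp]: "space (std_gaussian :: 'b::euclidean_space measure) = UNIV"
  by (simp add: std_gaussian_density)

lemma char_std_gaussian:
  "(\<integral>x. iexp (u \<bullet> x) \<partial>std_gaussian) = of_real (exp (- ((norm (u :: 'b::euclidean_space))\<^sup>2 / 2)))"
proof -
  define e where "e = (SOME b :: 'b. b \<in> Basis)"
  have e: "e \<in> Basis" unfolding e_def using nonempty_Basis by (simp add: some_in_eq)
  have "(\<integral>x. iexp (u \<bullet> x) \<partial>std_gaussian) = of_real (exp (- ((u \<bullet> e)\<^sup>2 / 2)) * (\<Prod>b\<in>Basis - {e}. exp (- ((u \<bullet> b)\<^sup>2 / 2))))"
    unfolding std_gaussian_def e_def[symmetric] by (subst char_bordered_gaussian[OF e]) auto
  also have "exp (- ((u \<bullet> e)\<^sup>2 / 2)) * (\<Prod>b\<in>Basis - {e}. exp (- ((u \<bullet> b)\<^sup>2 / 2))) = (\<Prod>b\<in>Basis. exp (- ((u \<bullet> b)\<^sup>2 / 2)))"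
    using e by (simp add: prod.remove[of Basis e])
  also have "\<dots> = exp (- ((norm u)\<^sup>2 / 2))"
    by (simp only: exp_sum[OF finite_Basis, symmetric])
       (simp add: norm_eq_sqrt_inner euclidean_inner[of u u] power2_eq_square sum_negf sum_divide_distrib sum_nonneg)
  finally show ?thesis .
qed

section \<open>Gaussian smoothing and test functions\<close>

context prob_space
begin

lemma expectation_bound:
  fixes f :: "'a \<Rightarrow> 'c::{second_countable_topology, banach}"
  assumes "f \<in> borel_measurable M" "\<And>\<omega>. \<omega> \<in> space M \<Longrightarrow> norm (f \<omega>) \<le> b"
  shows "integrable M f" "norm (\<integral>\<omega>. f \<omega> \<partial>M) \<le> b"
proof -
  show i: "integrable M f" using assms by (intro integrable_const_bound[of _ b]) auto
  have "norm (\<integral>\<omega>. f \<omega> \<partial>M) \<le> (\<integral>\<omega>. norm (f \<omega>) \<partial>M)" by (rule integral_norm_bound)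
  also have "\<dots> \<le> (\<integral>\<omega>. b \<partial>M)" by (rule integral_mono) (use i assms in auto)
  finally show "norm (\<integral>\<omega>. f \<omega> \<partial>M) \<le> b" by (simp add: prob_space)
qed

text \<open>Tightness of a single law: the norm is finite everywhere, so the probability that it
  exceeds N tends to 0.\<close>

lemma ex_norm_less:
  fixes Y :: "'a \<Rightarrow> 'b::euclidean_space"
  assumes [measurable]: "Y \<in> borel_measurable M" and "0 < (e::real)"
  shows "\<exists>R>0. \<exists>A\<in>sets M. measure M A < e \<and> (\<forall>\<omega>\<in>space M - A. norm (Y \<omega>) < R)"
proof -
  have "AE \<omega> in M. \<forall>\<^sub>F n in sequentially. norm (Y \<omega>) < real (Suc n)"
  proof (rule AE_I2)
    fix \<omega>
    obtain N :: nat where N: "norm (Y \<omega>) < real N" using reals_Archimedean2 by blast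
    show "\<forall>\<^sub>F n in sequentially. norm (Y \<omega>) < real (Suc n)"
      using eventually_ge_at_top[of N] by eventually_elim (use N in simp)
  qed
  from eventually_measure_tail_less[OF _ this assms(2)] obtain N A where
    "A \<in> sets M" "measure M A < e" "\<forall>\<omega>\<in>space M - A. \<forall>n\<ge>N. norm (Y \<omega>) < real (Suc n)"
    by auto
  then show ?thesis
    by (intro exI[of _ "real (Suc N)"] conjI bexI[of _ A]) auto
qed

text \<open>
  The law of \<open>Y + s G\<close> with \<open>G\<close> an independent standard Gaussian vector, tested against \<open>h\<close>, is a
  functional of the characteristic function of \<open>Y\<close>: the Gaussian kernel is its own Fourier
  transform.
\<close>

lemma smoothed_expectation:
  fixes Y :: "'a \<Rightarrow> 'b::euclidean_space" and h :: "'b \<Rightarrow> real"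
  assumes Y[measurable]: "Y \<in> borel_measurable M" and h: "integrable lborel h" and s: "0 < s"
    and h_b: "\<And>x. \<bar>h x\<bar> \<le> H"
  shows "complex_of_real (\<integral>\<omega>. (\<integral>g. h (Y \<omega> + s *\<^sub>R g) \<partial>std_gaussian) \<partial>M)
     = (\<integral>z. of_real (h z / (s ^ DIM('b) * sqrt (2 * pi) ^ DIM('b))) *
          (\<integral>g. iexp (z \<bullet> g / s) * (\<integral>\<omega>. iexp ((- g /\<^sub>R s) \<bullet> Y \<omega>) \<partial>M) \<partial>std_gaussian) \<partial>lborel)"
proof -
  define C where "C = s ^ DIM('b) * sqrt (2 * pi) ^ DIM('b)"
  have C: "0 < C" using s by (simp add: C_def)
  have [measurable]: "h \<in> borel_measurable borel" using h by auto
  interpret G: prob_space "std_gaussian :: 'b measure" by (rule prob_space_std_gaussian)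
  interpret PG: pair_sigma_finite M "std_gaussian :: 'b measure" ..
  interpret PL: pair_sigma_finite M "lborel :: 'b measure" ..
  define K where "K w = exp (- ((norm w)\<^sup>2 / 2))" for w :: 'b
  have [measurable]: "K \<in> borel_measurable borel" unfolding K_def by measurable
  have K01: "0 \<le> K w" "K w \<le> 1" for w by (auto simp: K_def)
  \<comment> \<open>The substitution z = y + s g; \<open>C\<close> collects the Gaussian
    normalisation and the Jacobian s^d.\<close>
  have inner: "(\<integral>g. h (y + s *\<^sub>R g) \<partial>std_gaussian) = (\<integral>z. h z / C * K ((z - y) /\<^sub>R s) \<partial>lborel)" for y
  proof -
    have "(\<integral>g. h (y + s *\<^sub>R g) \<partial>std_gaussian) = (\<integral>g. (K g / sqrt (2 * pi) ^ DIM('b)) *\<^sub>R h (y + s *\<^sub>R g) \<partial>lborel)"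
      unfolding std_gaussian_density K_def by (subst integral_density) auto
    also have "\<dots> = (\<integral>z. h z / C * K ((z - y) /\<^sub>R s) \<partial>lborel)"
    proof -
      have "(\<integral>z. h z / C * K ((z - y) /\<^sub>R s) \<partial>lborel)
          = (\<integral>z. h z / C * K ((z - y) /\<^sub>R s) \<partial>density (distr lborel borel (\<lambda>x. y + s *\<^sub>R x)) (\<lambda>_. \<bar>s\<bar> ^ DIM('b)))"
        using lborel_affine[of s y] s by simp
      also have "\<dots> = (\<integral>z. (\<bar>s\<bar> ^ DIM('b)) *\<^sub>R (h z / C * K ((z - y) /\<^sub>R s)) \<partial>distr lborel borel (\<lambda>x. y + s *\<^sub>R x))"
        by (subst integral_density) auto
      also have "\<dots> = (\<integral>x. (\<bar>s\<bar> ^ DIM('b)) *\<^sub>R (h (y + s *\<^sub>R x) / C * K x) \<partial>lborel)"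
        using s by (subst integral_distr) auto
      also have "\<dots> = (\<integral>g. (K g / sqrt (2 * pi) ^ DIM('b)) *\<^sub>R h (y + s *\<^sub>R g) \<partial>lborel)"
        using s by (intro Bochner_Integration.integral_cong) (auto simp: C_def)
      finally show ?thesis by simp
    qed
    finally show ?thesis .
  qed
  have prod_int: "integrable (M \<Otimes>\<^sub>M lborel) (\<lambda>(\<omega>, z). h z / C * K ((z - Y \<omega>) /\<^sub>R s))"
  proof (rule integrableI_bounded)
    show "(\<lambda>(\<omega>, z). h z / C * K ((z - Y \<omega>) /\<^sub>R s)) \<in> borel_measurable (M \<Otimes>\<^sub>M lborel)" by measurable
    have "(\<integral>\<^sup>+p. ennreal (norm (case p of (\<omega>, z) \<Rightarrow> h z / C * K ((z - Y \<omega>) /\<^sub>R s))) \<partial>(M \<Otimes>\<^sub>M lborel))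
       = (\<integral>\<^sup>+\<omega>. \<integral>\<^sup>+z. ennreal (norm (h z / C * K ((z - Y \<omega>) /\<^sub>R s))) \<partial>lborel \<partial>M)"
      by (subst lborel.nn_integral_fst[symmetric]) auto
    also have "\<dots> \<le> (\<integral>\<^sup>+\<omega>. \<integral>\<^sup>+z. ennreal (norm (h z / C)) \<partial>lborel \<partial>M)"
    proof (intro nn_integral_mono ennreal_leI)
      fix \<omega> z
      have "norm (h z / C) * K ((z - Y \<omega>) /\<^sub>R s) \<le> norm (h z / C) * 1"
        by (intro mult_left_mono K01) auto
      then show "norm (h z / C * K ((z - Y \<omega>) /\<^sub>R s)) \<le> norm (h z / C)"
        using K01 by (simp add: norm_mult abs_mult)
    qed
    also have "\<dots> = (\<integral>\<^sup>+z. ennreal (norm (h z / C)) \<partial>lborel)"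
      by (simp add: emeasure_space_1)
    also have "\<dots> < \<infinity>"
    proof -
      have "integrable lborel (\<lambda>z. h z / C)" using h by simp
      then show ?thesis by (simp only: integrable_iff_bounded)
    qed
    finally show "(\<integral>\<^sup>+p. ennreal (norm (case p of (\<omega>, z) \<Rightarrow> h z / C * K ((z - Y \<omega>) /\<^sub>R s))) \<partial>(M \<Otimes>\<^sub>M lborel)) < \<infinity>" .
  qed
  have K_fourier: "complex_of_real (K ((z - y) /\<^sub>R s)) = (\<integral>g. iexp (z \<bullet> g / s) * iexp ((- g /\<^sub>R s) \<bullet> y) \<partial>std_gaussian)" for z y
  proof -
    have "complex_of_real (K ((z - y) /\<^sub>R s)) = (\<integral>g. iexp (((z - y) /\<^sub>R s) \<bullet> g) \<partial>std_gaussian)"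
      unfolding char_std_gaussian K_def ..
    also have "\<dots> = (\<integral>g. iexp (z \<bullet> g / s) * iexp ((- g /\<^sub>R s) \<bullet> y) \<partial>std_gaussian)"
      by (intro Bochner_Integration.integral_cong)
         (simp_all add: exp_add[symmetric] inner_diff_left inner_commute divide_inverse algebra_simps)
    finally show ?thesis .
  qed
  have "(\<integral>\<omega>. (\<integral>g. h (Y \<omega> + s *\<^sub>R g) \<partial>std_gaussian) \<partial>M) = (\<integral>\<omega>. (\<integral>z. h z / C * K ((z - Y \<omega>) /\<^sub>R s) \<partial>lborel) \<partial>M)"
    unfolding inner ..
  also have "\<dots> = (\<integral>z. (\<integral>\<omega>. h z / C * K ((z - Y \<omega>) /\<^sub>R s) \<partial>M) \<partial>lborel)"
    by (rule PL.Fubini_integral[OF prod_int, symmetric])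
  finally have "complex_of_real (\<integral>\<omega>. (\<integral>g. h (Y \<omega> + s *\<^sub>R g) \<partial>std_gaussian) \<partial>M)
      = (\<integral>z. complex_of_real (\<integral>\<omega>. h z / C * K ((z - Y \<omega>) /\<^sub>R s) \<partial>M) \<partial>lborel)"
    by (simp only: integral_complex_of_real)
  also have "\<dots> = (\<integral>z. of_real (h z / C) * (\<integral>g. iexp (z \<bullet> g / s) * (\<integral>\<omega>. iexp ((- g /\<^sub>R s) \<bullet> Y \<omega>) \<partial>M) \<partial>std_gaussian) \<partial>lborel)"
  proof (rule Bochner_Integration.integral_cong[OF refl])
    fix z :: 'b
    have i2: "integrable (M \<Otimes>\<^sub>M std_gaussian) (\<lambda>(\<omega>, g). iexp (z \<bullet> g / s) * iexp ((- g /\<^sub>R s) \<bullet> Y \<omega>))"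
    proof -
      interpret P: pair_prob_space M "std_gaussian :: 'b measure" ..
      show ?thesis
        by (rule P.expectation_bound(1)[where b = 1]) (auto simp: norm_mult split_beta)
    qed
    have "complex_of_real (\<integral>\<omega>. h z / C * K ((z - Y \<omega>) /\<^sub>R s) \<partial>M) = of_real (h z / C) * complex_of_real (\<integral>\<omega>. K ((z - Y \<omega>) /\<^sub>R s) \<partial>M)"
      by (simp only: integral_mult_right_zero of_real_mult)
    also have "complex_of_real (\<integral>\<omega>. K ((z - Y \<omega>) /\<^sub>R s) \<partial>M) = (\<integral>\<omega>. (\<integral>g. iexp (z \<bullet> g / s) * iexp ((- g /\<^sub>R s) \<bullet> Y \<omega>) \<partial>std_gaussian) \<partial>M)"
      by (simp only: integral_complex_of_real[symmetric] K_fourier)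
    also have "\<dots> = (\<integral>g. (\<integral>\<omega>. iexp (z \<bullet> g / s) * iexp ((- g /\<^sub>R s) \<bullet> Y \<omega>) \<partial>M) \<partial>std_gaussian)"
      by (rule PG.Fubini_integral[OF i2, symmetric])
    also have "\<dots> = (\<integral>g. iexp (z \<bullet> g / s) * (\<integral>\<omega>. iexp ((- g /\<^sub>R s) \<bullet> Y \<omega>) \<partial>M) \<partial>std_gaussian)"
      by (simp only: integral_mult_right_zero)
    finally show "complex_of_real (\<integral>\<omega>. h z / C * K ((z - Y \<omega>) /\<^sub>R s) \<partial>M)
        = of_real (h z / C) * (\<integral>g. iexp (z \<bullet> g / s) * (\<integral>\<omega>. iexp ((- g /\<^sub>R s) \<bullet> Y \<omega>) \<partial>M) \<partial>std_gaussian)" .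
  qed
  finally show ?thesis unfolding C_def .
qed

end

text \<open>The ball is enlarged by 1 so that two points at distance less than 1 either both lie in
  it or both lie where \<open>h\<close> vanishes.\<close>

lemma uniformly_continuous_compact_support:
  fixes h :: "'b::euclidean_space \<Rightarrow> real"
  assumes "continuous_on UNIV h" "\<And>x. R < norm x \<Longrightarrow> h x = 0" "0 < e"
  shows "\<exists>d>0. \<forall>x y. norm (x - y) < d \<longrightarrow> \<bar>h x - h y\<bar> < e"
proof -
  have "uniformly_continuous_on (cball 0 (R + 1)) h"
    using assms(1) by (intro compact_uniformly_continuous) (auto intro: continuous_on_subset)
  then obtain d where d: "0 < d" "\<And>x y. x \<in> cball 0 (R + 1) \<Longrightarrow> y \<in> cball 0 (R + 1) \<Longrightarrow> dist y x < d \<Longrightarrow> dist (h y) (h x) < e"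
    using assms(3) unfolding uniformly_continuous_on_def by blast
  show ?thesis
  proof (intro exI conjI allI impI)
    show "0 < min d 1" using d by simp
    fix x y :: 'b assume xy: "norm (x - y) < min d 1"
    show "\<bar>h x - h y\<bar> < e"
    proof (cases "norm x \<le> R + 1 \<and> norm y \<le> R + 1")
      case True
      then show ?thesis using d(2)[of y x] xy by (simp add: dist_norm)
    next
      case False
      have "\<bar>norm x - norm y\<bar> \<le> norm (x - y)" by (rule norm_triangle_ineq3)
      with False xy have "R < norm x" "R < norm y" by auto
      then show ?thesis using assms by simp
    qed
  qed
qed

text \<open>For compactly supported test functions, Gaussian smoothing turns expectations into
  integrals of characteristic functions, which converge. Bounded test functions are reduced to these
  by a cut-off. Tightness of the sequence is not presupposed: it follows from the convergence for
  the cut-off function and the tightness of the limit.\<close>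

theorem levy_continuity:
  fixes Y :: "nat \<Rightarrow> 'a \<Rightarrow> 'b::euclidean_space" and f :: "'b \<Rightarrow> real"
  assumes M: "prob_space M" and N: "prob_space \<nu>" and sets_N [measurable_cong]: "sets \<nu> = sets borel"
    and Y [measurable]: "\<And>n. Y n \<in> borel_measurable M"
    and char: "\<And>u. (\<lambda>n. \<integral>\<omega>. iexp (u \<bullet> Y n \<omega>) \<partial>M) \<longlonglongrightarrow> (\<integral>y. iexp (u \<bullet> y) \<partial>\<nu>)"
    and f: "continuous_on UNIV f" "bounded (range f)"
  shows "(\<lambda>n. \<integral>\<omega>. f (Y n \<omega>) \<partial>M) \<longlonglongrightarrow> (\<integral>y. f y \<partial>\<nu>)"
proof -
  interpret M: prob_space M by (rule M)
  interpret N: prob_space \<nu> by (rule N)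
  interpret G: prob_space "std_gaussian :: 'b measure" by (rule prob_space_std_gaussian)
  have G1: "measure (std_gaussian :: 'b measure) UNIV = 1" using G.prob_space by simp
  have space_N: "space \<nu> = UNIV" using sets_N sets_eq_imp_space_eq[of \<nu> borel] by simp
  have id_N [measurable]: "(\<lambda>y. y) \<in> borel_measurable \<nu>" by measurable
  have compact: "(\<lambda>n. \<integral>\<omega>. h (Y n \<omega>) \<partial>M) \<longlonglongrightarrow> (\<integral>y. h y \<partial>\<nu>)"
    if h: "continuous_on UNIV h" and supp: "\<And>x. R < norm x \<Longrightarrow> h x = 0" for h :: "'b \<Rightarrow> real" and R
  proof -
    have h_M [measurable]: "h \<in> borel_measurable borel" using h by (rule borel_measurable_continuous_onI)
    have "compact (h ` cball 0 R)" using h by (intro compact_continuous_image) (auto intro: continuous_on_subset)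
    then have "bounded (h ` cball 0 R)" by (rule compact_imp_bounded)
    then obtain H0 where H0: "\<And>x. x \<in> cball 0 R \<Longrightarrow> norm (h x) \<le> H0"
      unfolding bounded_iff by blast
    define H where "H = max H0 1"
    have H: "0 < H" "\<bar>h x\<bar> \<le> H" for x
    proof -
      show "0 < H" by (simp add: H_def)
      have "\<bar>h x\<bar> \<le> max H0 1"
      proof (cases "norm x \<le> R")
        case True
        then show ?thesis using H0[of x] by simp
      qed (use supp[of x] in simp)
      then show "\<bar>h x\<bar> \<le> H" by (simp add: H_def)
    qed
    have h_int: "integrable lborel h"
    proof -
      have "integrable lborel (\<lambda>x. indicator (cball 0 R) x *\<^sub>R h x)"
        using borel_integrable_compact[of "cball 0 R" h] h by (auto intro: continuous_on_subset simp: set_integrable_def)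
      moreover have "(\<lambda>x. indicator (cball 0 R) x *\<^sub>R h x) = h"
        using supp by (auto simp: indicator_def fun_eq_iff not_le)
      ultimately show ?thesis by simp
    qed
    \<comment> \<open>Dominated convergence is used twice: inside with the constant 1, outside with
      |c|, which is integrable because \<open>h\<close> is.\<close>
    have smooth: "(\<lambda>n. \<integral>\<omega>. (\<integral>g. h (Y n \<omega> + s *\<^sub>R g) \<partial>std_gaussian) \<partial>M) \<longlonglongrightarrow> (\<integral>y. (\<integral>g. h (y + s *\<^sub>R g) \<partial>std_gaussian) \<partial>\<nu>)"
      if s: "0 < s" for s
    proof -
      define c where "c z = complex_of_real (h z / (s ^ DIM('b) * sqrt (2 * pi) ^ DIM('b)))" for z
      have c_int: "integrable lborel c" unfolding c_def using h_int by (intro integrable_of_real integrable_divide) auto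
      then have [measurable]: "c \<in> borel_measurable borel" by auto
      define \<phi> where "\<phi> n u = (\<integral>\<omega>. iexp (u \<bullet> Y n \<omega>) \<partial>M)" for n and u :: 'b
      define \<phi>' where "\<phi>' u = (\<integral>y. iexp (u \<bullet> y) \<partial>\<nu>)" for u :: 'b
      have \<phi>1: "cmod (\<phi> n u) \<le> 1" "cmod (\<phi>' u) \<le> 1" for n u
        unfolding \<phi>_def \<phi>'_def by (auto intro!: M.expectation_bound(2) N.expectation_bound(2))
      have \<phi>_lim: "(\<lambda>n. \<phi> n u) \<longlonglongrightarrow> \<phi>' u" for u
        unfolding \<phi>_def \<phi>'_def by (rule char)
      have [measurable]: "\<phi> n \<in> borel_measurable borel" for n
        unfolding \<phi>_def by (rule M.borel_measurable_lebesgue_integral) measurable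
      have [measurable]: "\<phi>' \<in> borel_measurable borel"
        unfolding \<phi>'_def by (rule N.borel_measurable_lebesgue_integral) measurable
      have inner: "(\<lambda>n. \<integral>g. iexp (z \<bullet> g / s) * \<phi> n (- g /\<^sub>R s) \<partial>std_gaussian) \<longlonglongrightarrow> (\<integral>g. iexp (z \<bullet> g / s) * \<phi>' (- g /\<^sub>R s) \<partial>std_gaussian)" for z
        by (rule integral_dominated_convergence[where w = "\<lambda>_. 1"])
           (use \<phi>1 \<phi>_lim in \<open>auto simp: norm_mult intro!: tendsto_mult_left\<close>)
      have "(\<lambda>n. \<integral>z. c z * (\<integral>g. iexp (z \<bullet> g / s) * \<phi> n (- g /\<^sub>R s) \<partial>std_gaussian) \<partial>lborel)
          \<longlonglongrightarrow> (\<integral>z. c z * (\<integral>g. iexp (z \<bullet> g / s) * \<phi>' (- g /\<^sub>R s) \<partial>std_gaussian) \<partial>lborel)"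
      proof (rule integral_dominated_convergence[where w = "\<lambda>z. cmod (c z)"])
        show "integrable lborel (\<lambda>z. cmod (c z))" using c_int by simp
        show "AE z in lborel. cmod (c z * (\<integral>g. iexp (z \<bullet> g / s) * \<phi> n (- g /\<^sub>R s) \<partial>std_gaussian)) \<le> cmod (c z)" for n
        proof (rule AE_I2)
          fix z
          have "cmod (\<integral>g. iexp (z \<bullet> g / s) * \<phi> n (- g /\<^sub>R s) \<partial>std_gaussian) \<le> 1"
            by (rule G.expectation_bound(2)) (use \<phi>1 in \<open>auto simp: norm_mult\<close>)
          then show "cmod (c z * (\<integral>g. iexp (z \<bullet> g / s) * \<phi> n (- g /\<^sub>R s) \<partial>std_gaussian)) \<le> cmod (c z)"
            unfolding norm_mult by (intro mult_left_le) auto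
        qed
        show "AE z in lborel. (\<lambda>n. c z * (\<integral>g. iexp (z \<bullet> g / s) * \<phi> n (- g /\<^sub>R s) \<partial>std_gaussian))
            \<longlonglongrightarrow> c z * (\<integral>g. iexp (z \<bullet> g / s) * \<phi>' (- g /\<^sub>R s) \<partial>std_gaussian)"
          by (intro AE_I2 tendsto_mult_left inner)
      qed measurable
      moreover have "complex_of_real (\<integral>\<omega>. (\<integral>g. h (Y n \<omega> + s *\<^sub>R g) \<partial>std_gaussian) \<partial>M)
          = (\<integral>z. c z * (\<integral>g. iexp (z \<bullet> g / s) * \<phi> n (- g /\<^sub>R s) \<partial>std_gaussian) \<partial>lborel)" for n
        unfolding c_def \<phi>_def by (rule M.smoothed_expectation[OF Y h_int s H(2)])
      moreover have "complex_of_real (\<integral>y. (\<integral>g. h (y + s *\<^sub>R g) \<partial>std_gaussian) \<partial>\<nu>)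
          = (\<integral>z. c z * (\<integral>g. iexp (z \<bullet> g / s) * \<phi>' (- g /\<^sub>R s) \<partial>std_gaussian) \<partial>lborel)"
        unfolding c_def \<phi>'_def by (rule N.smoothed_expectation[OF id_N h_int s H(2)])
      ultimately show ?thesis by (simp only: tendsto_of_real_iff[symmetric, where 'a = complex])
    qed
    show ?thesis
    proof (rule LIMSEQ_I)
      fix e :: real assume e: "0 < e"
      have "\<exists>d>0. \<forall>x y. norm (x - y) < d \<longrightarrow> \<bar>h x - h y\<bar> < e / 8"
        by (rule uniformly_continuous_compact_support[OF h, of R]) (use supp e in auto)
      then obtain d where d: "0 < d" "\<And>x y. norm (x - y) < d \<Longrightarrow> \<bar>h x - h y\<bar> < e / 8"
        by blast
      have "0 < e / (16 * H)" using e H by simp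
      from G.ex_norm_less[of "\<lambda>g. g", OF _ this] obtain R' A where R': "0 < R'" "A \<in> sets (std_gaussian :: 'b measure)"
          "measure std_gaussian A < e / (16 * H)" "\<And>g. g \<notin> A \<Longrightarrow> norm g < R'"
        by auto
      \<comment> \<open>Off \<open>A\<close> the perturbation s g is shorter than d, the distance at
        which \<open>h\<close> varies by less than e / 8.\<close>
      define s where "s = d / R'"
      have s: "0 < s" using d R' by (simp add: s_def)
      define h_s where "h_s y = (\<integral>g. h (y + s *\<^sub>R g) \<partial>std_gaussian)" for y
      have hs_M: "h_s \<in> borel_measurable borel"
        unfolding h_s_def by (rule G.borel_measurable_lebesgue_integral) measurable
      have hs: "\<bar>h_s y - h y\<bar> \<le> e / 4" for y
      proof -
        have i: "integrable std_gaussian (\<lambda>g. h (y + s *\<^sub>R g))"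
          by (rule G.expectation_bound(1)[where b = H]) (use H in auto)
        have "h_s y - h y = (\<integral>g. h (y + s *\<^sub>R g) - h y \<partial>std_gaussian)"
          using i by (simp add: h_s_def G1)
        then have "\<bar>h_s y - h y\<bar> \<le> (\<integral>g. \<bar>h (y + s *\<^sub>R g) - h y\<bar> \<partial>std_gaussian)"
          by (simp only:) (rule integral_abs_bound)
        also have "\<dots> \<le> (\<integral>g. e / 8 + 2 * H * indicator A g \<partial>std_gaussian)"
        proof (rule integral_mono)
          show "integrable std_gaussian (\<lambda>g. \<bar>h (y + s *\<^sub>R g) - h y\<bar>)" using i by simp
          show "integrable std_gaussian (\<lambda>g. e / 8 + 2 * H * indicator A g :: real)"
            using R' by (auto simp: G.emeasure_eq_measure)
          fix g
          show "\<bar>h (y + s *\<^sub>R g) - h y\<bar> \<le> e / 8 + 2 * H * indicator A g"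
          proof (cases "g \<in> A")
            case True
            then show ?thesis using H(2)[of "y + s *\<^sub>R g"] H(2)[of y] e by simp
          next
            case False
            then have "norm (s *\<^sub>R g) < s * R'" using R'(4)[of g] s by simp
            then have "norm ((y + s *\<^sub>R g) - y) < d" using R'(1) by (simp add: s_def)
            from d(2)[OF this] show ?thesis using False by simp
          qed
        qed
        also have "\<dots> = e / 8 + 2 * H * measure std_gaussian A"
          using R' by (subst Bochner_Integration.integral_add) (auto simp: G1 G.emeasure_eq_measure)
        also have "\<dots> \<le> e / 8 + 2 * H * (e / (16 * H))"
          using R' H by (intro add_left_mono mult_left_mono) auto
        also have "\<dots> = e / 4" using H by (simp add: field_simps)
        finally show ?thesis .
      qed
      have hs_H: "\<bar>h_s y\<bar> \<le> H + e / 4" for y using hs[of y] H(2)[of y] by linarith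
      \<comment> \<open>Stated for an arbitrary probability space because it is applied to
        \<open>Y n\<close> on \<open>M\<close> and to the identity on the limit law.\<close>
      have cmp: "\<bar>(\<integral>\<omega>. h_s (Z \<omega>) \<partial>P) - (\<integral>\<omega>. h (Z \<omega>) \<partial>P)\<bar> \<le> e / 4"
        if "prob_space P" "Z \<in> borel_measurable P" for P :: "'x measure" and Z :: "'x \<Rightarrow> 'b"
      proof -
        interpret P: prob_space P by (rule that(1))
        have i1: "integrable P (\<lambda>\<omega>. h_s (Z \<omega>))"
        proof (rule P.expectation_bound(1))
          show "norm (h_s (Z \<omega>)) \<le> H + e / 4" for \<omega> unfolding real_norm_def by (rule hs_H)
        qed (rule measurable_compose[OF that(2) hs_M])
        have i2: "integrable P (\<lambda>\<omega>. h (Z \<omega>))"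
        proof (rule P.expectation_bound(1))
          show "norm (h (Z \<omega>)) \<le> H" for \<omega> unfolding real_norm_def by (rule H(2))
        qed (rule measurable_compose[OF that(2) h_M])
        from i1 i2 have "(\<integral>\<omega>. h_s (Z \<omega>) \<partial>P) - (\<integral>\<omega>. h (Z \<omega>) \<partial>P) = (\<integral>\<omega>. h_s (Z \<omega>) - h (Z \<omega>) \<partial>P)" by simp
        moreover have "norm (\<integral>\<omega>. h_s (Z \<omega>) - h (Z \<omega>) \<partial>P) \<le> e / 4"
          proof (rule P.expectation_bound(2))
          show "norm (h_s (Z \<omega>) - h (Z \<omega>)) \<le> e / 4" for \<omega> unfolding real_norm_def by (rule hs)
        qed (intro borel_measurable_diff measurable_compose[OF that(2) hs_M] measurable_compose[OF that(2) h_M])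
        ultimately show ?thesis by simp
      qed
      from LIMSEQ_D[OF smooth[OF s], of "e / 4"] e obtain n0 where
        n0: "\<And>n. n0 \<le> n \<Longrightarrow> \<bar>(\<integral>\<omega>. h_s (Y n \<omega>) \<partial>M) - (\<integral>y. h_s y \<partial>\<nu>)\<bar> < e / 4"
        unfolding h_s_def real_norm_def by auto
      show "\<exists>n0. \<forall>n\<ge>n0. norm ((\<integral>\<omega>. h (Y n \<omega>) \<partial>M) - (\<integral>y. h y \<partial>\<nu>)) < e"
      proof (intro exI[of _ n0] allI impI)
        fix n assume "n0 \<le> n"
        from n0[OF this] cmp[OF M Y[of n]] cmp[OF N id_N]
        show "norm ((\<integral>\<omega>. h (Y n \<omega>) \<partial>M) - (\<integral>y. h y \<partial>\<nu>)) < e" unfolding real_norm_def using e by linarith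
      qed
    qed
  qed
  obtain B0 where B0: "\<And>x. norm (f x) \<le> B0" using f(2) unfolding bounded_iff by auto
  define B where "B = max B0 1"
  have B: "0 < B" "\<bar>f x\<bar> \<le> B" for x using B0[of x] by (auto simp: B_def)
  have f_M: "f \<in> borel_measurable borel" using f(1) by (rule borel_measurable_continuous_onI)
  show ?thesis
  proof (rule LIMSEQ_I)
    fix e :: real assume e: "0 < e"
    have "0 < e / (8 * B)" using e B by simp
    from N.ex_norm_less[OF id_N this] obtain R A where R: "0 < R" "A \<in> sets \<nu>" "measure \<nu> A < e / (8 * B)" "\<And>y. y \<notin> A \<Longrightarrow> norm y < R"
      by (auto simp: space_N)
    \<comment> \<open>A continuous cut-off supported in the ball of radius R + 1, so that the
      compact case applies to it and to its product with \<open>f\<close>.\<close>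
    define \<psi> where "\<psi> x = max 0 (min 1 (R + 1 - norm x))" for x :: 'b
    have \<psi>: "0 \<le> \<psi> x" "\<psi> x \<le> 1" "R + 1 < norm x \<Longrightarrow> \<psi> x = 0" "norm x < R \<Longrightarrow> \<psi> x = 1" for x
      by (auto simp: \<psi>_def)
    have \<psi>_cont: "continuous_on UNIV \<psi>" unfolding \<psi>_def by (intro continuous_intros)
    have \<psi>_M [measurable]: "\<psi> \<in> borel_measurable borel" using \<psi>_cont by (rule borel_measurable_continuous_onI)
    have lim1: "(\<lambda>n. \<integral>\<omega>. f (Y n \<omega>) * \<psi> (Y n \<omega>) \<partial>M) \<longlonglongrightarrow> (\<integral>y. f y * \<psi> y \<partial>\<nu>)"
      by (rule compact[of _ "R + 1"]) (use f(1) \<psi>_cont \<psi>(3) in \<open>auto intro: continuous_on_mult\<close>)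
    have lim2: "(\<lambda>n. \<integral>\<omega>. \<psi> (Y n \<omega>) \<partial>M) \<longlonglongrightarrow> (\<integral>y. \<psi> y \<partial>\<nu>)"
      by (rule compact[of _ "R + 1"]) (use \<psi>_cont \<psi>(3) in auto)
    have \<psi>_int: "integrable \<nu> \<psi>" by (rule N.expectation_bound(1)[where b = 1]) (use \<psi> in auto)
    have \<psi>_N: "1 - (\<integral>y. \<psi> y \<partial>\<nu>) \<le> e / (8 * B)"
    proof -
      have "(\<integral>y. 1 - \<psi> y \<partial>\<nu>) \<le> (\<integral>y. indicator A y \<partial>\<nu>)"
      proof (rule integral_mono)
        show "1 - \<psi> y \<le> indicator A y" for y using \<psi>[of y] R(4)[of y] by (cases "y \<in> A") auto
      qed (use \<psi>_int R in \<open>auto simp: N.emeasure_eq_measure\<close>)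
      then show ?thesis using \<psi>_int R by (simp add: N.prob_space)
    qed
    \<comment> \<open>The cut-off loses at most \<open>B\<close> times the mass that it misses, and
      this mass is an expectation already covered by the compact case.\<close>
    have cut: "\<bar>(\<integral>\<omega>. f (Z \<omega>) \<partial>P) - (\<integral>\<omega>. f (Z \<omega>) * \<psi> (Z \<omega>) \<partial>P)\<bar> \<le> B * (1 - (\<integral>\<omega>. \<psi> (Z \<omega>) \<partial>P))"
      if "prob_space P" "Z \<in> borel_measurable P" for P :: "'x measure" and Z :: "'x \<Rightarrow> 'b"
    proof -
      interpret P: prob_space P by (rule that(1))
      have fZ: "(\<lambda>\<omega>. f (Z \<omega>)) \<in> borel_measurable P" by (rule measurable_compose[OF that(2) f_M])
      have \<psi>Z: "(\<lambda>\<omega>. \<psi> (Z \<omega>)) \<in> borel_measurable P" by (rule measurable_compose[OF that(2) \<psi>_M])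
      have i1: "integrable P (\<lambda>\<omega>. f (Z \<omega>))" by (rule P.expectation_bound(1)[OF fZ, of B]) (simp add: B)
      have i2: "integrable P (\<lambda>\<omega>. \<psi> (Z \<omega>))" by (rule P.expectation_bound(1)[OF \<psi>Z, of 1]) (simp add: \<psi>(1,2))
      have i3: "integrable P (\<lambda>\<omega>. f (Z \<omega>) * \<psi> (Z \<omega>))"
      proof (rule P.expectation_bound(1)[where b = "B * 1"])
        show "norm (f (Z \<omega>) * \<psi> (Z \<omega>)) \<le> B * 1" for \<omega>
          unfolding real_norm_def abs_mult using B \<psi>[of "Z \<omega>"] by (intro mult_mono) auto
      qed (intro borel_measurable_times fZ \<psi>Z)
      have "(\<integral>\<omega>. f (Z \<omega>) \<partial>P) - (\<integral>\<omega>. f (Z \<omega>) * \<psi> (Z \<omega>) \<partial>P) = (\<integral>\<omega>. f (Z \<omega>) * (1 - \<psi> (Z \<omega>)) \<partial>P)"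
        using i1 i3 by (simp add: right_diff_distrib)
      also have "\<bar>\<dots>\<bar> \<le> (\<integral>\<omega>. \<bar>f (Z \<omega>) * (1 - \<psi> (Z \<omega>))\<bar> \<partial>P)" by (rule integral_abs_bound)
      also have "\<dots> \<le> (\<integral>\<omega>. B * (1 - \<psi> (Z \<omega>)) \<partial>P)"
      proof (rule integral_mono)
        show "integrable P (\<lambda>\<omega>. \<bar>f (Z \<omega>) * (1 - \<psi> (Z \<omega>))\<bar>)" using i1 i3 by (simp add: right_diff_distrib)
        show "\<bar>f (Z \<omega>) * (1 - \<psi> (Z \<omega>))\<bar> \<le> B * (1 - \<psi> (Z \<omega>))" for \<omega>
          unfolding abs_mult using B(2)[of "Z \<omega>"] \<psi>[of "Z \<omega>"] by (intro mult_mono) auto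
      qed (use i2 in auto)
      also have "\<dots> = B * (1 - (\<integral>\<omega>. \<psi> (Z \<omega>) \<partial>P))" using i2 by (simp add: P.prob_space)
      finally show ?thesis .
    qed
    have "0 < e / (8 * B)" "0 < e / 8" using e B by auto
    from LIMSEQ_D[OF lim2 this(1)] LIMSEQ_D[OF lim1 this(2)] obtain n1 n2 where
      n1: "\<And>n. n1 \<le> n \<Longrightarrow> \<bar>(\<integral>\<omega>. \<psi> (Y n \<omega>) \<partial>M) - (\<integral>y. \<psi> y \<partial>\<nu>)\<bar> < e / (8 * B)" and
      n2: "\<And>n. n2 \<le> n \<Longrightarrow> \<bar>(\<integral>\<omega>. f (Y n \<omega>) * \<psi> (Y n \<omega>) \<partial>M) - (\<integral>y. f y * \<psi> y \<partial>\<nu>)\<bar> < e / 8"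
      unfolding real_norm_def by auto
    show "\<exists>n0. \<forall>n\<ge>n0. norm ((\<integral>\<omega>. f (Y n \<omega>) \<partial>M) - (\<integral>y. f y \<partial>\<nu>)) < e"
    proof (intro exI[of _ "max n1 n2"] allI impI)
      fix n assume n: "max n1 n2 \<le> n"
      have "1 - (\<integral>\<omega>. \<psi> (Y n \<omega>) \<partial>M) \<le> e / (8 * B) + e / (8 * B)"
        using n1[of n] n \<psi>_N by auto
      then have "B * (1 - (\<integral>\<omega>. \<psi> (Y n \<omega>) \<partial>M)) \<le> B * (e / (8 * B) + e / (8 * B))" using B by (intro mult_left_mono) auto
      moreover have "B * (1 - (\<integral>y. \<psi> y \<partial>\<nu>)) \<le> B * (e / (8 * B))" using B \<psi>_N by (intro mult_left_mono) auto
      moreover have b1: "B * (e / (8 * B)) = e / 8" using B(1) by simp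
      moreover have "B * (e / (8 * B) + e / (8 * B)) = e / 8 + e / 8" by (simp only: distrib_left b1)
      ultimately have "\<bar>(\<integral>\<omega>. f (Y n \<omega>) \<partial>M) - (\<integral>\<omega>. f (Y n \<omega>) * \<psi> (Y n \<omega>) \<partial>M)\<bar> \<le> e / 4"
        "\<bar>(\<integral>y. f y \<partial>\<nu>) - (\<integral>y. f y * \<psi> y \<partial>\<nu>)\<bar> \<le> e / 8"
        using cut[OF M Y[of n]] cut[OF N id_N] by linarith+
      moreover have "\<bar>(\<integral>\<omega>. f (Y n \<omega>) * \<psi> (Y n \<omega>) \<partial>M) - (\<integral>y. f y * \<psi> y \<partial>\<nu>)\<bar> < e / 8"
        using n2[of n] n by simp
      ultimately show "norm ((\<integral>\<omega>. f (Y n \<omega>) \<partial>M) - (\<integral>y. f y \<partial>\<nu>)) < e"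
        unfolding real_norm_def using e by linarith
    qed
  qed
qed

section \<open>The limiting covariance\<close>

lemma axis_1_in_Basis: "axis l (1 :: real) \<in> Basis"
  unfolding Basis_vec_def by (auto intro!: exI[of _ l])

text \<open>If \<open>k\<close> vanishes at \<open>l\<close>, this is the identity bordered by
  \<open>k\<close>, with corner entry k . k + s; the term -1 compensates the diagonal entry of
  \<open>mat 1\<close>. The number \<open>s\<close> is the Schur complement of the identity
  block.\<close>

definition arrow_matrix :: "'d::finite \<Rightarrow> real ^ 'd \<Rightarrow> real \<Rightarrow> real ^ 'd ^ 'd" where
  "arrow_matrix l k s = mat 1 + outer k (axis l 1) + outer (axis l 1) k + (k \<bullet> k + s - 1) *\<^sub>R outer (axis l 1) (axis l 1)"

definition arrow_inverse :: "'d::finite \<Rightarrow> real ^ 'd \<Rightarrow> real \<Rightarrow> real ^ 'd ^ 'd" where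
  "arrow_inverse l k s = mat 1 - outer (axis l 1) (axis l 1) + (1 / s) *\<^sub>R outer (k - axis l 1) (k - axis l 1)"

lemma arrow_matrix_mult:
  "arrow_matrix l k s *v x = x + (x $ l) *\<^sub>R k + ((k \<bullet> x) + (k \<bullet> k + s - 1) * x $ l) *\<^sub>R axis l 1"
  by (simp add: arrow_matrix_def matrix_vector_mult_add_rdistrib outer_mult_vec inner_axis' scaleR_matrix_vector_assoc[symmetric] scaleR_left_distrib)

lemma arrow_inverse_mult:
  "arrow_inverse l k s *v x = x - (x $ l) *\<^sub>R axis l 1 + ((k \<bullet> x - x $ l) / s) *\<^sub>R (k - axis l 1)"
  by (simp add: arrow_inverse_def matrix_vector_mult_add_rdistrib matrix_vector_mult_diff_rdistrib outer_mult_vec inner_axis' inner_diff_left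
      scaleR_matrix_vector_assoc[symmetric])

lemma arrow_matrix_inverse:
  assumes "k $ l = 0" "s \<noteq> 0"
  shows "arrow_matrix l k s ** arrow_inverse l k s = mat 1"
proof -
  have "arrow_matrix l k s *v (arrow_inverse l k s *v x) = x" for x
  proof -
    define c where "c = (k \<bullet> x - x $ l) / s"
    define y where "y = arrow_inverse l k s *v x"
    have y: "y = x - (x $ l) *\<^sub>R axis l 1 + c *\<^sub>R (k - axis l 1)"
      by (simp add: y_def arrow_inverse_mult c_def)
    have yl: "y $ l = - c" using assms by (simp add: y)
    have ky: "k \<bullet> y = k \<bullet> x + c * (k \<bullet> k)"
      using assms by (simp add: y inner_add_right inner_diff_right inner_axis)
    have cs: "c * s = k \<bullet> x - x $ l" using assms by (simp add: c_def)
    have "arrow_matrix l k s *v y = x + (k \<bullet> x - x $ l - c * s) *\<^sub>R axis l 1"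
      unfolding arrow_matrix_mult yl ky by (simp add: y algebra_simps)
    then show ?thesis by (simp add: y_def cs)
  qed
  then show ?thesis by (subst matrix_eq) (simp add: matrix_vector_mul_assoc[symmetric])
qed

text \<open>A factorisation T^t T with T = I + (k + (sqrt s - 1) e) e^t, where e is the basis vector
  at \<open>l\<close>. As \<open>k\<close> vanishes at \<open>l\<close>, the rank-one determinant
  formula gives det T = sqrt s.\<close>

lemma det_arrow_matrix:
  assumes "k $ l = 0" "0 \<le> s"
  shows "det (arrow_matrix l k s) = s"
proof -
  define r where "r = sqrt s - 1"
  define kk where "kk = k + r *\<^sub>R axis l 1"
  define T where "T = mat 1 + outer kk (axis l 1)"
  have rr: "r + r + r * r = s - 1" using assms by (simp add: r_def algebra_simps)
  have Tt: "transpose T = mat 1 + outer (axis l 1) kk"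
    by (simp add: T_def transpose_def vec_eq_iff mat_def)
  have "transpose T *v (T *v x) = arrow_matrix l k s *v x" for x
  proof -
    have "transpose T *v (T *v x) = x + (x $ l) *\<^sub>R kk + (kk \<bullet> x + (x $ l) * (kk \<bullet> kk)) *\<^sub>R axis l 1"
    proof -
      have "T *v x = x + (x $ l) *\<^sub>R kk"
        by (simp add: T_def matrix_vector_mult_add_rdistrib outer_mult_vec inner_axis')
      moreover have "transpose T *v y = y + (kk \<bullet> y) *\<^sub>R axis l 1" for y
        unfolding Tt by (simp add: matrix_vector_mult_add_rdistrib outer_mult_vec)
      ultimately show ?thesis by (simp add: inner_add_right del: transpose_matrix_vector)
    qed
    also have "kk \<bullet> x = k \<bullet> x + r * x $ l" by (simp add: kk_def inner_add_left inner_axis')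
    also have "kk \<bullet> kk = k \<bullet> k + r * r"
      using assms by (simp add: kk_def inner_add_left inner_add_right inner_axis inner_axis')
    also have "x + (x $ l) *\<^sub>R kk + (k \<bullet> x + r * x $ l + x $ l * (k \<bullet> k + r * r)) *\<^sub>R axis l 1
        = x + (x $ l) *\<^sub>R k + (k \<bullet> x + (k \<bullet> k + (r + r + r * r)) * x $ l) *\<^sub>R axis l 1"
      by (simp add: vec_eq_iff kk_def algebra_simps)
    also have "\<dots> = arrow_matrix l k s *v x" unfolding rr arrow_matrix_mult by simp
    finally show ?thesis .
  qed
  then have "transpose T ** T = arrow_matrix l k s"
    by (subst matrix_eq) (simp add: matrix_vector_mul_assoc[symmetric] del: transpose_matrix_vector)
  moreover have "det T = sqrt s"
    unfolding T_def det_identity_plus_outer using assms by (simp add: kk_def r_def inner_axis inner_add_left)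
  ultimately have "det (arrow_matrix l k s) = sqrt s * sqrt s"
    by (metis det_mul det_transpose)
  then show ?thesis using assms by simp
qed

text \<open>Completing the square: with z = x + x_l k, the quadratic form is s x_l^2 plus the sum of
  the z_i^2 over i \<noteq> l. The determinant 1 / s of the covariance accounts for the factor sqrt
  s of the density.\<close>

lemma gaussian_arrow:
  fixes k :: "real ^ 'd"
  assumes k: "k $ l = 0" and s: "0 < s"
  shows "gaussian_measure 0 (matrix_inv (arrow_matrix l k s)) = bordered_gaussian (axis l 1) (sqrt s) k"
proof -
  let ?e = "axis l 1 :: real ^ 'd"
  have e: "?e \<in> Basis" by (rule axis_1_in_Basis)
  have inv: "matrix_inv (arrow_matrix l k s) = arrow_inverse l k s"
    by (rule matrix_inv_eqI) (rule arrow_matrix_inverse, use k s in auto)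
  have inv': "matrix_inv (arrow_inverse l k s) = arrow_matrix l k s"
    by (rule matrix_inv_eqI) (use arrow_matrix_inverse[OF k, of s] s matrix_left_right_inverse in auto)
  have "det (arrow_matrix l k s) * det (arrow_inverse l k s) = 1"
    using arrow_matrix_inverse[OF k, of s] s by (metis det_I det_mul less_irrefl)
  then have det: "det (arrow_inverse l k s) = 1 / s"
    using det_arrow_matrix[OF k, of s] s by (simp add: field_simps)
  have "exp (- ((x - 0) \<bullet> (arrow_matrix l k s *v (x - 0))) / 2) / sqrt ((2 * pi) ^ CARD('d) * (1 / s))
      = bordered_density ?e (sqrt s) k x" for x
  proof -
    define z where "z = x + (x $ l) *\<^sub>R k"
    have zb: "z \<bullet> b = x \<bullet> b + (k \<bullet> b) * (x \<bullet> ?e)" for b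
      by (simp add: z_def inner_add_left inner_axis mult.commute)
    have zl: "z \<bullet> ?e = x $ l" using k by (simp add: z_def inner_axis)
    have card: "card ((Basis :: (real ^ 'd) set) - {?e}) + 1 = CARD('d)"
      using e by (simp add: card_Diff_singleton_if)
    have split: "(\<Sum>b\<in>Basis - {?e}. (z \<bullet> b)\<^sup>2) = z \<bullet> z - (x $ l)\<^sup>2"
      using e zl by (simp add: euclidean_inner[of z z] sum.remove[of Basis ?e] power2_eq_square)
    have quad: "x \<bullet> (arrow_matrix l k s *v x) = (z \<bullet> z - (x $ l)\<^sup>2) + s * (x $ l)\<^sup>2"
      unfolding arrow_matrix_mult z_def
      by (simp add: inner_add_left inner_add_right inner_axis inner_axis' inner_commute[of x k] power2_eq_square algebra_simps)
    have "bordered_density ?e (sqrt s) k x = sqrt s * gauss (sqrt s * x $ l) * (\<Prod>b\<in>Basis - {?e}. gauss (z \<bullet> b))"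
      by (simp add: bordered_density_def zb inner_axis)
    also have "\<dots> = sqrt s * ((1 / sqrt (2 * pi)) * exp (- (s * (x $ l)\<^sup>2 / 2))) *
        (\<Prod>b\<in>Basis - {?e}. (1 / sqrt (2 * pi)) * exp (- ((z \<bullet> b)\<^sup>2 / 2)))"
      using s by (simp add: std_normal_density_def power_mult_distrib)
    also have "\<dots> = sqrt s * (1 / sqrt (2 * pi)) ^ CARD('d) * (exp (- (s * (x $ l)\<^sup>2 / 2)) * exp (\<Sum>b\<in>Basis - {?e}. - ((z \<bullet> b)\<^sup>2 / 2)))"
    proof -
      have 1: "(\<Prod>b\<in>Basis - {?e}. (1 / sqrt (2 * pi)) * exp (- ((z \<bullet> b)\<^sup>2 / 2)))
          = (1 / sqrt (2 * pi)) ^ card ((Basis :: (real ^ 'd) set) - {?e}) * exp (\<Sum>b\<in>Basis - {?e}. - ((z \<bullet> b)\<^sup>2 / 2))"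
        by (simp only: prod.distrib prod_constant exp_sum[OF finite_Diff[OF finite_Basis]])
      have 2: "(1 / sqrt (2 * pi)) ^ CARD('d) = (1 / sqrt (2 * pi)) ^ card ((Basis :: (real ^ 'd) set) - {?e}) * (1 / sqrt (2 * pi))"
        by (simp only: card[symmetric] power_add power_one_right)
      show ?thesis unfolding 1 2 by (simp only: mult_ac)
    qed
    also have "(\<Sum>b\<in>Basis - {?e}. - ((z \<bullet> b)\<^sup>2 / 2)) = - ((z \<bullet> z - (x $ l)\<^sup>2) / 2)"
      unfolding split[symmetric] by (simp add: sum_negf sum_divide_distrib)
    also have "exp (- (s * (x $ l)\<^sup>2 / 2)) * exp (- ((z \<bullet> z - (x $ l)\<^sup>2) / 2)) = exp (- (x \<bullet> (arrow_matrix l k s *v x)) / 2)"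
      unfolding quad by (simp add: exp_add[symmetric] field_simps)
    also have "sqrt s * (1 / sqrt (2 * pi)) ^ CARD('d) = 1 / sqrt ((2 * pi) ^ CARD('d) * (1 / s))"
    proof -
      define c where "c = sqrt (2 * pi)"
      have "0 < c" by (simp add: c_def)
      have "sqrt ((2 * pi) ^ CARD('d) * (1 / s)) = c ^ CARD('d) * (1 / sqrt s)"
        by (simp only: real_sqrt_mult[of "(2 * pi) ^ CARD('d)"] real_sqrt_power real_sqrt_divide real_sqrt_one c_def)
      then show ?thesis unfolding c_def[symmetric] using s \<open>0 < c\<close> by (simp add: power_one_over)
    qed
    finally show ?thesis by simp
  qed
  then show ?thesis
    unfolding gaussian_measure_def inv inv' det bordered_gaussian_def by simp
qed

lemma char_gaussian_arrow:
  fixes k :: "real ^ 'd"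
  assumes k: "k $ l = 0" and s: "0 < s"
  shows "(\<integral>x. iexp (u \<bullet> x) \<partial>gaussian_measure 0 (matrix_inv (arrow_matrix l k s)))
    = of_real (exp (- ((u \<bullet> (arrow_inverse l k s *v u)) / 2)))"
proof -
  let ?e = "axis l 1 :: real ^ 'd"
  have e: "?e \<in> Basis" by (rule axis_1_in_Basis)
  have s': "0 < sqrt s" using s by simp
  have uk: "(\<Sum>b\<in>Basis - {?e}. (u \<bullet> b) * (k \<bullet> b)) = u \<bullet> k"
    using e k by (simp add: euclidean_inner[of u k] sum.remove[of Basis ?e] inner_axis)
  have uu: "(\<Sum>b\<in>Basis - {?e}. (u \<bullet> b)\<^sup>2) = u \<bullet> u - (u $ l)\<^sup>2"
    using e by (simp add: euclidean_inner[of u u] sum.remove[of Basis ?e] power2_eq_square inner_axis)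
  have "(\<Prod>b\<in>Basis - {?e}. exp (- ((u \<bullet> b)\<^sup>2 / 2))) = exp (- ((u \<bullet> u - (u $ l)\<^sup>2) / 2))"
    unfolding uu[symmetric] by (simp add: exp_sum[symmetric] sum_negf sum_divide_distrib)
  moreover have "((u \<bullet> ?e - u \<bullet> k) / sqrt s)\<^sup>2 = (u $ l - u \<bullet> k)\<^sup>2 / s"
    using s by (simp add: power_divide inner_axis)
  moreover have "u \<bullet> (arrow_inverse l k s *v u) = (u $ l - u \<bullet> k)\<^sup>2 / s + (u \<bullet> u - (u $ l)\<^sup>2)"
  proof -
    have "u \<bullet> (arrow_inverse l k s *v u) = u \<bullet> u - (u $ l)\<^sup>2 + ((k \<bullet> u - u $ l) / s) * (u \<bullet> k - u $ l)"
      unfolding arrow_inverse_mult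
      by (simp add: inner_add_right inner_diff_right inner_axis power2_eq_square)
    also have "((k \<bullet> u - u $ l) / s) * (u \<bullet> k - u $ l) = (u $ l - u \<bullet> k)\<^sup>2 / s"
      by (simp add: power2_eq_square inner_commute[of k u] algebra_simps)
    finally show ?thesis by simp
  qed
  ultimately show ?thesis
    unfolding gaussian_arrow[OF k s] char_bordered_gaussian[OF e s'] uk
    by (simp add: exp_add[symmetric] add_divide_distrib)
qed

section \<open>The matrix \<Lambda> in coordinates\<close>

context
  fixes p :: nat and ix :: "'d::finite \<Rightarrow> nat" and \<theta> :: "nat \<Rightarrow> real" and \<rho> :: real
  assumes ix: "bij_betw ix UNIV {1..p + 2}" and \<rho>: "\<bar>\<rho>\<bar> < 1" "\<rho> \<noteq> 0"
begin

text \<open>The coordinate that carries the past input; all others carry outputs.\<close>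

definition last_index :: 'd where "last_index = inv ix (p + 2)"

definition border :: "real ^ 'd" where
  "border = (\<chi> i. if ix i \<le> p + 1 then K_row \<theta> \<rho> (ix i) else 0)"

lemma ix_inj: "ix i = ix j \<longleftrightarrow> i = j"
  using ix by (auto simp: bij_betw_def inj_on_def)

lemma ix_range: "1 \<le> ix i" "ix i \<le> p + 2"
  using ix by (auto simp: bij_betw_def)

lemma ix_last: "ix last_index = p + 2"
proof -
  have "p + 2 \<in> range ix" using ix by (auto simp: bij_betw_def)
  then show ?thesis unfolding last_index_def by (rule f_inv_into_f)
qed

lemma ix_le_iff: "ix i \<le> p + 1 \<longleftrightarrow> i \<noteq> last_index"
  using ix_inj[of i last_index] ix_range(2)[of i] by (auto simp: ix_last)

lemma ix_le_Suc_iff: "ix i \<le> Suc p \<longleftrightarrow> i \<noteq> last_index"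
  using ix_le_iff[of i] by simp

lemma border_nth: "border $ i = (if i = last_index then 0 else K_row \<theta> \<rho> (ix i))"
  unfolding border_def by (simp add: ix_le_Suc_iff)

lemma border_last: "border $ last_index = 0"
  by (simp add: border_nth)

text \<open>This is where \<rho> \<noteq> 0 makes the limit nondegenerate: S is the Schur complement
  of \<Lambda> and also its determinant.\<close>

lemma S_const_pos: "0 < S_const p \<rho>"
proof -
  have "0 < \<rho> ^ (2 * (p + 1))" unfolding power_mult using \<rho> by simp
  moreover have "\<rho>\<^sup>2 < 1" using \<rho> by (simp add: abs_square_less_1)
  ultimately show ?thesis by (simp add: S_const_def)
qed

lemma sum_ix: "(\<Sum>i\<in>UNIV - {last_index}. f (ix i)) = (\<Sum>j=1..p+1. f j)" for f :: "nat \<Rightarrow> real"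
proof (rule sum.reindex_bij_betw)
  have "bij_betw ix (UNIV - {last_index}) ({1..p + 2} - {ix last_index})"
    using ix by (intro bij_betw_DiffI) (auto simp: bij_betw_def ix_last)
  moreover have "{1..p + 2} - {ix last_index} = {1..p + 1}" by (auto simp: ix_last)
  ultimately show "bij_betw ix (UNIV - {last_index}) {1..p + 1}" by simp
qed

text \<open>The leading entry of K is 0 and drops out, and the index shift turns the others into the
  sum of the (\<theta>_j + \<rho>^j)^2. Hence the corner of \<Lambda> has the form required by
  \<open>arrow_matrix\<close>.\<close>

lemma H_const_eq: "H_const p \<theta> \<rho> = border \<bullet> border + S_const p \<rho>"
proof -
  have "border \<bullet> border = (\<Sum>i\<in>UNIV - {last_index}. (K_row \<theta> \<rho> (ix i))\<^sup>2)"
    by (simp add: inner_vec_def sum.remove[of UNIV last_index] border_nth power2_eq_square)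
  also have "\<dots> = (\<Sum>j=1..p+1. (K_row \<theta> \<rho> j)\<^sup>2)"
    by (rule sum_ix)
  also have "\<dots> = (\<Sum>j=Suc 1..Suc p. (K_row \<theta> \<rho> j)\<^sup>2)"
    by (subst sum.atLeast_Suc_atMost) (auto simp: K_row_def)
  also have "\<dots> = (\<Sum>j=1..p. (\<theta> j + \<rho> ^ j)\<^sup>2)"
    by (subst sum.shift_bounds_cl_Suc_ivl) (auto simp: K_row_def power2_eq_square algebra_simps intro!: sum.cong)
  finally show ?thesis by (simp add: H_const_def S_const_def)
qed

lemma Lambda_eq: "Lambda p ix \<theta> \<rho> = arrow_matrix last_index border (S_const p \<rho>)"
  by (auto simp: Lambda_def bordered_matrix_def arrow_matrix_def vec_eq_iff mat_def axis_def ix_le_Suc_iff ix_inj H_const_eq border_nth)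

lemma Lambda_inverse_eq: "Lambda_inverse p ix \<theta> \<rho> = arrow_inverse last_index border (S_const p \<rho>)"
proof -
  have "(1 - \<rho>\<^sup>2) / \<rho> ^ (2 * (p + 1)) = 1 / S_const p \<rho>" by (simp add: S_const_def)
  note c = this
  show ?thesis
    unfolding Lambda_inverse_def c using less_imp_neq[OF S_const_pos]
    by (auto simp: bordered_matrix_def arrow_inverse_def vec_eq_iff mat_def axis_def ix_le_Suc_iff ix_inj border_nth field_simps)
qed

lemma Lambda_mult_inverse: "Lambda p ix \<theta> \<rho> ** Lambda_inverse p ix \<theta> \<rho> = mat 1"
  unfolding Lambda_eq Lambda_inverse_eq using border_last S_const_pos by (intro arrow_matrix_inverse) auto

lemma matrix_inv_Lambda: "matrix_inv (Lambda p ix \<theta> \<rho>) = Lambda_inverse p ix \<theta> \<rho>"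
  by (rule matrix_inv_eqI) (rule Lambda_mult_inverse)

lemma invertible_Lambda: "invertible (Lambda p ix \<theta> \<rho>)"
  unfolding invertible_def using Lambda_mult_inverse matrix_left_right_inverse by blast

lemma prob_space_limit: "prob_space (gaussian_measure 0 (matrix_inv (Lambda p ix \<theta> \<rho>)))"
  unfolding Lambda_eq gaussian_arrow[OF border_last S_const_pos]
  by (rule prob_space_bordered_gaussian) (use S_const_pos in \<open>auto simp: axis_1_in_Basis\<close>)

lemma char_limit:
  "(\<integral>x. iexp (u \<bullet> x) \<partial>gaussian_measure 0 (matrix_inv (Lambda p ix \<theta> \<rho>)))
    = of_real (exp (- ((u \<bullet> (Lambda_inverse p ix \<theta> \<rho> *v u)) / 2)))"
  unfolding Lambda_eq Lambda_inverse_eq by (rule char_gaussian_arrow[OF border_last S_const_pos])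

text \<open>
  The quadratic form of \<open>\<Lambda>\<close> is the stationary variance of \<open>u \<bullet> \<Phi>\<^sub>n\<close>: the coefficients below are those
  of \<open>V\<^sub>n, \<dots>, V\<^bsub>n-p\<^esub>\<close> and of \<open>\<epsilon>\<^bsub>n-p-1\<^esub>\<close> in the limiting closed loop.
\<close>

lemma Lambda_quadratic:
  "u \<bullet> (Lambda p ix \<theta> \<rho> *v u) = (\<Sum>i\<in>UNIV - {last_index}. (u $ i + K_row \<theta> \<rho> (ix i) * u $ last_index)\<^sup>2)
     + (\<rho> ^ (p + 1) * u $ last_index)\<^sup>2 / (1 - \<rho>\<^sup>2)"
proof -
  define z where "z = u + (u $ last_index) *\<^sub>R border"
  have "u \<bullet> (Lambda p ix \<theta> \<rho> *v u) = (z \<bullet> z - (u $ last_index)\<^sup>2) + S_const p \<rho> * (u $ last_index)\<^sup>2"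
    unfolding Lambda_eq arrow_matrix_mult z_def
    by (simp add: inner_add_left inner_add_right inner_axis inner_axis' inner_commute[of u border] power2_eq_square algebra_simps)
  also have "z \<bullet> z - (u $ last_index)\<^sup>2 = (\<Sum>i\<in>UNIV - {last_index}. (u $ i + K_row \<theta> \<rho> (ix i) * u $ last_index)\<^sup>2)"
    by (simp add: inner_vec_def sum.remove[of UNIV last_index] z_def border_nth power2_eq_square mult.commute)
  also have "S_const p \<rho> * (u $ last_index)\<^sup>2 = (\<rho> ^ (p + 1) * u $ last_index)\<^sup>2 / (1 - \<rho>\<^sup>2)"
    by (simp only: S_const_def power_mult_distrib power_mult[symmetric] mult.commute[of "p + 1" 2]) simp
  finally show ?thesis .
qed

end

section \<open>The adaptively controlled process\<close>

lemma borel_measurable_vec_iff: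
  fixes f :: "'a \<Rightarrow> real ^ 'd"
  shows "f \<in> borel_measurable N \<longleftrightarrow> (\<forall>i. (\<lambda>\<omega>. f \<omega> $ i) \<in> borel_measurable N)"
proof
  assume [measurable]: "f \<in> borel_measurable N"
  have "(\<lambda>\<omega>. f \<omega> \<bullet> axis i 1) \<in> borel_measurable N" for i by measurable
  then show "\<forall>i. (\<lambda>\<omega>. f \<omega> $ i) \<in> borel_measurable N" by (simp add: inner_axis)
next
  assume "\<forall>i. (\<lambda>\<omega>. f \<omega> $ i) \<in> borel_measurable N"
  then show "f \<in> borel_measurable N"
    by (subst borel_measurable_euclidean_space) (auto simp: Basis_vec_def inner_axis)
qed

locale adaptive_arx = martingale_noise M F V \<sigma> a
  for M :: "'a measure" and F V \<sigma> a +
  fixes p :: nat and ix :: "'d::finite \<Rightarrow> nat" and \<theta> :: "nat \<Rightarrow> real" and \<rho> :: real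
    and X U :: "int \<Rightarrow> 'a \<Rightarrow> real" and \<epsilon> x :: "nat \<Rightarrow> 'a \<Rightarrow> real" and est :: "nat \<Rightarrow> 'a \<Rightarrow> real ^ 'd"
  assumes p_ge_1: "p \<ge> 1" and ix: "bij_betw ix UNIV {1..p + 2}"
    and \<rho>: "\<bar>\<rho>\<bar> < 1" "\<rho> \<noteq> 0"
    and X_init: "\<And>k. k \<le> 0 \<Longrightarrow> X k \<in> borel_measurable (F 0)"
    and \<epsilon>_init: "\<epsilon> 0 \<in> borel_measurable (F 0)"
    and U_init: "U 0 \<in> borel_measurable (F 0)" "U (- 1) \<in> borel_measurable (F 0)"
    and est_init: "est 0 \<in> borel_measurable (F 0)"
    and x_pred: "\<And>n. x (n + 1) \<in> borel_measurable (F n)"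
    and x_small: "AE \<omega> in M. (\<lambda>n. \<Sum>k=1..n. (x k \<omega>)\<^sup>2) \<in> o(\<lambda>n. real n)"
    and x_regular: "as_regular a M x"
    and model: "arx_model M p \<theta> \<rho> X U \<epsilon> V"
    and ls: "least_squares M p ix X U est"
    and control: "tracking_control M p ix X U est x"
begin

abbreviation l :: 'd where "l \<equiv> last_index p ix"
abbreviation par :: "real ^ 'd" where "par \<equiv> true_parameter p ix \<theta> \<rho>"

definition \<Phi> :: "'a \<Rightarrow> nat \<Rightarrow> real ^ 'd" where "\<Phi> \<omega> n = regressor p ix X U n \<omega>"
definition err :: "nat \<Rightarrow> 'a \<Rightarrow> real ^ 'd" where "err n \<omega> = est n \<omega> - par"
text \<open>With this sign it is the excitation error, the inner product of par - est and the
  regressor. From time 1 on, the tracking error is this quantity plus the noise.\<close>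

definition exc :: "nat \<Rightarrow> 'a \<Rightarrow> real" where "exc n \<omega> = - (err n \<omega> \<bullet> \<Phi> \<omega> n)"

lemma ix_props: "ix i \<le> p + 1 \<longleftrightarrow> i \<noteq> l" "1 \<le> ix i" "ix l = p + 2"
  using ix_le_iff[OF ix \<rho>, of i] ix_range[OF ix \<rho>, of i] ix_last[OF ix \<rho>] by auto

lemma \<Phi>_nth: "\<Phi> \<omega> n $ i = (if i = l then U (int n - 1) \<omega> else X (int n - int (ix i) + 1) \<omega>)"
  using ix_props(1)[of i] by (auto simp: \<Phi>_def regressor_def)

lemma sum_UNIV_split: "(\<Sum>i\<in>UNIV. g i) = g l + (\<Sum>i\<in>UNIV - {l}. g i)" for g :: "'d \<Rightarrow> real"
  by (simp add: sum.remove[of UNIV l])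

lemma gram_eq: "gram p ix X U n \<omega> = information (\<Phi> \<omega>) (Suc n)"
  by (simp add: gram_def information_def \<Phi>_def columnvector_rowvector lessThan_Suc_atMost)

lemma X_step:
  assumes "\<omega> \<in> space M"
  shows "X (int n + 1) \<omega> = (\<Sum>k=1..p. \<theta> k * X (int n - int k + 1) \<omega>) + U (int n) \<omega> + \<epsilon> (n + 1) \<omega>"
    and "\<epsilon> (Suc n) \<omega> = \<rho> * \<epsilon> n \<omega> + V (Suc n) \<omega>"
  using model assms by (auto simp: arx_model_def)

lemma est_step:
  assumes "\<omega> \<in> space M"
  shows "est (Suc n) \<omega> = est n \<omega> + ((X (int n + 1) \<omega> - U (int n) \<omega> - est n \<omega> \<bullet> \<Phi> \<omega> n) / (1 + leverage (\<Phi> \<omega>) n)) *\<^sub>R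
          (inv_information (\<Phi> \<omega>) n *v \<Phi> \<omega> n)"
proof -
  have "est (Suc n) \<omega> = est n \<omega> + (X (int n + 1) \<omega> - U (int n) \<omega> - est n \<omega> \<bullet> \<Phi> \<omega> n) *\<^sub>R
          (matrix_inv (gram p ix X U n \<omega>) *v \<Phi> \<omega> n)"
    using ls assms by (simp add: least_squares_def \<Phi>_def)
  then show ?thesis
    unfolding gram_eq matrix_inv_information inv_information_Suc_mult by (simp add: divide_inverse)
qed

lemma U_step: "1 \<le> n \<Longrightarrow> \<omega> \<in> space M \<Longrightarrow> U (int n) \<omega> = x (Suc n) \<omega> - est n \<omega> \<bullet> \<Phi> \<omega> n"
  using control by (simp add: tracking_control_def \<Phi>_def)

section \<open>Measurability of the closed loop\<close>

lemma borel_measurable_cong_F: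
  assumes "g \<in> borel_measurable (F n)" "\<And>\<omega>. \<omega> \<in> space M \<Longrightarrow> f \<omega> = g \<omega>"
  shows "f \<in> borel_measurable (F n)"
  using assms measurable_cong[of "F n" f g borel] by (simp add: space_F)

text \<open>Outputs, inputs, noise state, estimator and inverse matrix feed into each other, so
  their measurability needs a joint induction. The input appears at time n - 1 because the one at
  time n is then computed from the rest, except at n = 0, where it is given.\<close>

definition adapted :: "nat \<Rightarrow> bool" where
  "adapted n \<longleftrightarrow> (\<forall>k\<le>int n. X k \<in> borel_measurable (F n)) \<and> U (int n - 1) \<in> borel_measurable (F n)
     \<and> \<epsilon> n \<in> borel_measurable (F n) \<and> est n \<in> borel_measurable (F n)
     \<and> (\<forall>i j. (\<lambda>\<omega>. inv_information (\<Phi> \<omega>) n $ i $ j) \<in> borel_measurable (F n))"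

lemma adapted_\<Phi>: "adapted n \<Longrightarrow> (\<lambda>\<omega>. \<Phi> \<omega> n) \<in> borel_measurable (F n)"
  unfolding borel_measurable_vec_iff
proof
  fix i assume A: "adapted n"
  have "int n - int (ix i) + 1 \<le> int n" using ix_props(2)[of i] by simp
  then show "(\<lambda>\<omega>. \<Phi> \<omega> n $ i) \<in> borel_measurable (F n)"
    using A by (cases "i = l") (auto simp: \<Phi>_nth adapted_def)
qed

lemma adapted_U:
  assumes "adapted n"
  shows "U (int n) \<in> borel_measurable (F n)"
\<comment> \<open>The control law holds from time 1 on; the input at time 0 is arbitrary.\<close>
proof (cases "n = 0")
  case False
  have [measurable]: "(\<lambda>\<omega>. \<Phi> \<omega> n) \<in> borel_measurable (F n)" "est n \<in> borel_measurable (F n)" "x (Suc n) \<in> borel_measurable (F n)"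
    using adapted_\<Phi>[OF assms] assms x_pred[of n] by (auto simp: adapted_def)
  show ?thesis
    by (rule borel_measurable_cong_F[of "\<lambda>\<omega>. x (Suc n) \<omega> - est n \<omega> \<bullet> \<Phi> \<omega> n"]) (use U_step[of n] False in auto)
qed (use U_init in simp)

lemma adapted_gain:
  assumes "adapted n"
  shows "(\<lambda>\<omega>. (inv_information (\<Phi> \<omega>) n *v \<Phi> \<omega> n) $ i) \<in> borel_measurable (F n)"
    and "(\<lambda>\<omega>. leverage (\<Phi> \<omega>) n) \<in> borel_measurable (F n)"
proof -
  have \<Phi>_m: "(\<lambda>\<omega>. \<Phi> \<omega> n $ i) \<in> borel_measurable (F n)" for i
    using adapted_\<Phi>[OF assms] by (simp add: borel_measurable_vec_iff)
  have P_m: "(\<lambda>\<omega>. inv_information (\<Phi> \<omega>) n $ i $ j) \<in> borel_measurable (F n)" for i j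
    using assms by (simp add: adapted_def)
  show *: "(\<lambda>\<omega>. (inv_information (\<Phi> \<omega>) n *v \<Phi> \<omega> n) $ i) \<in> borel_measurable (F n)" for i
    unfolding matrix_vector_mult_def vec_lambda_beta
    by (intro borel_measurable_sum borel_measurable_times P_m \<Phi>_m)
  show "(\<lambda>\<omega>. leverage (\<Phi> \<omega>) n) \<in> borel_measurable (F n)"
    unfolding leverage_def inner_vec_def inner_real_def
    by (intro borel_measurable_sum borel_measurable_times * \<Phi>_m)
qed

lemma adapted: "adapted n"
proof (induction n)
  case 0
  then show ?case
    using X_init U_init \<epsilon>_init est_init by (auto simp: adapted_def)
next
  case (Suc n)
  have mono: "f \<in> borel_measurable (F n) \<Longrightarrow> f \<in> borel_measurable (F (Suc n))" for f :: "'a \<Rightarrow> real"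
    by (rule measurable_F_mono) auto
  have IH: "\<And>k. k \<le> int n \<Longrightarrow> X k \<in> borel_measurable (F n)" "\<epsilon> n \<in> borel_measurable (F n)" "est n \<in> borel_measurable (F n)"
    "\<And>i j. (\<lambda>\<omega>. inv_information (\<Phi> \<omega>) n $ i $ j) \<in> borel_measurable (F n)"
    using Suc by (auto simp: adapted_def)
  have \<Phi>_F: "(\<lambda>\<omega>. \<Phi> \<omega> n) \<in> borel_measurable (F n)" by (rule adapted_\<Phi>[OF Suc])
  have U_F: "U (int n) \<in> borel_measurable (F n)" by (rule adapted_U[OF Suc])
  note gain = adapted_gain[OF Suc]
  have \<epsilon>: "\<epsilon> (Suc n) \<in> borel_measurable (F (Suc n))"
    by (rule borel_measurable_cong_F[of "\<lambda>\<omega>. \<rho> * \<epsilon> n \<omega> + V (Suc n) \<omega>"])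
       (use mono[OF IH(2)] V_F[of n] X_step(2)[of _ n] in auto)
  have X_F: "X (int n + 1) \<in> borel_measurable (F (Suc n))"
  proof (rule borel_measurable_cong_F)
    show "(\<lambda>\<omega>. (\<Sum>k=1..p. \<theta> k * X (int n - int k + 1) \<omega>) + U (int n) \<omega> + \<epsilon> (n + 1) \<omega>) \<in> borel_measurable (F (Suc n))"
      using \<epsilon> by (intro borel_measurable_add borel_measurable_sum borel_measurable_times borel_measurable_const mono[OF U_F] mono[OF IH(1)]) auto
  qed (rule X_step(1))
  have "X k \<in> borel_measurable (F (Suc n))" if "k \<le> int (Suc n)" for k
  proof (cases "k = int n + 1")
    case False
    then show ?thesis using that by (intro mono IH(1)) auto
  qed (use X_F in simp)
  moreover have "est (Suc n) \<in> borel_measurable (F (Suc n))"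
    unfolding borel_measurable_vec_iff
  proof
    fix i
    have e_F: "est n \<in> borel_measurable (F (Suc n))"
      by (rule measurable_F_mono[OF IH(3)]) simp
    have [measurable]: "(\<lambda>\<omega>. \<Phi> \<omega> n) \<in> borel_measurable (F (Suc n))"
      by (rule measurable_F_mono[OF \<Phi>_F]) simp
    have [measurable]: "(\<lambda>\<omega>. est n \<omega> $ i) \<in> borel_measurable (F (Suc n))"
      using e_F unfolding borel_measurable_vec_iff by blast
    note [measurable] = e_F
    note [measurable] = X_F mono[OF U_F] mono[OF gain(1)] mono[OF gain(2)]
    show "(\<lambda>\<omega>. est (Suc n) \<omega> $ i) \<in> borel_measurable (F (Suc n))"
      by (rule borel_measurable_cong_F[of "\<lambda>\<omega>. est n \<omega> $ i + ((X (int n + 1) \<omega> - U (int n) \<omega> - est n \<omega> \<bullet> \<Phi> \<omega> n) / (1 + leverage (\<Phi> \<omega>) n)) *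
          (inv_information (\<Phi> \<omega>) n *v \<Phi> \<omega> n) $ i"]) (measurable, simp add: est_step)
  qed
  moreover have "(\<lambda>\<omega>. inv_information (\<Phi> \<omega>) (Suc n) $ i $ j) \<in> borel_measurable (F (Suc n))" for i j
  proof (rule mono)
    note [measurable] = gain IH(4)
    show "(\<lambda>\<omega>. inv_information (\<Phi> \<omega>) (Suc n) $ i $ j) \<in> borel_measurable (F n)"
      by (simp add: leverage_def[symmetric])
  qed
  moreover have "U (int (Suc n) - 1) \<in> borel_measurable (F (Suc n))"
    using mono[OF U_F] by simp
  ultimately show ?case using \<epsilon> by (simp add: adapted_def)
qed

lemma \<Phi>_F: "(\<lambda>\<omega>. \<Phi> \<omega> n) \<in> borel_measurable (F n)"
  by (rule adapted_\<Phi>[OF adapted])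

lemma \<epsilon>_F: "\<epsilon> n \<in> borel_measurable (F n)"
  using adapted[of n] by (simp add: adapted_def)

lemma est_F: "est n \<in> borel_measurable (F n)"
  using adapted[of n] by (simp add: adapted_def)

lemma err_F: "err n \<in> borel_measurable (F n)"
  unfolding err_def using est_F[of n] by measurable

lemma exc_F: "exc n \<in> borel_measurable (F n)"
  unfolding exc_def using err_F[of n] \<Phi>_F[of n] by measurable

lemma \<Phi>_nth_F: "k \<le> n \<Longrightarrow> (\<lambda>\<omega>. \<Phi> \<omega> k $ i) \<in> borel_measurable (F n)"
  by (drule measurable_F_mono[OF \<Phi>_F[of k]]) (simp add: borel_measurable_vec_iff)

text \<open>The matrix with index \<open>Suc n\<close> contains the regressors up to time n, so it
  is still known at time n.\<close>

lemma information_F: "m \<le> Suc n \<Longrightarrow> (\<lambda>\<omega>. information (\<Phi> \<omega>) m $ i $ j) \<in> borel_measurable (F n)"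
  unfolding information_def by (auto simp: sum_component intro!: borel_measurable_add borel_measurable_sum borel_measurable_times \<Phi>_nth_F)

lemma log_volume_F: "(\<lambda>\<omega>. log_volume (\<Phi> \<omega>) (Suc n)) \<in> borel_measurable (F n)"
  unfolding log_volume_def det_def
  by (intro borel_measurable_ln borel_measurable_sum borel_measurable_times borel_measurable_prod information_F) auto

lemma leverage_F: "(\<lambda>\<omega>. leverage (\<Phi> \<omega>) n) \<in> borel_measurable (F n)"
  by (rule adapted_gain[OF adapted])

text \<open>The model equation at time n - 1, solved for the noise. Eliminating the unobserved noise
  in this way is what brings the additional output and the past input into the regressor.\<close>

lemma noise_state:
  assumes "1 \<le> n" "\<omega> \<in> space M"
  shows "\<epsilon> n \<omega> = X (int n) \<omega> - (\<Sum>k=1..p. \<theta> k * X (int n - int k) \<omega>) - U (int n - 1) \<omega>"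
  using X_step(1)[OF assms(2), of "n - 1"] assms(1) by (simp add: of_nat_diff)

lemma par_nth:
  "par $ i = (if i = l then - \<rho> else (if ix i \<le> p then \<theta> (ix i) else 0) - \<rho> * (if ix i = 1 then - 1 else \<theta> (ix i - 1)))"
  using p_ge_1 ix_props(1)[of i] ix_props(3) unfolding true_parameter_def by (cases "i = l") simp_all

text \<open>Inserting \<open>noise_state\<close> into the recursion for \<epsilon> leaves V as the
  only noise. The vector (-1, \<theta>, 1) in the parameter consists of the coefficients of
  -\<epsilon>_n in terms of the regressor. At n = 0 the noise state is not expressed by the data,
  hence n \<ge> 1.\<close>

lemma regression:
  assumes n: "1 \<le> n" and \<omega>: "\<omega> \<in> space M"
  shows "X (int n + 1) \<omega> = par \<bullet> \<Phi> \<omega> n + U (int n) \<omega> + V (Suc n) \<omega>"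
proof -
  let ?Y = "\<lambda>j. X (int n - int j + 1) \<omega>"
  let ?c = "\<lambda>j. (if j \<le> p then \<theta> j else 0) - \<rho> * (if j = 1 then - 1 else \<theta> (j - 1))"
  have "par \<bullet> \<Phi> \<omega> n = par $ l * U (int n - 1) \<omega> + (\<Sum>i\<in>UNIV - {l}. ?c (ix i) * ?Y (ix i))"
  proof -
    have "par \<bullet> \<Phi> \<omega> n = par $ l * \<Phi> \<omega> n $ l + (\<Sum>i\<in>UNIV - {l}. par $ i * \<Phi> \<omega> n $ i)"
      unfolding inner_vec_def inner_real_def by (rule sum_UNIV_split)
    moreover have "(\<Sum>i\<in>UNIV - {l}. par $ i * \<Phi> \<omega> n $ i) = (\<Sum>i\<in>UNIV - {l}. ?c (ix i) * ?Y (ix i))"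
      by (rule sum.cong[OF refl]) (simp only: par_nth \<Phi>_nth Diff_iff singleton_iff if_False simp_thms)
    ultimately show ?thesis by (simp only: \<Phi>_nth simp_thms if_True)
  qed
  also have "par $ l = - \<rho>"
    by (simp add: par_nth)
  also have "(\<Sum>i\<in>UNIV - {l}. ?c (ix i) * ?Y (ix i)) = (\<Sum>j=1..p+1. ?c j * ?Y j)"
    by (rule sum_ix[OF ix \<rho>, of "\<lambda>j. ?c j * ?Y j"])
  also have "\<dots> = (\<Sum>j=1..p+1. (if j \<le> p then \<theta> j else 0) * ?Y j) - \<rho> * (\<Sum>j=1..p+1. (if j = 1 then - 1 else \<theta> (j - 1)) * ?Y j)"
    by (simp only: sum_subtractf sum_distrib_left left_diff_distrib mult.assoc)
  also have "(\<Sum>j=1..p+1. (if j \<le> p then \<theta> j else 0) * ?Y j) = (\<Sum>j=1..p. \<theta> j * ?Y j)"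
    by (simp cong: sum.cong_simp)
  also have "(\<Sum>j=1..p+1. (if j = 1 then - 1 else \<theta> (j - 1)) * ?Y j) = - X (int n) \<omega> + (\<Sum>k=1..p. \<theta> k * X (int n - int k) \<omega>)"
  proof -
    have "(\<Sum>j=1..p+1. (if j = 1 then - 1 else \<theta> (j - 1)) * ?Y j) = - X (int n) \<omega> + (\<Sum>j=Suc 1..Suc p. (if j = 1 then - 1 else \<theta> (j - 1)) * ?Y j)"
      by (subst sum.atLeast_Suc_atMost) auto
    also have "(\<Sum>j=Suc 1..Suc p. (if j = 1 then - 1 else \<theta> (j - 1)) * ?Y j) = (\<Sum>k=1..p. \<theta> k * X (int n - int k) \<omega>)"
      by (subst sum.shift_bounds_cl_Suc_ivl) (auto intro!: sum.cong)
    finally show ?thesis .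
  qed
  finally have "par \<bullet> \<Phi> \<omega> n = (\<Sum>j=1..p. \<theta> j * ?Y j) + \<rho> * \<epsilon> n \<omega>"
    unfolding noise_state[OF n \<omega>] by (simp add: algebra_simps)
  then show ?thesis
    using X_step[OF \<omega>, of n] by simp
qed

lemma closed_loop:
  assumes "1 \<le> n" "\<omega> \<in> space M"
  shows "X (int n + 1) \<omega> = exc n \<omega> + x (Suc n) \<omega> + V (Suc n) \<omega>"
  using regression[OF assms] U_step[OF assms] by (simp add: exc_def err_def inner_diff_left)

lemma err_step:
  assumes "1 \<le> n" "\<omega> \<in> space M"
  shows "err (Suc n) \<omega> = err n \<omega> + ((exc n \<omega> + V (Suc n) \<omega>) / (1 + leverage (\<Phi> \<omega>) n)) *\<^sub>R (inv_information (\<Phi> \<omega>) n *v \<Phi> \<omega> n)"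
proof -
  have "X (int n + 1) \<omega> - U (int n) \<omega> - est n \<omega> \<bullet> \<Phi> \<omega> n = exc n \<omega> + V (Suc n) \<omega>"
    using regression[OF assms] by (simp add: exc_def err_def inner_diff_left)
  then show ?thesis using est_step[OF assms(2), of n] by (simp add: err_def)
qed

text \<open>The new rank-one term, applied to the old error, contributes minus the excitation times
  the regressor. The correction contributes excitation plus noise, since c + c g = exc + V. The
  excitation cancels.\<close>

lemma information_err_step:
  assumes "1 \<le> n" "\<omega> \<in> space M"
  shows "information (\<Phi> \<omega>) (Suc n) *v err (Suc n) \<omega> = information (\<Phi> \<omega>) n *v err n \<omega> + V (Suc n) \<omega> *\<^sub>R \<Phi> \<omega> n"
proof -
  let ?A = "information (\<Phi> \<omega>) n" and ?w = "inv_information (\<Phi> \<omega>) n *v \<Phi> \<omega> n" and ?g = "leverage (\<Phi> \<omega>) n"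
  define c where "c = (exc n \<omega> + V (Suc n) \<omega>) / (1 + ?g)"
  have cg: "c + c * ?g = exc n \<omega> + V (Suc n) \<omega>"
  proof -
    have "c + c * ?g = c * (1 + ?g)" by (simp add: distrib_left)
    then show ?thesis using leverage_nonneg[of "\<Phi> \<omega>" n] by (simp add: c_def)
  qed
  have Aw: "?A *v ?w = \<Phi> \<omega> n" by (simp add: matrix_vector_mul_assoc information_mult_inv)
  have \<Phi>e: "\<Phi> \<omega> n \<bullet> err n \<omega> = - exc n \<omega>" by (simp add: exc_def inner_commute)
  have e: "err (Suc n) \<omega> = err n \<omega> + c *\<^sub>R ?w" unfolding c_def by (rule err_step[OF assms])
  have "information (\<Phi> \<omega>) (Suc n) *v err (Suc n) \<omega> = ?A *v err n \<omega> + c *\<^sub>R \<Phi> \<omega> n + (- exc n \<omega> + c * ?g) *\<^sub>R \<Phi> \<omega> n"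
    unfolding information_Suc matrix_vector_mult_add_rdistrib outer_mult_vec e inner_add_right \<Phi>e inner_scaleR_right
    by (simp add: matrix_vector_right_distrib matrix_vector_mult_scaleR Aw leverage_def)
  also have "\<dots> = ?A *v err n \<omega> + (c + c * ?g - exc n \<omega>) *\<^sub>R \<Phi> \<omega> n"
    by (simp add: algebra_simps)
  finally show ?thesis unfolding cg by simp
qed

section \<open>The Lyapunov function of the estimation error\<close>

definition lyap :: "nat \<Rightarrow> 'a \<Rightarrow> real" where
  "lyap n \<omega> = err n \<omega> \<bullet> (information (\<Phi> \<omega>) n *v err n \<omega>)"

text \<open>This is the leverage with respect to the updated inverse. Its complement 1 / (1 + g) is
  the factor by which an update without noise would shrink the prediction error for the same
  regressor.\<close>

definition ratio :: "nat \<Rightarrow> 'a \<Rightarrow> real" where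
  "ratio n \<omega> = leverage (\<Phi> \<omega>) n / (1 + leverage (\<Phi> \<omega>) n)"

lemma ratio: "0 \<le> ratio n \<omega>" "ratio n \<omega> \<le> 1" "1 - ratio n \<omega> = 1 / (1 + leverage (\<Phi> \<omega>) n)"
  using leverage_nonneg[of "\<Phi> \<omega>" n] by (auto simp: ratio_def field_simps)

lemma inner_information_commute: "u \<bullet> (information (\<Phi> \<omega>) n *v v) = v \<bullet> (information (\<Phi> \<omega>) n *v u)"
  unfolding inner_information by (simp add: inner_commute mult.commute)

lemma gain_inner_information:
  "(inv_information (\<Phi> \<omega>) n *v \<Phi> \<omega> n) \<bullet> (information (\<Phi> \<omega>) n *v u) = \<Phi> \<omega> n \<bullet> u"
  by (subst inner_information_commute) (simp add: matrix_vector_mul_assoc information_mult_inv inner_commute)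

lemma lyap_nonneg: "0 \<le> lyap n \<omega>"
  unfolding lyap_def inner_information by (intro add_nonneg_nonneg sum_nonneg) auto

lemma lyap_step:
  assumes "1 \<le> n" "\<omega> \<in> space M"
  shows "lyap (Suc n) \<omega> = lyap n \<omega> - (1 - ratio n \<omega>) * (exc n \<omega>)\<^sup>2 - 2 * (1 - ratio n \<omega>) * exc n \<omega> * V (Suc n) \<omega>
     + ratio n \<omega> * (V (Suc n) \<omega>)\<^sup>2"
proof -
  let ?w = "inv_information (\<Phi> \<omega>) n *v \<Phi> \<omega> n" and ?g = "leverage (\<Phi> \<omega>) n"
  define c where "c = (1 - ratio n \<omega>) * (exc n \<omega> + V (Suc n) \<omega>)"
  have e: "err (Suc n) \<omega> = err n \<omega> + c *\<^sub>R ?w"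
    using err_step[OF assms] by (simp add: c_def ratio(3))
  have \<Phi>e: "\<Phi> \<omega> n \<bullet> err n \<omega> = - exc n \<omega>" by (simp add: exc_def inner_commute)
  have cg: "c * ?g = ratio n \<omega> * (exc n \<omega> + V (Suc n) \<omega>)"
    by (simp add: c_def ratio(3)) (simp add: ratio_def)
  have "lyap (Suc n) \<omega> = lyap n \<omega> + V (Suc n) \<omega> * (err n \<omega> \<bullet> \<Phi> \<omega> n) + c * (?w \<bullet> (information (\<Phi> \<omega>) n *v err n \<omega>)) + V (Suc n) \<omega> * (c * (?w \<bullet> \<Phi> \<omega> n))"
  proof -
    have "lyap (Suc n) \<omega> = err (Suc n) \<omega> \<bullet> (information (\<Phi> \<omega>) n *v err n \<omega> + V (Suc n) \<omega> *\<^sub>R \<Phi> \<omega> n)"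
      unfolding lyap_def information_err_step[OF assms] ..
    then show ?thesis unfolding e lyap_def by (simp add: inner_add_left inner_add_right distrib_left)
  qed
  also have "\<dots> = lyap n \<omega> - V (Suc n) \<omega> * exc n \<omega> - c * exc n \<omega> + V (Suc n) \<omega> * (c * ?g)"
    unfolding gain_inner_information \<Phi>e by (simp add: exc_def leverage_def inner_commute)
  finally show ?thesis unfolding cg by (simp add: c_def power2_eq_square algebra_simps)
qed

text \<open>The quadratic form of A_n is nonnegative at a shift of the error along A_n^-1 \<Phi>_n.
  The bound makes the weighted squared excitation integrable whenever the Lyapunov function
  is.\<close>

lemma lyap_ge: "(1 - ratio n \<omega>) * (exc n \<omega>)\<^sup>2 \<le> lyap n \<omega>"
proof -
  let ?w = "inv_information (\<Phi> \<omega>) n *v \<Phi> \<omega> n" and ?g = "leverage (\<Phi> \<omega>) n" and ?A = "information (\<Phi> \<omega>) n"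
  \<comment> \<open>The optimal shift would be exc / g. Dividing by 1 + g instead avoids a zero
    denominator and yields the required bound exc^2 / (1 + g).\<close>
  define t where "t = exc n \<omega> / (1 + ?g)"
  have g: "0 \<le> ?g" by (rule leverage_nonneg)
  have \<Phi>e: "\<Phi> \<omega> n \<bullet> err n \<omega> = - exc n \<omega>" by (simp add: exc_def inner_commute)
  have Aw: "?A *v ?w = \<Phi> \<omega> n" by (simp add: matrix_vector_mul_assoc information_mult_inv)
  define z where "z = err n \<omega> + t *\<^sub>R ?w"
  have "0 \<le> z \<bullet> (?A *v z)"
    unfolding inner_information by (intro add_nonneg_nonneg sum_nonneg) auto
  also have "z \<bullet> (?A *v z) = lyap n \<omega> - 2 * t * exc n \<omega> + t\<^sup>2 * ?g"
  proof -
    have "z \<bullet> (?A *v z) = lyap n \<omega> + t * (err n \<omega> \<bullet> (?A *v ?w)) + t * (?w \<bullet> (?A *v err n \<omega>)) + t * t * (?w \<bullet> (?A *v ?w))"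
      by (simp add: z_def lyap_def matrix_vector_right_distrib matrix_vector_mult_scaleR inner_add_left inner_add_right algebra_simps)
    then show ?thesis
      unfolding gain_inner_information Aw using \<Phi>e by (simp add: leverage_def inner_commute power2_eq_square)
  qed
  finally have "2 * t * exc n \<omega> - t\<^sup>2 * ?g \<le> lyap n \<omega>" by simp
  moreover have "t * exc n \<omega> \<le> 2 * t * exc n \<omega> - t\<^sup>2 * ?g"
  proof -
    have "t\<^sup>2 * ?g \<le> t\<^sup>2 * (1 + ?g)" by (intro mult_left_mono) auto
    also have "\<dots> = t * exc n \<omega>" using g by (simp add: t_def power2_eq_square)
    finally show ?thesis by simp
  qed
  moreover have "t * exc n \<omega> = (1 - ratio n \<omega>) * (exc n \<omega>)\<^sup>2"
    by (simp add: t_def ratio(3) power2_eq_square)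
  ultimately show ?thesis by linarith
qed

text \<open>The volume is taken with index \<open>Suc n\<close>: it is known at time n, and its
  increment dominates \<open>ratio (Suc n)\<close>.\<close>

lemma AE_sum_excitation:
  "AE \<omega> in M. \<exists>A\<ge>1. \<forall>n\<ge>1. (\<Sum>k=1..n. (1 - ratio k \<omega>) * (exc k \<omega>)\<^sup>2) \<le> A * (1 + log_volume (\<Phi> \<omega>) (Suc n))\<^sup>2"
proof (rule lyapunov_sum_bound)
  show "lyap (Suc n) \<in> borel_measurable (F (Suc n))" for n
  proof -
    have [measurable]: "(\<lambda>\<omega>. err (Suc n) \<omega> $ i) \<in> borel_measurable (F (Suc n))" for i
      using err_F[of "Suc n"] by (auto simp: borel_measurable_vec_iff)
    note [measurable] = information_F[of "Suc n" "Suc n"]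
    show ?thesis unfolding lyap_def inner_vec_def matrix_vector_mult_def by simp
  qed
  show "ratio n \<in> borel_measurable (F n)" for n
    unfolding ratio_def using leverage_F[of n] by measurable
  show "ratio (Suc n) \<omega> \<le> log_volume (\<Phi> \<omega>) (Suc (Suc n)) - log_volume (\<Phi> \<omega>) (Suc n)" for n \<omega>
    unfolding ratio_def by (rule leverage_ratio_le)
qed (use exc_F log_volume_F lyap_nonneg ratio log_volume_nonneg lyap_step lyap_ge in auto)

text \<open>The first exponent is 2 / b for b midway between 2 and a and governs the squared
  reference; the second is the exponent of the squared noise in \<open>AE_V_growth\<close>. Both are
  below 1 because a > 2.\<close>

definition \<kappa> :: real where "\<kappa> = max (4 / (2 + a)) ((2 + a) / (2 * a))"

lemma \<kappa>: "0 < \<kappa>" "\<kappa> < 1" "4 / (2 + a) \<le> \<kappa>" "(2 + a) / (2 * a) \<le> \<kappa>"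
  using a_gt_2 by (auto simp: \<kappa>_def less_max_iff_disj)

text \<open>A single term is at most the partial sum, so |x_k|^b is of order k and x_k^2 is of order
  k^(2 / b), where b > 2 gives an exponent below 1.\<close>

lemma AE_x_growth: "AE \<omega> in M. \<exists>K\<ge>0. \<forall>k\<ge>1. (x k \<omega>)\<^sup>2 \<le> K * real k powr \<kappa>"
proof -
  define b where "b = (2 + a) / 2"
  have b: "2 \<le> b" "b < a" "2 / b = 4 / (2 + a)" using a_gt_2 by (auto simp: b_def)
  have "AE \<omega> in M. (\<lambda>n. \<Sum>k=1..n. \<bar>x k \<omega>\<bar> powr b) \<in> O(\<lambda>n. real n)"
    using x_regular b by (auto simp: as_regular_def)
  then show ?thesis
  proof eventually_elim
    case (elim \<omega>)
    define S where "S n = (\<Sum>k=1..n. \<bar>x k \<omega>\<bar> powr b)" for n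
    from elim obtain c where c: "0 < c" "\<forall>\<^sub>F n in sequentially. norm (S n) \<le> c * norm (real n)"
      unfolding S_def by (elim landau_o.bigE) auto
    then obtain N where N: "\<And>n. N \<le> n \<Longrightarrow> S n \<le> c * real n"
      unfolding eventually_sequentially by (auto simp: S_def sum_nonneg)
    have S_mono: "S m \<le> S n" if "m \<le> n" for m n
      unfolding S_def using that by (intro sum_mono2) auto
    have S0: "0 \<le> S n" for n unfolding S_def by (intro sum_nonneg) auto
    \<comment> \<open>The summand \<open>S N\<close> covers the indices below \<open>N\<close>,
      where the asymptotic bound does not yet hold.\<close>
    define K where "K = c + S N"
    have K: "0 \<le> K" using c S0[of N] by (simp add: K_def)
    have xb: "\<bar>x k \<omega>\<bar> powr b \<le> K * real k" if k: "1 \<le> k" for k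
    proof -
      have "\<bar>x k \<omega>\<bar> powr b \<le> S k"
        unfolding S_def using k by (intro member_le_sum) auto
      also have "S k \<le> K * real k"
      proof (cases "N \<le> k")
        case True
        then have "S k \<le> c * real k" by (rule N)
        also have "\<dots> \<le> K * real k" using S0[of N] by (intro mult_right_mono) (auto simp: K_def)
        finally show ?thesis .
      next
        case False
        have "S k \<le> S N * 1" using S_mono[of k N] False by simp
        also have "\<dots> \<le> K * real k" using k c S0[of N] by (intro mult_mono) (auto simp: K_def)
        finally show ?thesis .
      qed
      finally show ?thesis .
    qed
    show ?case
    proof (intro exI[of _ "K powr (2 / b)"] conjI allI impI)
      fix k :: nat assume k: "1 \<le> k"
      have "(x k \<omega>)\<^sup>2 = (\<bar>x k \<omega>\<bar> powr b) powr (2 / b)" using b(1) by (simp add: powr_powr)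
      also have "\<dots> \<le> (K * real k) powr (2 / b)" using b xb[OF k] by (intro powr_mono2) auto
      also have "\<dots> = K powr (2 / b) * real k powr (2 / b)" using K by (simp add: powr_mult)
      also have "\<dots> \<le> K powr (2 / b) * real k powr \<kappa>"
        using k \<kappa>(3) b(3) by (intro mult_left_mono powr_mono) auto
      finally show "(x k \<omega>)\<^sup>2 \<le> K powr (2 / b) * real k powr \<kappa>" .
    qed simp
  qed
qed

lemma AE_V_growth': "AE \<omega> in M. \<exists>K\<ge>0. \<forall>k\<ge>1. (V k \<omega>)\<^sup>2 \<le> K * real k powr \<kappa>"
  using AE_V_growth
proof eventually_elim
  case (elim \<omega>)
  then obtain K where K: "0 \<le> K" "\<And>n. (V (Suc n) \<omega>)\<^sup>2 \<le> K * real (Suc n) powr ((2 + a) / (2 * a))" by blast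
  have "(V k \<omega>)\<^sup>2 \<le> K * real k powr \<kappa>" if k: "1 \<le> k" for k
  proof -
    have "(V k \<omega>)\<^sup>2 \<le> K * real k powr ((2 + a) / (2 * a))" using K(2)[of "k - 1"] k by simp
    also have "\<dots> \<le> K * real k powr \<kappa>" using k K \<kappa>(4) by (intro mult_left_mono powr_mono) auto
    finally show ?thesis .
  qed
  with K(1) show ?case by blast
qed

text \<open>The constant E = |\<epsilon>_0| + K / (1 - |\<rho>|) satisfies |\<rho>| E + K \<le> E,
  so the autoregression preserves the bound.\<close>

lemma \<epsilon>_bound:
  assumes \<omega>: "\<omega> \<in> space M" and K: "0 \<le> K" "\<And>k. 1 \<le> k \<Longrightarrow> \<bar>V k \<omega>\<bar> \<le> K * real k powr (\<kappa> / 2)"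
  shows "1 \<le> k \<Longrightarrow> \<bar>\<epsilon> k \<omega>\<bar> \<le> (\<bar>\<epsilon> 0 \<omega>\<bar> + K / (1 - \<bar>\<rho>\<bar>)) * real k powr (\<kappa> / 2)"
proof (induction k rule: dec_induct)
  case base
  have "\<bar>\<epsilon> 1 \<omega>\<bar> \<le> \<bar>\<rho>\<bar> * \<bar>\<epsilon> 0 \<omega>\<bar> + \<bar>V 1 \<omega>\<bar>"
    using X_step(2)[OF \<omega>, of 0] by (simp add: abs_mult[symmetric] abs_triangle_ineq)
  moreover have "\<bar>\<rho>\<bar> * \<bar>\<epsilon> 0 \<omega>\<bar> \<le> 1 * \<bar>\<epsilon> 0 \<omega>\<bar>" using \<rho> by (intro mult_right_mono) auto
  moreover have "\<bar>V 1 \<omega>\<bar> \<le> K" using K(2)[of 1] by simp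
  moreover have "K \<le> K / (1 - \<bar>\<rho>\<bar>)" using \<rho> K(1) by (simp add: field_simps)
  ultimately show ?case by simp
next
  case (step k)
  define E where "E = \<bar>\<epsilon> 0 \<omega>\<bar> + K / (1 - \<bar>\<rho>\<bar>)"
  have E: "0 \<le> E" "\<bar>\<rho>\<bar> * E + K \<le> E"
  proof -
    show "0 \<le> E" using \<rho> K by (simp add: E_def)
    have "K = (1 - \<bar>\<rho>\<bar>) * (K / (1 - \<bar>\<rho>\<bar>))" using \<rho> by simp
    also have "\<dots> \<le> (1 - \<bar>\<rho>\<bar>) * E" using \<rho> by (intro mult_left_mono) (auto simp: E_def)
    finally show "\<bar>\<rho>\<bar> * E + K \<le> E" by (simp add: algebra_simps)
  qed
  have "\<bar>\<epsilon> (Suc k) \<omega>\<bar> \<le> \<bar>\<rho>\<bar> * \<bar>\<epsilon> k \<omega>\<bar> + \<bar>V (Suc k) \<omega>\<bar>"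
    using X_step(2)[OF \<omega>, of k] by (simp add: abs_mult[symmetric] abs_triangle_ineq)
  also have "\<dots> \<le> \<bar>\<rho>\<bar> * (E * real k powr (\<kappa> / 2)) + K * real (Suc k) powr (\<kappa> / 2)"
    using step(3) K(2)[of "Suc k"] unfolding E_def[symmetric] by (intro add_mono mult_left_mono) auto
  also have "\<dots> \<le> \<bar>\<rho>\<bar> * (E * real (Suc k) powr (\<kappa> / 2)) + K * real (Suc k) powr (\<kappa> / 2)"
    using E \<kappa> by (intro add_right_mono mult_left_mono powr_mono2) auto
  also have "\<dots> = (\<bar>\<rho>\<bar> * E + K) * real (Suc k) powr (\<kappa> / 2)" by (simp add: algebra_simps)
  also have "\<dots> \<le> E * real (Suc k) powr (\<kappa> / 2)" using E by (intro mult_right_mono) auto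
  finally show ?case unfolding E_def .
qed

text \<open>All coordinates of the regressor at time k are bounded by a multiple of
  \<open>s k\<close>: the outputs by the closed loop equation and the growth of reference and noise,
  the input by the model equation. This is the hypothesis on \<open>r\<close> that closes the loop
  in \<open>closed_loop_path\<close>.\<close>

lemma path_stability:
  assumes \<omega>: "\<omega> \<in> space M"
    and V: "0 \<le> K1" "\<And>k. 1 \<le> k \<Longrightarrow> (V k \<omega>)\<^sup>2 \<le> K1 * real k powr \<kappa>"
    and x: "0 \<le> K2" "\<And>k. 1 \<le> k \<Longrightarrow> (x k \<omega>)\<^sup>2 \<le> K2 * real k powr \<kappa>"
    and A: "1 \<le> A" "\<And>n. 1 \<le> n \<Longrightarrow> (\<Sum>k=1..n. (1 - ratio k \<omega>) * (exc k \<omega>)\<^sup>2) \<le> A * (1 + log_volume (\<Phi> \<omega>) (Suc n))\<^sup>2"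
  shows "\<exists>\<mu> B. 0 < \<mu> \<and> \<mu> < 1 \<and> (\<forall>k\<ge>1. (norm (\<Phi> \<omega> k))\<^sup>2 \<le> B * real k powr \<mu>)"
    and "(\<lambda>n. (\<Sum>k=1..n. (exc k \<omega>)\<^sup>2) / real n) \<longlonglongrightarrow> 0"
proof -
  define m where "m = rec_nat 0 (\<lambda>k mk. max mk ((exc (Suc k) \<omega>)\<^sup>2))"
  have m: "m 0 = 0" "\<And>k. m (Suc k) = max (m k) ((exc (Suc k) \<omega>)\<^sup>2)" by (simp_all add: m_def)
  have m_mono: "m i \<le> m j" if "i \<le> j" for i j
    by (rule lift_Suc_mono_le[of m, OF _ that]) (simp add: m)
  have m0: "0 \<le> m k" for k using m_mono[of 0 k] m by simp
  define s where "s k = sqrt (m (k - 1) + real k powr \<kappa>)" for k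
  have s1: "1 \<le> s k" if "1 \<le> k" for k
  proof -
    have "1 \<le> real k powr \<kappa>" using that \<kappa> by (intro ge_one_powr_ge_zero) auto
    then have "1 \<le> m (k - 1) + real k powr \<kappa>" using m0[of "k - 1"] by linarith
    then show ?thesis by (simp add: s_def)
  qed
  have le_s: "\<bar>y\<bar> \<le> sqrt K * s k" if "y\<^sup>2 \<le> K * real i powr \<kappa>" "0 \<le> K" "i \<le> k" for y K i k
  proof -
    have "real i powr \<kappa> \<le> m (k - 1) + real k powr \<kappa>"
      using that \<kappa> m0[of "k - 1"] by (intro add_increasing powr_mono2) auto
    then have "K * real i powr \<kappa> \<le> K * (m (k - 1) + real k powr \<kappa>)" using that by (intro mult_left_mono)
    then have "y\<^sup>2 \<le> K * (m (k - 1) + real k powr \<kappa>)" using that by linarith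
    then have "sqrt (y\<^sup>2) \<le> sqrt (K * (m (k - 1) + real k powr \<kappa>))" by (rule real_sqrt_le_mono)
    then show ?thesis by (simp add: s_def real_sqrt_mult)
  qed
  have exc_s: "\<bar>exc i \<omega>\<bar> \<le> s k" if "1 \<le> i" "i \<le> k - 1" for i k
  proof -
    have "(exc i \<omega>)\<^sup>2 \<le> m i" using m(2)[of "i - 1"] that by simp
    also have "\<dots> \<le> m (k - 1) + real k powr \<kappa>" using m_mono[OF that(2)] powr_ge_zero[of "real k" \<kappa>] by linarith
    finally have "sqrt ((exc i \<omega>)\<^sup>2) \<le> s k" unfolding s_def by (rule real_sqrt_le_mono)
    then show ?thesis by simp
  qed
  \<comment> \<open>Outputs up to time 1 are not governed by the tracking control, which starts with
    the input at time 1.\<close>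
  define C0 where "C0 = (\<Sum>j\<in>{- int p..1}. \<bar>X j \<omega>\<bar>)"
  have C0: "0 \<le> C0" "\<And>j. j \<in> {- int p..1} \<Longrightarrow> \<bar>X j \<omega>\<bar> \<le> C0"
    unfolding C0_def by (auto intro!: sum_nonneg member_le_sum)
  define c1 where "c1 = 1 + sqrt K1 + sqrt K2 + C0"
  have c1: "0 \<le> c1" using V x C0 by (simp add: c1_def)
  have X_s: "\<bar>X j \<omega>\<bar> \<le> c1 * s k" if j: "- int p \<le> j" "j \<le> int k" and k: "1 \<le> k" for j k
  proof (cases "j \<le> 1")
    case True
    have "\<bar>X j \<omega>\<bar> \<le> C0 * 1" using C0(2)[of j] True j by simp
    also have "\<dots> \<le> c1 * s k" using s1[OF k] C0 V x by (intro mult_mono) (auto simp: c1_def)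
    finally show ?thesis .
  next
    case False
    define i where "i = nat (j - 1)"
    have i: "1 \<le> i" "j = int i + 1" "Suc i \<le> k" using False j by (auto simp: i_def)
    have "X j \<omega> = exc i \<omega> + x (Suc i) \<omega> + V (Suc i) \<omega>" unfolding i(2) by (rule closed_loop[OF i(1) \<omega>])
    then have "\<bar>X j \<omega>\<bar> \<le> \<bar>exc i \<omega>\<bar> + \<bar>x (Suc i) \<omega>\<bar> + \<bar>V (Suc i) \<omega>\<bar>" by linarith
    also have "\<dots> \<le> s k + sqrt K2 * s k + sqrt K1 * s k"
      using i exc_s[of i k] le_s[OF x(2)[of "Suc i"] x(1), of k] le_s[OF V(2)[of "Suc i"] V(1), of k] by (intro add_mono) auto
    also have "\<dots> \<le> c1 * s k" using C0 s1[OF k] by (simp add: c1_def algebra_simps)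
    finally show ?thesis .
  qed
  have V': "\<bar>V k \<omega>\<bar> \<le> sqrt K1 * real k powr (\<kappa> / 2)" if "1 \<le> k" for k
  proof -
    have "sqrt ((V k \<omega>)\<^sup>2) \<le> sqrt (K1 * real k powr \<kappa>)" using V(2)[OF that] by (rule real_sqrt_le_mono)
    then show ?thesis by (simp add: real_sqrt_mult powr_half_sqrt_powr)
  qed
  define E where "E = \<bar>\<epsilon> 0 \<omega>\<bar> + sqrt K1 / (1 - \<bar>\<rho>\<bar>)"
  have E: "0 \<le> E" using \<rho> V by (simp add: E_def)
  have \<epsilon>_s: "\<bar>\<epsilon> k \<omega>\<bar> \<le> E * s k" if k: "1 \<le> k" for k
  proof -
    have "\<bar>\<epsilon> k \<omega>\<bar> \<le> E * real k powr (\<kappa> / 2)"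
      unfolding E_def by (rule \<epsilon>_bound[OF \<omega> _ V' k]) (use V in auto)
    also have "real k powr (\<kappa> / 2) = sqrt (real k powr \<kappa>)" by (simp add: powr_half_sqrt_powr)
    also have "E * \<dots> \<le> E * s k" unfolding s_def using E m0 by (intro mult_left_mono real_sqrt_le_mono) auto
    finally show ?thesis by simp
  qed
  define T where "T = (\<Sum>j=1..p. \<bar>\<theta> j\<bar>)"
  have T: "0 \<le> T" by (simp add: T_def sum_nonneg)
  define c2 where "c2 = c1 * (1 + T) + E"
  have c2: "0 \<le> c2" "c1 \<le> c2" using c1 T E by (auto simp: c2_def algebra_simps)
  \<comment> \<open>The input is recovered from the model. The control law would bring in the
    estimator, for which no bound is available here.\<close>
  have U_s: "\<bar>U (int k - 1) \<omega>\<bar> \<le> c2 * s k" if k: "1 \<le> k" for k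
  proof -
    have "\<bar>\<Sum>j=1..p. \<theta> j * X (int k - int j) \<omega>\<bar> \<le> (\<Sum>j=1..p. \<bar>\<theta> j\<bar> * (c1 * s k))"
      using k by (intro order_trans[OF sum_abs] sum_mono) (auto simp: abs_mult intro!: mult_left_mono X_s)
    also have "\<dots> = T * (c1 * s k)" by (simp add: T_def sum_distrib_right)
    finally have 1: "\<bar>\<Sum>j=1..p. \<theta> j * X (int k - int j) \<omega>\<bar> \<le> T * (c1 * s k)" .
    have "U (int k - 1) \<omega> = X (int k) \<omega> - (\<Sum>j=1..p. \<theta> j * X (int k - int j) \<omega>) - \<epsilon> k \<omega>"
      using noise_state[OF k \<omega>] by simp
    then have "\<bar>U (int k - 1) \<omega>\<bar> \<le> \<bar>X (int k) \<omega>\<bar> + \<bar>\<Sum>j=1..p. \<theta> j * X (int k - int j) \<omega>\<bar> + \<bar>\<epsilon> k \<omega>\<bar>" by linarith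
    also have "\<dots> \<le> c1 * s k + T * (c1 * s k) + E * s k"
      using 1 X_s[of "int k" k] \<epsilon>_s[OF k] k by (intro add_mono) auto
    finally show ?thesis by (simp add: c2_def algebra_simps)
  qed
  have \<Phi>_s: "\<bar>\<Phi> \<omega> k $ i\<bar> \<le> c2 * s k" if k: "1 \<le> k" for k i
  proof (cases "i = l")
    case False
    then have "ix i \<le> p + 1" using ix_props(1) by blast
    then have "\<bar>X (int k - int (ix i) + 1) \<omega>\<bar> \<le> c1 * s k"
      using k ix_props(2)[of i] by (intro X_s) auto
    also have "\<dots> \<le> c2 * s k" using c2 s1[OF k] by (intro mult_right_mono) auto
    finally show ?thesis using False by (simp add: \<Phi>_nth)
  qed (use U_s[OF k] in \<open>simp add: \<Phi>_nth\<close>)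
  define C where "C = max 1 (real CARD('d) * c2\<^sup>2)"
  have \<Phi>_le: "(norm (\<Phi> \<omega> k))\<^sup>2 \<le> C * (m (k - 1) + real k powr \<kappa>)" if k: "1 \<le> k" for k
  proof -
    have s2: "(s k)\<^sup>2 = m (k - 1) + real k powr \<kappa>" using m0 by (simp add: s_def)
    have "(norm (\<Phi> \<omega> k))\<^sup>2 = (\<Sum>i\<in>UNIV. (\<Phi> \<omega> k $ i)\<^sup>2)"
      unfolding power2_norm_eq_inner by (simp add: inner_vec_def power2_eq_square)
    also have "\<dots> \<le> (\<Sum>i\<in>(UNIV :: 'd set). (c2 * s k)\<^sup>2)"
      using \<Phi>_s[OF k] by (intro sum_mono) (metis abs_ge_zero power2_abs power_mono)
    also have "\<dots> = (real CARD('d) * c2\<^sup>2) * (s k)\<^sup>2" by (simp add: power_mult_distrib)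
    also have "\<dots> \<le> C * (s k)\<^sup>2" by (intro mult_right_mono) (auto simp: C_def)
    finally show ?thesis unfolding s2 .
  qed
  interpret closed_loop_path "\<lambda>k. (exc k \<omega>)\<^sup>2" "\<lambda>k. (1 - ratio k \<omega>) * (exc k \<omega>)\<^sup>2" "trace_drop (\<Phi> \<omega>)"
    "\<lambda>n. log_volume (\<Phi> \<omega>) (Suc n)" "\<lambda>k. (norm (\<Phi> \<omega> k))\<^sup>2" m A "real CARD('d)" "ln (fact CARD('d))" "real CARD('d)" C \<kappa>
  proof
    fix k :: nat
    let ?g = "leverage (\<Phi> \<omega>) k"
    have g: "0 \<le> ?g" by (rule leverage_nonneg)
    \<comment> \<open>The squared excitation is \<alpha> (1 + g), and the bound on the leverage
      replaces 1 + g by 2 + \<delta> r.\<close>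
    have "(exc k \<omega>)\<^sup>2 = ((1 - ratio k \<omega>) * (exc k \<omega>)\<^sup>2) * (1 + ?g)" using g by (simp add: ratio(3))
    also have "\<dots> \<le> ((1 - ratio k \<omega>) * (exc k \<omega>)\<^sup>2) * (2 + trace_drop (\<Phi> \<omega>) k * (norm (\<Phi> \<omega> k))\<^sup>2)"
      using leverage_le[of "\<Phi> \<omega>" k] ratio(2)[of k \<omega>] by (intro mult_left_mono) auto
    finally show "(exc k \<omega>)\<^sup>2 \<le> (1 - ratio k \<omega>) * (exc k \<omega>)\<^sup>2 * (2 + trace_drop (\<Phi> \<omega>) k * (norm (\<Phi> \<omega> k))\<^sup>2)" .
    show "0 \<le> (1 - ratio k \<omega>) * (exc k \<omega>)\<^sup>2" using ratio(2)[of k \<omega>] by simp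
    show "log_volume (\<Phi> \<omega>) (Suc k) \<le> ln (fact CARD('d)) + real CARD('d) * ln (1 + (\<Sum>k\<le>k. (norm (\<Phi> \<omega> k))\<^sup>2))"
      using log_volume_le[of "\<Phi> \<omega>" "Suc k"] by (simp add: lessThan_Suc_atMost)
  qed (use A m \<kappa> \<Phi>_le trace_drop_nonneg sum_trace_drop_le log_volume_nonneg in \<open>auto simp: C_def Suc_le_eq\<close>)
  show "\<exists>\<mu> B. 0 < \<mu> \<and> \<mu> < 1 \<and> (\<forall>k\<ge>1. (norm (\<Phi> \<omega> k))\<^sup>2 \<le> B * real k powr \<mu>)"
    "(\<lambda>n. (\<Sum>k=1..n. (exc k \<omega>)\<^sup>2) / real n) \<longlonglongrightarrow> 0"
    using stability by blast+
qed

lemma AE_stability: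
  "AE \<omega> in M. (\<exists>\<mu> B. 0 < \<mu> \<and> \<mu> < 1 \<and> (\<forall>k\<ge>1. (norm (\<Phi> \<omega> k))\<^sup>2 \<le> B * real k powr \<mu>))
     \<and> (\<lambda>n. (\<Sum>k=1..n. (exc k \<omega>)\<^sup>2) / real n) \<longlonglongrightarrow> 0"
  using AE_space AE_V_growth' AE_x_growth AE_sum_excitation
proof eventually_elim
  case (elim \<omega>)
  then obtain K1 K2 A where
    "0 \<le> K1" "\<And>k. 1 \<le> k \<Longrightarrow> (V k \<omega>)\<^sup>2 \<le> K1 * real k powr \<kappa>"
    "0 \<le> K2" "\<And>k. 1 \<le> k \<Longrightarrow> (x k \<omega>)\<^sup>2 \<le> K2 * real k powr \<kappa>"
    "1 \<le> A" "\<And>n. 1 \<le> n \<Longrightarrow> (\<Sum>k=1..n. (1 - ratio k \<omega>) * (exc k \<omega>)\<^sup>2) \<le> A * (1 + log_volume (\<Phi> \<omega>) (Suc n))\<^sup>2"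
    by blast
  from path_stability[OF elim(1) this] show ?case by blast
qed

lemma AE_\<epsilon>_growth: "AE \<omega> in M. \<exists>K\<ge>0. \<forall>k. (\<epsilon> k \<omega>)\<^sup>2 \<le> K * real (Suc k) powr \<kappa>"
  using AE_space AE_V_growth'
proof eventually_elim
  case (elim \<omega>)
  then obtain K1 where K1: "0 \<le> K1" "\<And>k. 1 \<le> k \<Longrightarrow> (V k \<omega>)\<^sup>2 \<le> K1 * real k powr \<kappa>" by blast
  have V': "\<bar>V k \<omega>\<bar> \<le> sqrt K1 * real k powr (\<kappa> / 2)" if "1 \<le> k" for k
  proof -
    have "sqrt ((V k \<omega>)\<^sup>2) \<le> sqrt (K1 * real k powr \<kappa>)" using K1(2)[OF that] by (rule real_sqrt_le_mono)
    then show ?thesis by (simp add: real_sqrt_mult powr_half_sqrt_powr)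
  qed
  define E where "E = \<bar>\<epsilon> 0 \<omega>\<bar> + sqrt K1 / (1 - \<bar>\<rho>\<bar>)"
  have E: "0 \<le> E" "\<bar>\<epsilon> 0 \<omega>\<bar> \<le> E" using \<rho> K1 by (auto simp: E_def)
  have "(\<epsilon> k \<omega>)\<^sup>2 \<le> E\<^sup>2 * real (Suc k) powr \<kappa>" for k
  proof -
    have "\<bar>\<epsilon> k \<omega>\<bar> \<le> E * real (Suc k) powr (\<kappa> / 2)"
    proof (cases "k = 0")
      case False
      then have "\<bar>\<epsilon> k \<omega>\<bar> \<le> E * real k powr (\<kappa> / 2)"
        unfolding E_def by (intro \<epsilon>_bound[OF elim(1) _ V']) (use K1 in auto)
      also have "\<dots> \<le> E * real (Suc k) powr (\<kappa> / 2)" using E \<kappa> by (intro mult_left_mono powr_mono2) auto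
      finally show ?thesis .
    qed (use E in simp)
    then have "\<bar>\<epsilon> k \<omega>\<bar>\<^sup>2 \<le> (E * real (Suc k) powr (\<kappa> / 2))\<^sup>2" by (intro power_mono) auto
    also have "\<dots> = E\<^sup>2 * real (Suc k) powr \<kappa>"
      by (simp add: power_mult_distrib powr_half_sqrt_powr)
    finally show ?thesis by simp
  qed
  then show ?case by (intro exI[of _ "E\<^sup>2"]) auto
qed

end

section \<open>Convergence of the empirical covariance\<close>

text \<open>For k \<le> s the truncated difference is 0 and \<open>g 0 = 0\<close> removes the term.
  These are s + 1 indices, hence the upper limit \<open>n - Suc s\<close>.\<close>

lemma sum_shift_mult:
  fixes g h :: "nat \<Rightarrow> real"
  assumes "g 0 = 0"
  shows "(\<Sum>k<n. g (k - s) * h k) = (\<Sum>m<n - Suc s. g (Suc m) * h (m + Suc s))"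
proof (induction n)
  case (Suc n)
  show ?case
  proof (cases "n \<le> s")
    case True
    then show ?thesis using Suc assms by simp
  next
    case False
    then have "Suc n - Suc s = Suc (n - Suc s)" "n - s = Suc (n - Suc s)" "n - Suc s + Suc s = n" by auto
    then show ?thesis using Suc by simp
  qed
qed simp

lemma sum_shift_truncated:
  fixes h :: "nat \<Rightarrow> real"
  shows "(\<Sum>k<n. h (k - t)) = (\<Sum>m<n - t. h m) + real (min n t) * h 0"
proof (induction n)
  case (Suc n)
  show ?case
  proof (cases "n < t")
    case True
    then have "min (Suc n) t = Suc (min n t)" by simp
    then show ?thesis using Suc True by (simp add: distrib_right)
  next
    case False
    then have "Suc n - t = Suc (n - t)" "min (Suc n) t = min n t" by auto
    then show ?thesis using Suc by simp
  qed
qed simp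

text \<open>Each squared residual occurs in at most p + 1 windows, and a window of length p + 1
  costs another factor p + 1 by Cauchy-Schwarz. The start at p + 2 keeps all window indices at 2 or
  above; the finitely many earlier terms vanish in the average.\<close>

lemma window_average_tendsto_0:
  fixes y r :: "nat \<Rightarrow> real"
  assumes y: "\<And>k. p + 2 \<le> k \<Longrightarrow> \<bar>y k\<bar> \<le> C * (\<Sum>t\<le>p. \<bar>r (k - t)\<bar>)"
    and r: "(\<lambda>n. (\<Sum>k=2..n. (r k)\<^sup>2) / real n) \<longlonglongrightarrow> 0"
  shows "(\<lambda>n. (\<Sum>k<n. (y k)\<^sup>2) / real n) \<longlonglongrightarrow> 0"
proof (rule tendsto_sandwich[OF _ _ tendsto_const])
  define Y where "Y = (\<Sum>k<p + 2. (y k)\<^sup>2)"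
  define D where "D = C\<^sup>2 * real (p + 1)"
  show "\<forall>\<^sub>F n in sequentially. 0 \<le> (\<Sum>k<n. (y k)\<^sup>2) / real n"
    by (intro always_eventually allI divide_nonneg_nonneg sum_nonneg) auto
  have bound: "(\<Sum>k<n. (y k)\<^sup>2) \<le> Y + D * (real (p + 1) * (\<Sum>k=2..n. (r k)\<^sup>2))" for n
  proof -
    have "(\<Sum>k<n. (y k)\<^sup>2) \<le> (\<Sum>k\<in>{..<p + 2} \<union> {p + 2..<n}. (y k)\<^sup>2)"
      by (intro sum_mono2) auto
    also have "\<dots> = Y + (\<Sum>k\<in>{p + 2..<n}. (y k)\<^sup>2)"
      unfolding Y_def by (intro sum.union_disjoint) auto
    also have "(\<Sum>k\<in>{p + 2..<n}. (y k)\<^sup>2) \<le> (\<Sum>k\<in>{p + 2..<n}. D * (\<Sum>t\<le>p. (r (k - t))\<^sup>2))"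
    proof (rule sum_mono)
      fix k assume "k \<in> {p + 2..<n}"
      then have "\<bar>y k\<bar>\<^sup>2 \<le> (C * (\<Sum>t\<le>p. \<bar>r (k - t)\<bar>))\<^sup>2" by (intro power_mono y) auto
      also have "\<dots> = C\<^sup>2 * (\<Sum>t\<le>p. \<bar>r (k - t)\<bar>)\<^sup>2" by (simp add: power_mult_distrib)
      also have "\<dots> \<le> C\<^sup>2 * (real (p + 1) * (\<Sum>t\<le>p. (r (k - t))\<^sup>2))"
        using sum_squared_le_sum_of_squares[of "\<lambda>t. \<bar>r (k - t)\<bar>" "{..p}"]
        by (intro mult_left_mono) (auto simp: mult.commute)
      finally show "(y k)\<^sup>2 \<le> D * (\<Sum>t\<le>p. (r (k - t))\<^sup>2)" by (simp add: D_def mult.assoc)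
    qed
    also have "\<dots> = D * (\<Sum>t\<le>p. \<Sum>k\<in>{p + 2..<n}. (r (k - t))\<^sup>2)"
      by (subst sum.swap) (simp add: sum_distrib_left)
    also have "\<dots> \<le> D * (\<Sum>t\<le>p. \<Sum>k=2..n. (r k)\<^sup>2)"
    proof (intro mult_left_mono sum_mono)
      fix t assume t: "t \<in> {..p}"
      have "(\<Sum>k\<in>{p + 2..<n}. (r (k - t))\<^sup>2) = (\<Sum>k\<in>(\<lambda>k. k - t) ` {p + 2..<n}. (r k)\<^sup>2)"
        by (subst sum.reindex) (use t in \<open>auto simp: inj_on_def\<close>)
      also have "\<dots> \<le> (\<Sum>k=2..n. (r k)\<^sup>2)"
        by (rule sum_mono2) (use t in auto)
      finally show "(\<Sum>k\<in>{p + 2..<n}. (r (k - t))\<^sup>2) \<le> (\<Sum>k=2..n. (r k)\<^sup>2)" .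
    qed (simp add: D_def)
    finally show ?thesis by simp
  qed
  show "\<forall>\<^sub>F n in sequentially. (\<Sum>k<n. (y k)\<^sup>2) / real n \<le> Y / real n + D * real (p + 1) * ((\<Sum>k=2..n. (r k)\<^sup>2) / real n)"
  proof (rule always_eventually, rule allI)
    fix n
    have "(\<Sum>k<n. (y k)\<^sup>2) / real n \<le> (Y + D * (real (p + 1) * (\<Sum>k=2..n. (r k)\<^sup>2))) / real n"
      by (rule divide_right_mono[OF bound]) simp
    then show "(\<Sum>k<n. (y k)\<^sup>2) / real n \<le> Y / real n + D * real (p + 1) * ((\<Sum>k=2..n. (r k)\<^sup>2) / real n)"
      by (simp add: add_divide_distrib mult.assoc)
  qed
  have "(\<lambda>n. Y / real n + D * real (p + 1) * ((\<Sum>k=2..n. (r k)\<^sup>2) / real n)) \<longlonglongrightarrow> 0 + D * real (p + 1) * 0"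
    by (intro tendsto_add tendsto_mult tendsto_const r lim_const_over_n)
  then show "(\<lambda>n. Y / real n + D * real (p + 1) * ((\<Sum>k=2..n. (r k)\<^sup>2) / real n)) \<longlonglongrightarrow> 0" by simp
qed

lemma (in prob_space) tends_in_prob_deterministic:
  assumes "z \<longlonglongrightarrow> c"
  shows "tends_in_prob M (\<lambda>n \<omega>. z n) (c :: real)"
  by (rule tends_in_prob_AE) (use assms in auto)

lemma shifted_ratio_tendsto_1: "(\<lambda>n. real (n - t) / real n) \<longlonglongrightarrow> 1"
proof -
  have "(\<lambda>n. 1 - real t / real n) \<longlonglongrightarrow> 1 - 0"
    by (intro tendsto_diff tendsto_const lim_const_over_n)
  then have "(\<lambda>n. 1 - real t / real n) \<longlonglongrightarrow> 1" by simp
  then show ?thesis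
  proof (rule Lim_transform_eventually)
    show "\<forall>\<^sub>F n in sequentially. 1 - real t / real n = real (n - t) / real n"
      using eventually_ge_at_top[of "Suc t"] by eventually_elim (auto simp: field_simps of_nat_diff)
  qed
qed

context adaptive_arx
begin

text \<open>With the weights Y / n the sum of squares is of order n^(\<kappa> - 1), which tends to 0
  because \<kappa> < 1. Only the growth of \<open>Y\<close> along paths enters, no moments.\<close>

lemma cross_LLN:
  assumes Y: "\<And>m. Y m \<in> borel_measurable (F m)"
    and growth: "AE \<omega> in M. \<exists>K\<ge>0. \<forall>m. (Y m \<omega>)\<^sup>2 \<le> K * real (Suc m) powr \<kappa>"
  shows "tends_in_prob M (\<lambda>n \<omega>. (\<Sum>m<n - s. Y m \<omega> * V (Suc m) \<omega>) / real n) (0 :: real)"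
proof -
  define W where "W n m \<omega> = (if m < n - s then Y m \<omega> / real n else 0)" for n m \<omega>
  have W_F: "W n m \<in> borel_measurable (F m)" for n m
    unfolding W_def using Y[of m] by (cases "m < n - s") auto
  have [measurable]: "W n m \<in> borel_measurable M" for n m by (rule measurable_F_M[OF W_F])
  have "AE \<omega> in M. (\<lambda>n. \<Sum>m<n. (W n m \<omega>)\<^sup>2) \<longlonglongrightarrow> 0"
    using growth
  proof eventually_elim
    case (elim \<omega>)
    then obtain K where K: "0 \<le> K" "\<And>m. (Y m \<omega>)\<^sup>2 \<le> K * real (Suc m) powr \<kappa>" by blast
    show ?case
    proof (rule tendsto_sandwich[OF _ _ tendsto_const])
      show "\<forall>\<^sub>F n in sequentially. 0 \<le> (\<Sum>m<n. (W n m \<omega>)\<^sup>2)"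
        by (intro always_eventually allI sum_nonneg) auto
      show "\<forall>\<^sub>F n in sequentially. (\<Sum>m<n. (W n m \<omega>)\<^sup>2) \<le> K * real n powr (\<kappa> - 1)"
        using eventually_ge_at_top[of 1]
      proof eventually_elim
        case (elim n)
        have "(\<Sum>m<n. (W n m \<omega>)\<^sup>2) \<le> (\<Sum>m<n. K * real n powr \<kappa> / (real n)\<^sup>2)"
        proof (rule sum_mono)
          fix m assume m: "m \<in> {..<n}"
          have "(W n m \<omega>)\<^sup>2 \<le> (Y m \<omega>)\<^sup>2 / (real n)\<^sup>2" by (simp add: W_def power_divide)
          also have "\<dots> \<le> (K * real n powr \<kappa>) / (real n)\<^sup>2"
            using m K \<kappa> by (intro divide_right_mono order_trans[OF K(2)] mult_left_mono powr_mono2) auto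
          finally show "(W n m \<omega>)\<^sup>2 \<le> K * real n powr \<kappa> / (real n)\<^sup>2" .
        qed
        also have "\<dots> = K * (real n powr \<kappa> / real n)" using elim by (simp add: power2_eq_square)
        also have "\<dots> = K * real n powr (\<kappa> - 1)" using elim by (simp add: powr_diff)
        finally show ?case .
      qed
      show "(\<lambda>n. K * real n powr (\<kappa> - 1)) \<longlonglongrightarrow> 0"
        using \<kappa> by (intro tendsto_mult_right_zero tendsto_neg_powr filterlim_real_sequentially) auto
    qed
  qed
  then have "tends_in_prob M (\<lambda>n \<omega>. \<Sum>m<n. (W n m \<omega>)\<^sup>2) 0"
    by (intro tends_in_prob_AE) measurable
  from transform_tends_in_prob_0[OF W_F this]
  have "tends_in_prob M (\<lambda>n \<omega>. \<Sum>m<n. W n m \<omega> * V (Suc m) \<omega>) 0" .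
  moreover have "(\<Sum>m<n. W n m \<omega> * V (Suc m) \<omega>) = (\<Sum>m<n - s. Y m \<omega> * V (Suc m) \<omega>) / real n" for n \<omega>
  proof -
    have "(\<Sum>m<n. W n m \<omega> * V (Suc m) \<omega>) = (\<Sum>m<n - s. W n m \<omega> * V (Suc m) \<omega>)"
      by (rule sum.mono_neutral_right) (auto simp: W_def)
    also have "\<dots> = (\<Sum>m<n - s. Y m \<omega> * V (Suc m) \<omega>) / real n"
      unfolding sum_divide_distrib by (intro sum.cong) (auto simp: W_def)
    finally show ?thesis .
  qed
  ultimately show ?thesis by simp
qed

text \<open>
  Nothing is known about \<open>V 0\<close>, and truncated subtraction sends \<open>k - j\<close> to \<open>0\<close> for small \<open>k\<close>.
\<close>

definition Vz :: "nat \<Rightarrow> 'a \<Rightarrow> real" where "Vz k \<omega> = (if k = 0 then 0 else V k \<omega>)"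

lemma Vz_F: "k \<le> n \<Longrightarrow> Vz k \<in> borel_measurable (F n)"
  using measurable_F_mono[OF V_F[of "k - 1"], of n] by (cases "k = 0") (auto simp: Vz_def[abs_def])

lemma \<epsilon>_F': "k \<le> n \<Longrightarrow> \<epsilon> k \<in> borel_measurable (F n)"
  by (rule measurable_F_mono[OF \<epsilon>_F])

lemma AE_Vz_growth: "AE \<omega> in M. \<exists>K\<ge>0. \<forall>k. (Vz k \<omega>)\<^sup>2 \<le> K * real (Suc k) powr \<kappa>"
  using AE_V_growth'
proof eventually_elim
  case (elim \<omega>)
  then obtain K where K: "0 \<le> K" "\<And>k. 1 \<le> k \<Longrightarrow> (V k \<omega>)\<^sup>2 \<le> K * real k powr \<kappa>" by blast
  have "(Vz k \<omega>)\<^sup>2 \<le> K * real (Suc k) powr \<kappa>" for k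
  proof (cases "k = 0")
    case False
    then have "(Vz k \<omega>)\<^sup>2 \<le> K * real k powr \<kappa>" using K(2)[of k] by (simp add: Vz_def)
    also have "\<dots> \<le> K * real (Suc k) powr \<kappa>" using K \<kappa> by (intro mult_left_mono powr_mono2) auto
    finally show ?thesis .
  qed (use K in \<open>simp add: Vz_def\<close>)
  with K(1) show ?case by blast
qed

lemma growth_delayed:
  assumes "AE \<omega> in M. \<exists>K\<ge>0. \<forall>k. (Y k \<omega>)\<^sup>2 \<le> K * real (Suc k) powr \<kappa>" "\<And>m. d m \<le> m"
  shows "AE \<omega> in M. \<exists>K\<ge>0. \<forall>m. ((Y (d m) \<omega>)\<^sup>2 :: real) \<le> K * real (Suc m) powr \<kappa>"
  using assms(1)
proof eventually_elim
  case (elim \<omega>)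
  then obtain K where K: "0 \<le> K" "\<And>k. (Y k \<omega>)\<^sup>2 \<le> K * real (Suc k) powr \<kappa>" by blast
  have "(Y (d m) \<omega>)\<^sup>2 \<le> K * real (Suc m) powr \<kappa>" for m
    using K \<kappa> assms(2)[of m] by (intro order_trans[OF K(2)] mult_left_mono powr_mono2) auto
  with K(1) show ?case by blast
qed

lemma AE_\<epsilon>_square_negligible: "AE \<omega> in M. (\<lambda>n. ((\<epsilon> n \<omega>)\<^sup>2 - (\<epsilon> 0 \<omega>)\<^sup>2) / real n) \<longlonglongrightarrow> 0"
  using AE_\<epsilon>_growth
proof eventually_elim
  case (elim \<omega>)
  then obtain K where K: "0 \<le> K" "\<And>k. (\<epsilon> k \<omega>)\<^sup>2 \<le> K * real (Suc k) powr \<kappa>" by blast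
  have lim: "(\<lambda>n. (\<epsilon> n \<omega>)\<^sup>2 / real n) \<longlonglongrightarrow> 0"
  proof (rule tendsto_sandwich[OF _ _ tendsto_const])
    show "\<forall>\<^sub>F n in sequentially. 0 \<le> (\<epsilon> n \<omega>)\<^sup>2 / real n" by simp
    show "\<forall>\<^sub>F n in sequentially. (\<epsilon> n \<omega>)\<^sup>2 / real n \<le> 2 * K * real (Suc n) powr (\<kappa> - 1)"
      using eventually_ge_at_top[of 1]
    proof eventually_elim
      case (elim n)
      have "(\<epsilon> n \<omega>)\<^sup>2 / real n \<le> (K * real (Suc n) powr \<kappa>) / (real (Suc n) / 2)"
        using elim K by (intro frac_le K(2)) auto
      also have "\<dots> = 2 * K * real (Suc n) powr (\<kappa> - 1)" by (simp add: powr_diff)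
      finally show ?case .
    qed
    have "(\<lambda>n. real (Suc n) powr (\<kappa> - 1)) \<longlonglongrightarrow> 0"
      using \<kappa> by (intro tendsto_neg_powr filterlim_compose[OF filterlim_real_sequentially] filterlim_Suc) auto
    then show "(\<lambda>n. 2 * K * real (Suc n) powr (\<kappa> - 1)) \<longlonglongrightarrow> 0" by (rule tendsto_mult_right_zero)
  qed
  have "(\<lambda>n. (\<epsilon> n \<omega>)\<^sup>2 / real n - (\<epsilon> 0 \<omega>)\<^sup>2 / real n) \<longlonglongrightarrow> 0 - 0"
    by (intro tendsto_diff lim lim_const_over_n)
  then show ?case by (simp add: diff_divide_distrib)
qed

text \<open>Squaring the autoregression and summing expresses (1 - \<rho>^2) times the sum of the
  \<epsilon>^2 by the squared noise, a martingale transform and a boundary term. No stationarity is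
  involved.\<close>

lemma noise_state_LLN: "tends_in_prob M (\<lambda>n \<omega>. (\<Sum>k<n. (\<epsilon> k \<omega>)\<^sup>2) / real n) (\<sigma>\<^sup>2 / (1 - \<rho>\<^sup>2))"
proof -
  have \<rho>2: "\<rho>\<^sup>2 < 1" using \<rho> by (simp add: abs_square_less_1)
  have c: "tends_in_prob M (\<lambda>n \<omega>. (\<Sum>m<n - 0. \<epsilon> m \<omega> * V (Suc m) \<omega>) / real n) 0"
    by (rule cross_LLN[OF \<epsilon>_F AE_\<epsilon>_growth])
  have [measurable]: "\<epsilon> n \<in> borel_measurable M" for n by (rule measurable_F_M[OF \<epsilon>_F])
  have e: "tends_in_prob M (\<lambda>n \<omega>. ((\<epsilon> n \<omega>)\<^sup>2 - (\<epsilon> 0 \<omega>)\<^sup>2) / real n) 0"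
    by (rule tends_in_prob_AE[OF _ AE_\<epsilon>_square_negligible]) measurable
  have id: "(\<Sum>k<n. (\<epsilon> k \<omega>)\<^sup>2) / real n = (1 / (1 - \<rho>\<^sup>2)) * (2 * \<rho> * ((\<Sum>m<n - 0. \<epsilon> m \<omega> * V (Suc m) \<omega>) / real n)
      + (\<Sum>k<n. (V (Suc k) \<omega>)\<^sup>2) / real n + (- 1) * (((\<epsilon> n \<omega>)\<^sup>2 - (\<epsilon> 0 \<omega>)\<^sup>2) / real n))" if \<omega>: "\<omega> \<in> space M" for n \<omega>
  proof -
    have "(\<Sum>k<n. (\<epsilon> (Suc k) \<omega>)\<^sup>2) = \<rho>\<^sup>2 * (\<Sum>k<n. (\<epsilon> k \<omega>)\<^sup>2) + 2 * \<rho> * (\<Sum>k<n. \<epsilon> k \<omega> * V (Suc k) \<omega>) + (\<Sum>k<n. (V (Suc k) \<omega>)\<^sup>2)"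
      unfolding X_step(2)[OF \<omega>]
      by (simp add: power2_sum sum.distrib sum_distrib_left power_mult_distrib algebra_simps)
    moreover have "(\<Sum>k<n. (\<epsilon> (Suc k) \<omega>)\<^sup>2) = (\<Sum>k<n. (\<epsilon> k \<omega>)\<^sup>2) + ((\<epsilon> n \<omega>)\<^sup>2 - (\<epsilon> 0 \<omega>)\<^sup>2)"
      by (induction n) auto
    ultimately have "(1 - \<rho>\<^sup>2) * (\<Sum>k<n. (\<epsilon> k \<omega>)\<^sup>2) = 2 * \<rho> * (\<Sum>k<n. \<epsilon> k \<omega> * V (Suc k) \<omega>) + (\<Sum>k<n. (V (Suc k) \<omega>)\<^sup>2) - ((\<epsilon> n \<omega>)\<^sup>2 - (\<epsilon> 0 \<omega>)\<^sup>2)"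
      by (simp add: algebra_simps)
    then have "(\<Sum>k<n. (\<epsilon> k \<omega>)\<^sup>2) = (1 / (1 - \<rho>\<^sup>2)) * (2 * \<rho> * (\<Sum>k<n. \<epsilon> k \<omega> * V (Suc k) \<omega>) + (\<Sum>k<n. (V (Suc k) \<omega>)\<^sup>2) - ((\<epsilon> n \<omega>)\<^sup>2 - (\<epsilon> 0 \<omega>)\<^sup>2))"
      using \<rho>2 by (simp add: eq_divide_eq mult.commute)
    note id = this
    have alg: "c * (r * (a / d) + b / d + (- 1) * (e / d)) = (c * (r * a + b - e)) / d" for c r a b e d :: real
      by (simp add: add_divide_distrib diff_divide_distrib right_diff_distrib distrib_left)
    show ?thesis
      unfolding alg minus_nat.diff_0 by (rule arg_cong[where f = "\<lambda>x. x / real n", OF id])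
  qed
  have "tends_in_prob M (\<lambda>n \<omega>. (1 / (1 - \<rho>\<^sup>2)) * (2 * \<rho> * ((\<Sum>m<n - 0. \<epsilon> m \<omega> * V (Suc m) \<omega>) / real n)
      + (\<Sum>k<n. (V (Suc k) \<omega>)\<^sup>2) / real n + (- 1) * (((\<epsilon> n \<omega>)\<^sup>2 - (\<epsilon> 0 \<omega>)\<^sup>2) / real n))) ((1 / (1 - \<rho>\<^sup>2)) * (2 * \<rho> * 0 + \<sigma>\<^sup>2 + (- 1) * 0))"
    by (intro tends_in_prob_cmult tends_in_prob_add c e noise_square_LLN)
  then show ?thesis
    using tends_in_prob_cong[OF id] by simp
qed

text \<open>Index 0 is the remote noise state, index j \<ge> 1 the noise j - 1 steps back. These p +
  2 sequences are asymptotically uncorrelated, so the empirical variance of a linear combination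
  tends to a weighted sum of squared coefficients.\<close>

definition \<zeta> :: "nat \<Rightarrow> nat \<Rightarrow> 'a \<Rightarrow> real" where
  "\<zeta> j k \<omega> = (if j = 0 then \<epsilon> (k - (p + 1)) \<omega> else Vz (k - (j - 1)) \<omega>)"

definition \<zeta>_cov :: "nat \<Rightarrow> nat \<Rightarrow> real" where
  "\<zeta>_cov i j = (if i \<noteq> j then 0 else if i = 0 then \<sigma>\<^sup>2 / (1 - \<rho>\<^sup>2) else \<sigma>\<^sup>2)"

lemma filterlim_diff_const: "filterlim (\<lambda>n. n - t :: nat) at_top sequentially"
  unfolding filterlim_at_top
proof
  show "\<forall>\<^sub>F n in sequentially. z \<le> n - t" for z
    using eventually_ge_at_top[of "z + t"] by eventually_elim simp
qed

lemma tends_in_prob_shift: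
  assumes "tends_in_prob M (\<lambda>n \<omega>. (S n \<omega> :: real) / real n) c" "\<And>\<omega>. S 0 \<omega> = 0"
  shows "tends_in_prob M (\<lambda>n \<omega>. S (n - t) \<omega> / real n) c"
proof -
  have "tends_in_prob M (\<lambda>n \<omega>. S (n - t) \<omega> / real (n - t) * (real (n - t) / real n)) (c * 1)"
    by (intro tends_in_prob_mult tends_in_prob_subseq[OF assms(1) filterlim_diff_const]
        tends_in_prob_deterministic shifted_ratio_tendsto_1)
  moreover have "S (n - t) \<omega> / real (n - t) * (real (n - t) / real n) = S (n - t) \<omega> / real n" for n \<omega>
    using assms(2) by (cases "n \<le> t") auto
  ultimately show ?thesis by (simp only: mult_1_right)
qed

text \<open>Indexed by the time of the noise factor with index \<open>i\<close>, the sum is a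
  martingale transform, because the other factor is at least one step older: this is i < j between
  noises and i \<le> p + 1 against the noise state.\<close>

lemma \<zeta>_LLN_cross:
  assumes "1 \<le> i" "i < j \<or> j = 0" "i \<le> p + 1"
  shows "tends_in_prob M (\<lambda>n \<omega>. (\<Sum>k<n. \<zeta> i k \<omega> * \<zeta> j k \<omega>) / real n) 0"
proof -
  define Y where "Y m \<omega> = \<zeta> j (m + i) \<omega>" for m \<omega>
  have "(\<Sum>k<n. \<zeta> i k \<omega> * \<zeta> j k \<omega>) = (\<Sum>m<n - i. Y m \<omega> * V (Suc m) \<omega>)" for n \<omega>
  proof -
    have "(\<Sum>k<n. \<zeta> i k \<omega> * \<zeta> j k \<omega>) = (\<Sum>k<n. Vz (k - (i - 1)) \<omega> * \<zeta> j k \<omega>)"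
      using assms(1) by (simp add: \<zeta>_def)
    also have "\<dots> = (\<Sum>m<n - Suc (i - 1). Vz (Suc m) \<omega> * \<zeta> j (m + Suc (i - 1)) \<omega>)"
      by (rule sum_shift_mult) (simp add: Vz_def)
    also have "\<dots> = (\<Sum>m<n - i. Y m \<omega> * V (Suc m) \<omega>)"
      using assms(1) by (simp add: Y_def Vz_def mult.commute)
    finally show ?thesis .
  qed
  moreover have "tends_in_prob M (\<lambda>n \<omega>. (\<Sum>m<n - i. Y m \<omega> * V (Suc m) \<omega>) / real n) 0"
  proof (cases "j = 0")
    case True
    have Y: "Y m \<omega> = \<epsilon> (m + i - (p + 1)) \<omega>" for m \<omega> using True by (simp add: Y_def \<zeta>_def)
    show ?thesis
      unfolding Y by (rule cross_LLN[OF \<epsilon>_F' growth_delayed[OF AE_\<epsilon>_growth]]) (use assms in auto)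
  next
    case False
    have Y: "Y m \<omega> = Vz (m + i - (j - 1)) \<omega>" for m \<omega> using False by (simp add: Y_def \<zeta>_def)
    show ?thesis
      unfolding Y by (rule cross_LLN[OF Vz_F growth_delayed[OF AE_Vz_growth]]) (use assms False in auto)
  qed
  ultimately show ?thesis by simp
qed

lemma \<zeta>_LLN:
  assumes "i \<le> p + 1" "j \<le> p + 1"
  shows "tends_in_prob M (\<lambda>n \<omega>. (\<Sum>k<n. \<zeta> i k \<omega> * \<zeta> j k \<omega>) / real n) (\<zeta>_cov i j)"
proof -
  consider "i = 0" "j = 0" | "i = j" "1 \<le> i" | "1 \<le> i" "i < j \<or> j = 0" | "1 \<le> j" "j < i \<or> i = 0"
    by linarith
  then show ?thesis
  proof cases
    case 1
    have [measurable]: "\<epsilon> 0 \<in> borel_measurable M" by (rule measurable_F_M[OF \<epsilon>_F])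
    have "tends_in_prob M (\<lambda>n \<omega>. (\<Sum>k<n - (p + 1). (\<epsilon> k \<omega>)\<^sup>2) / real n + real (min n (p + 1)) * (\<epsilon> 0 \<omega>)\<^sup>2 / real n) (\<sigma>\<^sup>2 / (1 - \<rho>\<^sup>2) + 0)"
    proof (rule tends_in_prob_add[OF tends_in_prob_shift[OF noise_state_LLN] tends_in_prob_AE])
      show "AE \<omega> in M. (\<lambda>n. real (min n (p + 1)) * (\<epsilon> 0 \<omega>)\<^sup>2 / real n) \<longlonglongrightarrow> 0"
      proof (rule AE_I2)
        fix \<omega>
        have "(\<lambda>n. real (p + 1) * (\<epsilon> 0 \<omega>)\<^sup>2 / real n) \<longlonglongrightarrow> 0" by (rule lim_const_over_n)
        then show "(\<lambda>n. real (min n (p + 1)) * (\<epsilon> 0 \<omega>)\<^sup>2 / real n) \<longlonglongrightarrow> 0"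
        proof (rule Lim_transform_eventually)
          show "\<forall>\<^sub>F n in sequentially. real (p + 1) * (\<epsilon> 0 \<omega>)\<^sup>2 / real n = real (min n (p + 1)) * (\<epsilon> 0 \<omega>)\<^sup>2 / real n"
            using eventually_ge_at_top[of "p + 1"] by eventually_elim (simp add: min_absorb2)
        qed
      qed
    qed auto
    moreover have "(\<Sum>k<n. \<zeta> i k \<omega> * \<zeta> j k \<omega>) = (\<Sum>k<n - (p + 1). (\<epsilon> k \<omega>)\<^sup>2) + real (min n (p + 1)) * (\<epsilon> 0 \<omega>)\<^sup>2" for n \<omega>
      using 1 sum_shift_truncated[of "\<lambda>k. (\<epsilon> k \<omega>)\<^sup>2" "p + 1" n] by (simp add: \<zeta>_def power2_eq_square)
    ultimately show ?thesis using 1 by (simp only: add_divide_distrib) (simp add: \<zeta>_cov_def)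
  next
    case 2
    have "(\<Sum>k<n. \<zeta> i k \<omega> * \<zeta> j k \<omega>) = (\<Sum>m<n - i. (V (Suc m) \<omega>)\<^sup>2)" for n \<omega>
    proof -
      have "(\<Sum>k<n. \<zeta> i k \<omega> * \<zeta> j k \<omega>) = (\<Sum>k<n. Vz (k - (i - 1)) \<omega> * Vz (k - (i - 1)) \<omega>)"
        using 2 by (simp add: \<zeta>_def)
      also have "\<dots> = (\<Sum>m<n - Suc (i - 1). Vz (Suc m) \<omega> * Vz (m + Suc (i - 1) - (i - 1)) \<omega>)"
        by (rule sum_shift_mult[of "\<lambda>k. Vz k \<omega>" "i - 1" "\<lambda>k. Vz (k - (i - 1)) \<omega>"]) (simp add: Vz_def)
      also have "\<dots> = (\<Sum>m<n - i. (V (Suc m) \<omega>)\<^sup>2)"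
        using 2 by (intro sum.cong) (auto simp: Vz_def power2_eq_square Suc_diff_le)
      finally show ?thesis .
    qed
    then show ?thesis
      using tends_in_prob_shift[OF noise_square_LLN, of i] 2 by (simp add: \<zeta>_cov_def)
  next
    case 3
    then show ?thesis using \<zeta>_LLN_cross[of i j] assms by (auto simp: \<zeta>_cov_def)
  next
    case 4
    then show ?thesis using \<zeta>_LLN_cross[of j i] assms by (auto simp: \<zeta>_cov_def mult.commute)
  qed
qed

text \<open>Coordinate j of the regressor contributes the noise j - 1 steps back directly; the
  entries of K and the power of \<rho> come from the expansion of the past input in
  \<open>input_expand\<close>.\<close>

definition coef :: "real ^ 'd \<Rightarrow> nat \<Rightarrow> real" where
  "coef u j = (if j = 0 then - (\<rho> ^ (p + 1)) * u $ l else u $ inv ix j + K_row \<theta> \<rho> j * u $ l)"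

definition \<Psi> :: "real ^ 'd \<Rightarrow> nat \<Rightarrow> 'a \<Rightarrow> real" where
  "\<Psi> u k \<omega> = (\<Sum>j\<le>p + 1. coef u j * \<zeta> j k \<omega>)"

lemma \<Psi>_LLN: "tends_in_prob M (\<lambda>n \<omega>. (\<Sum>k<n. (\<Psi> u k \<omega>)\<^sup>2) / real n) (\<sigma>\<^sup>2 * (u \<bullet> (Lambda p ix \<theta> \<rho> *v u)))"
proof -
  have "tends_in_prob M (\<lambda>n \<omega>. \<Sum>i\<le>p + 1. \<Sum>j\<le>p + 1. (coef u i * coef u j) * ((\<Sum>k<n. \<zeta> i k \<omega> * \<zeta> j k \<omega>) / real n))
      (\<Sum>i\<le>p + 1. \<Sum>j\<le>p + 1. (coef u i * coef u j) * \<zeta>_cov i j)"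
    by (intro tends_in_prob_sum tends_in_prob_cmult \<zeta>_LLN) auto
  moreover have "(\<Sum>k<n. (\<Psi> u k \<omega>)\<^sup>2) / real n = (\<Sum>i\<le>p + 1. \<Sum>j\<le>p + 1. (coef u i * coef u j) * ((\<Sum>k<n. \<zeta> i k \<omega> * \<zeta> j k \<omega>) / real n))" for n \<omega>
  proof -
    have "(\<Sum>k<n. (\<Psi> u k \<omega>)\<^sup>2) = (\<Sum>k<n. \<Sum>i\<le>p + 1. \<Sum>j\<le>p + 1. (coef u i * coef u j) * (\<zeta> i k \<omega> * \<zeta> j k \<omega>))"
      unfolding \<Psi>_def power2_eq_square sum_product by (intro sum.cong refl) (simp only: mult_ac)
    also have "\<dots> = (\<Sum>i\<le>p + 1. \<Sum>k<n. \<Sum>j\<le>p + 1. (coef u i * coef u j) * (\<zeta> i k \<omega> * \<zeta> j k \<omega>))"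
      by (rule sum.swap)
    also have "\<dots> = (\<Sum>i\<le>p + 1. \<Sum>j\<le>p + 1. \<Sum>k<n. (coef u i * coef u j) * (\<zeta> i k \<omega> * \<zeta> j k \<omega>))"
      by (intro sum.cong refl sum.swap)
    finally show ?thesis
      by (simp only: sum_divide_distrib sum_distrib_left times_divide_eq_right)
  qed
  moreover have "(\<Sum>i\<le>p + 1. \<Sum>j\<le>p + 1. (coef u i * coef u j) * \<zeta>_cov i j) = \<sigma>\<^sup>2 * (u \<bullet> (Lambda p ix \<theta> \<rho> *v u))"
  proof -
    have "(\<Sum>i\<le>p + 1. \<Sum>j\<le>p + 1. (coef u i * coef u j) * \<zeta>_cov i j) = (\<Sum>i\<le>p + 1. (coef u i)\<^sup>2 * \<zeta>_cov i i)"
    proof (rule sum.cong[OF refl])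
      fix i assume i: "i \<in> {..p + 1}"
      have "(\<Sum>j\<le>p + 1. (coef u i * coef u j) * \<zeta>_cov i j) = (\<Sum>j\<in>{i}. (coef u i * coef u j) * \<zeta>_cov i j)"
        using i by (intro sum.mono_neutral_right) (auto simp: \<zeta>_cov_def)
      then show "(\<Sum>j\<le>p + 1. (coef u i * coef u j) * \<zeta>_cov i j) = (coef u i)\<^sup>2 * \<zeta>_cov i i" by (simp add: power2_eq_square)
    qed
    also have "\<dots> = (\<Sum>i\<in>insert 0 {1..p + 1}. (coef u i)\<^sup>2 * \<zeta>_cov i i)"
      by (intro sum.cong) auto
    also have "(\<Sum>i\<in>insert 0 {1..p + 1}. (coef u i)\<^sup>2 * \<zeta>_cov i i) = (coef u 0)\<^sup>2 * (\<sigma>\<^sup>2 / (1 - \<rho>\<^sup>2)) + (\<Sum>i=1..p + 1. (coef u i)\<^sup>2 * \<sigma>\<^sup>2)"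
      by (subst sum.insert) (auto simp: \<zeta>_cov_def intro!: sum.cong)
    also have "(\<Sum>i=1..p + 1. (coef u i)\<^sup>2 * \<sigma>\<^sup>2) = \<sigma>\<^sup>2 * (\<Sum>i=1..p + 1. (coef u i)\<^sup>2)"
      by (simp only: sum_distrib_left mult.commute)
    also have "(\<Sum>i=1..p + 1. (coef u i)\<^sup>2) = (\<Sum>i\<in>UNIV - {l}. (coef u (ix i))\<^sup>2)"
      by (rule sum_ix[OF ix \<rho>, symmetric])
    also have "\<dots> = (\<Sum>i\<in>UNIV - {l}. (u $ i + K_row \<theta> \<rho> (ix i) * u $ l)\<^sup>2)"
    proof (rule sum.cong[OF refl])
      fix i
      have "inj ix" using ix by (simp add: bij_betw_def)
      then show "(coef u (ix i))\<^sup>2 = (u $ i + K_row \<theta> \<rho> (ix i) * u $ l)\<^sup>2"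
        using ix_props(2)[of i] by (simp add: coef_def)
    qed
    also have "(coef u 0)\<^sup>2 * (\<sigma>\<^sup>2 / (1 - \<rho>\<^sup>2)) + \<sigma>\<^sup>2 * (\<Sum>i\<in>UNIV - {l}. (u $ i + K_row \<theta> \<rho> (ix i) * u $ l)\<^sup>2)
        = \<sigma>\<^sup>2 * (u \<bullet> (Lambda p ix \<theta> \<rho> *v u))"
      unfolding Lambda_quadratic[OF ix \<rho>]
      by (simp add: coef_def S_const_def power_mult_distrib algebra_simps flip: power_mult)
    finally show ?thesis .
  qed
  ultimately show ?thesis by (simp only:)
qed

text \<open>From time 2 on the closed loop makes this the excitation error one step earlier plus the
  reference, the part of the output that is negligible in quadratic mean.\<close>

definition resid :: "nat \<Rightarrow> 'a \<Rightarrow> real" where "resid j \<omega> = X (int j) \<omega> - V j \<omega>"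

lemma \<epsilon>_expand: "t \<le> k \<Longrightarrow> \<omega> \<in> space M \<Longrightarrow> \<epsilon> k \<omega> = (\<Sum>j<t. \<rho> ^ j * V (k - j) \<omega>) + \<rho> ^ t * \<epsilon> (k - t) \<omega>"
proof (induction t)
  case (Suc t)
  then have "k - t = Suc (k - Suc t)" by simp
  then have "\<epsilon> (k - t) \<omega> = \<rho> * \<epsilon> (k - Suc t) \<omega> + V (k - t) \<omega>" using X_step(2)[OF Suc.prems(2), of "k - Suc t"] by simp
  with Suc show ?case by (simp add: algebra_simps)
qed simp

text \<open>The model gives the past input through outputs and \<epsilon>_k. Unrolling \<epsilon>_k
  by p + 1 steps pairs \<rho>^j V_(k-j) with \<theta>_j V_(k-j), the origin of the entries
  \<theta>_j + \<rho>^j of K. The current noise cancels between X_k and \<epsilon>_k, whence the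
  leading 0.\<close>

lemma input_expand:
  assumes k: "p + 2 \<le> k" and \<omega>: "\<omega> \<in> space M"
  shows "U (int k - 1) \<omega> = (\<Sum>j=1..p + 1. K_row \<theta> \<rho> j * Vz (k - (j - 1)) \<omega>) - \<rho> ^ (p + 1) * \<epsilon> (k - (p + 1)) \<omega>
     + (resid k \<omega> - (\<Sum>j=1..p. \<theta> j * resid (k - j) \<omega>))"
proof -
  have X: "X (int k - int j) \<omega> = V (k - j) \<omega> + resid (k - j) \<omega>" if "j \<le> p" for j
    using k that by (simp add: resid_def of_nat_diff)
  have "\<epsilon> k \<omega> = (\<Sum>j<Suc p. \<rho> ^ j * V (k - j) \<omega>) + \<rho> ^ (p + 1) * \<epsilon> (k - (p + 1)) \<omega>"
    using \<epsilon>_expand[of "p + 1" k \<omega>] k \<omega> by simp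
  also have "(\<Sum>j<Suc p. \<rho> ^ j * V (k - j) \<omega>) = V k \<omega> + (\<Sum>j=1..p. \<rho> ^ j * V (k - j) \<omega>)"
    by (subst sum.lessThan_Suc_shift) (simp add: sum.atLeast1_atMost_eq)
  finally have e: "\<epsilon> k \<omega> = V k \<omega> + (\<Sum>j=1..p. \<rho> ^ j * V (k - j) \<omega>) + \<rho> ^ (p + 1) * \<epsilon> (k - (p + 1)) \<omega>" .
  have "(\<Sum>j=1..p. \<theta> j * X (int k - int j) \<omega>) = (\<Sum>j=1..p. \<theta> j * V (k - j) \<omega>) + (\<Sum>j=1..p. \<theta> j * resid (k - j) \<omega>)"
    unfolding sum.distrib[symmetric] by (intro sum.cong refl) (simp add: X distrib_left)
  moreover have "X (int k) \<omega> = V k \<omega> + resid k \<omega>" by (simp add: resid_def)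
  moreover have "U (int k - 1) \<omega> = X (int k) \<omega> - (\<Sum>j=1..p. \<theta> j * X (int k - int j) \<omega>) - \<epsilon> k \<omega>"
    using noise_state[of k \<omega>] k \<omega> by simp
  ultimately have "U (int k - 1) \<omega> = - ((\<Sum>j=1..p. \<theta> j * V (k - j) \<omega>) + (\<Sum>j=1..p. \<rho> ^ j * V (k - j) \<omega>))
      - \<rho> ^ (p + 1) * \<epsilon> (k - (p + 1)) \<omega> + (resid k \<omega> - (\<Sum>j=1..p. \<theta> j * resid (k - j) \<omega>))"
    unfolding e by linarith
  also have "- ((\<Sum>j=1..p. \<theta> j * V (k - j) \<omega>) + (\<Sum>j=1..p. \<rho> ^ j * V (k - j) \<omega>)) = (\<Sum>j=1..p + 1. K_row \<theta> \<rho> j * Vz (k - (j - 1)) \<omega>)"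
  proof -
    have "(\<Sum>j=1..p + 1. K_row \<theta> \<rho> j * Vz (k - (j - 1)) \<omega>) = (\<Sum>j=Suc 1..Suc p. K_row \<theta> \<rho> j * Vz (k - (j - 1)) \<omega>)"
      by (subst sum.atLeast_Suc_atMost) (auto simp: K_row_def)
    also have "\<dots> = (\<Sum>j=1..p. - (\<theta> j * V (k - j) \<omega> + \<rho> ^ j * V (k - j) \<omega>))"
      using k by (subst sum.shift_bounds_cl_Suc_ivl) (auto simp: K_row_def Vz_def algebra_simps intro!: sum.cong)
    finally show ?thesis by (simp only: sum_negf sum.distrib)
  qed
  finally show ?thesis .
qed

text \<open>The difference consists of residuals alone, and for k \<ge> p + 2 all of them have index
  at least 2, where the closed loop equation is available.\<close>

lemma regressor_expand:
  assumes k: "p + 2 \<le> k" and \<omega>: "\<omega> \<in> space M"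
  shows "u \<bullet> \<Phi> \<omega> k - \<Psi> u k \<omega> = (\<Sum>j=1..p + 1. u $ inv ix j * resid (k - (j - 1)) \<omega>)
     + u $ l * (resid k \<omega> - (\<Sum>j=1..p. \<theta> j * resid (k - j) \<omega>))"
proof -
  have inj: "inj ix" using ix by (simp add: bij_betw_def)
  have "u \<bullet> \<Phi> \<omega> k = u $ l * U (int k - 1) \<omega> + (\<Sum>i\<in>UNIV - {l}. u $ inv ix (ix i) * X (int k - int (ix i) + 1) \<omega>)"
  proof -
    have "u \<bullet> \<Phi> \<omega> k = u $ l * \<Phi> \<omega> k $ l + (\<Sum>i\<in>UNIV - {l}. u $ i * \<Phi> \<omega> k $ i)"
      unfolding inner_vec_def inner_real_def by (rule sum_UNIV_split)
    moreover have "(\<Sum>i\<in>UNIV - {l}. u $ i * \<Phi> \<omega> k $ i) = (\<Sum>i\<in>UNIV - {l}. u $ inv ix (ix i) * X (int k - int (ix i) + 1) \<omega>)"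
      using inj by (intro sum.cong) (auto simp: \<Phi>_nth)
    ultimately show ?thesis by (simp add: \<Phi>_nth)
  qed
  also have "(\<Sum>i\<in>UNIV - {l}. u $ inv ix (ix i) * X (int k - int (ix i) + 1) \<omega>) = (\<Sum>j=1..p + 1. u $ inv ix j * X (int k - int j + 1) \<omega>)"
    by (rule sum_ix[OF ix \<rho>, of "\<lambda>j. u $ inv ix j * X (int k - int j + 1) \<omega>"])
  also have "\<dots> = (\<Sum>j=1..p + 1. u $ inv ix j * Vz (k - (j - 1)) \<omega>) + (\<Sum>j=1..p + 1. u $ inv ix j * resid (k - (j - 1)) \<omega>)"
    unfolding sum.distrib[symmetric]
  proof (rule sum.cong[OF refl])
    fix j assume j: "j \<in> {1..p + 1}"
    then have "int k - int j + 1 = int (k - (j - 1))" "k - (j - 1) \<noteq> 0" using k by auto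
    then have "X (int k - int j + 1) \<omega> = Vz (k - (j - 1)) \<omega> + resid (k - (j - 1)) \<omega>"
      by (simp only: resid_def Vz_def if_False)
    then show "u $ inv ix j * X (int k - int j + 1) \<omega> = u $ inv ix j * Vz (k - (j - 1)) \<omega> + u $ inv ix j * resid (k - (j - 1)) \<omega>"
      by (simp only: distrib_left)
  qed
  finally have \<Phi>: "u \<bullet> \<Phi> \<omega> k = u $ l * U (int k - 1) \<omega> + ((\<Sum>j=1..p + 1. u $ inv ix j * Vz (k - (j - 1)) \<omega>) + (\<Sum>j=1..p + 1. u $ inv ix j * resid (k - (j - 1)) \<omega>))" .
  have "\<Psi> u k \<omega> = coef u 0 * \<epsilon> (k - (p + 1)) \<omega> + (\<Sum>j=1..p + 1. coef u j * Vz (k - (j - 1)) \<omega>)"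
  proof -
    have "{..p + 1} = insert 0 {1..p + 1}" by auto
    then show ?thesis unfolding \<Psi>_def by (simp only:) (subst sum.insert, auto simp: \<zeta>_def intro!: sum.cong)
  qed
  also have "(\<Sum>j=1..p + 1. coef u j * Vz (k - (j - 1)) \<omega>)
     = (\<Sum>j=1..p + 1. u $ inv ix j * Vz (k - (j - 1)) \<omega>) + u $ l * (\<Sum>j=1..p + 1. K_row \<theta> \<rho> j * Vz (k - (j - 1)) \<omega>)"
    unfolding sum_distrib_left sum.distrib[symmetric] by (intro sum.cong refl) (auto simp: coef_def algebra_simps)
  finally show ?thesis unfolding \<Phi> input_expand[OF k \<omega>] by (simp add: coef_def algebra_simps)
qed

text \<open>Residuals are excitation plus reference, both with squares summing to o(n), and a window
  of p + 1 residuals dominates the difference.\<close>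

lemma AE_remainder: "AE \<omega> in M. (\<lambda>n. (\<Sum>k<n. (u \<bullet> \<Phi> \<omega> k - \<Psi> u k \<omega>)\<^sup>2) / real n) \<longlonglongrightarrow> 0"
  using AE_space AE_stability x_small
proof eventually_elim
  case (elim \<omega>)
  note \<omega> = elim(1)
  have exc0: "(\<lambda>n. (\<Sum>k=1..n. (exc k \<omega>)\<^sup>2) / real n) \<longlonglongrightarrow> 0" using elim(2) by blast
  have x0: "(\<lambda>n. (\<Sum>k=1..n. (x k \<omega>)\<^sup>2) / real n) \<longlonglongrightarrow> 0"
    using smalloD_tendsto[OF elim(3)] by simp
  have r0: "(\<lambda>n. (\<Sum>k=2..n. (resid k \<omega>)\<^sup>2) / real n) \<longlonglongrightarrow> 0"
  proof (rule tendsto_sandwich[OF _ _ tendsto_const])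
    show "\<forall>\<^sub>F n in sequentially. 0 \<le> (\<Sum>k=2..n. (resid k \<omega>)\<^sup>2) / real n"
      by (intro always_eventually allI divide_nonneg_nonneg sum_nonneg) auto
    show "\<forall>\<^sub>F n in sequentially. (\<Sum>k=2..n. (resid k \<omega>)\<^sup>2) / real n \<le> 2 * ((\<Sum>k=1..n. (exc k \<omega>)\<^sup>2) / real n) + 2 * ((\<Sum>k=1..n. (x k \<omega>)\<^sup>2) / real n)"
    proof (rule always_eventually, rule allI)
      fix n
      have "(\<Sum>k=2..n. (resid k \<omega>)\<^sup>2) \<le> (\<Sum>k=2..n. 2 * (exc (k - 1) \<omega>)\<^sup>2 + 2 * (x k \<omega>)\<^sup>2)"
      proof (rule sum_mono)
        fix k assume k: "k \<in> {2..n}"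
        then have "X (int (k - 1) + 1) \<omega> = exc (k - 1) \<omega> + x (Suc (k - 1)) \<omega> + V (Suc (k - 1)) \<omega>"
          by (intro closed_loop \<omega>) auto
        then have "resid k \<omega> = exc (k - 1) \<omega> + x k \<omega>" using k by (simp add: resid_def of_nat_diff)
        moreover have "2 * exc (k - 1) \<omega> * x k \<omega> \<le> (exc (k - 1) \<omega>)\<^sup>2 + (x k \<omega>)\<^sup>2" by (rule sum_squares_bound)
        ultimately show "(resid k \<omega>)\<^sup>2 \<le> 2 * (exc (k - 1) \<omega>)\<^sup>2 + 2 * (x k \<omega>)\<^sup>2" by (simp add: power2_sum)
      qed
      also have "\<dots> = 2 * (\<Sum>k=2..n. (exc (k - 1) \<omega>)\<^sup>2) + 2 * (\<Sum>k=2..n. (x k \<omega>)\<^sup>2)"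
        by (simp only: sum.distrib sum_distrib_left)
      also have "\<dots> \<le> 2 * (\<Sum>k=1..n. (exc k \<omega>)\<^sup>2) + 2 * (\<Sum>k=1..n. (x k \<omega>)\<^sup>2)"
      proof (intro add_mono mult_left_mono)
        have "(\<Sum>k=2..n. (exc (k - 1) \<omega>)\<^sup>2) = (\<Sum>k\<in>(\<lambda>k. k - 1) ` {2..n}. (exc k \<omega>)\<^sup>2)"
          by (subst sum.reindex) (auto simp: inj_on_def)
        also have "\<dots> \<le> (\<Sum>k=1..n. (exc k \<omega>)\<^sup>2)" by (rule sum_mono2) auto
        finally show "(\<Sum>k=2..n. (exc (k - 1) \<omega>)\<^sup>2) \<le> (\<Sum>k=1..n. (exc k \<omega>)\<^sup>2)" .
        show "(\<Sum>k=2..n. (x k \<omega>)\<^sup>2) \<le> (\<Sum>k=1..n. (x k \<omega>)\<^sup>2)" by (rule sum_mono2) auto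
      qed auto
      finally have "(\<Sum>k=2..n. (resid k \<omega>)\<^sup>2) / real n \<le> (2 * (\<Sum>k=1..n. (exc k \<omega>)\<^sup>2) + 2 * (\<Sum>k=1..n. (x k \<omega>)\<^sup>2)) / real n"
        by (rule divide_right_mono) simp
      then show "(\<Sum>k=2..n. (resid k \<omega>)\<^sup>2) / real n \<le> 2 * ((\<Sum>k=1..n. (exc k \<omega>)\<^sup>2) / real n) + 2 * ((\<Sum>k=1..n. (x k \<omega>)\<^sup>2) / real n)"
        by (simp only: add_divide_distrib times_divide_eq_right)
    qed
    show "(\<lambda>n. 2 * ((\<Sum>k=1..n. (exc k \<omega>)\<^sup>2) / real n) + 2 * ((\<Sum>k=1..n. (x k \<omega>)\<^sup>2) / real n)) \<longlonglongrightarrow> 0"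
      using tendsto_add[OF tendsto_mult_right_zero[OF exc0, of 2] tendsto_mult_right_zero[OF x0, of 2]] by simp
  qed
  define T where "T = (\<Sum>j=1..p. \<bar>\<theta> j\<bar>)"
  have T: "0 \<le> T" by (simp add: T_def sum_nonneg)
  show ?case
  proof (rule window_average_tendsto_0[OF _ r0])
    fix k assume k: "p + 2 \<le> k"
    define R where "R = (\<Sum>t\<le>p. \<bar>resid (k - t) \<omega>\<bar>)"
    have r_le: "\<bar>resid (k - t) \<omega>\<bar> \<le> R" if "t \<le> p" for t
      unfolding R_def using that by (intro member_le_sum[where f = "\<lambda>t. \<bar>resid (k - t) \<omega>\<bar>"]) auto
    have R: "0 \<le> R" by (simp add: R_def sum_nonneg)
    have 1: "\<bar>\<Sum>j=1..p + 1. u $ inv ix j * resid (k - (j - 1)) \<omega>\<bar> \<le> real (p + 1) * norm u * R"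
    proof -
      have "\<bar>\<Sum>j=1..p + 1. u $ inv ix j * resid (k - (j - 1)) \<omega>\<bar> \<le> (\<Sum>j=1..p + 1. norm u * R)"
      proof (intro order_trans[OF sum_abs] sum_mono)
        fix j assume "j \<in> {1..p + 1}"
        then have "\<bar>resid (k - (j - 1)) \<omega>\<bar> \<le> R" by (intro r_le) auto
        then show "\<bar>u $ inv ix j * resid (k - (j - 1)) \<omega>\<bar> \<le> norm u * R"
          unfolding abs_mult by (intro mult_mono component_le_norm_cart) auto
      qed
      then show ?thesis by (simp add: mult.assoc)
    qed
    have 2: "\<bar>\<Sum>j=1..p. \<theta> j * resid (k - j) \<omega>\<bar> \<le> T * R"
      unfolding T_def sum_distrib_right
      by (intro order_trans[OF sum_abs] sum_mono) (auto simp: abs_mult intro!: mult_mono r_le)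
    have "\<bar>u $ l * (resid k \<omega> - (\<Sum>j=1..p. \<theta> j * resid (k - j) \<omega>))\<bar> \<le> norm u * (R + T * R)"
      unfolding abs_mult using r_le[of 0] 2 by (intro mult_mono component_le_norm_cart) auto
    then show "\<bar>u \<bullet> \<Phi> \<omega> k - \<Psi> u k \<omega>\<bar> \<le> (real (p + 1) * norm u + norm u * (1 + T)) * (\<Sum>t\<le>p. \<bar>resid (k - t) \<omega>\<bar>)"
      unfolding regressor_expand[OF k \<omega>] R_def[symmetric] using 1 by (simp add: algebra_simps)
  qed
qed

theorem gram_quadratic_limit:
  "tends_in_prob M (\<lambda>n \<omega>. (\<Sum>k<n. (u \<bullet> \<Phi> \<omega> k)\<^sup>2) / real n) (\<sigma>\<^sup>2 * (u \<bullet> (Lambda p ix \<theta> \<rho> *v u)))"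
proof -
  have [measurable]: "(\<lambda>\<omega>. \<Phi> \<omega> k) \<in> borel_measurable M" for k by (rule measurable_F_M[OF \<Phi>_F])
  have z: "\<zeta> j k \<in> borel_measurable M" for j k
    unfolding \<zeta>_def using measurable_F_M[OF \<epsilon>_F] measurable_F_M[OF Vz_F[OF order_refl]] by (cases "j = 0") auto
  have [measurable]: "\<Psi> u k \<in> borel_measurable M" for k
    unfolding \<Psi>_def using z by measurable
  have "tends_in_prob M (\<lambda>n \<omega>. (\<Sum>k<n. (u \<bullet> \<Phi> \<omega> k - \<Psi> u k \<omega>)\<^sup>2) / real n) 0"
    by (rule tends_in_prob_AE[OF _ AE_remainder]) measurable
  from tends_in_prob_quadratic_perturbation[OF \<Psi>_LLN[of u] this] show ?thesis by simp
qed

end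

section \<open>Asymptotic normality\<close>

definition bounded_in_prob :: "'a measure \<Rightarrow> (nat \<Rightarrow> 'a \<Rightarrow> real) \<Rightarrow> bool" where
  "bounded_in_prob M Z \<longleftrightarrow> (\<forall>e>0. \<exists>K. \<forall>\<^sub>F n in sequentially.
     \<exists>A\<in>sets M. measure M A < e \<and> (\<forall>\<omega>\<in>space M - A. \<bar>Z n \<omega>\<bar> \<le> K))"

context prob_space
begin

lemma measure_Un_less:
  assumes "A \<in> sets M" "B \<in> sets M" "measure M A < a" "measure M B < b"
  shows "measure M (A \<union> B) < a + b"
  using measure_Un_le[OF assms(1,2)] assms(3,4) by linarith

lemma bounded_in_prob_combine:
  assumes X: "bounded_in_prob M X" and Y: "bounded_in_prob M Y"
    and Z: "\<And>a b. \<exists>K. \<forall>n \<omega>. \<omega> \<in> space M \<longrightarrow> \<bar>X n \<omega>\<bar> \<le> a \<longrightarrow> \<bar>Y n \<omega>\<bar> \<le> b \<longrightarrow> \<bar>Z n \<omega>\<bar> \<le> K"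
  shows "bounded_in_prob M Z"
  unfolding bounded_in_prob_def
proof (intro allI impI)
  fix e :: real assume e: "0 < e"
  then have e2: "0 < e / 2" by simp
  obtain a where a: "\<forall>\<^sub>F n in sequentially. \<exists>A\<in>sets M. measure M A < e / 2 \<and> (\<forall>\<omega>\<in>space M - A. \<bar>X n \<omega>\<bar> \<le> a)"
    using X e2 unfolding bounded_in_prob_def by blast
  obtain b where b: "\<forall>\<^sub>F n in sequentially. \<exists>A\<in>sets M. measure M A < e / 2 \<and> (\<forall>\<omega>\<in>space M - A. \<bar>Y n \<omega>\<bar> \<le> b)"
    using Y e2 unfolding bounded_in_prob_def by blast
  obtain K where K: "\<And>n \<omega>. \<omega> \<in> space M \<Longrightarrow> \<bar>X n \<omega>\<bar> \<le> a \<Longrightarrow> \<bar>Y n \<omega>\<bar> \<le> b \<Longrightarrow> \<bar>Z n \<omega>\<bar> \<le> K"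
    using Z[of a b] by blast
  have "\<forall>\<^sub>F n in sequentially. \<exists>A\<in>sets M. measure M A < e \<and> (\<forall>\<omega>\<in>space M - A. \<bar>Z n \<omega>\<bar> \<le> K)"
    using a b
  proof eventually_elim
    case (elim n)
    then obtain A B where AB: "A \<in> sets M" "B \<in> sets M" "measure M A < e / 2" "measure M B < e / 2"
      "\<forall>\<omega>\<in>space M - A. \<bar>X n \<omega>\<bar> \<le> a" "\<forall>\<omega>\<in>space M - B. \<bar>Y n \<omega>\<bar> \<le> b" by blast
    show ?case
    proof (intro bexI[of _ "A \<union> B"] conjI ballI)
      show "measure M (A \<union> B) < e" using measure_Un_less[OF AB(1-4)] by simp
      show "\<bar>Z n \<omega>\<bar> \<le> K" if "\<omega> \<in> space M - (A \<union> B)" for \<omega> using AB(5,6) that by (intro K) auto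
    qed (use AB in auto)
  qed
  then show "\<exists>K. \<forall>\<^sub>F n in sequentially. \<exists>A\<in>sets M. measure M A < e \<and> (\<forall>\<omega>\<in>space M - A. \<bar>Z n \<omega>\<bar> \<le> K)" ..
qed

lemma bounded_in_prob_add:
  assumes "bounded_in_prob M X" "bounded_in_prob M Y"
  shows "bounded_in_prob M (\<lambda>n \<omega>. X n \<omega> + Y n \<omega>)"
  by (rule bounded_in_prob_combine[OF assms]) (meson abs_triangle_ineq add_mono order_trans)

lemma tends_in_prob_imp_bounded:
  assumes "tends_in_prob M Z (c :: real)"
  shows "bounded_in_prob M Z"
  unfolding bounded_in_prob_def
proof (intro allI impI exI)
  fix e :: real assume e: "0 < e"
  show "\<forall>\<^sub>F n in sequentially. \<exists>A\<in>sets M. measure M A < e \<and> (\<forall>\<omega>\<in>space M - A. \<bar>Z n \<omega>\<bar> \<le> \<bar>c\<bar> + 1)"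
    using tends_in_probD[OF assms e zero_less_one]
  proof eventually_elim
    case (elim n)
    then obtain A where A: "A \<in> sets M" "measure M A < e" "\<And>\<omega>. \<omega> \<in> space M - A \<Longrightarrow> \<bar>Z n \<omega> - c\<bar> < 1"
      by (auto simp: dist_real_def)
    show ?case
    proof (intro bexI[of _ A] conjI ballI)
      show "\<bar>Z n \<omega>\<bar> \<le> \<bar>c\<bar> + 1" if "\<omega> \<in> space M - A" for \<omega> using A(3)[OF that] by linarith
    qed (use A in auto)
  qed
qed

lemma bounded_in_prob_sum:
  assumes "finite I" "\<And>i. i \<in> I \<Longrightarrow> bounded_in_prob M (X i)"
  shows "bounded_in_prob M (\<lambda>n \<omega>. \<Sum>i\<in>I. \<bar>X i n \<omega>\<bar>)"
  using assms
proof (induction I rule: finite_induct)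
  case empty
  show ?case using tends_in_prob_imp_bounded[OF tends_in_prob_const[of 0]] by simp
next
  case (insert i I)
  have "bounded_in_prob M (X i)" "bounded_in_prob M (\<lambda>n \<omega>. \<Sum>i\<in>I. \<bar>X i n \<omega>\<bar>)"
    using insert by auto
  then have "bounded_in_prob M (\<lambda>n \<omega>. \<bar>X i n \<omega>\<bar> + (\<Sum>i\<in>I. \<bar>X i n \<omega>\<bar>))"
  proof (rule bounded_in_prob_combine)
    show "\<exists>K. \<forall>n \<omega>. \<omega> \<in> space M \<longrightarrow> \<bar>X i n \<omega>\<bar> \<le> a \<longrightarrow> \<bar>\<Sum>i\<in>I. \<bar>X i n \<omega>\<bar>\<bar> \<le> b
        \<longrightarrow> \<bar>\<bar>X i n \<omega>\<bar> + (\<Sum>i\<in>I. \<bar>X i n \<omega>\<bar>)\<bar> \<le> K" for a b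
    proof (intro exI[of _ "a + b"] allI impI)
      fix n \<omega> assume "\<bar>X i n \<omega>\<bar> \<le> a" "\<bar>\<Sum>i\<in>I. \<bar>X i n \<omega>\<bar>\<bar> \<le> b"
      then show "\<bar>\<bar>X i n \<omega>\<bar> + (\<Sum>i\<in>I. \<bar>X i n \<omega>\<bar>)\<bar> \<le> a + b" by linarith
    qed
  qed
  then show ?case using insert by simp
qed

lemma tends_in_prob_mult_bounded:
  assumes X: "tends_in_prob M X (0 :: real)" and Y: "bounded_in_prob M Y"
  shows "tends_in_prob M (\<lambda>n \<omega>. X n \<omega> * Y n \<omega>) 0"
proof (rule tends_in_probI)
  fix e :: real assume e: "0 < e"
  then have e2: "0 < e / 2" by simp
  obtain K where K: "\<forall>\<^sub>F n in sequentially. \<exists>A\<in>sets M. measure M A < e / 2 \<and> (\<forall>\<omega>\<in>space M - A. \<bar>Y n \<omega>\<bar> \<le> K)"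
    using Y e2 unfolding bounded_in_prob_def by blast
  have "0 < e / (\<bar>K\<bar> + 1)" using e by (simp add: add_nonneg_pos)
  from K tends_in_probD[OF X e2 this]
  show "\<forall>\<^sub>F n in sequentially. \<exists>A\<in>sets M. measure M A \<le> e \<and> (\<forall>\<omega>\<in>space M - A. dist (X n \<omega> * Y n \<omega>) 0 \<le> e)"
  proof eventually_elim
    case (elim n)
    then obtain A B where AB: "A \<in> sets M" "B \<in> sets M" "measure M A < e / 2" "measure M B < e / 2"
      "\<And>\<omega>. \<omega> \<in> space M - A \<Longrightarrow> \<bar>Y n \<omega>\<bar> \<le> K" "\<And>\<omega>. \<omega> \<in> space M - B \<Longrightarrow> \<bar>X n \<omega>\<bar> < e / (\<bar>K\<bar> + 1)"
      by (auto simp: dist_real_def)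
    show ?case
    proof (intro bexI[of _ "A \<union> B"] conjI ballI)
      show "measure M (A \<union> B) \<le> e" using measure_Un_less[OF AB(1-4)] by simp
      fix \<omega> assume \<omega>: "\<omega> \<in> space M - (A \<union> B)"
      have "\<bar>X n \<omega> * Y n \<omega>\<bar> \<le> (e / (\<bar>K\<bar> + 1)) * (\<bar>K\<bar> + 1)"
        unfolding abs_mult using AB(5,6)[of \<omega>] \<omega> e by (intro mult_mono) auto
      then show "dist (X n \<omega> * Y n \<omega>) 0 \<le> e" by (simp add: dist_real_def add_nonneg_pos split: if_splits)
    qed (use AB in auto)
  qed
qed

text \<open>Where |\<beta>| < 1/2 the inequality gives y \<le> m + y / 2, hence y \<le> 2 m. This
  yields tightness of the scaled error from an equation in which the error occurs on both
  sides.\<close>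

lemma bounded_in_prob_absorb:
  assumes m: "bounded_in_prob M m" and \<beta>: "tends_in_prob M \<beta> (0 :: real)"
    and y: "\<And>n \<omega>. \<omega> \<in> space M \<Longrightarrow> 0 \<le> y n \<omega> \<and> y n \<omega> \<le> m n \<omega> + \<beta> n \<omega> * y n \<omega>"
  shows "bounded_in_prob M y"
  unfolding bounded_in_prob_def
proof (intro allI impI)
  fix e :: real assume e: "0 < e"
  then have e2: "0 < e / 2" by simp
  obtain K where K: "\<forall>\<^sub>F n in sequentially. \<exists>A\<in>sets M. measure M A < e / 2 \<and> (\<forall>\<omega>\<in>space M - A. \<bar>m n \<omega>\<bar> \<le> K)"
    using m e2 unfolding bounded_in_prob_def by blast
  have "\<forall>\<^sub>F n in sequentially. \<exists>A\<in>sets M. measure M A < e \<and> (\<forall>\<omega>\<in>space M - A. \<bar>y n \<omega>\<bar> \<le> 2 * K)"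
    using K tends_in_probD[OF \<beta> e2 half_gt_zero[OF zero_less_one]]
  proof eventually_elim
    case (elim n)
    then obtain A B where AB: "A \<in> sets M" "B \<in> sets M" "measure M A < e / 2" "measure M B < e / 2"
      "\<And>\<omega>. \<omega> \<in> space M - A \<Longrightarrow> \<bar>m n \<omega>\<bar> \<le> K" "\<And>\<omega>. \<omega> \<in> space M - B \<Longrightarrow> \<bar>\<beta> n \<omega>\<bar> < 1 / 2"
      by (auto simp: dist_real_def)
    show ?case
    proof (intro bexI[of _ "A \<union> B"] conjI ballI)
      show "measure M (A \<union> B) < e" using measure_Un_less[OF AB(1-4)] by simp
      fix \<omega> assume \<omega>: "\<omega> \<in> space M - (A \<union> B)"
      then have "0 \<le> y n \<omega>" "y n \<omega> \<le> m n \<omega> + \<beta> n \<omega> * y n \<omega>" using y[of \<omega> n] by auto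
      moreover have "\<beta> n \<omega> * y n \<omega> \<le> 1 / 2 * y n \<omega>"
        using AB(6)[of \<omega>] \<omega> calculation(1) by (intro mult_right_mono) auto
      moreover have "m n \<omega> \<le> K" using AB(5)[of \<omega>] \<omega> by auto
      ultimately show "\<bar>y n \<omega>\<bar> \<le> 2 * K" by linarith
    qed (use AB in auto)
  qed
  then show "\<exists>K. \<forall>\<^sub>F n in sequentially. \<exists>A\<in>sets M. measure M A < e \<and> (\<forall>\<omega>\<in>space M - A. \<bar>y n \<omega>\<bar> \<le> K)" ..
qed

lemma iexp_diff_le: "norm (iexp a - iexp b) \<le> \<bar>a - b\<bar>"
proof -
  have "norm (iexp a - iexp b) = norm (iexp b * (iexp (a - b) - 1))"
    by (simp add: exp_diff right_diff_distrib)
  also have "\<dots> = norm (iexp (a - b) - 1)" by (simp add: norm_mult)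
  also have "\<dots> \<le> \<bar>a - b\<bar>" using iexp_approx1[of "a - b" 0] by simp
  finally show ?thesis .
qed

text \<open>Slutsky's lemma for characteristic functions: iexp is 1-Lipschitz and bounded, so a
  perturbation that is small off a small event hardly changes the expectation.\<close>

lemma char_fun_asymptotic:
  assumes X [measurable]: "\<And>n. X n \<in> borel_measurable M" and Y [measurable]: "\<And>n. Y n \<in> borel_measurable M"
    and XY: "tends_in_prob M (\<lambda>n \<omega>. X n \<omega> - Y n \<omega>) (0 :: real)"
    and lim: "(\<lambda>n. \<integral>\<omega>. iexp (Y n \<omega>) \<partial>M) \<longlonglongrightarrow> c"
  shows "(\<lambda>n. \<integral>\<omega>. iexp (X n \<omega>) \<partial>M) \<longlonglongrightarrow> c"
proof -
  have iX: "integrable M (\<lambda>\<omega>. iexp (X n \<omega>))" for n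
    by (rule expectation_bound(1)[where b = 1]) auto
  have iY: "integrable M (\<lambda>\<omega>. iexp (Y n \<omega>))" for n
    by (rule expectation_bound(1)[where b = 1]) auto
  have "(\<lambda>n. (\<integral>\<omega>. iexp (X n \<omega>) \<partial>M) - (\<integral>\<omega>. iexp (Y n \<omega>) \<partial>M)) \<longlonglongrightarrow> 0"
  proof (rule tendstoI)
    fix e :: real assume e: "0 < e"
    then have e4: "0 < e / 4" by simp
    show "\<forall>\<^sub>F n in sequentially. dist ((\<integral>\<omega>. iexp (X n \<omega>) \<partial>M) - (\<integral>\<omega>. iexp (Y n \<omega>) \<partial>M)) 0 < e"
      using tends_in_probD[OF XY e4 e4]
    proof eventually_elim
      case (elim n)
      then obtain A where A [measurable]: "A \<in> sets M" and mA: "measure M A < e / 4"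
        and le: "\<And>\<omega>. \<omega> \<in> space M - A \<Longrightarrow> \<bar>X n \<omega> - Y n \<omega>\<bar> < e / 4" by (auto simp: dist_real_def)
      have "norm ((\<integral>\<omega>. iexp (X n \<omega>) \<partial>M) - (\<integral>\<omega>. iexp (Y n \<omega>) \<partial>M)) = norm (\<integral>\<omega>. iexp (X n \<omega>) - iexp (Y n \<omega>) \<partial>M)"
        using iX iY by simp
      also have "\<dots> \<le> (\<integral>\<omega>. norm (iexp (X n \<omega>) - iexp (Y n \<omega>)) \<partial>M)" by (rule integral_norm_bound)
      also have "\<dots> \<le> (\<integral>\<omega>. e / 4 + 2 * indicator A \<omega> \<partial>M)"
      proof (rule integral_mono)
        show "integrable M (\<lambda>\<omega>. norm (iexp (X n \<omega>) - iexp (Y n \<omega>)))" using iX iY by simp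
        show "integrable M (\<lambda>\<omega>. e / 4 + 2 * indicator A \<omega>)"
          by (intro Bochner_Integration.integrable_add integrable_mult_right) (auto simp: emeasure_eq_measure)
        fix \<omega> assume \<omega>: "\<omega> \<in> space M"
        show "norm (iexp (X n \<omega>) - iexp (Y n \<omega>)) \<le> e / 4 + 2 * indicator A \<omega>"
        proof (cases "\<omega> \<in> A")
          case True
          have "norm (iexp (X n \<omega>) - iexp (Y n \<omega>)) \<le> 1 + 1"
            by (rule order_trans[OF norm_triangle_ineq4]) simp
          then show ?thesis using True e by simp
        next
          case False
          then show ?thesis using iexp_diff_le[of "X n \<omega>" "Y n \<omega>"] le[of \<omega>] \<omega> by simp
        qed
      qed
      also have "\<dots> = e / 4 + 2 * measure M A"
        by (subst Bochner_Integration.integral_add) (auto simp: emeasure_eq_measure prob_space)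
      finally show ?case using mA e by simp
    qed
  qed
  from tendsto_add[OF this lim] show ?thesis by simp
qed

end

context adaptive_arx
begin

section \<open>Linearisation of the scaled error\<close>

lemma Lambda_symmetric: "u \<bullet> (Lambda p ix \<theta> \<rho> *v v) = v \<bullet> (Lambda p ix \<theta> \<rho> *v u)"
  unfolding Lambda_eq[OF ix \<rho>] arrow_matrix_mult
  by (simp add: inner_add_right inner_axis inner_commute[of v u] inner_commute[of u "border p ix \<theta> \<rho>"]
      inner_commute[of v "border p ix \<theta> \<rho>"] algebra_simps)

definition deviation :: "nat \<Rightarrow> 'a \<Rightarrow> real ^ 'd \<Rightarrow> real ^ 'd" where
  "deviation n \<omega> v = (1 / real n) *\<^sub>R (information (\<Phi> \<omega>) n *v v) - \<sigma>\<^sup>2 *\<^sub>R (Lambda p ix \<theta> \<rho> *v v)"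

text \<open>Polarisation: the quadratic limits at u + v, u and v determine the bilinear one. The
  identity matrix contained in A_n disappears after division by n.\<close>

lemma tends_in_prob_inner_deviation: "tends_in_prob M (\<lambda>n \<omega>. u \<bullet> deviation n \<omega> v) 0"
proof -
  let ?q = "\<lambda>u. \<sigma>\<^sup>2 * (u \<bullet> (Lambda p ix \<theta> \<rho> *v u))" and ?Q = "\<lambda>u n \<omega>. (\<Sum>k<n. (u \<bullet> \<Phi> \<omega> k)\<^sup>2) / real n"
  have "tends_in_prob M (\<lambda>n \<omega>. (u \<bullet> v) / real n + (1 / 2 * ?Q (u + v) n \<omega> + ((- 1 / 2) * ?Q u n \<omega> + (- 1 / 2) * ?Q v n \<omega>)))
      (0 + (1 / 2 * ?q (u + v) + ((- 1 / 2) * ?q u + (- 1 / 2) * ?q v)))"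
    by (intro tends_in_prob_add tends_in_prob_cmult gram_quadratic_limit tends_in_prob_deterministic lim_const_over_n)
  moreover have "(u \<bullet> v) / real n + (1 / 2 * ?Q (u + v) n \<omega> + ((- 1 / 2) * ?Q u n \<omega> + (- 1 / 2) * ?Q v n \<omega>))
      = (u \<bullet> (information (\<Phi> \<omega>) n *v v)) / real n" for n \<omega>
  proof -
    have "(\<Sum>k<n. ((u + v) \<bullet> \<Phi> \<omega> k)\<^sup>2)
        = (\<Sum>k<n. (u \<bullet> \<Phi> \<omega> k)\<^sup>2) + (\<Sum>k<n. (v \<bullet> \<Phi> \<omega> k)\<^sup>2) + 2 * (\<Sum>k<n. (\<Phi> \<omega> k \<bullet> u) * (\<Phi> \<omega> k \<bullet> v))"
      unfolding sum_distrib_left sum.distrib[symmetric]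
      by (intro sum.cong refl) (simp add: inner_add_left power2_sum inner_commute)
    then show ?thesis unfolding inner_information by (simp add: add_divide_distrib)
  qed
  moreover have "0 + (1 / 2 * ?q (u + v) + ((- 1 / 2) * ?q u + (- 1 / 2) * ?q v)) = \<sigma>\<^sup>2 * (u \<bullet> (Lambda p ix \<theta> \<rho> *v v))"
    using Lambda_symmetric[of u v]
    by (simp add: inner_add_left inner_add_right matrix_vector_right_distrib algebra_simps)
  ultimately have "tends_in_prob M (\<lambda>n \<omega>. (u \<bullet> (information (\<Phi> \<omega>) n *v v)) / real n) (\<sigma>\<^sup>2 * (u \<bullet> (Lambda p ix \<theta> \<rho> *v v)))"
    by (simp only:)
  from tends_in_prob_add[OF this tends_in_prob_const[of "- (\<sigma>\<^sup>2 * (u \<bullet> (Lambda p ix \<theta> \<rho> *v v)))"]]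
  show ?thesis by (simp add: deviation_def inner_diff_right)
qed

lemma tends_in_prob_norm_deviation: "tends_in_prob M (\<lambda>n \<omega>. norm (deviation n \<omega> v)) 0"
proof (rule tends_in_prob_bound)
  have "tends_in_prob M (\<lambda>n \<omega>. \<Sum>b\<in>Basis. \<bar>b \<bullet> deviation n \<omega> v\<bar>) (\<Sum>b\<in>(Basis :: (real ^ 'd) set). \<bar>0\<bar>)"
    by (intro tends_in_prob_sum tends_in_prob_isCont[OF tends_in_prob_inner_deviation]) auto
  then show "tends_in_prob M (\<lambda>n \<omega>. \<Sum>b\<in>Basis. \<bar>b \<bullet> deviation n \<omega> v\<bar>) 0" by simp
  show "norm (norm (deviation n \<omega> v)) \<le> norm (\<Sum>b\<in>Basis. \<bar>b \<bullet> deviation n \<omega> v\<bar>)" for n \<omega>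
    using norm_le_l1[of "deviation n \<omega> v"] by (simp add: inner_commute sum_nonneg)
qed

text \<open>The regression equation is available from time 1 on, so the telescoping starts at A_1
  e_1. Subtracting the noise term with k = 0 lets the martingale sum start at 0.\<close>

definition initial_term :: "real ^ 'd \<Rightarrow> 'a \<Rightarrow> real" where
  "initial_term w \<omega> = w \<bullet> (information (\<Phi> \<omega>) 1 *v err 1 \<omega>) - (w \<bullet> \<Phi> \<omega> 0) * V 1 \<omega>"

lemma information_err:
  assumes "1 \<le> n" "\<omega> \<in> space M"
  shows "w \<bullet> (information (\<Phi> \<omega>) n *v err n \<omega>) = initial_term w \<omega> + (\<Sum>k<n. (w \<bullet> \<Phi> \<omega> k) * V (Suc k) \<omega>)"
  using assms(1)
proof (induction n rule: nat_induct_at_least)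
  case (Suc n)
  show ?case
    unfolding information_err_step[OF Suc.hyps assms(2)] inner_add_right Suc.IH by simp
qed (simp add: initial_term_def)

definition score :: "real ^ 'd \<Rightarrow> nat \<Rightarrow> 'a \<Rightarrow> real" where
  "score w n \<omega> = (\<Sum>k<n. ((w \<bullet> \<Phi> \<omega> k) / sqrt (real n)) * V (Suc k) \<omega>)"

definition scaled_err :: "nat \<Rightarrow> 'a \<Rightarrow> real ^ 'd" where
  "scaled_err n \<omega> = sqrt (real n) *\<^sub>R err n \<omega>"

text \<open>The solution w of \<sigma>^2 \<Lambda> w = u. Testing A_n e_n / n against w approximates
  u . e_n without inverting the random matrix.\<close>

definition dual :: "real ^ 'd \<Rightarrow> real ^ 'd" where
  "dual u = (1 / \<sigma>\<^sup>2) *\<^sub>R (Lambda_inverse p ix \<theta> \<rho> *v u)"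

lemma Lambda_dual: "\<sigma>\<^sup>2 *\<^sub>R (Lambda p ix \<theta> \<rho> *v dual u) = u"
  using \<sigma>_pos by (simp add: dual_def matrix_vector_mult_scaleR matrix_vector_mul_assoc Lambda_mult_inverse[OF ix \<rho>])

text \<open>A_n is symmetric, so (A_n w) . e_n is the initial term plus the martingale. Replacing
  A_n w / n by \<sigma>^2 \<Lambda> w = u leaves the deviation as the only error.\<close>

lemma scaled_err_expand:
  assumes "\<omega> \<in> space M"
  shows "u \<bullet> scaled_err n \<omega> = initial_term (dual u) \<omega> / sqrt (real n) + score (dual u) n \<omega> - deviation n \<omega> (dual u) \<bullet> scaled_err n \<omega>"
\<comment> \<open>At n = 0 all terms vanish, because sqrt 0 = 0 and division by 0 yields 0.\<close>
proof (cases "n = 0")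
  case False
  let ?w = "dual u"
  have "(information (\<Phi> \<omega>) n *v ?w) \<bullet> err n \<omega> = ?w \<bullet> (information (\<Phi> \<omega>) n *v err n \<omega>)"
    by (subst inner_commute) (simp add: inner_information inner_commute mult.commute)
  also have "\<dots> = initial_term ?w \<omega> + (\<Sum>k<n. (?w \<bullet> \<Phi> \<omega> k) * V (Suc k) \<omega>)"
    using False assms by (intro information_err) auto
  finally have i: "(information (\<Phi> \<omega>) n *v ?w) \<bullet> err n \<omega> = initial_term ?w \<omega> + (\<Sum>k<n. (?w \<bullet> \<Phi> \<omega> k) * V (Suc k) \<omega>)" .
  have "deviation n \<omega> ?w \<bullet> scaled_err n \<omega>
      = sqrt (real n) / real n * ((information (\<Phi> \<omega>) n *v ?w) \<bullet> err n \<omega>) - u \<bullet> scaled_err n \<omega>"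
    unfolding deviation_def Lambda_dual by (simp add: inner_diff_left scaled_err_def right_diff_distrib)
  moreover have "sqrt (real n) / real n = 1 / sqrt (real n)"
    using False by (simp add: real_div_sqrt field_simps)
  moreover have "score ?w n \<omega> = 1 / sqrt (real n) * (\<Sum>k<n. (?w \<bullet> \<Phi> \<omega> k) * V (Suc k) \<omega>)"
    by (simp add: score_def sum_distrib_left)
  ultimately show ?thesis unfolding i by (simp add: add_divide_distrib)
qed (simp add: scaled_err_def score_def)

section \<open>Limit law of the score martingale\<close>

lemma score_squares: "(\<Sum>k<n. ((w \<bullet> \<Phi> \<omega> k) / sqrt (real n))\<^sup>2) = (\<Sum>k<n. (w \<bullet> \<Phi> \<omega> k)\<^sup>2) / real n"
  by (simp add: power_divide sum_divide_distrib)

lemma score_squares_limit: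
  "tends_in_prob M (\<lambda>n \<omega>. \<Sum>k<n. ((w \<bullet> \<Phi> \<omega> k) / sqrt (real n))\<^sup>2) (\<sigma>\<^sup>2 * (w \<bullet> (Lambda p ix \<theta> \<rho> *v w)))"
  unfolding score_squares by (rule gram_quadratic_limit)

lemma score_weight_F: "(\<lambda>\<omega>. (w \<bullet> \<Phi> \<omega> k) / sqrt (real n)) \<in> borel_measurable (F k)"
  using \<Phi>_F[of k] by measurable

lemma bounded_in_prob_score: "bounded_in_prob M (score w)"
  unfolding bounded_in_prob_def
proof (intro allI impI)
  fix e :: real assume "0 < e"
  from transform_bounded_in_prob[OF score_weight_F score_squares_limit this, of w]
  obtain K where "\<forall>\<^sub>F n in sequentially. \<exists>A\<in>sets M. measure M A < e \<and> (\<forall>\<omega>\<in>space M - A. \<bar>score w n \<omega>\<bar> < K)"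
    unfolding score_def by blast
  then have "\<forall>\<^sub>F n in sequentially. \<exists>A\<in>sets M. measure M A < e \<and> (\<forall>\<omega>\<in>space M - A. \<bar>score w n \<omega>\<bar> \<le> K)"
    by eventually_elim (meson less_imp_le)
  then show "\<exists>K. \<forall>\<^sub>F n in sequentially. \<exists>A\<in>sets M. measure M A < e \<and> (\<forall>\<omega>\<in>space M - A. \<bar>score w n \<omega>\<bar> \<le> K)" ..
qed

lemma measurable_basics [measurable]:
  "(\<lambda>\<omega>. \<Phi> \<omega> k) \<in> borel_measurable M" "err n \<in> borel_measurable M" "V (Suc k) \<in> borel_measurable M"
  by (rule measurable_F_M[OF \<Phi>_F] measurable_F_M[OF err_F] measurable_F_M[OF V_F])+

lemma initial_term_limit: "tends_in_prob M (\<lambda>n \<omega>. initial_term w \<omega> / sqrt (real n)) 0"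
proof (rule tends_in_prob_AE)
  have [measurable]: "V 1 \<in> borel_measurable M" using measurable_basics(3)[of 0] by simp
  show "(\<lambda>\<omega>. initial_term w \<omega> / sqrt (real n)) \<in> borel_measurable M" for n
    unfolding initial_term_def inner_information by measurable
  have "(\<lambda>n. c / sqrt (real n)) \<longlonglongrightarrow> 0" for c :: real 
    by (intro tendsto_divide_0[OF tendsto_const] filterlim_at_top_imp_at_infinity
        filterlim_compose[OF sqrt_at_top filterlim_real_sequentially])
  then show "AE \<omega> in M. (\<lambda>n. initial_term w \<omega> / sqrt (real n)) \<longlonglongrightarrow> 0" by simp
qed

text \<open>Summing \<open>scaled_err_expand\<close> over the basis bounds the norm by a tight
  quantity plus the norm itself times a factor tending to 0, which is absorbed.\<close>

lemma bounded_in_prob_scaled_err: "bounded_in_prob M (\<lambda>n \<omega>. norm (scaled_err n \<omega>))"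
proof (rule bounded_in_prob_absorb)
  let ?m = "\<lambda>b n \<omega>. initial_term (dual b) \<omega> / sqrt (real n) + score (dual b) n \<omega>"
  let ?B = "Basis :: (real ^ 'd) set"
  show "bounded_in_prob M (\<lambda>n \<omega>. \<Sum>b\<in>?B. \<bar>?m b n \<omega>\<bar>)"
    by (intro bounded_in_prob_sum bounded_in_prob_add bounded_in_prob_score
        tends_in_prob_imp_bounded[OF initial_term_limit]) simp
  have "tends_in_prob M (\<lambda>n \<omega>. \<Sum>b\<in>?B. norm (deviation n \<omega> (dual b))) (\<Sum>b\<in>?B. 0)"
    by (intro tends_in_prob_sum tends_in_prob_norm_deviation)
  then show "tends_in_prob M (\<lambda>n \<omega>. \<Sum>b\<in>?B. norm (deviation n \<omega> (dual b))) 0" by simp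
  fix n \<omega> assume \<omega>: "\<omega> \<in> space M"
  have "norm (scaled_err n \<omega>) \<le> (\<Sum>b\<in>?B. \<bar>b \<bullet> scaled_err n \<omega>\<bar>)"
    using norm_le_l1[of "scaled_err n \<omega>"] by (simp add: inner_commute)
  also have "\<dots> \<le> (\<Sum>b\<in>?B. \<bar>?m b n \<omega>\<bar> + norm (deviation n \<omega> (dual b)) * norm (scaled_err n \<omega>))"
  proof (rule sum_mono)
    fix b :: "real ^ 'd"
    show "\<bar>b \<bullet> scaled_err n \<omega>\<bar> \<le> \<bar>?m b n \<omega>\<bar> + norm (deviation n \<omega> (dual b)) * norm (scaled_err n \<omega>)"
      unfolding scaled_err_expand[OF \<omega>, of b]
      using Cauchy_Schwarz_ineq2[of "deviation n \<omega> (dual b)" "scaled_err n \<omega>"] by linarith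
  qed
  finally show "0 \<le> norm (scaled_err n \<omega>) \<and> norm (scaled_err n \<omega>) \<le> (\<Sum>b\<in>?B. \<bar>?m b n \<omega>\<bar>)
      + (\<Sum>b\<in>?B. norm (deviation n \<omega> (dual b))) * norm (scaled_err n \<omega>)"
    by (simp add: sum.distrib sum_distrib_right)
qed

lemma score_approximation: "tends_in_prob M (\<lambda>n \<omega>. u \<bullet> scaled_err n \<omega> - score (dual u) n \<omega>) 0"
proof -
  have "tends_in_prob M (\<lambda>n \<omega>. norm (deviation n \<omega> (dual u)) * norm (scaled_err n \<omega>)) 0"
    by (rule tends_in_prob_mult_bounded[OF tends_in_prob_norm_deviation bounded_in_prob_scaled_err])
  then have "tends_in_prob M (\<lambda>n \<omega>. - (deviation n \<omega> (dual u) \<bullet> scaled_err n \<omega>)) 0"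
  proof (rule tends_in_prob_bound)
    show "norm (- (deviation n \<omega> (dual u) \<bullet> scaled_err n \<omega>)) \<le> norm (norm (deviation n \<omega> (dual u)) * norm (scaled_err n \<omega>))" for n \<omega>
      using Cauchy_Schwarz_ineq2[of "deviation n \<omega> (dual u)" "scaled_err n \<omega>"] by (simp add: abs_mult)
  qed
  from tends_in_prob_add[OF initial_term_limit[of "dual u"] this]
  have "tends_in_prob M (\<lambda>n \<omega>. initial_term (dual u) \<omega> / sqrt (real n) + - (deviation n \<omega> (dual u) \<bullet> scaled_err n \<omega>)) 0"
    by (simp only: add_0)
  then show ?thesis
  proof (rule tends_in_prob_cong[THEN iffD1, rotated])
    show "initial_term (dual u) \<omega> / sqrt (real n) + - (deviation n \<omega> (dual u) \<bullet> scaled_err n \<omega>)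
        = u \<bullet> scaled_err n \<omega> - score (dual u) n \<omega>" if "\<omega> \<in> space M" for n \<omega>
      using scaled_err_expand[OF that, of u n] by linarith
  qed
qed

text \<open>Stability gives |\<Phi>_k|^2 of order k^\<mu> with \<mu> < 1, so all squared weights are
  of order n^(\<mu> - 1). The constants depend on the path, whence the exceptional event.\<close>

lemma score_weight_negligible:
  assumes e: "0 < e"
  shows "\<forall>\<^sub>F n in sequentially. \<exists>A\<in>sets M. measure M A < e \<and> (\<forall>\<omega>\<in>space M - A. \<forall>k<n. \<bar>(w \<bullet> \<Phi> \<omega> k) / sqrt (real n)\<bar> \<le> e)"
proof -
  define P where "P n \<omega> \<longleftrightarrow> (\<forall>k<n. \<bar>(w \<bullet> \<Phi> \<omega> k) / sqrt (real n)\<bar> \<le> e)" for n \<omega>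
  have P: "Measurable.pred M (P n)" for n unfolding P_def by measurable
  have ev: "AE \<omega> in M. \<forall>\<^sub>F n in sequentially. P n \<omega>"
    using AE_stability
  proof eventually_elim
    case (elim \<omega>)
    then obtain \<mu> B where \<mu>: "0 < \<mu>" "\<mu> < 1" and B: "\<And>k. 1 \<le> k \<Longrightarrow> (norm (\<Phi> \<omega> k))\<^sup>2 \<le> B * real k powr \<mu>" by blast
    define C where "C = (norm w)\<^sup>2 * max \<bar>B\<bar> ((norm (\<Phi> \<omega> 0))\<^sup>2)"
    have bound: "(w \<bullet> \<Phi> \<omega> k)\<^sup>2 \<le> C * real n powr \<mu>" if k: "k < n" for k n
    proof -
      have n1: "1 \<le> real n powr \<mu>" using k \<mu> by (intro ge_one_powr_ge_zero) auto
      have "(w \<bullet> \<Phi> \<omega> k)\<^sup>2 \<le> (norm w)\<^sup>2 * (norm (\<Phi> \<omega> k))\<^sup>2"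
        using power_mono[OF Cauchy_Schwarz_ineq2[of w "\<Phi> \<omega> k"], of 2] by (simp add: power_mult_distrib)
      also have "(norm (\<Phi> \<omega> k))\<^sup>2 \<le> max \<bar>B\<bar> ((norm (\<Phi> \<omega> 0))\<^sup>2) * real n powr \<mu>"
      proof (cases "k = 0")
        case True
        have "(norm (\<Phi> \<omega> 0))\<^sup>2 * 1 \<le> max \<bar>B\<bar> ((norm (\<Phi> \<omega> 0))\<^sup>2) * real n powr \<mu>"
          using n1 by (intro mult_mono) auto
        then show ?thesis using True by simp
      next
        case False
        then have "(norm (\<Phi> \<omega> k))\<^sup>2 \<le> B * real k powr \<mu>" by (intro B) simp
        also have "\<dots> \<le> max \<bar>B\<bar> ((norm (\<Phi> \<omega> 0))\<^sup>2) * real n powr \<mu>"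
          using k \<mu> by (intro mult_mono powr_mono2) auto
        finally show ?thesis .
      qed
      finally show ?thesis by (simp add: C_def mult.assoc mult_left_mono)
    qed
    have "(\<lambda>n. C * real n powr (\<mu> - 1)) \<longlonglongrightarrow> 0"
      using \<mu> by (intro tendsto_mult_right_zero tendsto_neg_powr filterlim_real_sequentially) auto
    moreover have "0 < e\<^sup>2" using e by simp
    ultimately have "\<forall>\<^sub>F n in sequentially. C * real n powr (\<mu> - 1) < e\<^sup>2"
      by (rule order_tendstoD)
    then show ?case
      using eventually_ge_at_top[of 1]
    proof eventually_elim
      case (elim n)
      show ?case
        unfolding P_def
      proof (intro allI impI)
        fix k assume k: "k < n"
        have "\<bar>(w \<bullet> \<Phi> \<omega> k) / sqrt (real n)\<bar>\<^sup>2 = (w \<bullet> \<Phi> \<omega> k)\<^sup>2 / real n" by (simp add: power_divide)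
        also have "\<dots> \<le> C * real n powr \<mu> / real n" by (intro divide_right_mono bound k) simp
        also have "\<dots> = C * real n powr (\<mu> - 1)" using elim by (simp add: powr_diff)
        also have "\<dots> \<le> e\<^sup>2" using elim by simp
        finally show "\<bar>(w \<bullet> \<Phi> \<omega> k) / sqrt (real n)\<bar> \<le> e" using e by (rule power2_le_imp_le[OF _ less_imp_le])
      qed
    qed
  qed
  obtain N A where "A \<in> sets M" "measure M A < e" "\<forall>\<omega>\<in>space M - A. \<forall>n\<ge>N. P n \<omega>"
    using eventually_measure_tail_less[OF P ev e] by blast
  then have "\<exists>A\<in>sets M. measure M A < e \<and> (\<forall>\<omega>\<in>space M - A. P n \<omega>)" if "N \<le> n" for n
    using that by blast
  then show ?thesis
    unfolding P_def using eventually_ge_at_top[of N] by (rule eventually_mono[rotated])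
qed

text \<open>The factor \<sigma>^2 from the variance of the noise cancels against the 1 / \<sigma>^2
  left over from the limit of A_n / n, so the limit covariance is free of \<sigma>.\<close>

lemma char_score_limit:
  "(\<lambda>n. \<integral>\<omega>. iexp (score (dual u) n \<omega>) \<partial>M) \<longlonglongrightarrow> of_real (exp (- ((u \<bullet> (Lambda_inverse p ix \<theta> \<rho> *v u)) / 2)))"
proof -
  have q: "\<sigma>\<^sup>2 * (dual u \<bullet> (Lambda p ix \<theta> \<rho> *v dual u)) = (u \<bullet> (Lambda_inverse p ix \<theta> \<rho> *v u)) / \<sigma>\<^sup>2"
    using arg_cong[OF Lambda_dual[of u], of "\<lambda>x. dual u \<bullet> x"] by (simp add: dual_def inner_commute)
  have "tends_in_prob M (\<lambda>n \<omega>. \<Sum>k<n. ((dual u \<bullet> \<Phi> \<omega> k) / sqrt (real n))\<^sup>2) ((u \<bullet> (Lambda_inverse p ix \<theta> \<rho> *v u)) / \<sigma>\<^sup>2)"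
    unfolding q[symmetric] by (rule score_squares_limit)
  moreover have "0 \<le> (u \<bullet> (Lambda_inverse p ix \<theta> \<rho> *v u)) / \<sigma>\<^sup>2"
    unfolding q[symmetric] Lambda_quadratic[OF ix \<rho>] using \<rho>
    by (intro mult_nonneg_nonneg add_nonneg_nonneg sum_nonneg divide_nonneg_nonneg) (auto simp: abs_square_le_1)
  ultimately have "(\<lambda>n. \<integral>\<omega>. iexp (\<Sum>k<n. ((dual u \<bullet> \<Phi> \<omega> k) / sqrt (real n)) * V (Suc k) \<omega>) \<partial>M)
      \<longlonglongrightarrow> of_real (exp (- (\<sigma>\<^sup>2 * ((u \<bullet> (Lambda_inverse p ix \<theta> \<rho> *v u)) / \<sigma>\<^sup>2) / 2)))"
    by (rule martingale_CLT[OF score_weight_F _ _ score_weight_negligible])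
  then show ?thesis using \<sigma>_pos by (simp add: score_def)
qed

theorem converges_in_law_scaled_err:
  "converges_in_law M scaled_err (gaussian_measure 0 (matrix_inv (Lambda p ix \<theta> \<rho>)))"
  unfolding converges_in_law_def
proof (intro conjI allI impI)
  show [measurable]: "scaled_err n \<in> borel_measurable M" for n
    unfolding scaled_err_def by measurable
  have "score w n \<in> borel_measurable M" for w n unfolding score_def by measurable
  then have char: "(\<lambda>n. \<integral>\<omega>. iexp (u \<bullet> scaled_err n \<omega>) \<partial>M)
      \<longlonglongrightarrow> (\<integral>y. iexp (u \<bullet> y) \<partial>gaussian_measure 0 (matrix_inv (Lambda p ix \<theta> \<rho>)))" for u
    unfolding char_limit[OF ix \<rho>]
    by (intro char_fun_asymptotic[OF _ _ score_approximation char_score_limit]) measurable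
  fix f :: "real ^ 'd \<Rightarrow> real" assume "continuous_on UNIV f \<and> bounded (range f)"
  then show "(\<lambda>n. \<integral>\<omega>. f (scaled_err n \<omega>) \<partial>M) \<longlonglongrightarrow> (\<integral>y. f y \<partial>gaussian_measure 0 (matrix_inv (Lambda p ix \<theta> \<rho>)))"
    by (intro levy_continuity[OF prob_space_axioms prob_space_limit[OF ix \<rho>] _ _ char])
      (auto simp: gaussian_measure_def)
qed

end

text \<open>\<open>matrix_inv\<close> is a choice operator, so the last two conjuncts certify that
  the covariance is a genuine inverse and identify it with the explicit matrix.\<close>

theorem theorem4p1:
  fixes M :: "'a measure" and F :: "nat \<Rightarrow> 'a measure"
    and p :: nat and ix :: "'d::finite \<Rightarrow> nat"
    and \<theta> :: "nat \<Rightarrow> real" and \<rho> \<sigma> a :: real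
    and X U :: "int \<Rightarrow> 'a \<Rightarrow> real"
    and \<epsilon> V x :: "nat \<Rightarrow> 'a \<Rightarrow> real"
    and est :: "nat \<Rightarrow> 'a \<Rightarrow> real ^ 'd"
  assumes "prob_space M" and "filtered_space M F"
    and "p \<ge> 1" and "bij_betw ix UNIV {1..p + 2}"
    and "\<bar>\<rho>\<bar> < 1" and "\<rho> \<noteq> 0"
    and "martingale_difference M F V"
    and "\<sigma> > 0"
    and "\<And>n. AE \<omega> in M. real_cond_exp M (F n) (\<lambda>\<omega>'. (V (n + 1) \<omega>')\<^sup>2) \<omega> = \<sigma>\<^sup>2"
    and "a > 2" and "finite_conditional_moment a M F V"
    and "\<And>k. k \<le> 0 \<Longrightarrow> X k \<in> borel_measurable (F 0)"
    and "\<epsilon> 0 \<in> borel_measurable (F 0)"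
    and "U 0 \<in> borel_measurable (F 0)" and "U (- 1) \<in> borel_measurable (F 0)"
    and "est 0 \<in> borel_measurable (F 0)"
    and "\<And>n. x (n + 1) \<in> borel_measurable (F n)"
    and "AE \<omega> in M. (\<lambda>n. \<Sum>k=1..n. (x k \<omega>)\<^sup>2) \<in> o(\<lambda>n. real n)"
    and "as_regular a M x"
    and "arx_model M p \<theta> \<rho> X U \<epsilon> V"
    and "least_squares M p ix X U est"
    and "tracking_control M p ix X U est x"
  shows "converges_in_law M
           (\<lambda>n \<omega>. sqrt (real n) *\<^sub>R (est n \<omega> - true_parameter p ix \<theta> \<rho>))
           (gaussian_measure 0 (matrix_inv (Lambda p ix \<theta> \<rho>)))
       \<and> invertible (Lambda p ix \<theta> \<rho>)
       \<and> matrix_inv (Lambda p ix \<theta> \<rho>) = Lambda_inverse p ix \<theta> \<rho>"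
proof -
  interpret adaptive_arx M F V \<sigma> a p ix \<theta> \<rho> X U \<epsilon> x est
    using assms by (intro adaptive_arx.intro martingale_noise.intro martingale_noise_axioms.intro
        adaptive_arx_axioms.intro) simp_all
  show ?thesis
    using converges_in_law_scaled_err invertible_Lambda[OF ix \<rho>] matrix_inv_Lambda[OF ix \<rho>]
    by (simp add: scaled_err_def[abs_def] err_def)
qed

end
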